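(* Let $S\subset\partial\mathbb D$ be a closed set and let $\Sigma$ assign to each $s\in S$ a unital additive semi-group $\Sigma(s)\subset\mathbb R$ with $\Sigma(s)\neq\{0\}$. Then the Banach space $SAP_\Sigma(S)\cap H^\infty(\mathbb D)$ has the approximation property.
   Context: All Banach spaces are complex. A Banach space $X$ has the approximation property if for every compact $K\subset X$ and every $\varepsilon>0$ there is a finite rank bounded operator $P:X\to X$ with $\|Px-x\|<\varepsilon$ for all $x\in K$. Almost periodic functions: $C_b(\mathbb R)$ is the space of bounded continuous complex functions on $\mathbb R$ with sup-norm. $f\in C_b(\mathbb R)$ is almost periodic if the family of translates $\{f(\cdot+\tau)\}_{\tau\in\mathbb R}$ is relatively compact in $C_b(\mathbb R)$; $AP(\mathbb R)$ is the Banach algebra of such functions. For $f\in AP(\mathbb R)$: $M(f)=\lim_{T\to+\infty}\frac1{2T}\int_{-T}^Tf(x)\,dx$, $a_\lambda(f)=M(fe^{-i\lambda x})$, $\mathrm{spec}(f)=\{\lambda\in\mathbb R: a_\lambda(f)\ne0\}$. Semi-almost periodic functions: $\mathbb D$ is the open unit disk. $f\in L^\infty(\partial\mathbb D)$ is semi-almost periodic if for every $s\in\partial\mathbb D$ and $\varepsilon>0$ there are $\delta\in(0,\pi)$ and $g_{-1},g_1\in AP(\mathbb R)$ with $\operatorname{ess\,sup}_{x<0}|f(se^{ik\delta e^x})-g_k(x)|<\varepsilon$ for $k\in\{-1,1\}$. $SAP(\partial\mathbb D)$ is the Banach algebra of these functions with sup-norm; for closed $S\subset\partial\mathbb D$,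 $SAP(S)$ consists of those continuous on $\partial\mathbb D\setminus S$. The homomorphisms $E_s$: $AP(\mathbb R\sqcup(\mathbb R+i\pi))$ is the algebra of functions $g$ on $\mathbb R\sqcup(\mathbb R+i\pi)$ such that $x\mapsto g(x)$ and $x\mapsto g(x+i\pi)$ ($x\in\mathbb R$) are in $AP(\mathbb R)$. For $s\in\partial\mathbb D$ put $\varphi_s(z)=\frac{2i(s-z)}{s+z}$ (mapping $\partial\mathbb D\setminus\{-s\}$ onto $\mathbb R$), $\mathrm{Log}\,x=\ln x$ for $x>0$, $\mathrm{Log}\,x=\ln|x|+i\pi$ for $x<0$, and $L_sg:=g\circ\mathrm{Log}\circ\varphi_s$. Known fact: for each $f\in SAP(\partial\mathbb D)$ there is a unique $E_sf\in AP(\mathbb R\sqcup(\mathbb R+i\pi))$ such that $f-L_s(E_sf)$ is continuous and equal to $0$ at $s$. A unital additive semi-group in $\mathbb R$ is a subset containing $0$ and closed under addition. $SAP_\Sigma(S)$ is the set of $f\in SAP(S)$ such that for every $s\in S$ the spectra of $x\mapsto(E_sf)(x)$ and $x\mapsto(E_sf)(x+i\pi)$ are contained in $\Sigma(s)$. $H^\infty(\mathbb D)$ is the algebra of bounded holomorphic functions on $\mathbb D$ with sup-norm, identified with their boundary values in $L^\infty(\partial\mathbb D)$. *)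

theory Defs
  imports
    "HOL-Complex_Analysis.Complex_Analysis"
    "HOL-Probability.Essential_Supremum"
    "HOL-Library.Function_Algebras"
begin

section \<open>The approximation property\<close>

text \<open>
  A normed space is given by a subspace \<open>X\<close> of an ambient complex vector space with scalar
  multiplication \<open>smul\<close>, together with a function \<open>N\<close> whose restriction to \<open>X\<close> is the norm.
\<close>

definition bounded_finite_rank_operator ::
  "(complex \<Rightarrow> 'v::ab_group_add \<Rightarrow> 'v) \<Rightarrow> 'v set \<Rightarrow> ('v \<Rightarrow> real) \<Rightarrow> ('v \<Rightarrow> 'v) \<Rightarrow> bool" where
  "bounded_finite_rank_operator smul X N P \<longleftrightarrow>
     P \<in> X \<rightarrow> X \<and>
     (\<forall>x\<in>X. \<forall>y\<in>X. P (x + y) = P x + P y) \<and>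
     (\<forall>c. \<forall>x\<in>X. P (smul c x) = smul c (P x)) \<and>
     (\<exists>C. \<forall>x\<in>X. N (P x) \<le> C * N x) \<and>
     (\<exists>B. finite B \<and> P ` X \<subseteq> module.span smul B)"

text \<open>
  The value off \<open>X\<close> is irrelevant for the topology of \<open>X\<close>; it is fixed because the locale
  \<open>Metric_space\<close> asks for symmetry and nonnegativity on the whole type.
\<close>

definition norm_dist :: "'v::ab_group_add set \<Rightarrow> ('v \<Rightarrow> real) \<Rightarrow> 'v \<Rightarrow> 'v \<Rightarrow> real" where
  "norm_dist X N x y = (if x \<in> X \<and> y \<in> X then N (x - y) else 0)"

definition approximation_property ::
  "(complex \<Rightarrow> 'v::ab_group_add \<Rightarrow> 'v) \<Rightarrow> 'v set \<Rightarrow> ('v \<Rightarrow> real) \<Rightarrow> bool" where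
  "approximation_property smul X N \<longleftrightarrow>
     (\<forall>K \<epsilon>. compactin (Metric_space.mtopology X (norm_dist X N)) K \<and> 0 < \<epsilon> \<longrightarrow>
        (\<exists>P. bounded_finite_rank_operator smul X N P \<and> (\<forall>x\<in>K. N (P x - x) < \<epsilon>)))"


section \<open>Almost periodic functions\<close>

definition AP :: "(real \<Rightarrow> complex) set" where
  "AP = {f \<in> bcontfun. compact (closure (range (\<lambda>\<tau>. Bcontfun (\<lambda>x. f (x + \<tau>)))))}"

definition ap_mean :: "(real \<Rightarrow> complex) \<Rightarrow> complex" where
  "ap_mean f = Lim at_top (\<lambda>T. (1 / (2 * T)) *\<^sub>R integral {-T..T} f)"

definition ap_coeff :: "real \<Rightarrow> (real \<Rightarrow> complex) \<Rightarrow> complex" where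
  "ap_coeff \<mu> f = ap_mean (\<lambda>x. f x * exp (- \<i> * of_real \<mu> * of_real x))"

definition ap_spec :: "(real \<Rightarrow> complex) \<Rightarrow> real set" where
  "ap_spec f = {\<mu>. ap_coeff \<mu> f \<noteq> 0}"

definition lower_edge :: "(complex \<Rightarrow> complex) \<Rightarrow> real \<Rightarrow> complex" where
  "lower_edge g x = g (of_real x)"

definition upper_edge :: "(complex \<Rightarrow> complex) \<Rightarrow> real \<Rightarrow> complex" where
  "upper_edge g x = g (of_real x + \<i> * of_real pi)"

text \<open>
  Functions on the two lines \<open>Im z = 0\<close> and \<open>Im z = \<pi>\<close> are normalised to vanish elsewhere, so
  that equality of such functions is equality on the two lines.
\<close>

definition AP_strip :: "(complex \<Rightarrow> complex) set" where
  "AP_strip = {g. lower_edge g \<in> AP \<and> upper_edge g \<in> AP \<and>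
                  (\<forall>z. Im z \<noteq> 0 \<and> Im z \<noteq> pi \<longrightarrow> g z = 0)}"


section \<open>Semi-almost periodic functions on the unit circle\<close>

text \<open>
  Elements of \<open>L\<^sup>\<infinity>\<close> of the circle are represented by functions \<open>f\<close> on the complex plane of which
  only the values on the circle matter. Null sets on the circle are those whose preimage under
  \<open>cis\<close> is a Lebesgue null set of the real line. All the sets of functions below are invariant
  under changing \<open>f\<close> on a null set.
\<close>

definition Linf_circle :: "(complex \<Rightarrow> complex) set" where
  "Linf_circle = {f. (\<lambda>t. f (cis t)) \<in> borel_measurable lebesgue \<and>
                     esssup lebesgue (\<lambda>t. ereal (cmod (f (cis t)))) < \<infinity>}"

definition SAP_circle :: "(complex \<Rightarrow> complex) set" where
  "SAP_circle = {f \<in> Linf_circle. \<forall>s\<in>sphere 0 1. \<forall>\<epsilon>>0.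
     \<exists>\<delta>\<in>{0<..<pi}. \<exists>g :: real \<Rightarrow> real \<Rightarrow> complex. \<forall>k\<in>{-1, 1}.
       g k \<in> AP \<and>
       esssup (lebesgue_on {..<0})
         (\<lambda>x. ereal (cmod (f (s * exp (\<i> * of_real (k * \<delta> * exp x))) - g k x))) < ereal \<epsilon>}"

text \<open>Continuity off \<open>S\<close> of a class in \<open>L\<^sup>\<infinity>\<close> means that it has a representative continuous there.\<close>

definition SAP :: "complex set \<Rightarrow> (complex \<Rightarrow> complex) set" where
  "SAP S = {f \<in> SAP_circle. \<exists>h. continuous_on (sphere 0 1 - S) h \<and>
                (AE t in lebesgue. cis t \<notin> S \<longrightarrow> f (cis t) = h (cis t))}"

definition phi_map :: "complex \<Rightarrow> complex \<Rightarrow> complex" where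
  "phi_map s z = 2 * \<i> * (s - z) / (s + z)"

text \<open>
  \<open>phi_map s\<close> is real on the circle minus the point \<open>-s\<close>, and on the nonzero reals the principal branch \<open>Ln\<close> is
  \<open>ln x\<close> for \<open>x > 0\<close> and \<open>ln \<bar>x\<bar> + \<i> * pi\<close> for \<open>x < 0\<close>. The values of \<open>L_map s g\<close> at the two
  points \<open>s\<close> and \<open>-s\<close> are irrelevant.
\<close>

definition L_map :: "complex \<Rightarrow> (complex \<Rightarrow> complex) \<Rightarrow> complex \<Rightarrow> complex" where
  "L_map s g = g \<circ> Ln \<circ> phi_map s"

text \<open>The class of \<open>h\<close> is continuous at \<open>s\<close> with value \<open>0\<close>.\<close>

definition ess_continuous_zero_at :: "complex \<Rightarrow> (complex \<Rightarrow> complex) \<Rightarrow> bool" where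
  "ess_continuous_zero_at s h \<longleftrightarrow>
     (\<forall>\<epsilon>>0. \<exists>\<rho>>0. AE t in lebesgue. dist (cis t) s < \<rho> \<longrightarrow> cmod (h (cis t)) < \<epsilon>)"

definition E_hom :: "complex \<Rightarrow> (complex \<Rightarrow> complex) \<Rightarrow> complex \<Rightarrow> complex" where
  "E_hom s f = (THE g. g \<in> AP_strip \<and> ess_continuous_zero_at s (\<lambda>z. f z - L_map s g z))"

definition unital_additive_semigroup :: "real set \<Rightarrow> bool" where
  "unital_additive_semigroup G \<longleftrightarrow> 0 \<in> G \<and> (\<forall>a\<in>G. \<forall>b\<in>G. a + b \<in> G)"

definition SAP_spec :: "complex set \<Rightarrow> (complex \<Rightarrow> real set) \<Rightarrow> (complex \<Rightarrow> complex) set" where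
  "SAP_spec S \<Sigma> = {f \<in> SAP S. \<forall>s\<in>S.
     ap_spec (lower_edge (E_hom s f)) \<subseteq> \<Sigma> s \<and> ap_spec (upper_edge (E_hom s f)) \<subseteq> \<Sigma> s}"


section \<open>Bounded holomorphic functions on the unit disk\<close>

text \<open>Again functions on the disk are normalised to vanish outside it.\<close>

definition Hinf :: "(complex \<Rightarrow> complex) set" where
  "Hinf = {f. f holomorphic_on ball 0 1 \<and> bounded (f ` ball 0 1) \<and> (\<forall>z. z \<notin> ball 0 1 \<longrightarrow> f z = 0)}"

definition disk_norm :: "(complex \<Rightarrow> complex) \<Rightarrow> real" where
  "disk_norm f = (SUP z\<in>ball 0 1. cmod (f z))"

definition has_boundary_values :: "(complex \<Rightarrow> complex) \<Rightarrow> (complex \<Rightarrow> complex) \<Rightarrow> bool" where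
  "has_boundary_values f b \<longleftrightarrow>
     (AE t in lebesgue. ((\<lambda>r. f (of_real r * cis t)) \<longlongrightarrow> b (cis t)) (at_left 1))"

definition SAP_spec_Hinf ::
  "complex set \<Rightarrow> (complex \<Rightarrow> real set) \<Rightarrow> (complex \<Rightarrow> complex) set" where
  "SAP_spec_Hinf S \<Sigma> = {f \<in> Hinf. \<exists>b\<in>SAP_spec S \<Sigma>. has_boundary_values f b}"

definition scale_fun :: "complex \<Rightarrow> (complex \<Rightarrow> complex) \<Rightarrow> complex \<Rightarrow> complex" where
  "scale_fun c f = (\<lambda>z. c * f z)"

lemma vector_space_scale_fun: "vector_space scale_fun"
  by unfold_locales (auto simp: scale_fun_def fun_eq_iff algebra_simps)

lemma cmod_le_disk_norm:
  assumes "bounded (f ` ball 0 1)" "z \<in> ball 0 1"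
  shows "cmod (f z) \<le> disk_norm f"
  unfolding disk_norm_def
  using assms by (intro cSUP_upper bounded_imp_bdd_above)
    (auto simp: bounded_iff image_iff)

lemma Metric_space_Hinf:
  assumes "X \<subseteq> Hinf"
  shows "Metric_space X (norm_dist X disk_norm)"
proof
  have bdd: "bounded ((f - g) ` ball 0 1)" if "f \<in> X" "g \<in> X" for f g
  proof -
    have "bounded (f ` ball 0 1)" "bounded (g ` ball 0 1)"
      using that assms by (auto simp: Hinf_def)
    then show ?thesis
      using bounded_minus_comp[of f "ball 0 1" g] by (simp add: fun_diff_def)
  qed
  fix f g h
  have nonneg: "0 \<le> disk_norm (f - g)" if "f \<in> X" "g \<in> X"
    using cmod_le_disk_norm[OF bdd[OF that], of 0] norm_ge_zero[of "(f - g) 0"]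
    by (simp del: norm_ge_zero)
  then show "0 \<le> norm_dist X disk_norm f g"
    by (simp add: norm_dist_def)
  show "norm_dist X disk_norm f g = norm_dist X disk_norm g f"
    by (simp add: norm_dist_def disk_norm_def norm_minus_commute)
  show "norm_dist X disk_norm f g = 0 \<longleftrightarrow> f = g" if fg: "f \<in> X" "g \<in> X"
  proof
    assume "norm_dist X disk_norm f g = 0"
    then have 0: "disk_norm (f - g) = 0" using fg by (simp add: norm_dist_def)
    have "f z = g z" for z
    proof (cases "z \<in> ball 0 1")
      case True
      then show ?thesis using cmod_le_disk_norm[OF bdd[OF fg] True] 0 by simp
    next
      case False
      moreover have "f \<in> Hinf" "g \<in> Hinf" using fg assms by auto
      ultimately show ?thesis by (simp add: Hinf_def)
    qed
    then show "f = g" by (rule ext)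
  next
    assume "f = g"
    then show "norm_dist X disk_norm f g = 0"
      by (simp add: norm_dist_def disk_norm_def)
  qed
  show "norm_dist X disk_norm f h \<le> norm_dist X disk_norm f g + norm_dist X disk_norm g h"
    if "f \<in> X" "g \<in> X" "h \<in> X"
  proof -
    have "cmod ((f - h) z) \<le> disk_norm (f - g) + disk_norm (g - h)" if z: "z \<in> ball 0 1" for z
      using cmod_le_disk_norm[OF bdd[of f g] z] cmod_le_disk_norm[OF bdd[of g h] z]
        norm_triangle_ineq[of "(f - g) z" "(g - h) z"] \<open>f \<in> X\<close> \<open>g \<in> X\<close> \<open>h \<in> X\<close>
      by simp
    then have "disk_norm (f - h) \<le> disk_norm (f - g) + disk_norm (g - h)"
      unfolding disk_norm_def[of "f - h"] by (intro cSUP_least) auto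
    then show ?thesis using that by (simp add: norm_dist_def)
  qed
qed

end

theory Submission
  imports Defs
begin

text \<open>
  A function of the algebra oscillates in an essential way only at points of \<open>S\<close>, and at each such point
  its behaviour is that of two almost periodic functions, its edge functions. Up to a given tolerance only
  finitely many points matter (\<open>finite_oscillation_points\<close>). The approximating operator treats the edge
  functions at these points and the remainder separately (\<open>approximant\<close>).

  \<^item> Edge functions. A bounded operator of finite rank on almost periodic functions that is close to the
    identity on given functions is the mean against a nonnegative trigonometric polynomial of mean 1; it
    multiplies each Fourier coefficient by a factor. Such kernels exist for arbitrary finite sets of
    frequencies (\<open>trig_kernel_exists\<close>). That they approximate uniformly (\<open>AP_kernel_approximation\<close>)
    rests on a quantitative uniqueness theorem: an almost periodic function that is large somewhere has a
    Fourier coefficient that is bounded below in terms of its almost periods (\<open>AP_large_coefficient\<close>). The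
    latter follows by sampling from the Plancherel identity on a finite cyclic group.

  \<^item> Lifting to the disk. In the coordinate \<open>Ln \<circ> phi_map s\<close> the disk is a strip of width \<open>pi\<close>, whose two
    sides carry the two edge functions. For a bounded holomorphic function, shifting the contour across the strip
    relates the coefficients of the two edge functions (\<open>edge_coefficient_relation\<close>). Hence one sum of the
    exponentials \<open>exp (\<i> \<mu> w)\<close>, with the coefficients damped by a kernel, approximates both of
    them. By the maximum principle (\<open>boundary_maximum_principle\<close>) it is bounded by the norm of the given
    function. Multiplying it by a holomorphic peak factor localises it at \<open>s\<close>, so that the sum
    over all relevant points, the edge part, still has norm at most twice that of the function.

  \<^item> Remainder. After subtraction of the edge part the boundary values have small oscillation at every point of
    the circle (\<open>remainder_near_const\<close>). Again by the maximum principle the remainder is nearly invariant under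
    small rotations, so that averaging it over rotations against a concentrated kernel hardly changes it
    (\<open>smooth_part_close\<close>); the average is a polynomial.

  The frequencies of the edge part are frequencies of the given function, and polynomials have constant
  edge functions. Since 0 belongs to every \<open>\<Sigma> s\<close>, the operators therefore preserve the algebra. Their norms are at
  most 5, which reduces approximation on a compact set to approximation on a finite one.
\<close>

section \<open>Almost periodic functions: translates and means\<close>

text \<open>
  Compactness enters only through finite nets of translates. The centres of a net can be taken among the
  translates themselves, which keeps the space of bounded continuous functions out of the later arguments.
\<close>

lemma AP_D:
  assumes "f \<in> AP" "e > 0"
  shows "\<exists>T. finite T \<and> (\<forall>\<tau>. \<exists>t\<in>T. \<forall>x. cmod (f (x + \<tau>) - f (x + t)) \<le> e)"
proof -
  let ?F = "\<lambda>\<tau>. Bcontfun (\<lambda>x. f (x + \<tau>))"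
  have f: "f \<in> bcontfun" and cpt: "compact (closure (range ?F))"
    using assms by (auto simp: AP_def)
  have app: "apply_bcontfun (?F \<tau>) = (\<lambda>x. f (x + \<tau>))" for \<tau>
  proof -
    have "(\<lambda>x. f (x + \<tau>)) \<in> bcontfun"
      using f unfolding bcontfun_def
      by (auto intro!: continuous_intros continuous_on_compose2[of UNIV f]
          elim!: bounded_subset)
    then show ?thesis by (rule Bcontfun_inverse)
  qed
  obtain k where k: "finite k" "closure (range ?F) \<subseteq> (\<Union>x\<in>k. ball x (e/2))"
    using cpt assms(2) unfolding compact_eq_totally_bounded by (meson half_gt_zero)
  define T where "T = (\<lambda>x. SOME t. ?F t \<in> ball x (e/2)) ` k"
  have "\<exists>t\<in>T. \<forall>x. cmod (f (x + \<tau>) - f (x + t)) \<le> e" for \<tau>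
  proof -
    have "?F \<tau> \<in> closure (range ?F)" by (rule subsetD[OF closure_subset]) (rule rangeI)
    then have "?F \<tau> \<in> (\<Union>x\<in>k. ball x (e/2))" by (rule subsetD[OF k(2)])
    then obtain x where x: "x \<in> k" "?F \<tau> \<in> ball x (e/2)" by (rule UN_E)
    define t where "t = (SOME t. ?F t \<in> ball x (e/2))"
    have t: "?F t \<in> ball x (e/2)" unfolding t_def by (rule someI[of _ \<tau>]) (rule x(2))
    have "dist (?F \<tau>) (?F t) \<le> e"
      using x(2) t dist_triangle2[of "?F \<tau>" "?F t" x] unfolding mem_ball dist_commute[of x] by linarith
    then have "\<forall>y. dist (apply_bcontfun (?F \<tau>) y) (apply_bcontfun (?F t) y) \<le> e"
      using dist_bounded order_trans by blast
    then have "\<forall>y. cmod (f (y + \<tau>) - f (y + t)) \<le> e" by (simp add: app dist_norm)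
    moreover have "t \<in> T" using x by (auto simp: T_def t_def)
    ultimately show ?thesis by blast
  qed
  moreover have "finite T" using k by (simp add: T_def)
  ultimately show ?thesis by blast
qed

lemma AP_continuous: "f \<in> AP \<Longrightarrow> continuous_on A f"
  by (rule continuous_on_subset[of UNIV]) (auto simp: AP_def bcontfun_def)

lemma AP_I:
  assumes cont: "continuous_on UNIV f"
    and net: "\<And>e. e > 0 \<Longrightarrow> \<exists>T. finite T \<and> (\<forall>\<tau>. \<exists>t\<in>T. \<forall>x. cmod (f (x + \<tau>) - f (x + t)) \<le> e)"
  shows "f \<in> AP"
proof -
  let ?F = "\<lambda>\<tau>. Bcontfun (\<lambda>x. f (x + \<tau>))"
  obtain T where T: "finite T" "\<And>\<tau>. \<exists>t\<in>T. \<forall>x. cmod (f (x + \<tau>) - f (x + t)) \<le> 1"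
    using net[of 1] by auto
  have "bounded (range f)"
    unfolding bounded_iff
  proof (intro exI ballI)
    fix y assume "y \<in> range f"
    then obtain \<tau> where y: "y = f \<tau>" by auto
    obtain t where t: "t \<in> T" "\<forall>x. cmod (f (x + \<tau>) - f (x + t)) \<le> 1" using T by blast
    have "cmod (f \<tau> - f t) \<le> 1" using t(2)[rule_format, of 0] by simp
    then have "cmod (f \<tau>) \<le> cmod (f t) + 1" using norm_triangle_ineq2[of "f \<tau>" "f t"] by linarith
    also have "\<dots> \<le> (\<Sum>t\<in>T. cmod (f t)) + 1"
      using member_le_sum[of t T "\<lambda>t. cmod (f t)"] t T by simp
    finally show "cmod y \<le> (\<Sum>t\<in>T. cmod (f t)) + 1" by (simp add: y)
  qed
  then have f: "f \<in> bcontfun" using cont by (simp add: bcontfun_def)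
  have app: "apply_bcontfun (?F \<tau>) = (\<lambda>x. f (x + \<tau>))" for \<tau>
  proof -
    have "(\<lambda>x. f (x + \<tau>)) \<in> bcontfun"
      using f unfolding bcontfun_def
      by (auto intro!: continuous_intros continuous_on_compose2[of UNIV f]
          elim!: bounded_subset)
    then show ?thesis by (rule Bcontfun_inverse)
  qed
  have "compact (closure (range ?F))"
    unfolding compact_eq_totally_bounded
  proof (intro conjI allI impI)
    show "complete (closure (range ?F))" by (simp add: complete_eq_closed)
    fix e :: real assume "e > 0"
    obtain T where T: "finite T" "\<And>\<tau>. \<exists>t\<in>T. \<forall>x. cmod (f (x + \<tau>) - f (x + t)) \<le> e/2"
      using net[of "e/2"] \<open>e > 0\<close> by auto
    have "range ?F \<subseteq> (\<Union>x\<in>?F ` T. cball x (e/2))"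
    proof (clarify)
      fix \<tau>
      obtain t where t: "t \<in> T" "\<forall>x. cmod (f (x + \<tau>) - f (x + t)) \<le> e/2" using T by blast
      have "dist (?F t) (?F \<tau>) \<le> e/2"
        by (rule dist_bound) (use t in \<open>simp add: app dist_norm norm_minus_commute\<close>)
      then show "?F \<tau> \<in> (\<Union>x\<in>?F ` T. cball x (e/2))" using t by auto
    qed
    then have "closure (range ?F) \<subseteq> (\<Union>x\<in>?F ` T. cball x (e/2))"
      using T by (intro closure_minimal) (auto intro!: closed_UN)
    also have "\<dots> \<subseteq> (\<Union>x\<in>?F ` T. ball x e)" using \<open>e > 0\<close> by force
    finally show "\<exists>k. finite k \<and> closure (range ?F) \<subseteq> (\<Union>x\<in>k. ball x e)" using T by blast
  qed
  then show ?thesis using f by (simp add: AP_def)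
qed

lemma AP_bounded:
  assumes "f \<in> AP"
  obtains C where "C > 0" "\<And>x. cmod (f x) \<le> C"
proof -
  have "bounded (range f)" using assms by (auto simp: AP_def bcontfun_def)
  then obtain C where "C > 0" "\<And>x. cmod (f x) \<le> C" unfolding bounded_pos by auto
  then show ?thesis using that by blast
qed

text \<open>
  All closure properties of \<open>AP\<close> follow from one principle: a continuous function whose translates
  are controlled by those of two almost periodic functions is almost periodic.  The cells of a
  common refinement of the two finite nets are represented by translates, one for each nonempty
  cell.
\<close>

lemma AP_dominated:
  assumes f: "f \<in> AP" and g: "g \<in> AP" and cont: "continuous_on UNIV h"
    and dom: "\<And>e. e > 0 \<Longrightarrow> \<exists>d>0. \<forall>\<tau> \<tau>'. (\<forall>x. cmod (f (x + \<tau>) - f (x + \<tau>')) \<le> d) \<longrightarrow>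
      (\<forall>x. cmod (g (x + \<tau>) - g (x + \<tau>')) \<le> d) \<longrightarrow> (\<forall>x. cmod (h (x + \<tau>) - h (x + \<tau>')) \<le> e)"
  shows "h \<in> AP"
proof (rule AP_I[OF cont])
  fix e :: real assume "e > 0"
  then obtain d where d: "d > 0" "\<And>\<tau> \<tau>'. (\<forall>x. cmod (f (x + \<tau>) - f (x + \<tau>')) \<le> d) \<Longrightarrow>
      (\<forall>x. cmod (g (x + \<tau>) - g (x + \<tau>')) \<le> d) \<Longrightarrow> (\<forall>x. cmod (h (x + \<tau>) - h (x + \<tau>')) \<le> e)"
    using dom by metis
  obtain T where T: "finite T" "\<And>\<tau>. \<exists>t\<in>T. \<forall>x. cmod (f (x + \<tau>) - f (x + t)) \<le> d/2"
    using AP_D[OF f, of "d/2"] d by auto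
  obtain U where U: "finite U" "\<And>\<tau>. \<exists>t\<in>U. \<forall>x. cmod (g (x + \<tau>) - g (x + t)) \<le> d/2"
    using AP_D[OF g, of "d/2"] d by auto
  define R where "R = (\<lambda>(t,u) \<tau>. (\<forall>x. cmod (f (x + \<tau>) - f (x + t)) \<le> d/2) \<and> (\<forall>x. cmod (g (x + \<tau>) - g (x + u)) \<le> d/2))"
  define V where "V = (\<lambda>p. SOME \<tau>. R p \<tau>) ` (T \<times> U)"
  have "\<exists>t\<in>V. \<forall>x. cmod (h (x + \<tau>) - h (x + t)) \<le> e" for \<tau>
  proof -
    obtain t u where tu: "t \<in> T" "u \<in> U" "R (t,u) \<tau>" using T(2)[of \<tau>] U(2)[of \<tau>] by (auto simp: R_def)
    define v where "v = (SOME \<tau>. R (t,u) \<tau>)"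
    have v: "R (t,u) v" unfolding v_def by (rule someI) (rule tu)
    have tri: "cmod (a - b) \<le> d" if "cmod (a - c) \<le> d/2" "cmod (b - c) \<le> d/2" for a b c
      using norm_triangle_ineq4[of "a - c" "b - c"] that by simp
    have "\<forall>x. cmod (f (x + \<tau>) - f (x + v)) \<le> d" "\<forall>x. cmod (g (x + \<tau>) - g (x + v)) \<le> d"
      using tu(3) v tri unfolding R_def prod.case by blast+
    then have "\<forall>x. cmod (h (x + \<tau>) - h (x + v)) \<le> e" by (rule d(2))
    moreover have "v \<in> V" using tu by (auto simp: V_def v_def)
    ultimately show ?thesis by blast
  qed
  moreover have "finite V" using T U by (simp add: V_def)
  ultimately show "\<exists>T. finite T \<and> (\<forall>\<tau>. \<exists>t\<in>T. \<forall>x. cmod (h (x + \<tau>) - h (x + t)) \<le> e)" by blast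
qed

lemma AP_lipschitz:
  assumes f: "f \<in> AP" and g: "g \<in> AP" and cont: "continuous_on UNIV h"
    and lip: "\<And>x y. cmod (h x - h y) \<le> A * (cmod (f x - f y) + cmod (g x - g y))"
  shows "h \<in> AP"
proof (rule AP_dominated[OF f g cont])
  fix e :: real assume "e > 0"
  define d where "d = e / (2 * (\<bar>A\<bar> + 1))"
  have d: "d > 0" using \<open>e > 0\<close> by (simp add: d_def add_nonneg_pos)
  show "\<exists>d>0. \<forall>\<tau> \<tau>'. (\<forall>x. cmod (f (x + \<tau>) - f (x + \<tau>')) \<le> d) \<longrightarrow>
      (\<forall>x. cmod (g (x + \<tau>) - g (x + \<tau>')) \<le> d) \<longrightarrow> (\<forall>x. cmod (h (x + \<tau>) - h (x + \<tau>')) \<le> e)"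
  proof (intro exI[of _ d] conjI d allI impI)
    fix \<tau> \<tau>' x assume a: "\<forall>x. cmod (f (x + \<tau>) - f (x + \<tau>')) \<le> d" "\<forall>x. cmod (g (x + \<tau>) - g (x + \<tau>')) \<le> d"
    have "cmod (h (x + \<tau>) - h (x + \<tau>')) \<le> (\<bar>A\<bar> + 1) * (cmod (f (x + \<tau>) - f (x + \<tau>')) + cmod (g (x + \<tau>) - g (x + \<tau>')))"
      using lip[of "x + \<tau>" "x + \<tau>'"] by (rule order_trans) (intro mult_right_mono, auto)
    also have "\<dots> \<le> (\<bar>A\<bar> + 1) * (d + d)" using a by (intro mult_left_mono add_mono) auto
    also have "\<dots> = e" by (simp add: d_def field_simps add_nonneg_eq_0_iff)
    finally show "cmod (h (x + \<tau>) - h (x + \<tau>')) \<le> e" .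
  qed
qed

lemma AP_add:
  assumes "f \<in> AP" "g \<in> AP" shows "(\<lambda>x. f x + g x) \<in> AP"
proof (rule AP_lipschitz[where A=1 and f=f and g=g])
  fix x y
  show "cmod (f x + g x - (f y + g y)) \<le> 1 * (cmod (f x - f y) + cmod (g x - g y))"
    using norm_triangle_ineq[of "f x - f y" "g x - g y"] by (simp add: algebra_simps)
qed (auto intro!: continuous_intros AP_continuous[OF assms(1)] AP_continuous[OF assms(2)] assms)

lemma AP_mult:
  assumes "f \<in> AP" "g \<in> AP" shows "(\<lambda>x. f x * g x) \<in> AP"
proof -
  obtain C where C: "C > 0" "\<And>x. cmod (f x) \<le> C" using AP_bounded[OF assms(1)] by blast
  obtain D where D: "D > 0" "\<And>x. cmod (g x) \<le> D" using AP_bounded[OF assms(2)] by blast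
  show ?thesis
  proof (rule AP_lipschitz[where A="C + D" and f=f and g=g])
    fix x y
    have "cmod (f x * g x - f y * g y) = cmod (f x * (g x - g y) + (f x - f y) * g y)"
      by (simp add: algebra_simps)
    also have "\<dots> \<le> cmod (f x) * cmod (g x - g y) + cmod (f x - f y) * cmod (g y)"
      by (metis norm_triangle_ineq norm_mult)
    also have "\<dots> \<le> C * cmod (g x - g y) + cmod (f x - f y) * D"
      by (intro add_mono mult_right_mono mult_left_mono C D) auto
    also have "\<dots> \<le> (C + D) * (cmod (f x - f y) + cmod (g x - g y))"
      using C D by (simp add: algebra_simps)
    finally show "cmod (f x * g x - f y * g y) \<le> (C + D) * (cmod (f x - f y) + cmod (g x - g y))" .
  qed (auto intro!: continuous_intros AP_continuous[OF assms(1)] AP_continuous[OF assms(2)] assms)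
qed

lemma AP_const: "(\<lambda>x. c) \<in> AP"
  by (rule AP_I) (auto intro!: exI[of _ "{0}"])

lemma AP_cis: "(\<lambda>x. cis (\<mu> * x)) \<in> AP"
proof (rule AP_I)
  fix e :: real assume "e > 0"
  have "compact (sphere (0::complex) 1)" by simp
  then obtain k where k: "finite k" "sphere 0 1 \<subseteq> (\<Union>x\<in>k. ball (x::complex) (e/2))"
    unfolding compact_eq_totally_bounded using \<open>e > 0\<close> by (meson half_gt_zero)
  define T where "T = (\<lambda>x. SOME t. cis (\<mu> * t) \<in> ball x (e/2)) ` k"
  have "\<exists>t\<in>T. \<forall>x. cmod (cis (\<mu> * (x + \<tau>)) - cis (\<mu> * (x + t))) \<le> e" for \<tau>
  proof -
    have "cis (\<mu> * \<tau>) \<in> sphere 0 1" by simp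
    then obtain x where x: "x \<in> k" "cis (\<mu> * \<tau>) \<in> ball x (e/2)" using k by blast
    define t where "t = (SOME t. cis (\<mu> * t) \<in> ball x (e/2))"
    have t: "cis (\<mu> * t) \<in> ball x (e/2)" unfolding t_def by (rule someI[of _ \<tau>]) (use x in auto)
    have "cmod (cis (\<mu> * \<tau>) - cis (\<mu> * t)) \<le> e"
      using x(2) t dist_triangle2[of "cis (\<mu> * \<tau>)" "cis (\<mu> * t)" x] by (simp add: dist_commute dist_norm)
    moreover have "cmod (cis (\<mu> * (y + \<tau>)) - cis (\<mu> * (y + t))) = cmod (cis (\<mu> * \<tau>) - cis (\<mu> * t))" for y
    proof -
      have "cis (\<mu> * (y + \<tau>)) - cis (\<mu> * (y + t)) = cis (\<mu> * y) * (cis (\<mu> * \<tau>) - cis (\<mu> * t))"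
        by (simp add: algebra_simps cis_mult)
      then show ?thesis by (simp add: norm_mult)
    qed
    moreover have "t \<in> T" using x by (auto simp: T_def t_def)
    ultimately show ?thesis by (intro bexI[of _ t]) simp_all
  qed
  moreover have "finite T" using k by (simp add: T_def)
  ultimately show "\<exists>T. finite T \<and> (\<forall>\<tau>. \<exists>t\<in>T. \<forall>x. cmod (cis (\<mu> * (x + \<tau>)) - cis (\<mu> * (x + t))) \<le> e)"
    by blast
qed (auto intro!: continuous_intros)

lemma AP_cmult: "f \<in> AP \<Longrightarrow> (\<lambda>x. c * f x) \<in> AP"
  by (rule AP_mult[OF AP_const])

lemma AP_diff: "f \<in> AP \<Longrightarrow> g \<in> AP \<Longrightarrow> (\<lambda>x. f x - g x) \<in> AP"
  using AP_add[of f "\<lambda>x. -1 * g x"] AP_cmult[of g "-1"] by simp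

lemma AP_sum: "(\<And>i. i \<in> I \<Longrightarrow> f i \<in> AP) \<Longrightarrow> (\<lambda>x. \<Sum>i\<in>I. f i x) \<in> AP"
  by (induction I rule: infinite_finite_induct) (auto intro: AP_const AP_add)

lemma AP_power: "f \<in> AP \<Longrightarrow> (\<lambda>x. f x ^ n) \<in> AP"
  by (induction n) (auto intro: AP_const AP_mult)

lemma AP_cnj:
  assumes "f \<in> AP" shows "(\<lambda>x. cnj (f x)) \<in> AP"
proof (rule AP_lipschitz[where A=1 and f=f and g=f])
  fix x y
  have "cmod (cnj (f x) - cnj (f y)) = cmod (f x - f y)"
    by (metis complex_cnj_diff complex_mod_cnj)
  then show "cmod (cnj (f x) - cnj (f y)) \<le> 1 * (cmod (f x - f y) + cmod (f x - f y))"
    by simp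
qed (auto intro!: continuous_intros AP_continuous[OF assms] assms)

lemma AP_norm:
  assumes "f \<in> AP" shows "(\<lambda>x. of_real (cmod (f x))) \<in> AP"
proof (rule AP_lipschitz[where A=1 and f=f and g=f])
  fix x y
  show "cmod (complex_of_real (cmod (f x)) - complex_of_real (cmod (f y)))
         \<le> 1 * (cmod (f x - f y) + cmod (f x - f y))"
    using norm_triangle_ineq3[of "f x" "f y"] norm_ge_zero[of "f x - f y"]
    by (simp flip: of_real_diff)
qed (auto intro!: continuous_intros AP_continuous[OF assms] assms)

lemma AP_translate:
  assumes "f \<in> AP" shows "(\<lambda>x. f (x + c)) \<in> AP"
proof (rule AP_dominated[OF assms assms])
  show "continuous_on UNIV (\<lambda>x. f (x + c))"
    by (rule continuous_on_compose2[OF AP_continuous[OF assms, of UNIV]]) (auto intro!: continuous_intros)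
  fix e :: real assume "e > 0"
  then show "\<exists>d>0. \<forall>\<tau> \<tau>'. (\<forall>x. cmod (f (x + \<tau>) - f (x + \<tau>')) \<le> d) \<longrightarrow>
      (\<forall>x. cmod (f (x + \<tau>) - f (x + \<tau>')) \<le> d) \<longrightarrow> (\<forall>x. cmod (f (x + \<tau> + c) - f (x + \<tau>' + c)) \<le> e)"
    by (intro exI[of _ e]) (metis add.assoc add.commute)
qed

lemma AP_uniform_limit:
  assumes lim: "\<And>e. e > 0 \<Longrightarrow> \<exists>g\<in>AP. \<forall>x. cmod (f x - g x) \<le> e"
  shows "f \<in> AP"
proof (rule AP_I)
  show "continuous_on UNIV f"
    unfolding continuous_on_iff
  proof (intro ballI allI impI)
    fix x :: real and e :: real assume "e > 0"
    then obtain g where g: "g \<in> AP" "\<forall>x. cmod (f x - g x) \<le> e/4" using lim[of "e/4"] by auto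
    obtain d where d: "d > 0" "\<And>x'. dist x' x < d \<Longrightarrow> dist (g x') (g x) < e/4"
      using AP_continuous[OF g(1), of UNIV] \<open>e > 0\<close> unfolding continuous_on_iff
      by (metis UNIV_I zero_less_divide_iff zero_less_numeral)
    show "\<exists>d>0. \<forall>x'\<in>UNIV. dist x' x < d \<longrightarrow> dist (f x') (f x) < e"
    proof (intro exI[of _ d] conjI d ballI impI)
      fix x' assume "dist x' x < d"
      then have "cmod (g x' - g x) \<le> e/4" using d(2)[of x'] by (simp add: dist_norm)
      then have "cmod (f x' - f x) \<le> e/4 + e/4 + e/4"
        using norm_diff_triangle_le[OF norm_diff_triangle_le[OF g(2)[rule_format, of x']], of "g x" "e/4" "f x" "e/4"]
          g(2)[rule_format, of x] by (simp add: norm_minus_commute)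
      then show "dist (f x') (f x) < e" using \<open>e > 0\<close> by (simp add: dist_norm)
    qed
  qed
  fix e :: real assume "e > 0"
  then obtain g where g: "g \<in> AP" "\<forall>x. cmod (f x - g x) \<le> e/4" using lim[of "e/4"] by auto
  obtain T where T: "finite T" "\<And>\<tau>. \<exists>t\<in>T. \<forall>x. cmod (g (x + \<tau>) - g (x + t)) \<le> e/4"
    using AP_D[OF g(1), of "e/4"] \<open>e > 0\<close> by auto
  have "\<exists>t\<in>T. \<forall>x. cmod (f (x + \<tau>) - f (x + t)) \<le> e" for \<tau>
  proof -
    obtain t where t: "t \<in> T" "\<forall>x. cmod (g (x + \<tau>) - g (x + t)) \<le> e/4" using T by blast
    have "cmod (f (x + \<tau>) - f (x + t)) \<le> e" for x
      using norm_diff_triangle_le[OF norm_diff_triangle_le[OF g(2)[rule_format, of "x+\<tau>"] t(2)[rule_format, of x]],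
          of "f (x+t)" "e/4"] g(2)[rule_format, of "x+t"] \<open>e > 0\<close> by (simp add: norm_minus_commute)
    then show ?thesis using t by blast
  qed
  then show "\<exists>T. finite T \<and> (\<forall>\<tau>. \<exists>t\<in>T. \<forall>x. cmod (f (x + \<tau>) - f (x + t)) \<le> e)" using T by blast
qed

text \<open>A finite net of translates yields almost periods in every interval of a fixed length.\<close>

lemma AP_almost_periods:
  assumes "f \<in> AP" "e > 0"
  obtains l where "l > 0" "\<And>c. \<exists>\<tau>\<in>{c..c+l}. \<forall>x. cmod (f (x + \<tau>) - f x) \<le> e"
proof -
  obtain T where T: "finite T" "\<And>\<tau>. \<exists>t\<in>T. \<forall>x. cmod (f (x + \<tau>) - f (x + t)) \<le> e"
    using AP_D[OF assms] by auto
  define m where "m = (\<Sum>t\<in>T. \<bar>t\<bar>) + 1"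
  have m: "\<bar>t\<bar> \<le> m" if "t \<in> T" for t
    using member_le_sum[of t T abs] that T by (simp add: m_def)
  have m0: "m > 0" unfolding m_def by (simp add: add_nonneg_pos sum_nonneg)
  have "\<exists>\<tau>\<in>{c..c+2*m}. \<forall>x. cmod (f (x + \<tau>) - f x) \<le> e" for c
  proof -
    obtain t where t: "t \<in> T" "\<forall>x. cmod (f (x + (c + m)) - f (x + t)) \<le> e" using T(2)[of "c + m"] by blast
    have "cmod (f (x + (c + m - t)) - f x) \<le> e" for x
      using t(2)[rule_format, of "x - t"] by (simp add: algebra_simps)
    moreover have "c + m - t \<in> {c..c+2*m}" using m[OF t(1)] by auto
    ultimately show ?thesis by blast
  qed
  then show ?thesis using that[of "2*m"] m0 by auto
qed

lemma AP_uniformly_continuous: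
  assumes f: "f \<in> AP" and "e > 0"
  obtains d where "d > 0" "\<And>s x. \<bar>s\<bar> \<le> d \<Longrightarrow> cmod (f (x + s) - f x) \<le> e"
proof -
  obtain l where l: "l > 0" "\<And>c. \<exists>\<tau>\<in>{c..c+l}. \<forall>x. cmod (f (x + \<tau>) - f x) \<le> e/3"
    by (rule AP_almost_periods[OF f, of "e/3"]) (use \<open>e > 0\<close> in auto)
  have "uniformly_continuous_on {-1..l+1} f"
    by (rule compact_uniformly_continuous) (auto intro: AP_continuous f)
  then obtain d where d: "d > 0" "\<And>x x'. x \<in> {-1..l+1} \<Longrightarrow> x' \<in> {-1..l+1} \<Longrightarrow> dist x' x < d \<Longrightarrow> dist (f x') (f x) < e/3"
    unfolding uniformly_continuous_on_def using \<open>e > 0\<close> by (metis zero_less_divide_iff zero_less_numeral)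
  define d' where "d' = min (d/2) 1"
  have "cmod (f (x + s) - f x) \<le> e" if s: "\<bar>s\<bar> \<le> d'" for s x
  proof -
    obtain \<tau> where \<tau>: "\<tau> \<in> {-x..-x+l}" "\<forall>x. cmod (f (x + \<tau>) - f x) \<le> e/3" using l(2) by blast
    have "dist (f (x + \<tau> + s)) (f (x + \<tau>)) < e/3"
      by (rule d(2)) (use s \<tau> d(1) in \<open>auto simp: d'_def dist_norm min_def split: if_splits\<close>)
    then have "cmod (f (x + s + \<tau>) - f (x + \<tau>)) \<le> e/3" by (simp add: dist_norm algebra_simps)
    moreover have "cmod (f (x + s) - f (x + s + \<tau>)) \<le> e/3" "cmod (f (x + \<tau>) - f x) \<le> e/3"
      using \<tau>(2) by (auto simp: norm_minus_commute)
    ultimately have "cmod (f (x + s) - f x) \<le> e/3 + e/3 + e/3"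
      by (meson norm_diff_triangle_le)
    then show ?thesis by simp
  qed
  then show ?thesis using that[of d'] d(1) by (auto simp: d'_def)
qed

text \<open>Almost periods carry every value of the function arbitrarily far to the left.\<close>

lemma AP_bound_from_left:
  assumes f: "f \<in> AP" and le: "\<And>x. x < a \<Longrightarrow> cmod (f x) \<le> C"
  shows "cmod (f x) \<le> C"
proof (rule field_le_epsilon)
  fix e :: real assume "e > 0"
  obtain l where l: "l > 0" "\<And>c. \<exists>\<tau>\<in>{c..c+l}. \<forall>x. cmod (f (x + \<tau>) - f x) \<le> e"
    by (rule AP_almost_periods[OF f \<open>e > 0\<close>]) blast
  obtain \<tau> where \<tau>: "\<tau> \<in> {a - x - l - 1..a - x - l - 1 + l}" "\<forall>x. cmod (f (x + \<tau>) - f x) \<le> e" using l(2) by blast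
  have "cmod (f (x + \<tau>)) \<le> C" by (rule le) (use \<tau> in auto)
  then show "cmod (f x) \<le> C + e" using \<tau>(2)[rule_format, of x] norm_triangle_ineq2[of "f x" "f (x+\<tau>)"]
    by (simp add: norm_minus_commute)
qed

lemma AP_integrable: "f \<in> AP \<Longrightarrow> f integrable_on {a..b}"
  by (intro integrable_continuous_interval AP_continuous)

lemma norm_integral_le:
  fixes f :: "real \<Rightarrow> complex"
  assumes "continuous_on {a..b} f" "a \<le> b" "\<And>x. x \<in> {a..b} \<Longrightarrow> cmod (f x) \<le> C"
  shows "cmod (integral {a..b} f) \<le> C * (b - a)"
  using integral_bound[OF assms(2,1)] assms(3) by auto

lemma integral_translate:
  "integral {a..b::real} (\<lambda>x. f (x + c)) = integral {a + c..b + c} f"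
  using integral_shift_Icc_real[of a b f c] by (simp add: o_def add.commute)

text \<open>
  Averages over long windows hardly depend on the position of the window: moving the window by an
  almost period changes the average little, and an almost period can be found near any prescribed
  displacement.
\<close>

lemma AP_window_shift:
  assumes f: "f \<in> AP" and "e > 0"
  shows "\<exists>T0>0. \<forall>T\<ge>T0. \<forall>c c'. cmod (integral {c..c+T} f - integral {c'..c'+T} f) \<le> e * T"
proof -
  obtain C where C: "C > 0" "\<And>x. cmod (f x) \<le> C" using AP_bounded[OF f] by blast
  obtain l where l: "l > 0" "\<And>c. \<exists>\<tau>\<in>{c..c+l}. \<forall>x. cmod (f (x + \<tau>) - f x) \<le> e/2"
    by (rule AP_almost_periods[OF f, of "e/2"]) (use \<open>e > 0\<close> in auto)
  define T0 where "T0 = 4 * l * C / e"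
  have T0: "T0 > 0" using l C \<open>e > 0\<close> by (simp add: T0_def)
  have "cmod (integral {c..c+T} f - integral {c'..c'+T} f) \<le> e * T" if T: "T \<ge> T0" for T c c'
  proof -
    have "T > 0" using T T0 by simp
    obtain \<tau> where \<tau>: "\<tau> \<in> {c'-c..c'-c+l}" "\<forall>x. cmod (f (x + \<tau>) - f x) \<le> e/2" using l(2) by blast
    define s where "s = c + \<tau> - c'"
    have s: "0 \<le> s" "s \<le> l" using \<tau> by (auto simp: s_def)
    have "integral {c..c+T} (\<lambda>x. f (x + \<tau>) - f x) = integral {c..c+T} (\<lambda>x. f (x + \<tau>)) - integral {c..c+T} f"
      by (intro Henstock_Kurzweil_Integration.integral_diff AP_integrable f AP_translate)
    moreover have "integral {c..c+T} (\<lambda>x. f (x + \<tau>)) = integral {c'+s..c'+s+T} f"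
      using integral_translate[of c "c+T" f \<tau>] by (simp add: s_def algebra_simps)
    moreover have "cmod (integral {c..c+T} (\<lambda>x. f (x + \<tau>) - f x)) \<le> e/2 * (c + T - c)"
      by (rule norm_integral_le) (use \<open>T > 0\<close> \<tau> in \<open>auto intro!: AP_continuous AP_diff AP_translate f\<close>)
    ultimately have 1: "cmod (integral {c'+s..c'+s+T} f - integral {c..c+T} f) \<le> e/2 * T" by simp
    have "integral {c'..c'+s} f + integral {c'+s..c'+s+T} f = integral {c'..c'+s+T} f"
      by (rule Henstock_Kurzweil_Integration.integral_combine) (use s \<open>T > 0\<close> in \<open>auto intro: AP_integrable f\<close>)
    moreover have "integral {c'..c'+T} f + integral {c'+T..c'+s+T} f = integral {c'..c'+s+T} f"
      by (rule Henstock_Kurzweil_Integration.integral_combine) (use s \<open>T > 0\<close> in \<open>auto intro: AP_integrable f\<close>)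
    ultimately have "integral {c'+s..c'+s+T} f - integral {c'..c'+T} f = integral {c'+T..c'+s+T} f - integral {c'..c'+s} f"
      by (simp add: algebra_simps)
    moreover have "cmod (integral {c'+T..c'+s+T} f) \<le> C * (c'+s+T - (c'+T))" "cmod (integral {c'..c'+s} f) \<le> C * (c'+s-c')"
      by (rule norm_integral_le; use s C in \<open>auto intro: AP_continuous f\<close>)+
    ultimately have "cmod (integral {c'+s..c'+s+T} f - integral {c'..c'+T} f) \<le> C * s + C * s"
      using norm_triangle_ineq4[of "integral {c'+T..c'+s+T} f" "integral {c'..c'+s} f"] by simp
    also have "\<dots> \<le> e/2 * T"
    proof -
      have "4 * l * C \<le> e * T" using T \<open>e > 0\<close> by (simp add: T0_def field_simps)
      moreover have "C * s \<le> C * l" using s C by simp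
      ultimately show ?thesis by (simp add: algebra_simps)
    qed
    finally have 2: "cmod (integral {c'+s..c'+s+T} f - integral {c'..c'+T} f) \<le> e/2 * T" .
    show ?thesis
      using norm_diff_triangle_le[OF _ 2, of "integral {c..c+T} f" "e/2*T"] 1
      by (simp add: norm_minus_commute mult.commute)
  qed
  then show ?thesis using T0 by blast
qed

text \<open>
  All windows of one long length have nearly the same average, and longer windows are unions of such windows
  up to a bounded remainder. The averages therefore form a Cauchy family, uniformly in the position.
\<close>

lemma AP_mean_exists:
  assumes f: "f \<in> AP"
  shows "\<exists>m. \<forall>e>0. \<exists>T0>0. \<forall>T\<ge>T0. \<forall>c. cmod (integral {c..c+T} f - T *\<^sub>R m) \<le> e * T"
proof -
  obtain C where C: "C > 0" "\<And>x. cmod (f x) \<le> C" using AP_bounded[OF f] by blast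
  define A where "A = (\<lambda>T. (1/T) *\<^sub>R integral {0..0+T} f)"
  have key: "\<exists>T1>0. \<forall>T\<ge>T1. \<exists>T2>0. \<forall>T'\<ge>T2. \<forall>c. cmod (integral {c..c+T'} f - T' *\<^sub>R A T) \<le> e * T'" if "e > 0" for e
  proof -
    obtain T1 where T1: "T1 > 0" "\<And>T c c'. T \<ge> T1 \<Longrightarrow> cmod (integral {c..c+T} f - integral {c'..c'+T} f) \<le> e/2 * T"
      using AP_window_shift[OF f, of "e/2"] \<open>e > 0\<close> by (metis half_gt_zero)
    have "\<exists>T2>0. \<forall>T'\<ge>T2. \<forall>c. cmod (integral {c..c+T'} f - T' *\<^sub>R A T) \<le> e * T'" if T: "T \<ge> T1" for T
    proof -
      have "T > 0" using T T1 by simp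
      have step: "cmod (integral {c..c + real n * T} f - (real n * T) *\<^sub>R A T) \<le> e/2 * (real n * T)" for n c
      proof (induction n)
        case (Suc n)
        have "integral {c..c + real n * T} f + integral {c + real n * T..c + real n * T + T} f = integral {c..c + real n * T + T} f"
          by (rule Henstock_Kurzweil_Integration.integral_combine) (use \<open>T > 0\<close> in \<open>auto intro: AP_integrable f\<close>)
        then have "integral {c..c + real (Suc n) * T} f - (real (Suc n) * T) *\<^sub>R A T
          = (integral {c..c + real n * T} f - (real n * T) *\<^sub>R A T) + (integral {c + real n * T..c + real n * T + T} f - T *\<^sub>R A T)"
          by (simp add: algebra_simps)
        moreover have "cmod (integral {c + real n * T..c + real n * T + T} f - T *\<^sub>R A T) \<le> e/2 * T"
          using T1(2)[OF T, of "c + real n * T" 0] \<open>T > 0\<close> by (simp add: A_def)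
        ultimately have "cmod (integral {c..c + real (Suc n) * T} f - (real (Suc n) * T) *\<^sub>R A T) \<le> e/2 * (real n * T) + e/2 * T"
          using Suc norm_triangle_mono by metis
        then show ?case by (simp add: algebra_simps)
      qed auto
      define T2 where "T2 = 4 * C * T / e"
      have "cmod (integral {c..c+T'} f - T' *\<^sub>R A T) \<le> e * T'" if T': "T' \<ge> T2" for T' c
      proof -
        have "T' > 0" using T' \<open>T > 0\<close> C \<open>e > 0\<close> by (auto simp: T2_def intro: less_le_trans[of 0 "4 * C * T / e"])
        define n where "n = nat \<lfloor>T'/T\<rfloor>"
        have nn: "real n = of_int \<lfloor>T'/T\<rfloor>" using \<open>T' > 0\<close> \<open>T > 0\<close> by (simp add: n_def)
        have n1: "real n * T \<le> T'" using \<open>T > 0\<close> nn of_int_floor_le[of "T'/T"] by (metis pos_le_divide_eq)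
        have n2: "T' - real n * T \<le> T" using \<open>T > 0\<close> nn floor_correct[of "T'/T"]
          by (simp add: pos_divide_less_eq algebra_simps)
        have "integral {c..c + real n * T} f + integral {c + real n * T..c + T'} f = integral {c..c + T'} f"
          by (rule Henstock_Kurzweil_Integration.integral_combine) (use \<open>T > 0\<close> n1 in \<open>auto intro: AP_integrable f\<close>)
        then have eq: "integral {c..c+T'} f - T' *\<^sub>R A T = (integral {c..c + real n * T} f - (real n * T) *\<^sub>R A T)
             + (integral {c + real n * T..c + T'} f - (T' - real n * T) *\<^sub>R A T)"
          by (simp add: algebra_simps)
        have "cmod (integral {c + real n * T..c + T'} f) \<le> C * (c + T' - (c + real n * T))"
          by (rule norm_integral_le) (use n1 C in \<open>auto intro: AP_continuous f\<close>)
        then have a: "cmod (integral {c + real n * T..c + T'} f) \<le> C * T"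
          using n2 C(1) by (smt (verit, best) mult_left_mono)
        have "cmod (integral {0..0+T} f) \<le> C * (0 + T - 0)"
          by (rule norm_integral_le) (use \<open>T > 0\<close> C in \<open>auto intro: AP_continuous f\<close>)
        then have "cmod (A T) \<le> C" using \<open>T > 0\<close> by (simp add: A_def field_simps)
        then have b: "cmod ((T' - real n * T) *\<^sub>R A T) \<le> T * C"
          using n1 n2 \<open>T > 0\<close> by (simp del: of_real_diff) (intro mult_mono, auto)
        have "cmod (integral {c..c+T'} f - T' *\<^sub>R A T) \<le> e/2 * (real n * T) + (C * T + T * C)"
          unfolding eq by (intro order_trans[OF norm_triangle_ineq] add_mono step order_trans[OF norm_triangle_ineq4] a b)
        also have "\<dots> \<le> e/2 * T' + e/2 * T'"
        proof (rule add_mono)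
          show "e/2 * (real n * T) \<le> e/2 * T'" using n1 \<open>e > 0\<close> by simp
          show "C * T + T * C \<le> e/2 * T'" using T' \<open>e > 0\<close> by (simp add: T2_def field_simps)
        qed
        finally show ?thesis by (simp add: mult.commute)
      qed
      moreover have "T2 > 0" using \<open>T > 0\<close> C \<open>e > 0\<close> by (simp add: T2_def)
      ultimately show ?thesis by blast
    qed
    then show ?thesis using T1(1) by blast
  qed
  have closeA: "\<exists>T1>0. \<forall>T\<ge>T1. \<exists>T2>0. \<forall>T'\<ge>T2. cmod (A T' - A T) \<le> e" if e: "e > 0" for e
  proof -
    obtain T1 where T1: "T1 > 0" "\<forall>T\<ge>T1. \<exists>T2>0. \<forall>T'\<ge>T2. \<forall>c. cmod (integral {c..c+T'} f - T' *\<^sub>R A T) \<le> e * T'"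
      using key[OF e] by blast
    have "\<exists>T2>0. \<forall>T'\<ge>T2. cmod (A T' - A T) \<le> e" if T: "T \<ge> T1" for T
    proof -
      obtain T2 where T2: "T2 > 0" "\<forall>T'\<ge>T2. \<forall>c. cmod (integral {c..c+T'} f - T' *\<^sub>R A T) \<le> e * T'"
        using T1 T by blast
      have "cmod (A T' - A T) \<le> e" if "T' \<ge> T2" for T'
      proof -
        have T': "T' > 0" using that T2 by simp
        have "T' *\<^sub>R (A T' - A T) = integral {0..0+T'} f - T' *\<^sub>R A T" using T' by (simp add: A_def algebra_simps)
        then have "cmod (T' *\<^sub>R (A T' - A T)) \<le> e * T'" using T2(2) that by metis
        then show ?thesis using T' by simp
      qed
      then show ?thesis using T2(1) by blast
    qed
    then show ?thesis using T1(1) by blast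
  qed
  have "Cauchy (\<lambda>n. A (real n))"
    unfolding Cauchy_def
  proof (intro allI impI)
    fix e :: real assume "e > 0"
    then obtain T1 where T1: "T1 > 0" "\<forall>T\<ge>T1. \<exists>T2>0. \<forall>T'\<ge>T2. cmod (A T' - A T) \<le> e/3"
      using closeA[of "e/3"] by auto
    obtain T2 where T2: "T2 > 0" "\<forall>T'\<ge>T2. cmod (A T' - A T1) \<le> e/3" using T1(2) by blast
    obtain M where M: "real M \<ge> T2" using real_arch_simple by blast
    have "dist (A (real m)) (A (real n)) < e" if "m \<ge> M" "n \<ge> M" for m n
    proof -
      have "real m \<ge> T2" "real n \<ge> T2" using that M by auto
      then have "cmod (A (real m) - A T1) \<le> e/3" "cmod (A T1 - A (real n)) \<le> e/3"
        using T2(2) by (auto simp: norm_minus_commute)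
      then have "cmod (A (real m) - A (real n)) \<le> e/3 + e/3" by (rule norm_diff_triangle_le)
      then show ?thesis using \<open>e > 0\<close> by (simp add: dist_norm)
    qed
    then show "\<exists>M. \<forall>m\<ge>M. \<forall>n\<ge>M. dist (A (real m)) (A (real n)) < e" by blast
  qed
  then obtain m where m: "(\<lambda>n. A (real n)) \<longlonglongrightarrow> m" using Cauchy_convergent convergent_def by blast
  show ?thesis
  proof (intro exI[of _ m] allI impI)
    fix e :: real assume "e > 0"
    obtain T1 where T1: "T1 > 0" "\<forall>T\<ge>T1. \<exists>T2>0. \<forall>T'\<ge>T2. \<forall>c. cmod (integral {c..c+T'} f - T' *\<^sub>R A T) \<le> e/2 * T'"
      using key[of "e/2"] \<open>e > 0\<close> by auto
    have "\<forall>\<^sub>F n in sequentially. dist (A (real n)) m < e/2"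
      by (rule tendstoD[OF m]) (use \<open>e > 0\<close> in simp)
    moreover have "\<forall>\<^sub>F n in sequentially. real n \<ge> T1"
      by (meson eventually_sequentiallyI nat_ceiling_le_eq)
    ultimately obtain n where n: "dist (A (real n)) m < e/2" "real n \<ge> T1"
      using eventually_happens'[OF sequentially_bot eventually_conj] by blast
    then obtain T2 where T2: "T2 > 0" "\<forall>T'\<ge>T2. \<forall>c. cmod (integral {c..c+T'} f - T' *\<^sub>R A (real n)) \<le> e/2 * T'"
      using T1 by blast
    have "cmod (integral {c..c+T} f - T *\<^sub>R m) \<le> e * T" if "T \<ge> T2" for T c
    proof -
      have "T > 0" using that T2 by simp
      have "cmod (T *\<^sub>R A (real n) - T *\<^sub>R m) = T * cmod (A (real n) - m)"
        using \<open>T > 0\<close> by (simp flip: scaleR_right_diff_distrib)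
      also have "\<dots> \<le> T * (e/2)" using n(1) \<open>T > 0\<close> by (simp add: dist_norm)
      finally have "cmod (T *\<^sub>R A (real n) - T *\<^sub>R m) \<le> T * (e/2)" .
      moreover have "cmod (integral {c..c+T} f - T *\<^sub>R A (real n)) \<le> e/2 * T" using T2(2) that by blast
      ultimately have "cmod (integral {c..c+T} f - T *\<^sub>R m) \<le> e/2 * T + T * (e/2)"
        using norm_diff_triangle_le by blast
      then show ?thesis by (simp add: algebra_simps)
    qed
    then show "\<exists>T0>0. \<forall>T\<ge>T0. \<forall>c. cmod (integral {c..c+T} f - T *\<^sub>R m) \<le> e * T" using T2(1) by blast
  qed
qed

lemma ap_mean_eqI:
  "((\<lambda>T. (1 / (2 * T)) *\<^sub>R integral {-T..T} f) \<longlongrightarrow> m) at_top \<Longrightarrow> ap_mean f = m"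
  unfolding ap_mean_def by (rule tendsto_Lim) auto

lemma tendsto_of_window_means:
  assumes "\<And>e. e > 0 \<Longrightarrow> \<exists>T0>0. \<forall>T\<ge>T0. \<forall>c. cmod (integral {c..c+T} f - T *\<^sub>R m) \<le> e * T"
  shows "((\<lambda>T. (1 / (2 * T)) *\<^sub>R integral {-T..T} f) \<longlongrightarrow> m) at_top"
  unfolding tendsto_iff
proof (intro allI impI)
  fix e :: real assume "e > 0"
  obtain T0 where T0: "T0 > 0" "\<forall>T\<ge>T0. \<forall>c. cmod (integral {c..c+T} f - T *\<^sub>R m) \<le> e/2 * T"
    using assms[of "e/2"] \<open>e > 0\<close> by auto
  have "dist ((1 / (2 * T)) *\<^sub>R integral {-T..T} f) m < e" if "T \<ge> T0" for T
  proof -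
    have T: "T > 0" using that T0 by simp
    have "cmod (integral {-T..-T+2*T} f - (2*T) *\<^sub>R m) \<le> e/2 * (2*T)"
      by (rule T0(2)[rule_format]) (use that T in simp)
    moreover have "integral {-T..-T+2*T} f - (2*T) *\<^sub>R m = (2*T) *\<^sub>R ((1 / (2 * T)) *\<^sub>R integral {-T..T} f - m)"
      using T by (simp add: algebra_simps)
    ultimately have "2 * T * cmod ((1 / (2 * T)) *\<^sub>R integral {-T..T} f - m) \<le> e/2 * (2*T)"
      using T by (simp del: scaleR_right_diff_distrib)
    then have "cmod ((1 / (2 * T)) *\<^sub>R integral {-T..T} f - m) \<le> e/2" using T by (simp add: field_simps)
    then show ?thesis using \<open>e > 0\<close> unfolding dist_norm by simp
  qed
  then show "\<forall>\<^sub>F T in at_top. dist ((1 / (2 * T)) *\<^sub>R integral {-T..T} f) m < e"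
    using eventually_at_top_linorder by blast
qed

lemma AP_mean_window:
  assumes "f \<in> AP" "e > 0"
  shows "\<exists>T0>0. \<forall>T\<ge>T0. \<forall>c. cmod (integral {c..c+T} f - T *\<^sub>R ap_mean f) \<le> e * T"
  using AP_mean_exists[OF assms(1)] ap_mean_eqI[OF tendsto_of_window_means, of f] assms(2) by metis

lemma AP_mean_tendsto:
  assumes "f \<in> AP"
  shows "((\<lambda>T. (1 / (2 * T)) *\<^sub>R integral {-T..T} f) \<longlongrightarrow> ap_mean f) at_top"
  using tendsto_of_window_means AP_mean_window[OF assms] by blast

lemma ap_mean_add:
  assumes "f \<in> AP" "g \<in> AP"
  shows "ap_mean (\<lambda>x. f x + g x) = ap_mean f + ap_mean g"
proof (rule ap_mean_eqI)
  have "((\<lambda>T. (1 / (2 * T)) *\<^sub>R integral {-T..T} f + (1 / (2 * T)) *\<^sub>R integral {-T..T} g) \<longlongrightarrow> ap_mean f + ap_mean g) at_top"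
    by (intro tendsto_add AP_mean_tendsto assms)
  then show "((\<lambda>T. (1 / (2 * T)) *\<^sub>R integral {-T..T} (\<lambda>x. f x + g x)) \<longlongrightarrow> ap_mean f + ap_mean g) at_top"
    by (simp add: Henstock_Kurzweil_Integration.integral_add AP_integrable assms scaleR_add_right)
qed

lemma ap_mean_cmult:
  assumes "f \<in> AP"
  shows "ap_mean (\<lambda>x. c * f x) = c * ap_mean f"
proof (rule ap_mean_eqI)
  have "((\<lambda>T. c * ((1 / (2 * T)) *\<^sub>R integral {-T..T} f)) \<longlongrightarrow> c * ap_mean f) at_top"
    by (intro tendsto_mult_left AP_mean_tendsto assms)
  then show "((\<lambda>T. (1 / (2 * T)) *\<^sub>R integral {-T..T} (\<lambda>x. c * f x)) \<longlongrightarrow> c * ap_mean f) at_top"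
    by simp
qed

lemma ap_mean_diff:
  assumes "f \<in> AP" "g \<in> AP"
  shows "ap_mean (\<lambda>x. f x - g x) = ap_mean f - ap_mean g"
  using ap_mean_add[OF assms(1) AP_cmult[OF assms(2), of "-1"]] ap_mean_cmult[OF assms(2), of "-1"] by simp

lemma ap_mean_const: "ap_mean (\<lambda>x. c) = c"
proof (rule ap_mean_eqI)
  have "\<forall>\<^sub>F T::real in at_top. c = (1 / (2 * T)) *\<^sub>R integral {-T..T} (\<lambda>x. c)"
    using eventually_gt_at_top[of 0] by eventually_elim (simp add: scaleR_conv_of_real)
  then show "((\<lambda>T::real. (1 / (2 * T)) *\<^sub>R integral {-T..T} (\<lambda>x. c)) \<longlongrightarrow> c) at_top"
    by (rule Lim_transform_eventually[OF tendsto_const])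
qed

lemma ap_mean_sum:
  assumes "\<And>i. i \<in> I \<Longrightarrow> f i \<in> AP"
  shows "ap_mean (\<lambda>x. \<Sum>i\<in>I. f i x) = (\<Sum>i\<in>I. ap_mean (f i))"
  using assms by (induction I rule: infinite_finite_induct) (auto simp: ap_mean_const ap_mean_add AP_sum)

lemma ap_mean_bound:
  assumes f: "f \<in> AP" and "\<And>x. cmod (f x) \<le> C"
  shows "cmod (ap_mean f) \<le> C"
proof (rule tendsto_upperbound[OF tendsto_norm[OF AP_mean_tendsto[OF f]]])
  show "\<forall>\<^sub>F T in at_top. cmod ((1 / (2 * T)) *\<^sub>R integral {-T..T} f) \<le> C"
    using eventually_gt_at_top[of 0]
  proof eventually_elim
    case (elim T)
    have "cmod (integral {-T..T} f) \<le> C * (T - (-T))"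
      by (rule norm_integral_le) (use assms elim in \<open>auto intro: AP_continuous\<close>)
    then show ?case using elim by (simp add: field_simps)
  qed
qed simp

lemma ap_mean_translate:
  assumes f: "f \<in> AP"
  shows "ap_mean (\<lambda>x. f (x + c)) = ap_mean f"
proof (rule ap_mean_eqI[OF tendsto_of_window_means])
  fix e :: real assume "e > 0"
  then obtain T0 where T0: "T0 > 0" "\<forall>T\<ge>T0. \<forall>c. cmod (integral {c..c+T} f - T *\<^sub>R ap_mean f) \<le> e * T"
    using AP_mean_window[OF f] by blast
  have "integral {d..d+T} (\<lambda>x. f (x + c)) = integral {d + c..(d + c) + T} f" for d T
    using integral_translate[of d "d+T" f c] by (simp add: algebra_simps)
  then show "\<exists>T0>0. \<forall>T\<ge>T0. \<forall>d. cmod (integral {d..d+T} (\<lambda>x. f (x + c)) - T *\<^sub>R ap_mean f) \<le> e * T"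
    using T0 by metis
qed

lemma integral_cis:
  assumes "\<mu> \<noteq> 0" "a \<le> b"
  shows "((\<lambda>x. cis (\<mu> * x)) has_integral (cis (\<mu> * b) - cis (\<mu> * a)) / (\<i> * of_real \<mu>)) {a..b}"
proof -
  have "((\<lambda>x. cis (\<mu> * x) / (\<i> * of_real \<mu>)) has_vector_derivative cis (\<mu> * x)) (at x within {a..b})" for x
  proof -
    have "((\<lambda>z. exp (\<i> * of_real \<mu> * z) / (\<i> * of_real \<mu>)) has_field_derivative exp (\<i> * of_real \<mu> * of_real x)) (at (of_real x))"
      using assms(1) by (auto intro!: derivative_eq_intros simp: field_simps)
    then have "((\<lambda>x. exp (\<i> * of_real \<mu> * of_real x) / (\<i> * of_real \<mu>)) has_vector_derivative exp (\<i> * of_real \<mu> * of_real x)) (at x within {a..b})"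
      by (rule has_vector_derivative_real_field)
    then show ?thesis by (simp add: cis_conv_exp mult.assoc)
  qed
  then have "((\<lambda>x. cis (\<mu> * x)) has_integral (cis (\<mu> * b) / (\<i> * of_real \<mu>) - cis (\<mu> * a) / (\<i> * of_real \<mu>))) {a..b}"
    by (intro fundamental_theorem_of_calculus assms)
  then show ?thesis by (simp add: diff_divide_distrib)
qed

lemma ap_mean_cis: "ap_mean (\<lambda>x. cis (\<mu> * x)) = (if \<mu> = 0 then 1 else 0)"
proof (cases "\<mu> = 0")
  case False
  have "ap_mean (\<lambda>x. cis (\<mu> * x)) = 0"
  proof (rule ap_mean_eqI[OF tendsto_of_window_means])
    fix e :: real assume "e > 0"
    define T0 where "T0 = 2 / (\<bar>\<mu>\<bar> * e)"
    have "cmod (integral {c..c+T} (\<lambda>x. cis (\<mu> * x)) - T *\<^sub>R 0) \<le> e * T" if "T \<ge> T0" for T c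
    proof -
      have "T0 > 0" using False \<open>e > 0\<close> by (simp add: T0_def)
      then have "T > 0" using that by simp
      have "integral {c..c+T} (\<lambda>x. cis (\<mu> * x)) = (cis (\<mu> * (c+T)) - cis (\<mu> * c)) / (\<i> * of_real \<mu>)"
        by (rule integral_unique, rule integral_cis) (use False \<open>T > 0\<close> in auto)
      then have "cmod (integral {c..c+T} (\<lambda>x. cis (\<mu> * x))) = cmod (cis (\<mu> * (c+T)) - cis (\<mu> * c)) / \<bar>\<mu>\<bar>"
        by (simp add: norm_divide norm_mult)
      also have "\<dots> \<le> 2 / \<bar>\<mu>\<bar>"
        using norm_triangle_ineq4[of "cis (\<mu> * (c+T))" "cis (\<mu> * c)"] by (intro divide_right_mono) auto
      also have "\<dots> = e * T0" using False \<open>e > 0\<close> by (simp add: T0_def)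
      also have "\<dots> \<le> e * T" using that \<open>e > 0\<close> by simp
      finally show ?thesis by simp
    qed
    moreover have "T0 > 0" using False \<open>e > 0\<close> by (simp add: T0_def)
    ultimately show "\<exists>T0>0. \<forall>T\<ge>T0. \<forall>c. cmod (integral {c..c+T} (\<lambda>x. cis (\<mu> * x)) - T *\<^sub>R 0) \<le> e * T" by blast
  qed
  then show ?thesis using False by simp
qed (simp add: ap_mean_const)

text \<open>By nonnegativity each window of length \<open>L + d\<close> contributes at least \<open>d * y\<close> to the integral.\<close>

lemma ap_mean_ge:
  assumes f: "(\<lambda>x. of_real (g x)) \<in> AP" and nn: "\<And>x. 0 \<le> g x" and "d > 0" "L \<ge> 0" "y \<ge> 0"
    and ge: "\<And>c. \<exists>\<tau>\<in>{c..c+L}. \<forall>s\<in>{0..d}. y \<le> g (\<tau> + s)"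
  shows "d * y / (L + d) \<le> Re (ap_mean (\<lambda>x. of_real (g x)))"
proof -
  let ?f = "\<lambda>x. complex_of_real (g x)"
  have gc: "continuous_on A g" for A
    using continuous_on_Re[OF AP_continuous[OF f, of A]] by simp
  have gi: "g integrable_on {a..b}" for a b by (intro integrable_continuous_interval gc)
  have fg: "integral {a..b} ?f = of_real (integral {a..b} g)" for a b
    by (rule integral_unique) (intro has_integral_of_real integrable_integral gi)
  have one: "d * y \<le> integral {c..c+(L+d)} g" for c
  proof -
    obtain \<tau> where \<tau>: "\<tau> \<in> {c..c+L}" "\<forall>s\<in>{0..d}. y \<le> g (\<tau> + s)" using ge by blast
    have "d * y = integral {\<tau>..\<tau>+d} (\<lambda>x. y)" using \<open>d > 0\<close> by simp
    also have "\<dots> \<le> integral {\<tau>..\<tau>+d} g"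
    proof (rule integral_le)
      fix x assume "x \<in> {\<tau>..\<tau>+d}"
      then show "y \<le> g x" using \<tau>(2)[rule_format, of "x - \<tau>"] by simp
    qed (auto intro: gi)
    also have "\<dots> \<le> integral {c..c+(L+d)} g"
      by (rule integral_subset_le) (use \<tau> nn \<open>d > 0\<close> in \<open>auto intro: gi\<close>)
    finally show ?thesis .
  qed
  have many: "real n * (d * y) \<le> integral {0..real n * (L+d)} g" for n
  proof (induction n)
    case (Suc n)
    have "integral {0..real n * (L+d)} g + integral {real n * (L+d)..real n * (L+d) + (L+d)} g = integral {0..real n * (L+d) + (L+d)} g"
      by (rule Henstock_Kurzweil_Integration.integral_combine) (use assms in \<open>auto intro: gi\<close>)
    then show ?case using Suc one[of "real n * (L+d)"] by (simp add: algebra_simps)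
  qed auto
  show ?thesis
  proof (rule field_le_epsilon)
    fix e :: real assume "e > 0"
    then obtain T0 where T0: "T0 > 0" "\<forall>T\<ge>T0. \<forall>c. cmod (integral {c..c+T} ?f - T *\<^sub>R ap_mean ?f) \<le> e * T"
      using AP_mean_window[OF f] by blast
    obtain n :: nat where n: "real n > T0 / (L+d)" using reals_Archimedean2 by blast
    define T where "T = real n * (L+d)"
    have T: "T \<ge> T0" using n assms by (simp add: T_def field_simps)
    have "cmod (integral {0..0+T} ?f - T *\<^sub>R ap_mean ?f) \<le> e * T" using T0(2) T by blast
    then have "Re (integral {0..0+T} ?f - T *\<^sub>R ap_mean ?f) \<le> e * T" using complex_Re_le_cmod order_trans by blast
    then have "integral {0..T} g - T * Re (ap_mean ?f) \<le> e * T" by (simp add: fg)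
    then have "real n * (d * y) \<le> T * Re (ap_mean ?f) + e * T" using many[of n] by (simp add: T_def)
    also have "real n * (d * y) = T * (d * y / (L + d))" using assms by (simp add: T_def)
    finally have "T * (d * y / (L + d)) \<le> T * (Re (ap_mean ?f) + e)" by (simp add: algebra_simps)
    moreover have "T > 0" using T T0 by simp
    ultimately show "d * y / (L + d) \<le> Re (ap_mean ?f) + e" by (metis mult_le_cancel_left_pos)
  qed
qed

lemma ap_mean_nonneg:
  assumes "(\<lambda>x. of_real (g x)) \<in> AP" "\<And>x. 0 \<le> g x"
  shows "0 \<le> Re (ap_mean (\<lambda>x. of_real (g x)))"
  using ap_mean_ge[OF assms, of 1 0 0] assms(2) by simp

lemma Im_ap_mean_of_real:
  assumes f: "(\<lambda>x. of_real (g x)) \<in> AP"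
  shows "Im (ap_mean (\<lambda>x. of_real (g x))) = 0"
proof -
  have gc: "continuous_on A g" for A
    using continuous_on_Re[OF AP_continuous[OF f, of A]] by simp
  have "integral {a..b} (\<lambda>x. complex_of_real (g x)) = of_real (integral {a..b} g)" for a b
    by (rule integral_unique) (intro has_integral_of_real integrable_integral integrable_continuous_interval gc)
  then have "((\<lambda>T. Im ((1 / (2 * T)) *\<^sub>R integral {-T..T} (\<lambda>x. complex_of_real (g x)))) \<longlongrightarrow> 0) at_top" by simp
  moreover have "((\<lambda>T. Im ((1 / (2 * T)) *\<^sub>R integral {-T..T} (\<lambda>x. complex_of_real (g x)))) \<longlongrightarrow> Im (ap_mean (\<lambda>x. of_real (g x)))) at_top"
    by (intro tendsto_Im AP_mean_tendsto f)
  ultimately show ?thesis using tendsto_unique[OF trivial_limit_at_top_linorder] by blast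
qed

section \<open>Fourier analysis on a finite cyclic group\<close>

lemma dft_orthogonality:
  fixes n :: int
  assumes "M > 0"
  shows "(\<Sum>k<M. cis (2 * pi * real k * of_int n / real M)) = (if int M dvd n then of_nat M else 0)"
proof -
  define z where "z = cis (2 * pi * of_int n / real M)"
  have pw: "cis (2 * pi * real k * of_int n / real M) = z ^ k" for k
    unfolding z_def Complex.DeMoivre by (rule arg_cong[of _ _ cis]) (simp add: field_simps)
  show ?thesis
  proof (cases "int M dvd n")
    case True
    then obtain q where "n = int M * q" by (elim dvdE)
    then have "z = cis (2 * pi * of_int q)" using assms by (simp add: z_def mult.assoc del: cis_multiple_2pi)
    then have "z = 1" by (simp only: cis_multiple_2pi Ints_of_int)
    then show ?thesis using True by (simp add: pw)
  next
    case False
    have "z \<noteq> 1"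
    proof
      assume "z = 1"
      then have "cos (2 * pi * of_int n / real M) = 1" by (simp add: z_def complex_eq_iff)
      then obtain k :: int where "2 * pi * of_int n / real M = of_int k * 2 * pi"
        unfolding cos_one_2pi_int by blast
      then have "real_of_int n = of_int (k * int M)" using assms by (simp add: field_simps)
      then have "n = k * int M" by (rule of_int_eq_iff[THEN iffD1])
      then show False using False by simp
    qed
    moreover have "z ^ M = 1"
    proof -
      have "z ^ M = cis (real M * (2 * pi * of_int n / real M))" unfolding z_def by (rule Complex.DeMoivre)
      also have "real M * (2 * pi * of_int n / real M) = 2 * pi * of_int n" using assms by simp
      finally show ?thesis by (simp only: cis_multiple_2pi Ints_of_int)
    qed
    ultimately show ?thesis using False by (simp add: pw geometric_sum)
  qed
qed

definition dft :: "nat \<Rightarrow> (nat \<Rightarrow> complex) \<Rightarrow> nat \<Rightarrow> complex" where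
  "dft M u k = (\<Sum>j<M. u j * cis (- (2 * pi * real k * real j / real M)))"

definition cyclic_correlation :: "nat \<Rightarrow> (nat \<Rightarrow> complex) \<Rightarrow> nat \<Rightarrow> complex" where
  "cyclic_correlation M u t = (\<Sum>j<M. u ((j + t) mod M) * cnj (u j))"

lemma dft_parseval:
  assumes "M > 0"
  shows "(\<Sum>k<M. dft M u k * cnj (dft M v k)) = of_nat M * (\<Sum>j<M. u j * cnj (v j))"
proof -
  have "(\<Sum>k<M. dft M u k * cnj (dft M v k))
    = (\<Sum>k<M. \<Sum>j<M. \<Sum>i<M. u j * cnj (v i) * cis (2 * pi * real k * of_int (int i - int j) / real M))"
    unfolding dft_def sum_product cnj_sum
  proof (intro sum.cong refl)
    fix k j i
    have "cis (- (2 * pi * real k * real j / real M)) * cis (2 * pi * real k * real i / real M)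
      = cis (2 * pi * real k * of_int (int i - int j) / real M)"
      by (simp add: cis_mult diff_divide_distrib right_diff_distrib)
    then show "u j * cis (- (2 * pi * real k * real j / real M)) * cnj (v i * cis (- (2 * pi * real k * real i / real M))) =
       u j * cnj (v i) * cis (2 * pi * real k * of_int (int i - int j) / real M)"
      by (simp add: cis_cnj mult_ac)
  qed
  also have "\<dots> = (\<Sum>j<M. \<Sum>k<M. \<Sum>i<M. u j * cnj (v i) * cis (2 * pi * real k * of_int (int i - int j) / real M))"
    by (rule sum.swap)
  also have "\<dots> = (\<Sum>j<M. \<Sum>i<M. u j * cnj (v i) * (\<Sum>k<M. cis (2 * pi * real k * of_int (int i - int j) / real M)))"
    unfolding sum_distrib_left by (intro sum.cong refl sum.swap)
  also have "\<dots> = (\<Sum>j<M. \<Sum>i<M. if i = j then of_nat M * (u j * cnj (v j)) else 0)"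
  proof (intro sum.cong refl)
    fix j i assume ji: "j \<in> {..<M}" "i \<in> {..<M}"
    have "int M dvd (int i - int j) \<longleftrightarrow> i = j"
    proof
      assume "int M dvd (int i - int j)"
      then have "int i mod int M = int j mod int M" by (simp add: mod_eq_dvd_iff)
      then show "i = j" using ji by simp
    qed simp
    then show "u j * cnj (v i) * (\<Sum>k<M. cis (2 * pi * real k * of_int (int i - int j) / real M))
        = (if i = j then of_nat M * (u j * cnj (v j)) else 0)"
      using dft_orthogonality[OF assms, of "int i - int j"] by simp
  qed
  also have "\<dots> = of_nat M * (\<Sum>j<M. u j * cnj (v j))"
    by (simp add: sum_distrib_left)
  finally show ?thesis .
qed

lemma dft_plancherel:
  assumes "M > 0"
  shows "(\<Sum>k<M. (cmod (dft M u k))\<^sup>2) = real M * (\<Sum>j<M. (cmod (u j))\<^sup>2)"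
proof -
  have "complex_of_real (\<Sum>k<M. (cmod (dft M u k))\<^sup>2) = of_real (real M * (\<Sum>j<M. (cmod (u j))\<^sup>2))"
    using dft_parseval[OF assms, of u u] by (simp only: of_real_sum of_real_mult complex_norm_square of_real_of_nat_eq)
  then show ?thesis by (simp only: of_real_eq_iff)
qed

lemma dft_shift:
  assumes "M > 0"
  shows "dft M (\<lambda>j. u ((j + t) mod M)) k = dft M u k * cis (2 * pi * real k * real t / real M)"
proof -
  have bij: "bij_betw (\<lambda>j. (j + t) mod M) {..<M} {..<M}"
  proof -
    have "inj_on (\<lambda>j. (j + t) mod M) {..<M}"
    proof (rule inj_onI)
      fix x y assume xy: "x \<in> {..<M}" "y \<in> {..<M}" "(x + t) mod M = (y + t) mod M"
      then have "x mod M = y mod M"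
      proof -
        have "int (x + t) mod int M = int (y + t) mod int M" using xy(3) by (metis of_nat_mod)
        then have "int M dvd int (x + t) - int (y + t)" by (simp only: mod_eq_dvd_iff)
        then have "int x mod int M = int y mod int M" by (simp add: mod_eq_dvd_iff)
        then show ?thesis by (simp flip: of_nat_mod)
      qed
      then show "x = y" using xy by simp
    qed
    moreover have "(\<lambda>j. (j + t) mod M) ` {..<M} \<subseteq> {..<M}" using assms by auto
    ultimately show ?thesis
      by (simp add: bij_betw_def endo_inj_surj)
  qed
  have "dft M u k = (\<Sum>j<M. u ((j + t) mod M) * cis (- (2 * pi * real k * real ((j + t) mod M) / real M)))"
    unfolding dft_def by (rule sum.reindex_bij_betw[OF bij, symmetric])
  also have "\<dots> = (\<Sum>j<M. u ((j + t) mod M) * (cis (- (2 * pi * real k * real j / real M)) * cis (- (2 * pi * real k * real t / real M))))"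
  proof (intro sum.cong refl arg_cong2[where f="(*)"])
    fix j
    define q where "q = (j + t) div M"
    have "real (j + t) = real ((j + t) mod M) + real M * real q"
      unfolding q_def by (metis mod_mult_div_eq of_nat_add of_nat_mult)
    then have r: "real ((j + t) mod M) = real j + real t - real M * real q" by simp
    have "- (2 * pi * real k * real ((j + t) mod M) / real M)
       = (- (2 * pi * real k * real j / real M) + - (2 * pi * real k * real t / real M)) + 2 * pi * real_of_int (int (k * q))"
      unfolding r using assms by (simp add: field_simps)
    then have "cis (- (2 * pi * real k * real ((j + t) mod M) / real M))
       = cis (- (2 * pi * real k * real j / real M) + - (2 * pi * real k * real t / real M)) * cis (2 * pi * real_of_int (int (k * q)))"
      by (simp only: cis_mult)
    then show "cis (- (2 * pi * real k * real ((j + t) mod M) / real M))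
       = cis (- (2 * pi * real k * real j / real M)) * cis (- (2 * pi * real k * real t / real M))"
      by (simp only: cis_mult cis_multiple_2pi Ints_of_int mult_1_right)
  qed
  also have "\<dots> = dft M (\<lambda>j. u ((j + t) mod M)) k * cis (- (2 * pi * real k * real t / real M))"
    unfolding dft_def sum_distrib_right by (intro sum.cong refl) (simp add: mult_ac)
  finally have "dft M u k * cis (2 * pi * real k * real t / real M)
     = dft M (\<lambda>j. u ((j + t) mod M)) k * (cis (- (2 * pi * real k * real t / real M)) * cis (2 * pi * real k * real t / real M))"
    by (simp add: mult_ac)
  then show ?thesis by (simp add: cis_mult)
qed

text \<open>
  The transform of \<open>|dft u|\<^sup>2\<close> is the cyclic correlation of \<open>u\<close>.  Applying Plancherel to both \<open>u\<close>
  and its correlation bounds the \<open>l\<^sup>2\<close> norm of the correlation by the \<open>l\<^sup>4\<close> norm of the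
  transform, hence by the largest Fourier coefficient: a bounded sequence with many large
  correlations has a large Fourier coefficient.
\<close>

lemma dft_large_coefficient:
  assumes M: "M > 0" and C: "\<And>j. cmod (u j) \<le> C"
  shows "\<exists>k<M. (\<Sum>t<M. (cmod (cyclic_correlation M u t))\<^sup>2) \<le> (cmod (dft M u k))\<^sup>2 * (real M * C\<^sup>2)"
proof -
  let ?A = "\<lambda>k. (cmod (dft M u k))\<^sup>2"
  let ?r = "cyclic_correlation M u"
  have corr: "dft M (\<lambda>k. of_real (?A k)) t = of_nat M * cnj (?r t)" for t
  proof -
    have "of_nat M * ?r t = (\<Sum>k<M. dft M (\<lambda>j. u ((j + t) mod M)) k * cnj (dft M u k))"
      unfolding cyclic_correlation_def by (rule dft_parseval[OF M, symmetric])
    also have "\<dots> = (\<Sum>k<M. of_real (?A k) * cis (2 * pi * real k * real t / real M))"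
      by (intro sum.cong refl) (simp only: dft_shift[OF M] complex_norm_square mult_ac)
    finally have "cnj (of_nat M * ?r t) = (\<Sum>k<M. of_real (?A k) * cis (- (2 * pi * real k * real t / real M)))"
      by (simp add: cis_cnj)
    then show ?thesis unfolding dft_def by (simp add: mult_ac)
  qed
  have "(real M)\<^sup>2 * (\<Sum>t<M. (cmod (?r t))\<^sup>2) = (\<Sum>t<M. (cmod (dft M (\<lambda>k. of_real (?A k)) t))\<^sup>2)"
    unfolding corr by (simp add: norm_mult power_mult_distrib sum_distrib_left)
  also have "\<dots> = real M * (\<Sum>k<M. (?A k)\<^sup>2)"
    unfolding dft_plancherel[OF M] by (simp add: norm_power)
  finally have 1: "real M * (\<Sum>t<M. (cmod (?r t))\<^sup>2) = (\<Sum>k<M. (?A k)\<^sup>2)"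
    using M by (simp add: power2_eq_square)
  obtain K where K: "K < M" "\<And>k. k < M \<Longrightarrow> ?A k \<le> ?A K"
  proof -
    have "finite {..<M}" "{..<M} \<noteq> {}" using M by auto
    then have "Max (?A ` {..<M}) \<in> ?A ` {..<M}" by (intro Max_in) auto
    then obtain K where "K < M" "?A K = Max (?A ` {..<M})" by auto
    then show ?thesis using that[of K] by simp
  qed
  have "(\<Sum>k<M. (?A k)\<^sup>2) \<le> (\<Sum>k<M. ?A K * ?A k)"
  proof (rule sum_mono)
    fix k assume "k \<in> {..<M}"
    then have "?A k \<le> ?A K" using K(2) by blast
    then have "?A k * ?A k \<le> ?A K * ?A k" by (rule mult_right_mono) simp
    then show "(?A k)\<^sup>2 \<le> ?A K * ?A k" by (simp only: power2_eq_square[of "?A k"])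
  qed
  also have "\<dots> = ?A K * (real M * (\<Sum>j<M. (cmod (u j))\<^sup>2))"
    by (simp add: sum_distrib_left[symmetric] dft_plancherel[OF M])
  also have "\<dots> \<le> ?A K * (real M * (\<Sum>j<M. C\<^sup>2))"
    using C by (intro mult_left_mono sum_mono power_mono) auto
  finally have "real M * (\<Sum>t<M. (cmod (?r t))\<^sup>2) \<le> real M * (?A K * (real M * C\<^sup>2))"
    unfolding 1 by (simp add: algebra_simps)
  then have "(\<Sum>t<M. (cmod (?r t))\<^sup>2) \<le> ?A K * (real M * C\<^sup>2)" using M by simp
  then show ?thesis using K(1) by blast
qed

lemma card_of_syndetic:
  fixes P :: "nat \<Rightarrow> bool"
  assumes "\<And>i0. \<exists>i\<in>{i0..<i0+L}. P i"
  shows "n \<le> card {i. i < n * L \<and> P i}"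
proof (induction n)
  case (Suc n)
  obtain i where i: "i \<in> {n*L..<n*L+L}" "P i" using assms by blast
  have "insert i {i. i < n * L \<and> P i} \<subseteq> {i. i < Suc n * L \<and> P i}" using i by auto
  then have "card (insert i {i. i < n * L \<and> P i}) \<le> card {i. i < Suc n * L \<and> P i}"
    by (intro card_mono) auto
  then show ?case using Suc i by (simp)
qed auto

lemma card_div_preimage:
  fixes P :: "nat \<Rightarrow> bool"
  assumes "q > 0"
  shows "card {j. j < q * m \<and> P (j div q)} = q * card {i. i < m \<and> P i}"
proof -
  have "{j. j < q * m \<and> P (j div q)} = (\<lambda>(i,r). i * q + r) ` ({i. i < m \<and> P i} \<times> {..<q})"
  proof (intro equalityI subsetI)
    fix j assume "j \<in> {j. j < q * m \<and> P (j div q)}"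
    then show "j \<in> (\<lambda>(i,r). i * q + r) ` ({i. i < m \<and> P i} \<times> {..<q})"
      using assms by (intro image_eqI[of _ _ "(j div q, j mod q)"]) (auto simp: less_mult_imp_div_less mult.commute)
  next
    fix j assume "j \<in> (\<lambda>(i,r). i * q + r) ` ({i. i < m \<and> P i} \<times> {..<q})"
    then obtain i r where ir: "j = i * q + r" "i < m" "P i" "r < q" by auto
    have "i * q + r < (i + 1) * q" using ir by simp
    also have "\<dots> \<le> m * q" using ir by (intro mult_le_mono1) simp
    finally show "j \<in> {j. j < q * m \<and> P (j div q)}" using ir assms by (simp add: mult.commute)
  qed
  moreover have "inj_on (\<lambda>(i,r). i * q + r) ({i. i < m \<and> P i} \<times> {..<q})"
  proof (rule inj_onI, clarsimp)
    fix i r i' r' assume a: "r < q" "r' < q" "i * q + r = i' * q + r'"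
    have "i = i'" using arg_cong[OF a(3), of "\<lambda>x. x div q"] a(1,2) assms by simp
    then show "i = i' \<and> r = r'" using a by auto
  qed
  ultimately show ?thesis by (simp add: card_image card_cartesian_product mult.commute)
qed

section \<open>A nonzero almost periodic function has a large Fourier coefficient\<close>

text \<open>
  A function that is large somewhere and has many almost periods has, on long windows, a large
  sampled Fourier coefficient.  The lower bound does not depend on the sampling density \<open>q\<close> and on
  the length \<open>n\<close> of the window: the samples \<open>x0 + j * \<rho> / q\<close> with \<open>j div q\<close> in a syndetic set all lie
  within \<open>\<rho>\<close> of \<open>x0\<close> plus an almost period, so that both the set of indices at which the sample is large and
  the set of shifts at which the correlation is large have a density that is independent of \<open>q\<close>.
\<close>

lemma large_sampled_coefficient:
  fixes g :: "real \<Rightarrow> complex"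
  assumes C: "C > 0" "\<And>x. cmod (g x) \<le> C" and e: "e > 0" "cmod (g x0) \<ge> e"
    and pos': "\<rho>' > 0" "p > 0" "q' > 0" and pos2: "L > 0" "L' > 0" "H > 0" "n > 0"
    and \<rho>: "\<rho> = real p * \<rho>'" and q: "q = p * q'"
    and H1: "\<And>s x. \<bar>s\<bar> \<le> \<rho> \<Longrightarrow> cmod (g (x + s) - g x) \<le> e/4"
    and H2: "\<And>i0. \<exists>i\<in>{i0..<i0+L}. \<forall>x. cmod (g (x + real i * \<rho>) - g x) \<le> e/4"
    and H3: "\<And>s x. \<bar>s\<bar> \<le> \<rho>' \<Longrightarrow> cmod (g (x + s) - g x) \<le> d"
    and H4: "\<And>i0. \<exists>i\<in>{i0..<i0+L'}. \<forall>x. cmod (g (x + real i * \<rho>') - g x) \<le> d"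
    and m: "m = e\<^sup>2 / (4 * real L)" and d: "2 * d * C \<le> m / 4" and H: "2 * C\<^sup>2 / real H \<le> m / 4"
    and M: "M = q * L * L' * H * n"
  shows "\<exists>k<M. m / (2 * C * sqrt (real L' * real H)) * real M \<le>
     cmod (dft M (\<lambda>j. g (x0 + real j * (\<rho> / real q))) k)"
proof -
  define \<delta> where "\<delta> = \<rho> / real q"
  define a where "a = (\<lambda>j. g (x0 + real j * \<delta>))"
  let ?P = "\<lambda>i. \<forall>x. cmod (g (x + real i * \<rho>) - g x) \<le> e/4"
  let ?P' = "\<lambda>i. \<forall>x. cmod (g (x + real i * \<rho>') - g x) \<le> d"
  have pos: "\<rho> > 0" "q > 0" "L > 0" "L' > 0" "H > 0" "n > 0"
    using pos' pos2 by (auto simp: \<rho> q)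
  have \<delta>': "\<delta> = \<rho>' / real q'" using pos' by (simp add: \<delta>_def \<rho> q)
  have M0: "M > 0" using pos by (simp add: M)
  have mpos: "m > 0" using e pos by (simp add: m)
  have le: "q * L * L' * n \<le> M"
  proof -
    have "1 \<le> H" using pos by simp
    from mult_le_mono2[OF this, of "q * L * L' * n"] show ?thesis by (simp only: M mult_1_right mult_ac)
  qed
  have d0: "d \<ge> 0" using H3[of 0 0] pos' by simp
  have split: "real j * (r / real k) = real (j div k) * r + real (j mod k) * (r / real k)"
    and small: "\<bar>real (j mod k) * (r / real k)\<bar> \<le> r" if "k > 0" "r > 0" for j k :: nat and r :: real
  proof -
    have "real j = real (j div k) * real k + real (j mod k)"
      by (metis div_mult_mod_eq of_nat_add of_nat_mult)
    then show "real j * (r / real k) = real (j div k) * r + real (j mod k) * (r / real k)"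
      using that by (simp add: field_simps)
    have "real (j mod k) \<le> real k" using that by (simp add: less_imp_le)
    then have "real (j mod k) * (r / real k) \<le> real k * (r / real k)"
      using that by (intro mult_right_mono) auto
    then show "\<bar>real (j mod k) * (r / real k)\<bar> \<le> r" using that by simp
  qed
  have big: "cmod (a j) \<ge> e/2" if "?P (j div q)" for j
  proof -
    have "cmod (a j - g (x0 + real (j div q) * \<rho>)) \<le> e/4"
      using H1[OF small[OF pos(2,1), of j], of "x0 + real (j div q) * \<rho>"]
      by (simp only: a_def \<delta>_def split[OF pos(2,1), of j] add.assoc)
    then have "cmod (a j - g x0) \<le> e/4 + e/4"
      using that norm_diff_triangle_le by blast
    then show ?thesis using e norm_triangle_ineq3[of "a j" "g x0"] by simp
  qed
  have shift: "cmod (g (x + real t * \<delta>) - g x) \<le> 2 * d" if "?P' (t div q')" for t x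
  proof -
    have "cmod (g (x + real t * \<delta>) - g (x + real (t div q') * \<rho>')) \<le> d"
      using H3[OF small[OF pos'(3,1), of t], of "x + real (t div q') * \<rho>'"]
      by (simp only: \<delta>' split[OF pos'(3,1), of t] add.assoc)
    then have "cmod (g (x + real t * \<delta>) - g x) \<le> d + d"
      using that norm_diff_triangle_le by blast
    then show ?thesis by simp
  qed
  \<comment> \<open>samples within \<open>\<rho>\<close> of \<open>x0\<close> plus an almost period are large, and they are at least a fraction \<open>1 / L\<close> of all samples\<close>
  have count1: "M \<le> L * card {j. j < M \<and> ?P (j div q)}"
  proof -
    have "L' * H * n \<le> card {i. i < L' * H * n * L \<and> ?P i}" by (rule card_of_syndetic) (rule H2)
    then have "q * (L' * H * n) \<le> card {j. j < q * (L' * H * n * L) \<and> ?P (j div q)}"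
      using card_div_preimage[OF pos(2), of "L' * H * n * L" ?P] by simp
    then show ?thesis by (simp add: M mult_ac)
  qed
  have "real M * m \<le> (\<Sum>j<M. (cmod (a j))\<^sup>2)"
  proof -
    have "real M * m \<le> real (L * card {j. j < M \<and> ?P (j div q)}) * m"
      by (intro mult_right_mono of_nat_mono count1) (use mpos in auto)
    also have "\<dots> = (\<Sum>j\<in>{j. j < M \<and> ?P (j div q)}. (e/2)\<^sup>2)" using pos by (simp add: m power2_eq_square)
    also have "\<dots> \<le> (\<Sum>j\<in>{j. j < M \<and> ?P (j div q)}. (cmod (a j))\<^sup>2)"
      using big e by (intro sum_mono power_mono) auto
    also have "\<dots> \<le> (\<Sum>j<M. (cmod (a j))\<^sup>2)" by (intro sum_mono2) auto
    finally show ?thesis .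
  qed
  \<comment> \<open>compared with the square sum, a correlation at a shift near an almost period loses at most \<open>m / 4\<close> on average through the error of
    the almost period, and at most \<open>m / 4\<close> through the indices that wrap around, because the shift is at most \<open>M / H\<close>\<close>
  have rlow: "real M * (m / 2) \<le> cmod (cyclic_correlation M a t)" if t: "t < q * L * L' * n" "?P' (t div q')" for t
  proof -
    have tM: "t < M" and tH: "real t \<le> real M / real H"
    proof -
      show "t < M" using t(1) le by simp
      have "real t \<le> real (q * L * L' * n)" by (rule of_nat_mono) (rule less_imp_le_nat[OF t(1)])
      also have "\<dots> = real M / real H" using pos by (simp add: M)
      finally show "real t \<le> real M / real H" .
    qed
    have wrap: "cmod (a ((j + t) mod M) - a j) \<le> 2 * d + (if j < M - t then 0 else 2 * C)" if "j < M" for j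
    proof (cases "j < M - t")
      case True
      then have "(j + t) mod M = j + t" by simp
      then have "a ((j + t) mod M) - a j = g ((x0 + real j * \<delta>) + real t * \<delta>) - g (x0 + real j * \<delta>)"
        by (simp add: a_def algebra_simps)
      then show ?thesis using shift[OF t(2)] True by simp
    next
      case False
      have "cmod (a ((j + t) mod M) - a j) \<le> C + C"
        unfolding a_def by (rule order_trans[OF norm_triangle_ineq4]) (intro add_mono C)
      then show ?thesis using False d0 by simp
    qed
    have "cmod (cyclic_correlation M a t - of_real (\<Sum>j<M. (cmod (a j))\<^sup>2)) = cmod (\<Sum>j<M. (a ((j + t) mod M) - a j) * cnj (a j))"
      unfolding cyclic_correlation_def of_real_sum complex_norm_square
      by (simp add: sum_subtractf left_diff_distrib)
    also have "\<dots> \<le> (\<Sum>j<M. cmod ((a ((j + t) mod M) - a j) * cnj (a j)))" by (rule norm_sum)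
    also have "\<dots> \<le> (\<Sum>j<M. (2 * d + (if j < M - t then 0 else 2 * C)) * C)"
    proof (rule sum_mono)
      fix j assume j: "j \<in> {..<M}"
      have "cmod (a j) \<le> C" by (simp add: a_def C)
      then show "cmod ((a ((j + t) mod M) - a j) * cnj (a j)) \<le> (2 * d + (if j < M - t then 0 else 2 * C)) * C"
        unfolding norm_mult complex_mod_cnj using wrap[of j] j d0 C by (intro mult_mono) auto
    qed
    also have "\<dots> = real M * (2 * d * C) + (\<Sum>j<M. if j < M - t then 0 else 2 * C * C)"
    proof -
      have "(2 * d + (if j < M - t then 0 else 2 * C)) * C = 2 * d * C + (if j < M - t then 0 else 2 * C * C)" for j
        by (simp add: algebra_simps)
      then show ?thesis by (simp add: sum.distrib)
    qed
    also have "(\<Sum>j<M. if j < M - t then 0 else 2 * C * C) = (\<Sum>j\<in>{M-t..<M}. 2 * C * C)"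
    proof -
      have "(\<Sum>j<M. if j < M - t then 0 else 2 * C * C) = (\<Sum>j\<in>{M-t..<M}. if j < M - t then 0 else 2 * C * C)"
        by (rule sum.mono_neutral_right) auto
      then show ?thesis by simp
    qed
    also have "\<dots> = real t * (2 * C\<^sup>2)" using tM by (simp add: power2_eq_square)
    also have "\<dots> \<le> real M / real H * (2 * C\<^sup>2)" using tH by (rule mult_right_mono) simp
    also have "\<dots> = real M * (2 * C\<^sup>2 / real H)" by simp
    also have "real M * (2 * d * C) + real M * (2 * C\<^sup>2 / real H) \<le> real M * (m/4) + real M * (m/4)"
      by (intro add_mono mult_left_mono d H) auto
    also have "\<dots> = real M * (m/2)" by simp
    finally have "cmod (cyclic_correlation M a t - of_real (\<Sum>j<M. (cmod (a j))\<^sup>2)) \<le> real M * (m/2)" by simp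
    moreover have "cmod (complex_of_real (\<Sum>j<M. (cmod (a j))\<^sup>2)) \<ge> real M * m"
      using \<open>real M * m \<le> (\<Sum>j<M. (cmod (a j))\<^sup>2)\<close> by (simp add: abs_if del: of_real_sum)
    ultimately show ?thesis
      using norm_triangle_ineq2[of "of_real (\<Sum>j<M. (cmod (a j))\<^sup>2)" "cyclic_correlation M a t"]
      by (simp add: norm_minus_commute)
  qed
  have count2: "q * L * n \<le> card {t. t < q * L * L' * n \<and> ?P' (t div q')}"
  proof -
    have "p * L * n \<le> card {i. i < p * L * n * L' \<and> ?P' i}" by (rule card_of_syndetic) (rule H4)
    then have "q' * (p * L * n) \<le> card {j. j < q' * (p * L * n * L') \<and> ?P' (j div q')}"
      using card_div_preimage[OF pos'(3), of "p * L * n * L'" ?P'] by simp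
    then show ?thesis by (simp add: q mult_ac)
  qed
  have sumr: "real (q * L * n) * (real M * (m / 2))\<^sup>2 \<le> (\<Sum>t<M. (cmod (cyclic_correlation M a t))\<^sup>2)"
  proof -
    have "real (q * L * n) * (real M * (m / 2))\<^sup>2 \<le> real (card {t. t < q * L * L' * n \<and> ?P' (t div q')}) * (real M * (m / 2))\<^sup>2"
      by (intro mult_right_mono of_nat_mono count2) auto
    also have "\<dots> = (\<Sum>t\<in>{t. t < q * L * L' * n \<and> ?P' (t div q')}. (real M * (m / 2))\<^sup>2)" by simp
    also have "\<dots> \<le> (\<Sum>t\<in>{t. t < q * L * L' * n \<and> ?P' (t div q')}. (cmod (cyclic_correlation M a t))\<^sup>2)"
      using mpos by (intro sum_mono power_mono rlow) auto
    also have "\<dots> \<le> (\<Sum>t<M. (cmod (cyclic_correlation M a t))\<^sup>2)"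
      using le by (intro sum_mono2) auto
    finally show ?thesis .
  qed
  have "\<And>j. cmod (a j) \<le> C" by (simp add: a_def C)
  then obtain k where k: "k < M" "(\<Sum>t<M. (cmod (cyclic_correlation M a t))\<^sup>2) \<le> (cmod (dft M a k))\<^sup>2 * (real M * C\<^sup>2)"
    using dft_large_coefficient[OF M0] by metis
  have "(m / (2 * C * sqrt (real L' * real H)) * real M)\<^sup>2 * (real M * C\<^sup>2) = real (q * L * n) * (real M * (m / 2))\<^sup>2"
  proof -
    have "(m / (2 * C * sqrt (real L' * real H)) * real M)\<^sup>2 = m\<^sup>2 * (real M)\<^sup>2 / (4 * C\<^sup>2 * (real L' * real H))"
      using pos by (simp add: power_mult_distrib power_divide real_sqrt_pow2)
    moreover have "real M = real (q * L * n) * (real L' * real H)" by (simp add: M)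
    ultimately show ?thesis using pos C by (simp add: power_mult_distrib power_divide field_simps)
  qed
  also have "\<dots> \<le> (cmod (dft M a k))\<^sup>2 * (real M * C\<^sup>2)" using sumr k(2) by linarith
  finally have "(m / (2 * C * sqrt (real L' * real H)) * real M)\<^sup>2 \<le> (cmod (dft M a k))\<^sup>2"
    using M0 C by simp
  then have "m / (2 * C * sqrt (real L' * real H)) * real M \<le> cmod (dft M a k)"
    by (rule power2_le_imp_le) simp
  then show ?thesis using k(1) by (auto simp: a_def \<delta>_def)
qed

lemma sin_ge_quarter:
  fixes x :: real
  assumes "0 \<le> x" "x \<le> pi / 2"
  shows "x / 4 \<le> sin x"
proof (cases "x \<le> pi / 3")
  case True
  have "sin 0 - 0 / 4 \<le> sin x - x / 4"
  proof (rule DERIV_nonneg_imp_nondecreasing[OF assms(1)])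
    fix y assume y: "0 \<le> y" "y \<le> x"
    have "cos (pi/3) \<le> cos y" using y True pi_gt_zero by (intro cos_monotone_0_pi_le) linarith+
    then have "0 \<le> cos y - 1/4" by (simp add: cos_60)
    moreover have "((\<lambda>x. sin x - x / 4) has_real_derivative cos y - 1/4) (at y)"
      by (auto intro!: derivative_eq_intros)
    ultimately show "\<exists>z. ((\<lambda>x. sin x - x / 4) has_real_derivative z) (at y) \<and> 0 \<le> z" by blast
  qed
  then show ?thesis by simp
next
  case False
  have "sin (pi/6) \<le> sin x" using False assms pi_gt_zero by (intro sin_monotone_2pi_le) linarith+
  then have "1/2 \<le> sin x" by (simp add: sin_30)
  moreover have "x / 4 \<le> 1/2" using assms pi_less_4 by simp
  ultimately show ?thesis by simp
qed

lemma norm_integral_cis_ge: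
  assumes "\<delta> > 0" "\<bar>\<mu> * \<delta>\<bar> \<le> pi"
  shows "cmod (integral {c..c+\<delta>} (\<lambda>x. cis (- \<mu> * x))) \<ge> \<delta> / 4"
proof (cases "\<mu> = 0")
  case False
  define \<phi> where "\<phi> = \<bar>\<mu> * \<delta>\<bar> / 2"
  have \<phi>: "0 \<le> \<phi>" "\<phi> \<le> pi/2" using assms by (auto simp: \<phi>_def)
  have "integral {c..c+\<delta>} (\<lambda>x. cis (- \<mu> * x)) = (cis (- \<mu> * (c+\<delta>)) - cis (- \<mu> * c)) / (\<i> * of_real (-\<mu>))"
    by (rule integral_unique, rule integral_cis) (use False assms in auto)
  moreover have "cis (- \<mu> * (c+\<delta>)) - cis (- \<mu> * c) = cis (- \<mu> * c) * (cis (- \<mu> * \<delta>) - 1)"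
    by (simp add: algebra_simps cis_mult)
  moreover have "cmod (cis (- \<mu> * \<delta>) - 1) = 2 * sin \<phi>"
  proof -
    have "(cmod (cis (- \<mu> * \<delta>) - 1))\<^sup>2 = (cos (\<mu>*\<delta>) - 1)\<^sup>2 + (sin (\<mu>*\<delta>))\<^sup>2"
      by (simp add: cmod_power2)
    also have "\<dots> = 2 - 2 * cos (\<mu> * \<delta>)"
      using sin_cos_squared_add[of "\<mu>*\<delta>"] by (simp add: power2_eq_square algebra_simps)
    also have "cos (\<mu> * \<delta>) = cos (2 * \<phi>)" by (simp add: \<phi>_def)
    also have "\<dots> = 1 - 2 * (sin \<phi>)\<^sup>2" by (rule cos_double_sin)
    finally have "(cmod (cis (- \<mu> * \<delta>) - 1))\<^sup>2 = (2 * sin \<phi>)\<^sup>2" by (simp add: power_mult_distrib)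
    moreover have "0 \<le> 2 * sin \<phi>" using sin_ge_quarter[OF \<phi>] \<phi> by simp
    ultimately show ?thesis by (metis norm_ge_zero power2_eq_imp_eq)
  qed
  ultimately have "cmod (integral {c..c+\<delta>} (\<lambda>x. cis (- \<mu> * x))) = 2 * sin \<phi> / \<bar>\<mu>\<bar>"
    by (simp add: norm_mult norm_divide)
  moreover have "2 * (\<phi>/4) / \<bar>\<mu>\<bar> \<le> 2 * sin \<phi> / \<bar>\<mu>\<bar>"
    using sin_ge_quarter[OF \<phi>] by (intro divide_right_mono) auto
  moreover have "2 * (\<phi>/4) / \<bar>\<mu>\<bar> = \<delta> / 4" using False assms by (simp add: \<phi>_def abs_mult)
  ultimately show ?thesis by simp
qed (use assms in simp)

text \<open>
  A sampled coefficient with angle in \<open>[-pi, pi]\<close> survives the passage to an integral, since on one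
  sampling cell the exponential turns by at most half a revolution.
\<close>

lemma window_coefficient:
  fixes g :: "real \<Rightarrow> complex"
  assumes cont: "continuous_on UNIV g" and \<delta>: "\<delta> > 0" and M: "M > 0" and k: "k < M"
    and uc: "\<And>s x. \<bar>s\<bar> \<le> \<delta> \<Longrightarrow> cmod (g (x + s) - g x) \<le> \<kappa> / 8"
    and large: "\<kappa> * real M \<le> cmod (dft M (\<lambda>j. g (x0 + real j * \<delta>)) k)"
  shows "\<exists>\<mu>. \<bar>\<mu>\<bar> \<le> pi / \<delta> \<and>
    \<kappa> / 8 * (real M * \<delta>) \<le> cmod (integral {x0..x0 + real M * \<delta>} (\<lambda>x. g x * cis (- \<mu> * x)))"
proof -
  \<comment> \<open>the angle between consecutive samples, reduced to \<open>[-pi, pi]\<close>\<close>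
  define \<theta> where "\<theta> = (if 2 * k \<le> M then 2 * pi * real k / real M else 2 * pi * real k / real M - 2 * pi)"
  define \<mu> where "\<mu> = \<theta> / \<delta>"
  have \<theta>: "\<bar>\<theta>\<bar> \<le> pi"
  proof (cases "2 * k \<le> M")
    case True
    then have "2 * real k \<le> real M" by (metis of_nat_le_iff of_nat_mult of_nat_numeral)
    then have "2 * pi * real k \<le> pi * real M" using mult_left_mono[of "2 * real k" "real M" pi] by (simp add: algebra_simps)
    then show ?thesis using True M by (simp add: \<theta>_def field_simps)
  next
    case False
    then have "real M \<le> 2 * real k" "real k \<le> real M" using k by linarith+
    then have "pi * real M \<le> 2 * pi * real k" "2 * pi * real k \<le> 2 * pi * real M"
      using mult_left_mono[of "real M" "2 * real k" pi] by (simp_all add: algebra_simps)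
    then show ?thesis using False M by (simp add: \<theta>_def field_simps abs_le_iff)
  qed
  have \<mu>\<delta>: "\<mu> * \<delta> = \<theta>" using \<delta> by (simp add: \<mu>_def)
  have gi: "(\<lambda>x. g x * cis (- \<mu> * x)) integrable_on {a..b}" for a b
    by (intro integrable_continuous_interval continuous_intros continuous_on_subset[OF cont]) auto
  define W where "W = integral {0..0+\<delta>} (\<lambda>x. cis (- \<mu> * x))"
  have W: "cmod W \<ge> \<delta> / 4" unfolding W_def by (rule norm_integral_cis_ge) (use \<delta> \<theta> \<mu>\<delta> in auto)
  define x where "x = (\<lambda>j. x0 + real j * \<delta>)"
  have cell: "cmod (integral {x j..x j + \<delta>} (\<lambda>y. g y * cis (- \<mu> * y)) - g (x j) * cis (- \<mu> * x j) * W) \<le> \<kappa> / 8 * \<delta>" for j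
  proof -
    have "integral {x j..x j + \<delta>} (\<lambda>y. cis (- \<mu> * y)) = integral {0..\<delta>} (\<lambda>y. cis (- \<mu> * (y + x j)))"
      using integral_translate[of 0 \<delta> "\<lambda>y. cis (- \<mu> * y)" "x j"] by (simp add: add.commute)
    also have "(\<lambda>y. cis (- \<mu> * (y + x j))) = (\<lambda>y. cis (- \<mu> * x j) * cis (- \<mu> * y))"
      by (auto simp: cis_mult algebra_simps)
    finally have "integral {x j..x j + \<delta>} (\<lambda>y. cis (- \<mu> * y)) = cis (- \<mu> * x j) * W" by (simp add: W_def)
    then have "g (x j) * cis (- \<mu> * x j) * W = integral {x j..x j + \<delta>} (\<lambda>y. g (x j) * cis (- \<mu> * y))"
      by simp
    then have "integral {x j..x j + \<delta>} (\<lambda>y. g y * cis (- \<mu> * y)) - g (x j) * cis (- \<mu> * x j) * W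
      = integral {x j..x j + \<delta>} (\<lambda>y. g y * cis (- \<mu> * y) - g (x j) * cis (- \<mu> * y))"
      by (simp only:) (intro Henstock_Kurzweil_Integration.integral_diff[symmetric] gi integrable_continuous_interval continuous_intros)
    also have "cmod \<dots> \<le> \<kappa> / 8 * (x j + \<delta> - x j)"
    proof (rule norm_integral_le)
      show "continuous_on {x j..x j + \<delta>} (\<lambda>y. g y * cis (- \<mu> * y) - g (x j) * cis (- \<mu> * y))"
        by (intro continuous_intros continuous_on_subset[OF cont]) auto
      fix y assume y: "y \<in> {x j..x j + \<delta>}"
      have "cmod (g y * cis (- \<mu> * y) - g (x j) * cis (- \<mu> * y)) = cmod (g y - g (x j))"
        by (simp add: norm_mult flip: left_diff_distrib)
      also have "\<dots> \<le> \<kappa> / 8" using uc[of "y - x j" "x j"] y by simp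
      finally show "cmod (g y * cis (- \<mu> * y) - g (x j) * cis (- \<mu> * y)) \<le> \<kappa> / 8" .
    qed (use \<delta> in simp)
    finally show ?thesis by simp
  qed
  have tot: "integral {x0..x0 + real n * \<delta>} (\<lambda>y. g y * cis (- \<mu> * y)) = (\<Sum>j<n. integral {x j..x j + \<delta>} (\<lambda>y. g y * cis (- \<mu> * y)))" for n
  proof (induction n)
    case (Suc n)
    have "integral {x0..x0 + real n * \<delta>} (\<lambda>y. g y * cis (- \<mu> * y)) + integral {x0 + real n * \<delta>..x0 + real n * \<delta> + \<delta>} (\<lambda>y. g y * cis (- \<mu> * y))
      = integral {x0..x0 + real n * \<delta> + \<delta>} (\<lambda>y. g y * cis (- \<mu> * y))"
      by (rule Henstock_Kurzweil_Integration.integral_combine, use \<delta> in simp, use \<delta> in simp, rule gi)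
    then show ?case using Suc by (simp add: x_def algebra_simps)
  qed auto
  have dft: "(\<Sum>j<M. g (x j) * cis (- \<mu> * x j) * W) = cis (- \<mu> * x0) * W * dft M (\<lambda>j. g (x0 + real j * \<delta>)) k"
    unfolding dft_def sum_distrib_left
  proof (intro sum.cong refl)
    fix j
    have "cis (- \<mu> * x j) = cis (- \<mu> * x0) * cis (- (real j * \<theta>))"
      by (simp add: cis_mult x_def algebra_simps \<mu>\<delta>[symmetric])
    also have "cis (- (real j * \<theta>)) = cis (- (2 * pi * real k * real j / real M))"
    proof (cases "2 * k \<le> M")
      case True then show ?thesis by (simp add: \<theta>_def mult_ac)
    next
      case False
      then have "- (real j * \<theta>) = - (2 * pi * real k * real j / real M) + 2 * pi * of_int (int j)"
        by (simp add: \<theta>_def algebra_simps)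
      then have "cis (- (real j * \<theta>)) = cis (- (2 * pi * real k * real j / real M)) * cis (2 * pi * of_int (int j))"
        by (simp only: cis_mult)
      then show ?thesis by (simp only: cis_multiple_2pi Ints_of_int mult_1_right)
    qed
    finally show "g (x j) * cis (- \<mu> * x j) * W = cis (- \<mu> * x0) * W * (g (x0 + real j * \<delta>) * cis (- (2 * pi * real k * real j / real M)))"
      by (simp add: x_def mult_ac)
  qed
  have "cmod (integral {x0..x0 + real M * \<delta>} (\<lambda>y. g y * cis (- \<mu> * y)) - (\<Sum>j<M. g (x j) * cis (- \<mu> * x j) * W))
     \<le> (\<Sum>j<M. \<kappa> / 8 * \<delta>)"
    unfolding tot sum_subtractf[symmetric] by (rule sum_norm_le) (rule cell)
  then have err: "cmod (integral {x0..x0 + real M * \<delta>} (\<lambda>y. g y * cis (- \<mu> * y)) - cis (- \<mu> * x0) * W * dft M (\<lambda>j. g (x0 + real j * \<delta>)) k)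
     \<le> \<kappa> / 8 * (real M * \<delta>)" unfolding dft by (simp add: mult_ac)
  have \<kappa>: "\<kappa> \<ge> 0" using uc[of 0 0] \<delta> by simp
  have "\<delta> / 4 * (\<kappa> * real M) \<le> cmod W * cmod (dft M (\<lambda>j. g (x0 + real j * \<delta>)) k)"
    by (intro mult_mono W large) (use \<delta> \<kappa> in auto)
  then have "\<kappa> / 4 * (real M * \<delta>) \<le> cmod (cis (- \<mu> * x0) * W * dft M (\<lambda>j. g (x0 + real j * \<delta>)) k)"
    by (simp add: norm_mult mult_ac)
  then have "\<kappa> / 8 * (real M * \<delta>) \<le> cmod (integral {x0..x0 + real M * \<delta>} (\<lambda>y. g y * cis (- \<mu> * y)))"
    using err norm_triangle_ineq2[of "cis (- \<mu> * x0) * W * dft M (\<lambda>j. g (x0 + real j * \<delta>)) k" "integral {x0..x0 + real M * \<delta>} (\<lambda>y. g y * cis (- \<mu> * y))"]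
    by (simp add: norm_minus_commute)
  moreover have "\<bar>\<mu>\<bar> \<le> pi / \<delta>" using \<theta> \<delta> by (simp add: \<mu>_def abs_divide divide_right_mono)
  ultimately show ?thesis by blast
qed

lemma norm_add_eq_le:
  fixes a b c :: "'a::real_normed_vector"
  assumes "a + b = c" "norm a \<le> x" "norm b \<le> y" shows "norm c \<le> x + y"
  using norm_triangle_mono[OF assms(2,3)] assms(1) by simp

lemma AP_syndetic:
  assumes f: "f \<in> AP" and "e > 0" "\<rho> > 0" and uc: "\<And>s x. \<bar>s\<bar> \<le> \<rho> \<Longrightarrow> cmod (f (x + s) - f x) \<le> e"
  shows "\<exists>L>0. \<forall>i0. \<exists>i\<in>{i0..<i0+L}. \<forall>x. cmod (f (x + real i * \<rho>) - f x) \<le> 2 * e"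
proof -
  obtain l where l: "l > 0" "\<And>c. \<exists>\<tau>\<in>{c..c+l}. \<forall>x. cmod (f (x + \<tau>) - f x) \<le> e"
    by (rule AP_almost_periods[OF f \<open>e > 0\<close>]) blast
  define L where "L = nat \<lceil>l/\<rho>\<rceil> + 2"
  have L: "l / \<rho> \<le> real (nat \<lceil>l/\<rho>\<rceil>)" by linarith
  have "\<exists>i\<in>{i0..<i0+L}. \<forall>x. cmod (f (x + real i * \<rho>) - f x) \<le> 2 * e" for i0
  proof -
    obtain \<tau> where \<tau>: "\<tau> \<in> {real i0 * \<rho>..real i0 * \<rho> + l}" "\<forall>x. cmod (f (x + \<tau>) - f x) \<le> e" using l(2) by blast
    define i where "i = nat \<lfloor>\<tau> / \<rho>\<rfloor>"
    have i0: "real i0 \<le> \<tau> / \<rho>" using \<tau> \<open>\<rho> > 0\<close> by (simp add: pos_le_divide_eq)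
    then have i: "real i \<le> \<tau> / \<rho>" "\<tau> / \<rho> < real i + 1" unfolding i_def by linarith+
    have "\<tau> / \<rho> \<le> real i0 + l / \<rho>" using \<tau> \<open>\<rho> > 0\<close> by (simp add: field_simps)
    then have "i < i0 + L" using i(1) L unfolding L_def by linarith
    moreover have "i0 \<le> i" using i0 i by linarith
    moreover have "cmod (f (x + real i * \<rho>) - f x) \<le> 2 * e" for x
    proof -
      have "real i * \<rho> \<le> \<tau>" "\<tau> < real i * \<rho> + \<rho>" using i \<open>\<rho> > 0\<close> by (simp_all add: field_simps)
      then have "cmod (f ((x + \<tau>) + (real i * \<rho> - \<tau>)) - f (x + \<tau>)) \<le> e" by (intro uc) simp
      moreover have "(x + \<tau>) + (real i * \<rho> - \<tau>) = x + real i * \<rho>" by simp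
      ultimately have "cmod (f (x + real i * \<rho>) - f x) \<le> e + e"
        using norm_diff_triangle_le[OF _ \<tau>(2)[rule_format, of x]] by metis
      then show ?thesis by simp
    qed
    ultimately show ?thesis by (intro bexI[of _ i] allI) simp_all
  qed
  then show ?thesis unfolding L_def by (intro exI[of _ L] conjI) (auto simp: L_def)
qed

lemma ap_coeff_eq: "ap_coeff \<mu> f = ap_mean (\<lambda>x. f x * cis (- \<mu> * x))"
  unfolding ap_coeff_def by (simp add: cis_conv_exp algebra_simps)

lemma norm_cis_minus_one_le: "cmod (cis t - 1) \<le> \<bar>t\<bar>"
  using dist_exp_i_1[of t] abs_sin_x_le_abs_x[of "t/2"] by (simp add: cis_conv_exp)

lemma AP_mult_cis: "f \<in> AP \<Longrightarrow> (\<lambda>x. f x * cis (\<mu> * x)) \<in> AP"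
  by (intro AP_mult AP_cis)

text \<open>
  Window coefficients of length \<open>n * T1\<close> with frequencies in a bounded interval, all bounded below,
  force a Fourier coefficient bounded below: at an accumulation point of the frequencies a small
  mean would be small on all windows of one fixed length and for all nearby frequencies.
\<close>

lemma coefficient_of_windows:
  assumes g: "g \<in> AP" and C: "C > 0" "\<And>x. cmod (g x) \<le> C" and T1: "T1 > 0" and \<kappa>: "\<kappa> > 0"
    and win: "\<And>n. n > 0 \<Longrightarrow> \<exists>\<mu>. \<bar>\<mu>\<bar> \<le> B \<and>
       \<kappa> * (real n * T1) \<le> cmod (integral {x0..x0 + real n * T1} (\<lambda>x. g x * cis (- \<mu> * x)))"
  shows "\<exists>\<mu>. \<kappa> / 4 \<le> cmod (ap_coeff \<mu> g)"
proof -
  obtain \<nu> where \<nu>: "\<And>n. n > 0 \<Longrightarrow> \<bar>\<nu> n\<bar> \<le> B"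
    "\<And>n. n > 0 \<Longrightarrow> \<kappa> * (real n * T1) \<le> cmod (integral {x0..x0 + real n * T1} (\<lambda>x. g x * cis (- \<nu> n * x)))"
    using win by metis
  have cpt: "compact {-B..B}" by simp
  have "\<forall>n. \<nu> (Suc n) \<in> {-B..B}"
    using \<nu>(1)[OF zero_less_Suc] unfolding atLeastAtMost_iff abs_le_iff by (simp add: minus_le_iff)
  then obtain \<mu> r where r: "strict_mono r" "((\<lambda>n. \<nu> (Suc n)) \<circ> r) \<longlonglongrightarrow> \<mu>"
    using cpt[unfolded compact_def, THEN spec, of "\<lambda>n. \<nu> (Suc n)"] by blast
  have "\<kappa> / 4 \<le> cmod (ap_coeff \<mu> g)"
  proof (rule ccontr)
    assume "\<not> \<kappa> / 4 \<le> cmod (ap_coeff \<mu> g)"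
    then have small: "cmod (ap_coeff \<mu> g) < \<kappa> / 4" by simp
    have ap: "(\<lambda>x. g x * cis (- \<mu> * x)) \<in> AP" by (rule AP_mult_cis[OF g])
    obtain T where T: "T > 0" "\<And>T' c. T' \<ge> T \<Longrightarrow> cmod (integral {c..c+T'} (\<lambda>x. g x * cis (- \<mu> * x)) - T' *\<^sub>R ap_coeff \<mu> g) \<le> \<kappa>/4 * T'"
      using AP_mean_window[OF ap, of "\<kappa>/4"] \<kappa> unfolding ap_coeff_eq by auto
    have gi: "(\<lambda>x. g x * cis (- \<nu>'' * x)) integrable_on {a..b}" for a b \<nu>'' by (intro AP_integrable AP_mult_cis g)
    have near: "cmod (integral {c..c+T} (\<lambda>x. g x * cis (- \<nu>' * x))) \<le> 3/4 * \<kappa> * T" if "\<bar>\<nu>' - \<mu>\<bar> * T * C \<le> \<kappa>/4" for \<nu>' c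
    proof -
      have "cmod (integral {c..c+T} (\<lambda>x. g x * cis (- \<mu> * x))) \<le> \<kappa>/4 * T + T * (\<kappa>/4)"
      proof -
        have "cmod (T *\<^sub>R ap_coeff \<mu> g) \<le> T * (\<kappa>/4)" using small T by simp
        then show ?thesis using T(2)[of T c] norm_triangle_sub[of "integral {c..c+T} (\<lambda>x. g x * cis (- \<mu> * x))" "T *\<^sub>R ap_coeff \<mu> g"] by linarith
      qed
      \<comment> \<open>the first factor aligns the two exponentials at the left end of the window\<close>
      moreover have "cmod (cis ((\<nu>' - \<mu>) * c) * integral {c..c+T} (\<lambda>x. g x * cis (- \<nu>' * x)) - integral {c..c+T} (\<lambda>x. g x * cis (- \<mu> * x))) \<le> \<kappa>/4 * T"
      proof -
        have "cis ((\<nu>' - \<mu>) * c) * integral {c..c+T} (\<lambda>x. g x * cis (- \<nu>' * x)) - integral {c..c+T} (\<lambda>x. g x * cis (- \<mu> * x))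
          = integral {c..c+T} (\<lambda>x. cis ((\<nu>' - \<mu>) * c) * (g x * cis (- \<nu>' * x)) - g x * cis (- \<mu> * x))"
          unfolding integral_mult_right[symmetric]
          by (intro Henstock_Kurzweil_Integration.integral_diff[symmetric] integrable_on_mult_right gi)
        also have "cmod \<dots> \<le> \<kappa>/4 * (c + T - c)"
        proof (rule norm_integral_le)
          show "continuous_on {c..c+T} (\<lambda>x. cis ((\<nu>' - \<mu>) * c) * (g x * cis (- \<nu>' * x)) - g x * cis (- \<mu> * x))"
            by (intro continuous_intros AP_continuous g)
          fix x assume x: "x \<in> {c..c+T}"
          have "cis ((\<nu>' - \<mu>) * c) * cis (- \<nu>' * x) = cis (- \<mu> * x) * cis (- (\<nu>' - \<mu>) * (x - c))"
            by (simp add: cis_mult algebra_simps)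
          then have "cis ((\<nu>' - \<mu>) * c) * (g x * cis (- \<nu>' * x)) - g x * cis (- \<mu> * x) = g x * cis (- \<mu> * x) * (cis (- (\<nu>' - \<mu>) * (x - c)) - 1)"
            by (simp add: algebra_simps)
          then have "cmod (cis ((\<nu>' - \<mu>) * c) * (g x * cis (- \<nu>' * x)) - g x * cis (- \<mu> * x)) = cmod (g x) * cmod (cis (- (\<nu>' - \<mu>) * (x - c)) - 1)"
            by (simp add: norm_mult)
          also have "\<dots> \<le> C * (\<bar>\<nu>' - \<mu>\<bar> * T)"
          proof (intro mult_mono C)
            have "cmod (cis (- (\<nu>' - \<mu>) * (x - c)) - 1) \<le> \<bar>- (\<nu>' - \<mu>) * (x - c)\<bar>"
              by (rule norm_cis_minus_one_le)
            also have "\<dots> = \<bar>\<nu>' - \<mu>\<bar> * (x - c)" using x by (simp add: abs_mult abs_minus_commute)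
            also have "\<dots> \<le> \<bar>\<nu>' - \<mu>\<bar> * T" using x by (intro mult_left_mono) auto
            finally show "cmod (cis (- (\<nu>' - \<mu>) * (x - c)) - 1) \<le> \<bar>\<nu>' - \<mu>\<bar> * T" .
          qed (use C in auto)
          also have "\<dots> \<le> \<kappa>/4" using that by (simp add: mult_ac)
          finally show "cmod (cis ((\<nu>' - \<mu>) * c) * (g x * cis (- \<nu>' * x)) - g x * cis (- \<mu> * x)) \<le> \<kappa>/4" .
        qed (use T in simp)
        finally show ?thesis by simp
      qed
      ultimately have "cmod (cis ((\<nu>' - \<mu>) * c) * integral {c..c+T} (\<lambda>x. g x * cis (- \<nu>' * x))) \<le> \<kappa>/4 * T + (\<kappa>/4 * T + T * (\<kappa>/4))"
        using norm_triangle_sub order_trans add_mono by (smt (verit, best))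
      then show ?thesis by (simp add: norm_mult algebra_simps)
    qed
    have many: "cmod (integral {x0..x0 + real m * T} (\<lambda>x. g x * cis (- \<nu>' * x))) \<le> 3/4 * \<kappa> * (real m * T)" if "\<bar>\<nu>' - \<mu>\<bar> * T * C \<le> \<kappa>/4" for \<nu>' m
    proof (induction m)
      case (Suc m)
      have "integral {x0..x0 + real m * T} (\<lambda>x. g x * cis (- \<nu>' * x)) + integral {x0 + real m * T..x0 + real m * T + T} (\<lambda>x. g x * cis (- \<nu>' * x))
        = integral {x0..x0 + real m * T + T} (\<lambda>x. g x * cis (- \<nu>' * x))"
        by (rule Henstock_Kurzweil_Integration.integral_combine, use T in simp, use T in simp, rule gi)
      then have "cmod (integral {x0..x0 + real m * T + T} (\<lambda>x. g x * cis (- \<nu>' * x))) \<le> 3/4 * \<kappa> * (real m * T) + 3/4 * \<kappa> * T"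
        by (rule norm_add_eq_le[OF _ Suc near[OF that, of "x0 + real m * T"]])
      then show ?case by (simp add: algebra_simps)
    qed auto
    have le: "cmod (integral {x0..x0 + T'} (\<lambda>x. g x * cis (- \<nu>' * x))) \<le> 3/4 * \<kappa> * T' + C * T" if "\<bar>\<nu>' - \<mu>\<bar> * T * C \<le> \<kappa>/4" "T' \<ge> 0" for \<nu>' T'
    proof -
      define m where "m = nat \<lfloor>T' / T\<rfloor>"
      have "real m \<le> T' / T" "T' / T < real m + 1" unfolding m_def using T that by (auto simp: of_nat_nat)
      then have m: "real m * T \<le> T'" "T' < real m * T + T" using T by (simp_all add: field_simps)
      have "integral {x0..x0 + real m * T} (\<lambda>x. g x * cis (- \<nu>' * x)) + integral {x0 + real m * T..x0 + T'} (\<lambda>x. g x * cis (- \<nu>' * x))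
        = integral {x0..x0 + T'} (\<lambda>x. g x * cis (- \<nu>' * x))"
        by (rule Henstock_Kurzweil_Integration.integral_combine, use T in simp, use m in simp, rule gi)
      moreover have "cmod (integral {x0 + real m * T..x0 + T'} (\<lambda>x. g x * cis (- \<nu>' * x))) \<le> C * (x0 + T' - (x0 + real m * T))"
        by (rule norm_integral_le[OF AP_continuous[OF AP_mult_cis[OF g]]]) (use m C in \<open>auto simp: norm_mult\<close>)
      ultimately have "cmod (integral {x0..x0 + T'} (\<lambda>x. g x * cis (- \<nu>' * x))) \<le> 3/4 * \<kappa> * (real m * T) + C * (x0 + T' - (x0 + real m * T))"
        by (rule norm_add_eq_le[OF _ many[OF that(1)]])
      moreover have "C * (x0 + T' - (x0 + real m * T)) \<le> C * T" using m C by (intro mult_left_mono) auto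
      ultimately have "cmod (integral {x0..x0 + T'} (\<lambda>x. g x * cis (- \<nu>' * x))) \<le> 3/4 * \<kappa> * (real m * T) + C * T"
        by linarith
      moreover have "3/4 * \<kappa> * (real m * T) \<le> 3/4 * \<kappa> * T'" using m \<kappa> by (intro mult_left_mono) auto
      ultimately show ?thesis by linarith
    qed
    have "\<forall>\<^sub>F n in sequentially. dist (((\<lambda>n. \<nu> (Suc n)) \<circ> r) n) \<mu> < \<kappa> / (4 * T * C)"
      by (rule tendstoD[OF r(2)]) (use \<kappa> T C in simp)
    moreover have "\<forall>\<^sub>F n in sequentially. real n > 4 * C * T / (\<kappa> * T1)"
      by (metis eventually_at_top_dense filterlim_at_top_dense filterlim_real_sequentially)
    ultimately obtain n where n: "dist (((\<lambda>n. \<nu> (Suc n)) \<circ> r) n) \<mu> < \<kappa> / (4 * T * C)" "real n > 4 * C * T / (\<kappa> * T1)"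
      using eventually_happens'[OF sequentially_bot eventually_conj] by blast
    define N where "N = Suc (r n)"
    have "n \<le> r n" by (rule seq_suble[OF r(1)])
    then have N: "real N > 4 * C * T / (\<kappa> * T1)" "N > 0" using n(2) by (auto simp: N_def)
    have "\<bar>\<nu> N - \<mu>\<bar> < \<kappa> / (4 * T * C)" using n(1) by (simp add: N_def dist_real_def)
    then have "\<bar>\<nu> N - \<mu>\<bar> * T * C \<le> \<kappa>/4" using T C by (simp add: field_simps)
    then have "cmod (integral {x0..x0 + real N * T1} (\<lambda>x. g x * cis (- \<nu> N * x))) \<le> 3/4 * \<kappa> * (real N * T1) + C * T"
      using T1 by (intro le) auto
    then have "\<kappa> * (real N * T1) \<le> 3/4 * \<kappa> * (real N * T1) + C * T" using \<nu>(2)[OF N(2)] by linarith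
    moreover have "4 * C * T < real N * (\<kappa> * T1)" using N(1) \<kappa> T1 by (simp add: pos_divide_less_eq)
    ultimately show False by (simp add: algebra_simps)
  qed
  then show ?thesis by blast
qed

text \<open>
  A quantitative form of the uniqueness theorem for Fourier coefficients.  The constant depends
  only on a bound, on a lower bound for the supremum and on the almost periods, so that it is the
  same for all functions whose almost periods are controlled by those of one function \<open>f\<close>.  The factor 2
  in this control is what the difference of \<open>f\<close> and a kernel mean of \<open>f\<close> satisfies.
\<close>

lemma AP_large_coefficient:
  assumes f: "f \<in> AP" and e: "e > 0" and C: "C > 0"
  shows "\<exists>\<kappa>>0. \<forall>g. g \<in> AP \<longrightarrow> (\<forall>x. cmod (g x) \<le> C) \<longrightarrow> (\<exists>x. e \<le> cmod (g x)) \<longrightarrow>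
    (\<forall>\<tau> d. (\<forall>x. cmod (f (x + \<tau>) - f x) \<le> d) \<longrightarrow> (\<forall>x. cmod (g (x + \<tau>) - g x) \<le> 2 * d)) \<longrightarrow>
    (\<exists>\<mu>. \<kappa> \<le> cmod (ap_coeff \<mu> g))"
proof -
  \<comment> \<open>three scales: \<open>\<rho>\<close> and \<open>L\<close> locate large values, the finer \<open>\<rho>'\<close> and \<open>L'\<close> locate large correlations and
    determine the constant \<open>\<kappa>\<close>, and only then \<open>\<rho>2\<close> fixes the sampling density, as needed to pass from sums to integrals\<close>
  obtain \<rho> where \<rho>: "\<rho> > 0" "\<And>s x. \<bar>s\<bar> \<le> \<rho> \<Longrightarrow> cmod (f (x + s) - f x) \<le> e/16"
    using AP_uniformly_continuous[OF f, of "e/16"] e by auto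
  obtain L where L: "L > 0" "\<And>i0. \<exists>i\<in>{i0..<i0+L}. \<forall>x. cmod (f (x + real i * \<rho>) - f x) \<le> 2 * (e/16)"
    using AP_syndetic[OF f _ \<rho>] e by auto
  define m where "m = e\<^sup>2 / (4 * real L)"
  have m0: "m > 0" using e L by (simp add: m_def)
  define d where "d = m / (32 * C)"
  have d0: "d > 0" using m0 C by (simp add: d_def)
  obtain \<rho>1 where \<rho>1: "\<rho>1 > 0" "\<And>s x. \<bar>s\<bar> \<le> \<rho>1 \<Longrightarrow> cmod (f (x + s) - f x) \<le> d"
    using AP_uniformly_continuous[OF f d0] by blast
  obtain p :: nat where p: "real p > \<rho> / \<rho>1" using reals_Archimedean2 by blast
  have p0: "p > 0" using p \<rho> \<rho>1 by (metis divide_pos_pos less_trans of_nat_0_less_iff)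
  define \<rho>' where "\<rho>' = \<rho> / real p"
  have \<rho>'0: "\<rho>' > 0" using \<rho> p0 by (simp add: \<rho>'_def)
  have "\<rho>' \<le> \<rho>1" using p p0 \<rho>1 by (simp add: \<rho>'_def field_simps)
  then have \<rho>': "\<And>s x. \<bar>s\<bar> \<le> \<rho>' \<Longrightarrow> cmod (f (x + s) - f x) \<le> d" using \<rho>1(2) by force
  obtain L' where L': "L' > 0" "\<And>i0. \<exists>i\<in>{i0..<i0+L'}. \<forall>x. cmod (f (x + real i * \<rho>') - f x) \<le> 2 * d"
    using AP_syndetic[OF f d0 \<rho>'0 \<rho>'] by auto
  obtain H :: nat where H: "real H > 8 * C\<^sup>2 / m" using reals_Archimedean2 by blast
  have H0: "H > 0" using H m0 C by (metis divide_nonneg_pos less_le_trans not_gr_zero of_nat_0 order_less_irrefl zero_le_mult_iff zero_le_numeral zero_le_power2 le_less_trans)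
  have H2: "2 * C\<^sup>2 / real H \<le> m / 4" using H H0 m0 by (simp add: field_simps)
  define \<kappa> where "\<kappa> = m / (2 * C * sqrt (real L' * real H))"
  have \<kappa>0: "\<kappa> > 0" using m0 C L' H0 by (simp add: \<kappa>_def)
  obtain \<rho>2 where \<rho>2: "\<rho>2 > 0" "\<And>s x. \<bar>s\<bar> \<le> \<rho>2 \<Longrightarrow> cmod (f (x + s) - f x) \<le> \<kappa>/16"
    using AP_uniformly_continuous[OF f, of "\<kappa>/16"] \<kappa>0 by auto
  obtain q' :: nat where q': "real q' > \<rho>' / \<rho>2" using reals_Archimedean2 by blast
  have q'0: "q' > 0" using q' \<rho>'0 \<rho>2 by (metis divide_pos_pos less_trans of_nat_0_less_iff)
  define q where "q = p * q'"
  have q0: "q > 0" using p0 q'0 by (simp add: q_def)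
  define \<delta> where "\<delta> = \<rho> / real q"
  have \<delta>0: "\<delta> > 0" using \<rho> q0 by (simp add: \<delta>_def)
  have "\<delta> = \<rho>' / real q'" by (simp add: \<delta>_def \<rho>'_def q_def)
  moreover have "\<rho>' < \<rho>2 * real q'" using q' \<rho>2(1) by (simp add: pos_divide_less_eq mult.commute)
  ultimately have \<delta>2: "\<delta> \<le> \<rho>2" using q'0 by (simp add: pos_divide_le_eq)
  have "\<exists>\<mu>. \<kappa>/32 \<le> cmod (ap_coeff \<mu> g)"
    if g: "g \<in> AP" and gC: "\<forall>x. cmod (g x) \<le> C" and ge: "\<exists>x. e \<le> cmod (g x)"
      and dom: "\<forall>\<tau> d. (\<forall>x. cmod (f (x + \<tau>) - f x) \<le> d) \<longrightarrow> (\<forall>x. cmod (g (x + \<tau>) - g x) \<le> 2 * d)" for g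
  proof -
    have dom': "cmod (g (x + \<tau>) - g x) \<le> 2 * d" if "\<And>x. cmod (f (x + \<tau>) - f x) \<le> d" for \<tau> d x
      using dom that by blast
    obtain x0 where x0: "e \<le> cmod (g x0)" using ge by blast
    have "\<exists>\<mu>. \<bar>\<mu>\<bar> \<le> pi / \<delta> \<and> \<kappa>/8 * (real n * (real (q * L * L' * H) * \<delta>)) \<le>
       cmod (integral {x0..x0 + real n * (real (q * L * L' * H) * \<delta>)} (\<lambda>x. g x * cis (- \<mu> * x)))" if "n > 0" for n
    proof -
      define M where "M = q * L * L' * H * n"
      have M0: "M > 0" using q0 L L' H0 that by (simp add: M_def)
      have Mn: "real n * (real (q * L * L' * H) * \<delta>) = real M * \<delta>" by (simp add: M_def)
      have "\<exists>k<M. m / (2 * C * sqrt (real L' * real H)) * real M \<le>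
         cmod (dft M (\<lambda>j. g (x0 + real j * (\<rho> / real q))) k)"
      proof (rule large_sampled_coefficient[where d="4*d" and q=q and n=n and L=L and e=e and \<rho>'=\<rho>' and p=p and q'=q'])
        show "\<bar>s\<bar> \<le> \<rho> \<Longrightarrow> cmod (g (x + s) - g x) \<le> e/4" for s x
          using dom'[of s "e/16" x] \<rho>(2)[of s] e by simp
        show "\<exists>i\<in>{i0..<i0+L}. \<forall>x. cmod (g (x + real i * \<rho>) - g x) \<le> e/4" for i0
        proof -
          obtain i where "i \<in> {i0..<i0+L}" "\<forall>x. cmod (f (x + real i * \<rho>) - f x) \<le> 2 * (e/16)" using L(2) by blast
          then show ?thesis using dom'[of "real i * \<rho>" "2 * (e/16)"] by (intro bexI[of _ i]) simp_all
        qed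
        show "\<bar>s\<bar> \<le> \<rho>' \<Longrightarrow> cmod (g (x + s) - g x) \<le> 4*d" for s x
          using dom'[of s d x] \<rho>'[of s] d0 by simp
        show "\<exists>i\<in>{i0..<i0+L'}. \<forall>x. cmod (g (x + real i * \<rho>') - g x) \<le> 4*d" for i0
        proof -
          obtain i where "i \<in> {i0..<i0+L'}" "\<forall>x. cmod (f (x + real i * \<rho>') - f x) \<le> 2 * d" using L'(2) by blast
          then show ?thesis using dom'[of "real i * \<rho>'" "2 * d"] by (intro bexI[of _ i]) simp_all
        qed
        show "2 * (4 * d) * C \<le> m / 4" using C by (simp add: d_def)
        show "\<rho> = real p * \<rho>'" using p0 by (simp add: \<rho>'_def)
      qed (use C gC e x0 \<rho>'0 p0 q'0 L L' H0 that H2 in \<open>auto simp: m_def M_def q_def\<close>)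
      then obtain k where k: "k < M" "\<kappa> * real M \<le> cmod (dft M (\<lambda>j. g (x0 + real j * \<delta>)) k)"
        by (auto simp: \<kappa>_def \<delta>_def)
      have "\<exists>\<mu>. \<bar>\<mu>\<bar> \<le> pi / \<delta> \<and>
        \<kappa> / 8 * (real M * \<delta>) \<le> cmod (integral {x0..x0 + real M * \<delta>} (\<lambda>x. g x * cis (- \<mu> * x)))"
      proof (rule window_coefficient[OF AP_continuous[OF g] \<delta>0 M0 k(1) _ k(2)])
        show "\<bar>s\<bar> \<le> \<delta> \<Longrightarrow> cmod (g (x + s) - g x) \<le> \<kappa>/8" for s x
          using dom'[of s "\<kappa>/16" x] \<rho>2(2)[of s] \<delta>2 by simp
      qed
      then show ?thesis by (simp only: Mn)
    qed
    then have "\<exists>\<mu>. (\<kappa>/8) / 4 \<le> cmod (ap_coeff \<mu> g)"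
      by (intro coefficient_of_windows[OF g C, where ?T1.0="real (q * L * L' * H) * \<delta>"])
        (use gC \<kappa>0 \<delta>0 q0 L L' H0 in auto)
    then show ?thesis by simp
  qed
  then show ?thesis using \<kappa>0 by (intro exI[of _ "\<kappa>/32"]) simp
qed

section \<open>Trigonometric kernels and approximation of almost periodic functions\<close>

lemma ap_mean_cnj:
  assumes "f \<in> AP" shows "ap_mean (\<lambda>x. cnj (f x)) = cnj (ap_mean f)"
proof (rule ap_mean_eqI)
  have "((\<lambda>T. cnj ((1 / (2 * T)) *\<^sub>R integral {-T..T} f)) \<longlongrightarrow> cnj (ap_mean f)) at_top"
    by (intro tendsto_cnj AP_mean_tendsto assms)
  then show "((\<lambda>T. (1 / (2 * T)) *\<^sub>R integral {-T..T} (\<lambda>x. cnj (f x))) \<longlongrightarrow> cnj (ap_mean f)) at_top"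
    by (simp add: integral_cnj scaleR_conv_of_real)
qed

lemma norm_ap_mean_le:
  assumes h: "h \<in> AP" and G: "(\<lambda>x. of_real (G x)) \<in> AP" and le: "\<And>x. cmod (h x) \<le> G x"
  shows "cmod (ap_mean h) \<le> Re (ap_mean (\<lambda>x. of_real (G x)))"
proof (rule tendsto_le[OF trivial_limit_at_top_linorder])
  show "((\<lambda>T. Re ((1 / (2 * T)) *\<^sub>R integral {-T..T} (\<lambda>x. complex_of_real (G x)))) \<longlongrightarrow> Re (ap_mean (\<lambda>x. of_real (G x)))) at_top"
    by (intro tendsto_Re AP_mean_tendsto G)
  show "((\<lambda>T. cmod ((1 / (2 * T)) *\<^sub>R integral {-T..T} h)) \<longlongrightarrow> cmod (ap_mean h)) at_top"
    by (intro tendsto_norm AP_mean_tendsto h)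
  have Gi: "G integrable_on {a..b}" for a b
    using continuous_on_Re[OF AP_continuous[OF G, of "{a..b}"]] by (intro integrable_continuous_interval) simp
  have GR: "integral {a..b} (\<lambda>x. complex_of_real (G x)) = of_real (integral {a..b} G)" for a b
    by (rule integral_unique) (intro has_integral_of_real integrable_integral Gi)
  show "\<forall>\<^sub>F T in at_top. cmod ((1 / (2 * T)) *\<^sub>R integral {-T..T} h) \<le> Re ((1 / (2 * T)) *\<^sub>R integral {-T..T} (\<lambda>x. complex_of_real (G x)))"
    using eventually_gt_at_top[of 0]
  proof eventually_elim
    case (elim T)
    have "cmod (integral {-T..T} h) \<le> integral {-T..T} G"
      by (rule integral_norm_bound_integral) (auto intro: AP_integrable h Gi le)
    then show ?case using elim by (simp add: GR divide_right_mono)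
  qed
qed

lemma ap_mean_mono:
  assumes G: "(\<lambda>x. of_real (G x)) \<in> AP" and H: "(\<lambda>x. of_real (H x)) \<in> AP" and le: "\<And>x. G x \<le> H x"
  shows "Re (ap_mean (\<lambda>x. of_real (G x))) \<le> Re (ap_mean (\<lambda>x. of_real (H x)))"
proof -
  have "(\<lambda>x. complex_of_real (H x - G x)) \<in> AP" using AP_diff[OF H G] by simp
  then have "0 \<le> Re (ap_mean (\<lambda>x. of_real (H x - G x)))" using le by (intro ap_mean_nonneg) auto
  then show ?thesis using ap_mean_diff[OF H G] by simp
qed

lemma ap_mean_lincomb:
  assumes "\<And>i. i \<in> I \<Longrightarrow> f i \<in> AP"
  shows "ap_mean (\<lambda>x. \<Sum>i\<in>I. c i * f i x) = (\<Sum>i\<in>I. c i * ap_mean (f i))"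
  using ap_mean_sum[of I "\<lambda>i x. c i * f i x"] assms by (simp add: AP_cmult ap_mean_cmult)

lemma AP_trig_sum: "(\<lambda>x. \<Sum>\<mu>\<in>B. c \<mu> * cis (\<mu> * x)) \<in> AP"
  by (intro AP_sum AP_cmult AP_cis)

lemma ap_coeff_trig_sum:
  assumes "finite B"
  shows "ap_coeff \<nu> (\<lambda>x. \<Sum>\<mu>\<in>B. c \<mu> * cis (\<mu> * x)) = (if \<nu> \<in> B then c \<nu> else 0)"
proof -
  have "ap_coeff \<nu> (\<lambda>x. \<Sum>\<mu>\<in>B. c \<mu> * cis (\<mu> * x)) = ap_mean (\<lambda>x. \<Sum>\<mu>\<in>B. c \<mu> * cis ((\<mu> - \<nu>) * x))"
    unfolding ap_coeff_eq sum_distrib_right by (simp add: cis_mult algebra_simps)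
  also have "\<dots> = (\<Sum>\<mu>\<in>B. c \<mu> * (if \<mu> = \<nu> then 1 else 0))"
    using ap_mean_lincomb[of B "\<lambda>\<mu> x. cis ((\<mu> - \<nu>) * x)" c] by (simp add: AP_cis ap_mean_cis)
  also have "\<dots> = (if \<nu> \<in> B then c \<nu> else 0)" using assms by (simp add: if_distrib cong: if_cong)
  finally show ?thesis .
qed

lemma ap_coeff_add: "f \<in> AP \<Longrightarrow> g \<in> AP \<Longrightarrow> ap_coeff \<mu> (\<lambda>x. f x + g x) = ap_coeff \<mu> f + ap_coeff \<mu> g"
  unfolding ap_coeff_eq distrib_right by (intro ap_mean_add AP_mult_cis)

lemma ap_coeff_cmult: "f \<in> AP \<Longrightarrow> ap_coeff \<mu> (\<lambda>x. c * f x) = c * ap_coeff \<mu> f"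
  unfolding ap_coeff_eq mult.assoc by (intro ap_mean_cmult AP_mult_cis)

lemma ap_coeff_diff: "f \<in> AP \<Longrightarrow> g \<in> AP \<Longrightarrow> ap_coeff \<mu> (\<lambda>x. f x - g x) = ap_coeff \<mu> f - ap_coeff \<mu> g"
  unfolding ap_coeff_eq left_diff_distrib by (intro ap_mean_diff AP_mult_cis)

lemma norm_ap_coeff_le: "f \<in> AP \<Longrightarrow> (\<And>x. cmod (f x) \<le> C) \<Longrightarrow> cmod (ap_coeff \<mu> f) \<le> C"
  unfolding ap_coeff_eq by (rule ap_mean_bound[OF AP_mult_cis]) (simp_all add: norm_mult)

text \<open>The mean of the squared distance of \<open>f\<close> from its partial Fourier sum is nonnegative.\<close>

lemma bessel:
  assumes f: "f \<in> AP" and F: "finite F" and C: "\<And>x. cmod (f x) \<le> C"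
  shows "(\<Sum>\<mu>\<in>F. (cmod (ap_coeff \<mu> f))\<^sup>2) \<le> C\<^sup>2"
proof -
  define p where "p = (\<lambda>x. \<Sum>\<mu>\<in>F. ap_coeff \<mu> f * cis (\<mu> * x))"
  define S where "S = (\<Sum>\<mu>\<in>F. (cmod (ap_coeff \<mu> f))\<^sup>2)"
  have p: "p \<in> AP" unfolding p_def by (rule AP_trig_sum)
  have mean_p: "ap_mean (\<lambda>x. g x * cnj (p x)) = (\<Sum>\<mu>\<in>F. cnj (ap_coeff \<mu> f) * ap_coeff \<mu> g)" if g: "g \<in> AP" for g
  proof -
    have "(\<lambda>x. g x * cnj (p x)) = (\<lambda>x. \<Sum>\<mu>\<in>F. cnj (ap_coeff \<mu> f) * (g x * cis (- \<mu> * x)))"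
      unfolding p_def cnj_sum sum_distrib_left by (intro ext sum.cong refl) (simp add: cis_cnj mult_ac)
    then show ?thesis
      using ap_mean_lincomb[of F "\<lambda>\<mu> x. g x * cis (- \<mu> * x)" "\<lambda>\<mu>. cnj (ap_coeff \<mu> f)"] AP_mult_cis[OF g]
      unfolding ap_coeff_eq[of _ g] by metis
  qed
  have fp: "ap_mean (\<lambda>x. f x * cnj (p x)) = of_real S"
    unfolding mean_p[OF f] S_def of_real_sum by (intro sum.cong refl) (simp add: complex_norm_square mult.commute del: of_real_power)
  have pp: "ap_mean (\<lambda>x. p x * cnj (p x)) = of_real S"
  proof -
    have "ap_coeff \<mu> p = ap_coeff \<mu> f" if "\<mu> \<in> F" for \<mu>
      unfolding p_def ap_coeff_trig_sum[OF F] using that by simp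
    then show ?thesis unfolding mean_p[OF p] S_def of_real_sum
      by (intro sum.cong refl) (simp add: complex_norm_square mult.commute del: of_real_power)
  qed
  have pf: "ap_mean (\<lambda>x. p x * cnj (f x)) = of_real S"
    using ap_mean_cnj[OF AP_mult[OF f AP_cnj[OF p]]] fp by (simp add: mult.commute)
  have "(\<lambda>x. complex_of_real ((cmod (f x - p x))\<^sup>2)) = (\<lambda>x. (f x * cnj (f x) - f x * cnj (p x)) - (p x * cnj (f x) - p x * cnj (p x)))"
    by (auto simp: complex_norm_square algebra_simps simp del: of_real_power)
  moreover have "(\<lambda>x. complex_of_real ((cmod (f x - p x))\<^sup>2)) \<in> AP"
    using AP_power[OF AP_norm[OF AP_diff[OF f p]], of 2] by simp
  ultimately have "0 \<le> Re (ap_mean (\<lambda>x. (f x * cnj (f x) - f x * cnj (p x)) - (p x * cnj (f x) - p x * cnj (p x))))"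
    using ap_mean_nonneg[of "\<lambda>x. (cmod (f x - p x))\<^sup>2"] by simp
  also have "\<dots> = Re (ap_mean (\<lambda>x. f x * cnj (f x))) - S"
    by (simp add: ap_mean_diff AP_diff AP_mult AP_cnj f p fp pp pf)
  also have "Re (ap_mean (\<lambda>x. f x * cnj (f x))) \<le> C\<^sup>2"
  proof -
    have "cmod (f x * cnj (f x)) \<le> C\<^sup>2" for x
      unfolding norm_mult complex_mod_cnj power2_eq_square using C[of x] by (intro mult_mono) (auto intro: order_trans[OF norm_ge_zero])
    then have "cmod (ap_mean (\<lambda>x. f x * cnj (f x))) \<le> C\<^sup>2" by (intro ap_mean_bound AP_mult AP_cnj f)
    then show ?thesis using complex_Re_le_cmod order_trans by blast
  qed
  finally show ?thesis by (simp add: S_def)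
qed

lemma finite_large_coefficients:
  assumes f: "f \<in> AP" and \<kappa>: "\<kappa> > 0"
  shows "finite {\<mu>. \<kappa> \<le> cmod (ap_coeff \<mu> f)}"
proof (rule ccontr)
  assume inf: "infinite {\<mu>. \<kappa> \<le> cmod (ap_coeff \<mu> f)}"
  obtain C where C: "C > 0" "\<And>x. cmod (f x) \<le> C" using AP_bounded[OF f] by blast
  obtain n :: nat where n: "real n > C\<^sup>2 / \<kappa>\<^sup>2" using reals_Archimedean2 by blast
  obtain F where F: "finite F" "card F = n" "F \<subseteq> {\<mu>. \<kappa> \<le> cmod (ap_coeff \<mu> f)}"
    using infinite_arbitrarily_large[OF inf] by blast
  have "real n * \<kappa>\<^sup>2 = (\<Sum>\<mu>\<in>F. \<kappa>\<^sup>2)" by (simp add: F)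
  also have "\<dots> \<le> (\<Sum>\<mu>\<in>F. (cmod (ap_coeff \<mu> f))\<^sup>2)" using F \<kappa> by (intro sum_mono power_mono) auto
  also have "\<dots> \<le> C\<^sup>2" by (rule bessel[OF f F(1) C(2)])
  finally show False using n \<kappa> by (simp add: field_simps)
qed

inductive trig_poly :: "(real \<Rightarrow> complex) \<Rightarrow> bool" where
  monomial: "trig_poly (\<lambda>x. c * cis (\<mu> * x))"
| add: "trig_poly f \<Longrightarrow> trig_poly g \<Longrightarrow> trig_poly (\<lambda>x. f x + g x)"

lemma trig_poly_mult:
  assumes "trig_poly f" "trig_poly g" shows "trig_poly (\<lambda>x. f x * g x)"
  using assms(1)
proof induction
  case (monomial c \<mu>)
  show ?case using assms(2)
  proof induction
    case (monomial d \<nu>)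
    have "(\<lambda>x. c * cis (\<mu> * x) * (d * cis (\<nu> * x))) = (\<lambda>x. (c * d) * cis ((\<mu> + \<nu>) * x))"
    proof
      fix x
      have "cis (\<mu> * x) * cis (\<nu> * x) = cis ((\<mu> + \<nu>) * x)" by (simp add: cis_mult distrib_right)
      then show "c * cis (\<mu> * x) * (d * cis (\<nu> * x)) = (c * d) * cis ((\<mu> + \<nu>) * x)"
        by (metis mult.assoc mult.left_commute)
    qed
    then show ?case by (simp only: trig_poly.monomial)
  qed (simp add: distrib_left trig_poly.add)
qed (simp add: distrib_right trig_poly.add)

lemma trig_poly_const: "trig_poly (\<lambda>x. c)"
  using trig_poly.monomial[of c 0] by simp

lemma trig_poly_power: "trig_poly f \<Longrightarrow> trig_poly (\<lambda>x. f x ^ n)"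
  by (induction n) (auto intro: trig_poly_const trig_poly_mult)

lemma trig_poly_prod: "(\<And>i. i \<in> I \<Longrightarrow> trig_poly (f i)) \<Longrightarrow> trig_poly (\<lambda>x. \<Prod>i\<in>I. f i x)"
  by (induction I rule: infinite_finite_induct) (auto intro: trig_poly_const trig_poly_mult)

lemma trig_poly_cos: "trig_poly (\<lambda>x. of_real (cos (\<mu> * x)))"
proof -
  have "(\<lambda>x. complex_of_real (cos (\<mu> * x))) = (\<lambda>x. (1/2) * cis (\<mu> * x) + (1/2) * cis ((-\<mu>) * x))"
    by (auto simp: complex_eq_iff)
  then show ?thesis by (simp only: trig_poly.intros)
qed

lemma trig_poly_AP: "trig_poly f \<Longrightarrow> f \<in> AP"
  by (induction rule: trig_poly.induct) (auto intro: AP_cmult AP_cis AP_add)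

lemma trig_poly_representation:
  assumes "trig_poly f"
  shows "\<exists>B k. finite B \<and> (\<forall>x. f x = (\<Sum>\<mu>\<in>B. k \<mu> * cis (- \<mu> * x)))"
  using assms
proof induction
  case (monomial c \<mu>)
  show ?case by (intro exI[of _ "{-\<mu>}"] exI[of _ "\<lambda>_. c"]) simp
next
  case (add f g)
  obtain B k where B: "finite B" "\<forall>x. f x = (\<Sum>\<mu>\<in>B. k \<mu> * cis (- \<mu> * x))" using add.IH(1) by blast
  obtain D l where D: "finite D" "\<forall>x. g x = (\<Sum>\<mu>\<in>D. l \<mu> * cis (- \<mu> * x))" using add.IH(2) by blast
  have "f x + g x = (\<Sum>\<mu>\<in>B\<union>D. ((if \<mu> \<in> B then k \<mu> else 0) + (if \<mu> \<in> D then l \<mu> else 0)) * cis (- \<mu> * x))" for x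
  proof -
    have "f x = (\<Sum>\<mu>\<in>B\<union>D. (if \<mu> \<in> B then k \<mu> else 0) * cis (- \<mu> * x))"
      unfolding B(2)[rule_format] by (rule sum.mono_neutral_cong_left) (use B D in auto)
    moreover have "g x = (\<Sum>\<mu>\<in>B\<union>D. (if \<mu> \<in> D then l \<mu> else 0) * cis (- \<mu> * x))"
      unfolding D(2)[rule_format] by (rule sum.mono_neutral_cong_left) (use B D in auto)
    ultimately show ?thesis by (simp add: distrib_right sum.distrib)
  qed
  then show ?case using B(1) D(1) by (intro exI[of _ "B\<union>D"] exI) auto
qed

text \<open>A trigonometric polynomial that is a probability density with respect to the mean.  With the sign chosen
  in the exponent, \<open>k \<mu>\<close> is the factor by which the kernel multiplies the coefficient of frequency \<open>\<mu>\<close>.\<close>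

definition trig_kernel :: "real set \<Rightarrow> (real \<Rightarrow> complex) \<Rightarrow> (real \<Rightarrow> real) \<Rightarrow> bool" where
  "trig_kernel B k K \<longleftrightarrow> finite B \<and> (\<forall>t. of_real (K t) = (\<Sum>\<mu>\<in>B. k \<mu> * cis (- \<mu> * t))) \<and>
     (\<forall>t. 0 \<le> K t) \<and> ap_mean (\<lambda>t. of_real (K t)) = 1"

text \<open>
  A power of \<open>\<Prod>(1 + cos (\<lambda> t)) / 2\<close>, divided by its mean, concentrates where all the \<open>cis (\<lambda> t)\<close> are close to 1.
  The argument is the same for all finite sets of frequencies: with \<open>m N\<close> the mean of the \<open>N\<close>-th power,
  the defect is at most \<open>2 * (1 - m (N+1) / m N)\<close>, and the ratio of consecutive means
  cannot stay away from 1 because the base is close to 1 on a set of positive density.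
\<close>

lemma trig_kernel_exists:
  assumes \<Lambda>: "finite \<Lambda>" and \<epsilon>: "\<epsilon> > 0"
  obtains B k K where "trig_kernel B k K"
    "\<And>\<mu>. \<mu> \<in> \<Lambda> \<Longrightarrow> Re (ap_mean (\<lambda>t. of_real (K t * (1 - cos (\<mu> * t))))) \<le> \<epsilon>"
proof -
  define Q where "Q = (\<lambda>t. \<Prod>\<mu>\<in>\<Lambda>. (1 + cos (\<mu> * t)) / 2)"
  have fac: "0 \<le> (1 + cos x) / 2" "(1 + cos x) / 2 \<le> 1" for x :: real
    using cos_ge_minus_one[of x] cos_le_one[of x] by (simp_all del: cos_ge_minus_one cos_le_one)
  have Q0: "0 \<le> Q t" for t unfolding Q_def by (rule prod_nonneg) (use fac in auto)
  have Qle: "Q t \<le> (1 + cos (\<mu> * t)) / 2" if "\<mu> \<in> \<Lambda>" for \<mu> t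
  proof -
    have "Q t = (1 + cos (\<mu> * t)) / 2 * (\<Prod>\<mu>\<in>\<Lambda> - {\<mu>}. (1 + cos (\<mu> * t)) / 2)"
      unfolding Q_def by (rule prod.remove[OF \<Lambda> that])
    also have "\<dots> \<le> (1 + cos (\<mu> * t)) / 2 * 1"
      using fac by (intro mult_left_mono prod_le_1) auto
    finally show ?thesis by simp
  qed
  have Qt: "trig_poly (\<lambda>t. of_real (Q t))"
  proof -
    have "(\<lambda>t. complex_of_real (Q t)) = (\<lambda>t. \<Prod>\<mu>\<in>\<Lambda>. ((1/2) * (1 + of_real (cos (\<mu> * t)))))"
      by (simp add: Q_def fun_eq_iff)
    moreover have "trig_poly \<dots>"
      by (intro trig_poly_prod trig_poly_mult trig_poly_const trig_poly.add trig_poly_cos)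
    ultimately show ?thesis by simp
  qed
  then have QNt: "trig_poly (\<lambda>t. of_real (Q t ^ N))" for N
    using trig_poly_power[OF Qt, of N] by simp
  note QN = trig_poly_AP[OF QNt]
  define m where "m = (\<lambda>N. Re (ap_mean (\<lambda>t. of_real (Q t ^ N))))"
  have mm: "ap_mean (\<lambda>t. of_real (Q t ^ N)) = of_real (m N)" for N
    using Im_ap_mean_of_real[OF QN[of N]] by (simp add: m_def complex_eq_iff)
  define e where "e = min \<epsilon> 1"
  have e: "0 < e" "e \<le> 1" "e \<le> \<epsilon>" using \<epsilon> by (auto simp: e_def)
  \<comment> \<open>every long window contains an interval of fixed length on which \<open>Q\<close> is at least \<open>1 - e/4\<close>\<close>
  have "\<exists>c>0. \<forall>N. c * (1 - e/4) ^ N \<le> m N"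
  proof -
    have Qa: "(\<lambda>t. complex_of_real (Q t)) \<in> AP" using QN[of 1] by simp
    obtain d where d: "d > 0" "\<And>s x. \<bar>s\<bar> \<le> d \<Longrightarrow> cmod (complex_of_real (Q (x + s)) - of_real (Q x)) \<le> e/8"
      using AP_uniformly_continuous[OF Qa, of "e/8"] e by auto
    obtain l where l: "l > 0" "\<And>c. \<exists>\<tau>\<in>{c..c+l}. \<forall>x. cmod (complex_of_real (Q (x + \<tau>)) - of_real (Q x)) \<le> e/8"
      by (rule AP_almost_periods[OF Qa, of "e/8"]) (use e in auto)
    have "d * (1 - e/4) ^ N / (l + d) \<le> m N" for N
      unfolding m_def
    proof (rule ap_mean_ge[OF QN])
      fix c
      obtain \<tau> where \<tau>: "\<tau> \<in> {c..c+l}" "\<forall>x. cmod (complex_of_real (Q (x + \<tau>)) - of_real (Q x)) \<le> e/8" using l(2) by blast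
      have "(1 - e/4) ^ N \<le> Q (\<tau> + s) ^ N" if "s \<in> {0..d}" for s
      proof (rule power_mono)
        have "\<bar>Q \<tau> - Q 0\<bar> \<le> e/8" using \<tau>(2)[rule_format, of 0] by (simp flip: of_real_diff)
        moreover have "\<bar>Q (\<tau> + s) - Q \<tau>\<bar> \<le> e/8" using d(2)[of s \<tau>] that by (simp flip: of_real_diff)
        moreover have "Q 0 = 1" by (simp add: Q_def)
        ultimately show "1 - e/4 \<le> Q (\<tau> + s)" by linarith
      qed (use e in auto)
      then show "\<exists>\<tau>\<in>{c..c+l}. \<forall>s\<in>{0..d}. (1 - e/4) ^ N \<le> Q (\<tau> + s) ^ N" using \<tau>(1) by blast
    qed (use Q0 d l e in auto)
    then show ?thesis using d l by (intro exI[of _ "d / (l + d)"]) auto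
  qed
  then obtain c where c: "c > 0" "\<And>N. c * (1 - e/4) ^ N \<le> m N" by blast
  have mpos: "m N > 0" for N
    by (rule less_le_trans[OF _ c(2)]) (use c e in auto)
  \<comment> \<open>otherwise the means would decay faster than the lower bound just obtained\<close>
  have "\<exists>N. (1 - e/2) * m N < m (Suc N)"
  proof (rule ccontr)
    assume "\<not> ?thesis"
    then have step: "m (Suc N) \<le> (1 - e/2) * m N" for N by (simp add: not_less)
    have up: "m N \<le> (1 - e/2) ^ N" for N
    proof (induction N)
      case 0 show ?case by (simp add: m_def ap_mean_const)
    next
      case (Suc N)
      have "m (Suc N) \<le> (1 - e/2) * (1 - e/2) ^ N"
        by (rule order_trans[OF step]) (use Suc e in \<open>auto intro: mult_left_mono\<close>)
      then show ?case by simp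
    qed
    define r where "r = (1 - e/2) / (1 - e/4)"
    have "0 < 1 - e/4" using e by simp
    then have "r < 1" using e by (simp add: r_def)
    then obtain N where N: "r ^ N < c" using real_arch_pow_inv[OF c(1)] by blast
    have "c * (1 - e/4) ^ N \<le> (1 - e/2) ^ N" using c(2) up order_trans by blast
    then have "c \<le> r ^ N" using e by (simp add: r_def power_divide pos_le_divide_eq)
    then show False using N by simp
  qed
  then obtain N where N: "(1 - e/2) * m N < m (Suc N)" by blast
  define K where "K = (\<lambda>t. Q t ^ N / m N)"
  have Kt: "trig_poly (\<lambda>t. of_real (K t))"
    using trig_poly_mult[OF QNt[of N] trig_poly_const[of "of_real (inverse (m N))"]] by (simp add: K_def divide_inverse)
  obtain B k where Bk: "finite B" "\<forall>t. complex_of_real (K t) = (\<Sum>\<mu>\<in>B. k \<mu> * cis (- \<mu> * t))"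
    using trig_poly_representation[OF Kt] by blast
  have mean: "ap_mean (\<lambda>t. of_real (K t)) = 1"
    using ap_mean_cmult[OF QN[of N], of "of_real (inverse (m N))"] mpos[of N] unfolding mm
    by (simp add: K_def divide_inverse mult.commute del: of_real_power)
  have K: "trig_kernel B k K"
    unfolding trig_kernel_def using Bk mean mpos[of N] Q0 by (auto simp: K_def)
  have "Re (ap_mean (\<lambda>t. of_real (K t * (1 - cos (\<mu> * t))))) \<le> \<epsilon>" if \<mu>: "\<mu> \<in> \<Lambda>" for \<mu>
  proof -
    have 1: "(\<lambda>t. complex_of_real (K t * (1 - cos (\<mu> * t)))) \<in> AP"
      using AP_mult[OF trig_poly_AP[OF Kt] AP_diff[OF AP_const[of 1] trig_poly_AP[OF trig_poly_cos[of \<mu>]]]] by simp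
    have 2: "(\<lambda>t. complex_of_real (2 / m N * (Q t ^ N - Q t ^ Suc N))) \<in> AP"
      using AP_cmult[OF AP_diff[OF QN[of N] QN[of "Suc N"]], of "of_real (2 / m N)"] by simp
    have "Re (ap_mean (\<lambda>t. of_real (K t * (1 - cos (\<mu> * t))))) \<le> Re (ap_mean (\<lambda>t. of_real (2 / m N * (Q t ^ N - Q t ^ Suc N))))"
    proof (rule ap_mean_mono[OF 1 2])
      fix t
      have "1 - cos (\<mu> * t) \<le> 2 * (1 - Q t)" using Qle[OF \<mu>, of t] by simp
      then have "K t * (1 - cos (\<mu> * t)) \<le> K t * (2 * (1 - Q t))"
        using Q0 mpos[of N] by (intro mult_left_mono) (auto simp: K_def)
      then show "K t * (1 - cos (\<mu> * t)) \<le> 2 / m N * (Q t ^ N - Q t ^ Suc N)"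
        by (simp add: K_def algebra_simps)
    qed
    also have "ap_mean (\<lambda>t. of_real (2 / m N * (Q t ^ N - Q t ^ Suc N))) = of_real (2 / m N) * (of_real (m N) - of_real (m (Suc N)))"
      unfolding of_real_mult of_real_diff
      by (subst ap_mean_cmult) (use QN in \<open>auto intro!: AP_diff simp: ap_mean_diff mm simp del: of_real_power power_Suc of_real_mult\<close>)
    also have "Re \<dots> = 2 - 2 * (m (Suc N) / m N)" using mpos[of N] by (simp add: field_simps flip: of_real_diff of_real_mult)
    also have "\<dots> \<le> e" using N mpos[of N] by (simp add: field_simps)
    finally show ?thesis using e by simp
  qed
  then show ?thesis using that K by blast
qed

lemma trig_kernel_AP: "trig_kernel B k K \<Longrightarrow> (\<lambda>t. of_real (K t)) \<in> AP"
proof -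
  assume K: "trig_kernel B k K"
  have "(\<lambda>t. \<Sum>\<mu>\<in>B. k \<mu> * cis (- \<mu> * t)) \<in> AP" by (intro AP_sum AP_cmult AP_cis)
  moreover have "(\<lambda>t. complex_of_real (K t)) = (\<lambda>t. \<Sum>\<mu>\<in>B. k \<mu> * cis (- \<mu> * t))"
    using K by (auto simp: trig_kernel_def)
  ultimately show ?thesis by simp
qed

text \<open>
  The mean of \<open>t \<mapsto> g (x + t) * K t\<close> multiplies the Fourier coefficients of \<open>g\<close> by those of \<open>K\<close>.
  It has finite rank as an operator on \<open>g\<close> because \<open>K\<close> is a trigonometric polynomial, and norm
  at most 1 because \<open>K\<close> is a probability density.
\<close>

lemma ap_mean_kernel:
  assumes g: "g \<in> AP" and K: "trig_kernel B k K"
  shows "ap_mean (\<lambda>t. g (x + t) * of_real (K t)) = (\<Sum>\<mu>\<in>B. k \<mu> * ap_coeff \<mu> g * cis (\<mu> * x))"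
proof -
  have tr: "(\<lambda>t. g (x + t)) \<in> AP" using AP_translate[OF g, of x] by (simp add: add.commute)
  have "(\<lambda>t. g (x + t) * of_real (K t)) = (\<lambda>t. \<Sum>\<mu>\<in>B. k \<mu> * (g (x + t) * cis (- \<mu> * t)))"
    using K by (auto simp: trig_kernel_def sum_distrib_left intro!: sum.cong)
  then have "ap_mean (\<lambda>t. g (x + t) * of_real (K t)) = (\<Sum>\<mu>\<in>B. k \<mu> * ap_mean (\<lambda>t. g (x + t) * cis (- \<mu> * t)))"
    using ap_mean_lincomb[of B "\<lambda>\<mu> t. g (x + t) * cis (- \<mu> * t)" k] AP_mult_cis[OF tr] by metis
  also have "\<dots> = (\<Sum>\<mu>\<in>B. k \<mu> * ap_coeff \<mu> g * cis (\<mu> * x))"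
  proof (intro sum.cong refl)
    fix \<mu>
    have "(\<lambda>t. g (x + t) * cis (- \<mu> * t)) = (\<lambda>t. cis (\<mu> * x) * (g (t + x) * cis (- \<mu> * (t + x))))"
    proof
      fix t
      have "cis (- \<mu> * t) = cis (\<mu> * x) * cis (- \<mu> * (t + x))" by (simp add: cis_mult algebra_simps)
      then show "g (x + t) * cis (- \<mu> * t) = cis (\<mu> * x) * (g (t + x) * cis (- \<mu> * (t + x)))"
        by (simp add: add.commute mult_ac)
    qed
    then have "ap_mean (\<lambda>t. g (x + t) * cis (- \<mu> * t)) = cis (\<mu> * x) * ap_mean (\<lambda>t. g (t + x) * cis (- \<mu> * (t + x)))"
      using ap_mean_cmult[OF AP_translate[OF AP_mult_cis[OF g, of "-\<mu>"], of x]] by simp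
    also have "ap_mean (\<lambda>t. g (t + x) * cis (- \<mu> * (t + x))) = ap_coeff \<mu> g"
      unfolding ap_coeff_eq using ap_mean_translate[OF AP_mult_cis[OF g, of "-\<mu>"], of x] .
    finally show "k \<mu> * ap_mean (\<lambda>t. g (x + t) * cis (- \<mu> * t)) = k \<mu> * ap_coeff \<mu> g * cis (\<mu> * x)" by simp
  qed
  finally show ?thesis .
qed

lemma kernel_mean_bound:
  assumes g: "g \<in> AP" and K: "trig_kernel B k K" and C: "\<And>x. cmod (g x) \<le> C"
  shows "cmod (ap_mean (\<lambda>t. g (x + t) * of_real (K t))) \<le> C"
proof -
  have tr: "(\<lambda>t. g (x + t)) \<in> AP" using AP_translate[OF g, of x] by (simp add: add.commute)
  have K0: "\<And>t. 0 \<le> K t" and K1: "ap_mean (\<lambda>t. of_real (K t)) = 1"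
    using K unfolding trig_kernel_def by blast+
  have CK: "(\<lambda>t. complex_of_real (C * K t)) \<in> AP" using AP_cmult[OF trig_kernel_AP[OF K], of "of_real C"] by simp
  have "cmod (ap_mean (\<lambda>t. g (x + t) * of_real (K t))) \<le> Re (ap_mean (\<lambda>t. of_real (C * K t)))"
    by (rule norm_ap_mean_le[OF AP_mult[OF tr trig_kernel_AP[OF K]] CK])
      (use K0 C in \<open>simp add: norm_mult mult_right_mono\<close>)
  also have "ap_mean (\<lambda>t. of_real (C * K t)) = of_real C"
    using ap_mean_cmult[OF trig_kernel_AP[OF K], of "of_real C"] K1 by simp
  finally show ?thesis by simp
qed

lemma kernel_coefficient:
  assumes K: "trig_kernel B k K"
  shows "ap_mean (\<lambda>t. cis (\<mu> * t) * of_real (K t)) = (if \<mu> \<in> B then k \<mu> else 0)"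
proof -
  have "ap_mean (\<lambda>t. cis (\<mu> * (0 + t)) * of_real (K t)) = (\<Sum>\<nu>\<in>B. k \<nu> * ap_coeff \<nu> (\<lambda>t. cis (\<mu> * t)) * cis (\<nu> * 0))"
    by (rule ap_mean_kernel[OF AP_cis K])
  moreover have "ap_coeff \<nu> (\<lambda>t. cis (\<mu> * t)) = (if \<nu> = \<mu> then 1 else 0)" for \<nu>
    using ap_coeff_trig_sum[of "{\<mu>}" \<nu> "\<lambda>_. 1"] by simp
  moreover have "finite B" using K by (simp add: trig_kernel_def)
  ultimately show ?thesis by (simp add: if_distrib[of "(*) _"] if_distribR cong: if_cong)
qed

text \<open>Functions that are close to their value at 0 wherever \<open>cis (\<mu> t)\<close> is close to 1 are nearly
  reproduced at 0 by a kernel that is concentrated there.\<close>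

lemma kernel_mean_close:
  assumes h: "h \<in> AP" and K: "trig_kernel B k K"
    and le: "\<And>t. cmod (h t - c) \<le> a + b * (1 - cos (\<mu> * t))" and b: "b \<ge> 0"
    and conc: "Re (ap_mean (\<lambda>t. of_real (K t * (1 - cos (\<mu> * t))))) \<le> \<epsilon>"
  shows "cmod (ap_mean (\<lambda>t. h t * of_real (K t)) - c) \<le> a + b * \<epsilon>"
proof -
  note KA = trig_kernel_AP[OF K]
  have K1: "ap_mean (\<lambda>t. of_real (K t)) = 1" and K0: "\<And>t. 0 \<le> K t" using K by (auto simp: trig_kernel_def)
  have c1: "(\<lambda>t. complex_of_real (K t * (1 - cos (\<mu> * t)))) \<in> AP"
    using AP_mult[OF KA AP_diff[OF AP_const[of 1] trig_poly_AP[OF trig_poly_cos[of \<mu>]]]] by simp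
  have c2: "(\<lambda>t. complex_of_real (a * K t + b * (K t * (1 - cos (\<mu> * t))))) \<in> AP"
    using AP_add[OF AP_cmult[OF KA, of "of_real a"] AP_cmult[OF c1, of "of_real b"]] by simp
  have hK: "(\<lambda>t. h t * of_real (K t)) \<in> AP" by (rule AP_mult[OF h KA])
  have cK: "(\<lambda>t. c * of_real (K t)) \<in> AP" by (rule AP_cmult[OF KA])
  have "ap_mean (\<lambda>t. h t * of_real (K t)) - c = ap_mean (\<lambda>t. h t * of_real (K t) - c * of_real (K t))"
    unfolding ap_mean_diff[OF hK cK] ap_mean_cmult[OF KA] K1 by simp
  also have "cmod \<dots> \<le> Re (ap_mean (\<lambda>t. complex_of_real (a * K t + b * (K t * (1 - cos (\<mu> * t))))))"
  proof (rule norm_ap_mean_le[OF AP_diff[OF hK cK] c2])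
    fix t
    have "cmod (h t * of_real (K t) - c * of_real (K t)) = cmod (h t - c) * K t"
      using K0[of t] by (simp add: norm_mult flip: left_diff_distrib)
    also have "\<dots> \<le> (a + b * (1 - cos (\<mu> * t))) * K t" by (intro mult_right_mono le K0)
    finally show "cmod (h t * of_real (K t) - c * of_real (K t)) \<le> a * K t + b * (K t * (1 - cos (\<mu> * t)))"
      by (simp add: algebra_simps)
  qed
  also have "\<dots> = a + b * Re (ap_mean (\<lambda>t. of_real (K t * (1 - cos (\<mu> * t)))))"
    using ap_mean_add[OF AP_cmult[OF KA, of "of_real a"] AP_cmult[OF c1, of "of_real b"]]
    unfolding ap_mean_cmult[OF KA] ap_mean_cmult[OF c1] K1 by simp
  also have "\<dots> \<le> a + b * \<epsilon>" using conc b by (intro add_left_mono mult_left_mono)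
  finally show ?thesis .
qed

text \<open>
  The approximation theorem.  If a kernel with coefficients close to 1 at all large coefficients
  of \<open>f\<close> did not nearly reproduce \<open>f\<close>, the difference would have a large coefficient by the
  quantitative uniqueness theorem, because its almost periods are controlled by those of \<open>f\<close>.  But
  the coefficients of the difference are those of \<open>f\<close> multiplied by a factor of modulus at most 2
  that is small wherever \<open>f\<close> has a large coefficient.  By Bessel's inequality only finitely many
  frequencies have to be taken into account.
\<close>

lemma AP_kernel_approximation:
  assumes \<F>: "finite \<F>" "\<F> \<subseteq> AP" and \<epsilon>: "\<epsilon> > 0"
  obtains B k K where "trig_kernel B k K"
    "\<And>f x. f \<in> \<F> \<Longrightarrow> cmod ((\<Sum>\<mu>\<in>B. k \<mu> * ap_coeff \<mu> f * cis (\<mu> * x)) - f x) \<le> \<epsilon>"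
proof -
  have "\<exists>C>0. \<forall>x. cmod (f x) \<le> C" if "f \<in> \<F>" for f
    using AP_bounded[of f] that \<F> by (metis subsetD)
  then obtain C where C: "\<And>f. f \<in> \<F> \<Longrightarrow> C f > 0" "\<And>f x. f \<in> \<F> \<Longrightarrow> cmod (f x) \<le> C f" by metis
  have "\<exists>\<kappa>>0. \<forall>g. g \<in> AP \<longrightarrow> (\<forall>x. cmod (g x) \<le> 2 * C f) \<longrightarrow> (\<exists>x. \<epsilon> \<le> cmod (g x)) \<longrightarrow>
    (\<forall>\<tau> d. (\<forall>x. cmod (f (x + \<tau>) - f x) \<le> d) \<longrightarrow> (\<forall>x. cmod (g (x + \<tau>) - g x) \<le> 2 * d)) \<longrightarrow>
    (\<exists>\<mu>. \<kappa> \<le> cmod (ap_coeff \<mu> g))" if "f \<in> \<F>" for f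
    by (rule AP_large_coefficient) (use that \<F> \<epsilon> C in auto)
  then obtain \<kappa> where \<kappa>: "\<And>f. f \<in> \<F> \<Longrightarrow> \<kappa> f > 0" "\<And>f g. f \<in> \<F> \<Longrightarrow> g \<in> AP \<Longrightarrow> (\<forall>x. cmod (g x) \<le> 2 * C f) \<Longrightarrow> (\<exists>x. \<epsilon> \<le> cmod (g x)) \<Longrightarrow>
    (\<forall>\<tau> d. (\<forall>x. cmod (f (x + \<tau>) - f x) \<le> d) \<longrightarrow> (\<forall>x. cmod (g (x + \<tau>) - g x) \<le> 2 * d)) \<Longrightarrow>
    (\<exists>\<mu>. \<kappa> f \<le> cmod (ap_coeff \<mu> g))" by metis
  define \<Lambda> where "\<Lambda> = (\<Union>f\<in>\<F>. {\<mu>. \<kappa> f / 2 \<le> cmod (ap_coeff \<mu> f)})"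
  have \<Lambda>: "finite \<Lambda>" unfolding \<Lambda>_def
    by (intro finite_UN_I \<F>(1) finite_large_coefficients) (use \<F> \<kappa>(1) in auto)
  \<comment> \<open>a bound for the defect of the coefficients that works for all members of the family\<close>
  define \<eta> where "\<eta> = Min (insert 1 ((\<lambda>f. \<kappa> f / (4 * C f)) ` \<F>))"
  have \<eta>: "\<eta> > 0" unfolding \<eta>_def using \<F> \<kappa>(1) C(1) by (subst Min_gr_iff) auto
  have \<eta>le: "\<eta> \<le> \<kappa> f / (4 * C f)" if "f \<in> \<F>" for f unfolding \<eta>_def using \<F> that by (intro Min_le) auto
  obtain B k K where K: "trig_kernel B k K"
    "\<And>\<mu>. \<mu> \<in> \<Lambda> \<Longrightarrow> Re (ap_mean (\<lambda>t. of_real (K t * (1 - cos (\<mu> * t))))) \<le> \<eta>\<^sup>2 / 2"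
    using trig_kernel_exists[OF \<Lambda>, of "\<eta>\<^sup>2 / 2"] \<eta> by auto
  define k' where "k' = (\<lambda>\<mu>. if \<mu> \<in> B then k \<mu> else 0)"
  have finB: "finite B" using K by (simp add: trig_kernel_def)
  have k'1: "cmod (k' \<mu>) \<le> 1" for \<mu>
    using kernel_mean_bound[OF AP_cis K(1), of \<mu> 1 0] kernel_coefficient[OF K(1), of \<mu>] by (simp add: k'_def)
  have k'2: "cmod (1 - k' \<mu>) \<le> 2 * \<eta>" if \<mu>: "\<mu> \<in> \<Lambda>" for \<mu>
  proof -
    have "cmod (ap_mean (\<lambda>t. cis (\<mu> * t) * of_real (K t)) - 1) \<le> \<eta> + 2 / \<eta> * (\<eta>\<^sup>2 / 2)"
    proof (rule kernel_mean_close[OF AP_cis K(1) _ _ K(2)[OF \<mu>]])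
      fix t
      let ?y = "cmod (cis (\<mu> * t) - 1)"
      have y: "?y\<^sup>2 = 2 * (1 - cos (\<mu> * t))"
      proof -
        have "?y\<^sup>2 = (cos (\<mu> * t) - 1)\<^sup>2 + (sin (\<mu> * t))\<^sup>2" by (simp add: cmod_power2)
        then show ?thesis
          using sin_cos_squared_add[of "\<mu> * t"] by (simp only: power2_eq_square) (simp add: algebra_simps)
      qed
      \<comment> \<open>the kernel is known to concentrate with respect to the square of \<open>?y\<close>\<close>
      have "?y \<le> \<eta> + ?y\<^sup>2 / \<eta>"
      proof (cases "?y \<le> \<eta>")
        case True then show ?thesis using \<eta> by (simp add: add_increasing2)
      next
        case False
        then have "\<eta> * ?y \<le> ?y * ?y" by (intro mult_right_mono) auto
        then have "?y \<le> ?y\<^sup>2 / \<eta>" using \<eta> by (simp add: pos_le_divide_eq power2_eq_square mult.commute)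
        then show ?thesis using \<eta> by linarith
      qed
      then show "?y \<le> \<eta> + 2 / \<eta> * (1 - cos (\<mu> * t))" unfolding y by simp
    qed (use \<eta> in simp)
    then show ?thesis using \<eta> kernel_coefficient[OF K(1), of \<mu>]
      by (simp add: k'_def norm_minus_commute power2_eq_square)
  qed
  have "cmod ((\<Sum>\<mu>\<in>B. k \<mu> * ap_coeff \<mu> f * cis (\<mu> * x)) - f x) \<le> \<epsilon>" if f: "f \<in> \<F>" for f x
  proof (rule ccontr)
    assume neg: "\<not> ?thesis"
    have fAP: "f \<in> AP" using f \<F> by auto
    define T where "T = (\<lambda>g x. ap_mean (\<lambda>t. g (x + t) * of_real (K t)))"
    have T: "T g x = (\<Sum>\<mu>\<in>B. (k \<mu> * ap_coeff \<mu> g) * cis (\<mu> * x))" if "g \<in> AP" for g x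
      unfolding T_def ap_mean_kernel[OF that K(1)] by simp
    have TA: "T f \<in> AP"
    proof -
      have "T f = (\<lambda>x. \<Sum>\<mu>\<in>B. (k \<mu> * ap_coeff \<mu> f) * cis (\<mu> * x))" using T[OF fAP] by blast
      then show ?thesis using AP_trig_sum by simp
    qed
    define g where "g = (\<lambda>x. f x - T f x)"
    have gA: "g \<in> AP" unfolding g_def by (rule AP_diff[OF fAP TA])
    have "\<exists>\<mu>. \<kappa> f \<le> cmod (ap_coeff \<mu> g)"
    proof (rule \<kappa>(2)[OF f gA])
      show "\<forall>x. cmod (g x) \<le> 2 * C f"
      proof
        fix x
        have "cmod (T f x) \<le> C f" unfolding T_def by (rule kernel_mean_bound[OF fAP K(1) C(2)[OF f]])
        then show "cmod (g x) \<le> 2 * C f" unfolding g_def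
          using C(2)[OF f, of x] norm_triangle_ineq4[of "f x" "T f x"] by simp
      qed
      show "\<exists>x. \<epsilon> \<le> cmod (g x)" using neg by (intro exI[of _ x]) (simp add: g_def T[OF fAP] norm_minus_commute)
      show "\<forall>\<tau> d. (\<forall>x. cmod (f (x + \<tau>) - f x) \<le> d) \<longrightarrow> (\<forall>x. cmod (g (x + \<tau>) - g x) \<le> 2 * d)"
      proof (intro allI impI)
        fix \<tau> d x assume a: "\<forall>x. cmod (f (x + \<tau>) - f x) \<le> d"
        have tr: "(\<lambda>t. f (x + t)) \<in> AP" for x using AP_translate[OF fAP, of x] by (simp add: add.commute)
        have "T f (x + \<tau>) - T f x = ap_mean (\<lambda>t. f (x + \<tau> + t) * of_real (K t) - f (x + t) * of_real (K t))"
          unfolding T_def by (intro ap_mean_diff[symmetric] AP_mult trig_kernel_AP[OF K(1)] tr)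
        also have "\<dots> = ap_mean (\<lambda>t. (f ((x + t) + \<tau>) - f (x + t)) * of_real (K t))"
          by (simp add: left_diff_distrib add_ac)
        also have "cmod \<dots> \<le> d"
          by (rule kernel_mean_bound[OF AP_diff[OF AP_translate[OF fAP] fAP] K(1)]) (use a in blast)
        finally have "cmod (T f (x + \<tau>) - T f x) \<le> d" .
        moreover have "g (x + \<tau>) - g x = (f (x + \<tau>) - f x) - (T f (x + \<tau>) - T f x)" by (simp add: g_def)
        ultimately show "cmod (g (x + \<tau>) - g x) \<le> 2 * d"
          using a[rule_format, of x] norm_triangle_ineq4[of "f (x + \<tau>) - f x" "T f (x + \<tau>) - T f x"] by simp
      qed
    qed
    then obtain \<mu> where \<mu>: "\<kappa> f \<le> cmod (ap_coeff \<mu> g)" by blast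
    have "ap_coeff \<mu> (T f) = k' \<mu> * ap_coeff \<mu> f"
    proof -
      have "T f = (\<lambda>x. \<Sum>\<mu>\<in>B. (k \<mu> * ap_coeff \<mu> f) * cis (\<mu> * x))" using T[OF fAP] by blast
      then show ?thesis using ap_coeff_trig_sum[OF finB] by (simp add: k'_def)
    qed
    then have "ap_coeff \<mu> g = (1 - k' \<mu>) * ap_coeff \<mu> f"
      unfolding g_def ap_coeff_diff[OF fAP TA] by (simp add: algebra_simps)
    then have ag: "cmod (ap_coeff \<mu> g) = cmod (1 - k' \<mu>) * cmod (ap_coeff \<mu> f)" by (simp add: norm_mult)
    have "cmod (1 - k' \<mu>) \<le> 2" using norm_triangle_ineq4[of 1 "k' \<mu>"] k'1[of \<mu>] by simp
    then have "\<kappa> f \<le> 2 * cmod (ap_coeff \<mu> f)" using \<mu> unfolding ag by (meson mult_right_mono norm_ge_zero order_trans)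
    then have "\<mu> \<in> \<Lambda>" unfolding \<Lambda>_def by (intro UN_I[OF f]) simp
    then have "cmod (ap_coeff \<mu> g) \<le> (2 * \<eta>) * C f"
      unfolding ag by (intro mult_mono k'2 norm_ap_coeff_le[OF fAP] C(2)[OF f]) (use \<eta> in auto)
    also have "\<dots> \<le> \<kappa> f / 2" using \<eta>le[OF f] C(1)[OF f] by (simp add: field_simps)
    finally show False using \<mu> \<kappa>(1)[OF f] by simp
  qed
  then show ?thesis using that K(1) by blast
qed

section \<open>Logarithmic coordinates on the circle\<close>

text \<open>The inverse of \<open>Ln \<circ> phi_map s\<close>, which maps the strip \<open>0 \<le> Im w \<le> pi\<close> into the closed disk.\<close>

definition strip_to_disk :: "complex \<Rightarrow> complex \<Rightarrow> complex" where
  "strip_to_disk s w = s * ((2 * \<i> - exp w) / (2 * \<i> + exp w))"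

lemma cayley_real: "(2 * \<i> - of_real y) / (2 * \<i> + of_real y) = cis (2 * arctan (y / 2))"
proof -
  have nz: "2 * \<i> + of_real y \<noteq> 0" by (simp add: complex_eq_iff)
  have p: "1 + (y/2)\<^sup>2 > 0" by (simp add: add_pos_nonneg)
  have "cis (2 * arctan (y / 2)) = Complex ((1 - (y/2)\<^sup>2) / (1 + (y/2)\<^sup>2)) (2 * (y/2) / (1 + (y/2)\<^sup>2))"
    by (simp add: complex_eq_iff cos_tan_half sin_tan_half tan_arctan)
  also have "\<dots> = (2 * \<i> - of_real y) / (2 * \<i> + of_real y)"
    using nz p by (simp add: complex_eq_iff Re_divide Im_divide) (simp add: field_simps power2_eq_square)
  finally show ?thesis ..
qed

lemma strip_to_disk_lower: "strip_to_disk s (of_real x) = s * cis (2 * arctan (exp x / 2))"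
  unfolding strip_to_disk_def cayley_real[symmetric] by (simp flip: exp_of_real)

lemma strip_to_disk_upper: "strip_to_disk s (of_real x + \<i> * of_real pi) = s * cis (- (2 * arctan (exp x / 2)))"
proof -
  have "cis (- (2 * arctan (exp x / 2))) = cis (2 * arctan ((- exp x) / 2))" by (simp add: arctan_minus)
  also have "\<dots> = (2 * \<i> - of_real (- exp x)) / (2 * \<i> + of_real (- exp x))" by (rule cayley_real[symmetric])
  finally show ?thesis unfolding strip_to_disk_def by (simp add: exp_add exp_of_real)
qed

lemma phi_map_cis:
  assumes s: "cmod s = 1" and u: "\<bar>u\<bar> < pi"
  shows "phi_map s (s * cis u) = of_real (2 * tan (u / 2))"
proof -
  have "cos u \<noteq> -1"
  proof
    assume "cos u = -1"
    then have "cos \<bar>u\<bar> = cos pi" by simp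
    then show False using u cos_inj_pi[of "\<bar>u\<bar>" pi] by auto
  qed
  then have c: "1 + cos u \<noteq> 0" by linarith
  have "s \<noteq> 0" using s by auto
  have "1 + cis u \<noteq> 0" using c by (auto simp: complex_eq_iff)
  have eq: "\<i> * (1 - cis u) * (1 + of_real (cos u)) = of_real (sin u) * (1 + cis u)"
    using sin_cos_squared_add[of u] by (simp add: complex_eq_iff power2_eq_square algebra_simps)
  have "\<i> * (1 - cis u) / (1 + cis u) = of_real (sin u / (cos u + 1))"
  proof -
    have nz: "1 + complex_of_real (cos u) \<noteq> 0" using c by (metis of_real_1 of_real_add of_real_eq_0_iff)
    have "\<i> * (1 - cis u) / (1 + cis u) = of_real (sin u) / (1 + of_real (cos u))"
      using eq by (simp only: frac_eq_eq[OF \<open>1 + cis u \<noteq> 0\<close> nz])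
    then show ?thesis by (simp add: add.commute)
  qed
  moreover have "tan (u/2) = sin u / (cos u + 1)" using tan_half[of "u/2"] by simp
  moreover have "phi_map s (s * cis u) = 2 * (\<i> * (1 - cis u) / (1 + cis u))"
  proof -
    have "phi_map s (s * cis u) = (s * (2 * \<i> * (1 - cis u))) / (s * (1 + cis u))"
      unfolding phi_map_def by (simp add: algebra_simps)
    then show ?thesis using \<open>s \<noteq> 0\<close> by simp
  qed
  ultimately show ?thesis by simp
qed

lemma L_map_lower:
  assumes "cmod s = 1" "0 < u" "u < pi"
  shows "L_map s g (s * cis u) = lower_edge g (ln (2 * tan (u / 2)))"
proof -
  have "0 < tan (u/2)" using assms by (intro tan_gt_zero) auto
  then show ?thesis using assms unfolding L_map_def lower_edge_def
    by (simp add: phi_map_cis Ln_of_real del: of_real_mult)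
qed

lemma L_map_upper:
  assumes "cmod s = 1" "0 < u" "u < pi"
  shows "L_map s g (s * cis (- u)) = upper_edge g (ln (2 * tan (u / 2)))"
proof -
  have t: "0 < tan (u/2)" using assms by (intro tan_gt_zero) auto
  have "phi_map s (s * cis (-u)) = of_real (2 * tan (-u/2))"
    by (rule phi_map_cis) (use assms in auto)
  then have "phi_map s (s * cis (-u)) = of_real (- (2 * tan (u/2)))" by simp
  then have "Ln (phi_map s (s * cis (-u))) = of_real (ln (2 * tan (u/2))) + \<i> * of_real pi"
    using t Ln_of_real'[of "- (2 * tan (u/2))"] by (simp add: mult.commute)
  then show ?thesis unfolding L_map_def upper_edge_def by simp
qed

lemma arctan_half_exp: "0 < 2 * arctan (exp x / 2)" "2 * arctan (exp x / 2) < pi"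
  using arctan_ubound[of "exp x / 2"] by auto

lemma L_map_strip_lower: "cmod s = 1 \<Longrightarrow> L_map s g (strip_to_disk s (of_real x)) = lower_edge g x"
  unfolding strip_to_disk_lower by (subst L_map_lower) (use arctan_half_exp[of x] in \<open>auto simp: tan_arctan\<close>)

lemma L_map_strip_upper: "cmod s = 1 \<Longrightarrow> L_map s g (strip_to_disk s (of_real x + \<i> * of_real pi)) = upper_edge g x"
  unfolding strip_to_disk_upper by (subst L_map_upper) (use arctan_half_exp[of x] in \<open>auto simp: tan_arctan\<close>)

lemma AE_lebesgue_iff_negligible: "(AE x in lebesgue. P x) \<longleftrightarrow> negligible {x::real. \<not> P x}"
proof
  assume "AE x in lebesgue. P x"
  then obtain N where N: "N \<in> null_sets lebesgue" "{x \<in> space lebesgue. \<not> P x} \<subseteq> N"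
    by (auto simp: eventually_ae_filter)
  then have "negligible N" by (simp add: negligible_iff_null_sets)
  then show "negligible {x. \<not> P x}" by (rule negligible_subset) (use N(2) in auto)
next
  assume "negligible {x. \<not> P x}"
  then show "AE x in lebesgue. P x" by (intro AE_I'[of "{x. \<not> P x}"]) (auto simp: negligible_iff_null_sets)
qed

lemma AE_translate:
  assumes "AE x in lebesgue. P (x::real)" shows "AE x in lebesgue. P (x + c)"
proof -
  have "{x. \<not> P (x + c)} = (+) (-c) ` {x. \<not> P x}"
    by (force intro: image_eqI[of _ _ "_ + c"])
  then show ?thesis using assms negligible_translation unfolding AE_lebesgue_iff_negligible by metis
qed

text \<open>
  The logarithmic coordinate is differentiable on each of the two arcs between \<open>s\<close> and \<open>- s\<close>, and differentiable maps preserve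
  null sets.
\<close>

lemma AE_log_coordinate:
  assumes s: "cmod s = 1" and ae: "AE t in lebesgue. P (cis t)"
  shows "AE x in lebesgue. P (strip_to_disk s (of_real x)) \<and> P (strip_to_disk s (of_real x + \<i> * of_real pi))"
proof -
  obtain a where a: "s = cis a" using s by (metis cis_Arg norm_zero sgn_eq div_by_1 of_real_1 zero_neq_one)
  have main: "AE x in lebesgue. P (s * cis (k * (2 * arctan (exp x / 2))))" if k: "k = 1 \<or> k = -1" for k :: real
  proof -
    define N where "N = {t. \<not> P (cis t) \<and> 0 < k * (t - a) \<and> k * (t - a) < pi}"
    have "negligible N" using ae unfolding AE_lebesgue_iff_negligible
      by (rule negligible_subset) (auto simp: N_def)
    moreover have "(\<lambda>t. ln (2 * tan (k * (t - a) / 2))) differentiable_on N"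
    proof (rule differentiable_at_imp_differentiable_on)
      fix t assume t: "t \<in> N"
      have c: "cos (k * (t - a) / 2) \<noteq> 0" using t by (intro less_imp_neq[symmetric] cos_gt_zero) (auto simp: N_def)
      have p: "tan (k * (t - a) / 2) > 0" using t by (intro tan_gt_zero) (auto simp: N_def)
      have "\<exists>D. ((\<lambda>t. ln (2 * tan (k * (t - a) / 2))) has_real_derivative D) (at t)"
        using c p by (auto intro!: derivative_eq_intros exI)
      then show "(\<lambda>t. ln (2 * tan (k * (t - a) / 2))) differentiable (at t)"
        using real_differentiable_def by blast
    qed
    ultimately have neg: "negligible ((\<lambda>t. ln (2 * tan (k * (t - a) / 2))) ` N)"
      by (intro negligible_differentiable_image_negligible) auto
    have "{x. \<not> P (s * cis (k * (2 * arctan (exp x / 2))))} \<subseteq> (\<lambda>t. ln (2 * tan (k * (t - a) / 2))) ` N"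
    proof
      fix x assume x: "x \<in> {x. \<not> P (s * cis (k * (2 * arctan (exp x / 2))))}"
      define t where "t = a + k * (2 * arctan (exp x / 2))"
      have kt: "k * (t - a) = 2 * arctan (exp x / 2)" using k by (auto simp: t_def)
      have "cis t = s * cis (k * (2 * arctan (exp x / 2)))" by (simp add: a t_def cis_mult)
      then have "t \<in> N" using x arctan_half_exp[of x] by (simp add: N_def kt)
      moreover have "ln (2 * tan (k * (t - a) / 2)) = x" by (simp add: kt tan_arctan)
      ultimately show "x \<in> (\<lambda>t. ln (2 * tan (k * (t - a) / 2))) ` N" by force
    qed
    then show ?thesis unfolding AE_lebesgue_iff_negligible using negligible_subset[OF neg] by blast
  qed
  show ?thesis using main[of 1] main[of "-1"] by (auto simp: strip_to_disk_lower strip_to_disk_upper)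
qed

lemma dist_cis_ge:
  assumes "\<bar>u\<bar> \<le> pi" shows "\<bar>u\<bar> / 4 \<le> dist (cis (a + u)) (cis a)"
proof -
  have "dist (cis (a + u)) (cis a) = cmod (cis a * (cis u - 1))" by (simp add: dist_norm cis_mult algebra_simps)
  also have "\<dots> = 2 * \<bar>sin (u / 2)\<bar>" by (simp add: norm_mult cis_conv_exp dist_exp_i_1)
  also have "\<bar>sin (u / 2)\<bar> = sin (\<bar>u\<bar> / 2)"
    using assms sin_ge_zero[of "\<bar>u\<bar> / 2"] by (auto simp: abs_if)
  also have "\<bar>u\<bar> / 4 \<le> 2 * sin (\<bar>u\<bar> / 2)" using sin_ge_quarter[of "\<bar>u\<bar> / 2"] assms by simp
  finally show ?thesis .
qed

lemma angle_near:
  obtains j :: int and u where "t = a + u + 2 * pi * of_int j" "\<bar>u\<bar> \<le> pi" "\<bar>u\<bar> / 4 \<le> dist (cis t) (cis a)"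
proof -
  define j where "j = \<lfloor>(t - a + pi) / (2 * pi)\<rfloor>"
  define u where "u = t - a - 2 * pi * of_int j"
  have "of_int j \<le> (t - a + pi) / (2 * pi)" "(t - a + pi) / (2 * pi) < of_int j + 1" unfolding j_def by linarith+
  then have "2 * pi * of_int j \<le> t - a + pi" "t - a + pi < 2 * pi * of_int j + 2 * pi"
    using pi_gt_zero by (simp_all add: pos_le_divide_eq pos_divide_less_eq algebra_simps)
  then have u: "\<bar>u\<bar> \<le> pi" by (auto simp: u_def)
  have t: "t = a + u + 2 * pi * of_int j" by (simp add: u_def)
  have "cis t = cis (a + u) * cis (2 * pi * of_int j)" unfolding t cis_mult ..
  then have "cis t = cis (a + u)" by (simp only: cis_multiple_2pi Ints_of_int mult_1_right)
  then show ?thesis using that[OF t u] dist_cis_ge[OF u, of a] by simp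
qed

text \<open>
  Null sets also pass from the line to the circle near \<open>s\<close>. The coordinate is the \<open>y\<close> with \<open>z = s * cis (\<plusminus> exp y)\<close>
  here, which up to a translation is that in the definition of semi-almost periodicity.
\<close>

lemma AE_circle_near:
  assumes s: "s = cis a" and ae: "\<And>k. k \<in> {-1, 1} \<Longrightarrow> AE y in lebesgue. y < Y \<longrightarrow> P (s * cis (k * exp y))"
  shows "\<exists>\<rho>>0. AE t in lebesgue. dist (cis t) s < \<rho> \<longrightarrow> P (cis t)"
proof -
  define N where "N = (\<lambda>k. {y. \<not> (y < Y \<longrightarrow> P (s * cis (k * exp y)))})"
  have N: "negligible (N k)" if "k \<in> {-1, 1}" for k
    using ae[OF that] unfolding AE_lebesgue_iff_negligible N_def .
  define \<rho> where "\<rho> = min (exp Y) pi / 4"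
  have "\<rho> > 0" by (simp add: \<rho>_def)
  \<comment> \<open>the exceptional angles that lie \<open>j\<close> revolutions away from \<open>a\<close>\<close>
  define Z where "Z = (\<lambda>j::int. {a + 2 * pi * of_int j} \<union> (\<lambda>y. a + exp y + 2 * pi * of_int j) ` N 1 \<union> (\<lambda>y. a - exp y + 2 * pi * of_int j) ` N (-1))"
  have Z: "negligible (Z j)" for j
  proof -
    have "(\<lambda>y. a + exp y + 2 * pi * of_int j) differentiable_on (N 1)" "(\<lambda>y. a - exp y + 2 * pi * of_int j) differentiable_on (N (-1))"
      by (auto intro!: differentiable_at_imp_differentiable_on derivative_intros simp: real_differentiable_def
          intro!: exI derivative_eq_intros)
    then have "negligible ((\<lambda>y. a + exp y + 2 * pi * of_int j) ` N 1)" "negligible ((\<lambda>y. a - exp y + 2 * pi * of_int j) ` N (-1))"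
      using N by (auto intro: negligible_differentiable_image_negligible)
    then show ?thesis unfolding Z_def by (intro negligible_Un) auto
  qed
  have "negligible (\<Union>(range Z))" by (rule negligible_countable_Union) (use Z in auto)
  moreover have "{t. \<not> (dist (cis t) s < \<rho> \<longrightarrow> P (cis t))} \<subseteq> \<Union>(range Z)"
  proof
    fix t assume "t \<in> {t. \<not> (dist (cis t) s < \<rho> \<longrightarrow> P (cis t))}"
    then have d: "dist (cis t) (cis a) < \<rho>" and nP: "\<not> P (cis t)" by (auto simp: s)
    obtain j u where ju: "t = a + u + 2 * pi * of_int j" "\<bar>u\<bar> \<le> pi" "\<bar>u\<bar> / 4 \<le> dist (cis t) (cis a)" by (rule angle_near)
    have u: "\<bar>u\<bar> < exp Y" using ju d by (auto simp: \<rho>_def)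
    have "cis t = s * cis u * cis (2 * pi * of_int j)" by (simp only: ju(1) s cis_mult)
    then have ct: "cis t = s * cis u" by (simp only: cis_multiple_2pi Ints_of_int mult_1_right)
    show "t \<in> \<Union>(range Z)"
    proof (cases "u = 0")
      case True then show ?thesis using ju(1) by (auto simp: Z_def)
    next
      case False
      define y where "y = ln \<bar>u\<bar>"
      have ey: "exp y = \<bar>u\<bar>" using False by (simp add: y_def)
      have "y < Y" using u ey by (metis exp_less_cancel_iff)
      show ?thesis
      proof (cases "u > 0")
        case True
        then have "y \<in> N 1" using nP \<open>y < Y\<close> by (simp add: N_def ey ct)
        then have "t \<in> Z j" using True by (auto simp: Z_def ju(1) ey intro!: image_eqI[of _ _ y])
        then show ?thesis by blast
      next
        case neg: False
        then have "y \<in> N (-1)" using nP \<open>y < Y\<close> by (simp add: N_def ey ct)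
        then have "t \<in> Z j" using neg by (auto simp: Z_def ju(1) ey intro!: image_eqI[of _ _ y])
        then show ?thesis by blast
      qed
    qed
  qed
  ultimately have "AE t in lebesgue. dist (cis t) s < \<rho> \<longrightarrow> P (cis t)"
    unfolding AE_lebesgue_iff_negligible by (rule negligible_subset)
  then show ?thesis using \<open>\<rho> > 0\<close> by blast
qed

section \<open>Edge functions of semi-almost periodic functions\<close>

text \<open>
  The property that singles out the value of \<open>E_hom s b\<close>. As a relation it allows existence and uniqueness to be
  treated separately.
\<close>

definition is_edge :: "complex \<Rightarrow> (complex \<Rightarrow> complex) \<Rightarrow> (complex \<Rightarrow> complex) \<Rightarrow> bool" where
  "is_edge s b g \<longleftrightarrow> g \<in> AP_strip \<and> ess_continuous_zero_at s (\<lambda>z. b z - L_map s g z)"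

lemma is_edge_AP: "is_edge s b g \<Longrightarrow> lower_edge g \<in> AP" "is_edge s b g \<Longrightarrow> upper_edge g \<in> AP"
  by (auto simp: is_edge_def AP_strip_def)

lemma is_edge_lines:
  assumes s: "cmod s = 1" and g: "is_edge s b g" and e: "e > 0"
  shows "\<exists>X. AE x in lebesgue. x < X \<longrightarrow>
    cmod (b (strip_to_disk s (of_real x)) - lower_edge g x) < e \<and>
    cmod (b (strip_to_disk s (of_real x + \<i> * of_real pi)) - upper_edge g x) < e"
proof -
  obtain \<rho> where \<rho>: "\<rho> > 0" "AE t in lebesgue. dist (cis t) s < \<rho> \<longrightarrow> cmod (b (cis t) - L_map s g (cis t)) < e"
    using g e unfolding is_edge_def ess_continuous_zero_at_def by blast
  have close: "dist (s * cis u) s \<le> \<bar>u\<bar>" for u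
  proof -
    have "s * cis u - s = s * (cis u - 1)" by (simp add: algebra_simps)
    then show ?thesis using norm_cis_minus_one_le[of u] s by (simp add: dist_norm norm_mult)
  qed
  have small: "\<bar>2 * arctan (exp x / 2)\<bar> < \<rho>" if "x < ln \<rho>" for x
  proof -
    have "2 * arctan (exp x / 2) \<le> exp x" using arctan_le_self[of "exp x / 2"] by simp
    also have "\<dots> < \<rho>" using that \<rho>(1) by (metis exp_less_cancel_iff exp_ln)
    finally show ?thesis using arctan_half_exp[of x] by simp
  qed
  have "AE x in lebesgue. x < ln \<rho> \<longrightarrow>
    cmod (b (strip_to_disk s (of_real x)) - lower_edge g x) < e \<and>
    cmod (b (strip_to_disk s (of_real x + \<i> * of_real pi)) - upper_edge g x) < e"
    using AE_log_coordinate[OF s \<rho>(2)]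
  proof eventually_elim
    case (elim x)
    show ?case
    proof
      assume x: "x < ln \<rho>"
      have "dist (strip_to_disk s (of_real x)) s < \<rho>" "dist (strip_to_disk s (of_real x + \<i> * of_real pi)) s < \<rho>"
        unfolding strip_to_disk_lower strip_to_disk_upper
        using close[of "2 * arctan (exp x / 2)"] close[of "- (2 * arctan (exp x / 2))"] small[OF x] by auto
      then show "cmod (b (strip_to_disk s (of_real x)) - lower_edge g x) < e \<and>
        cmod (b (strip_to_disk s (of_real x + \<i> * of_real pi)) - upper_edge g x) < e"
        using elim L_map_strip_lower[OF s, of g x] L_map_strip_upper[OF s, of g x] by auto
    qed
  qed
  then show ?thesis by blast
qed

lemma open_not_negligible:
  fixes A :: "real set"
  assumes "open A" "y \<in> A" shows "\<not> negligible A"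
proof
  assume neg: "negligible A"
  obtain e where e: "e > 0" "cball y e \<subseteq> A" using assms open_contains_cball by blast
  have "negligible (cbox (y - e) (y + e))"
    by (rule negligible_subset[OF neg]) (use e in \<open>auto simp: cball_eq_atLeastAtMost\<close>)
  then have "box (y - e) (y + e) = {}" by (simp only: negligible_interval)
  then show False using e(1) by simp
qed

lemma AP_bound_from_left_AE:
  assumes f: "f \<in> AP" and ae: "AE x in lebesgue. x < a \<longrightarrow> cmod (f x) \<le> C"
  shows "cmod (f x) \<le> C"
proof (rule AP_bound_from_left[OF f, of a])
  fix y assume "y < a"
  show "cmod (f y) \<le> C"
  proof (rule ccontr)
    assume neg: "\<not> ?thesis"
    define A where "A = {x \<in> {..<a}. C < cmod (f x)}"
    have "open A"
    proof -
      have "continuous_on {..<a} (\<lambda>x. cmod (f x))" by (intro continuous_intros AP_continuous f)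
      then have "open ({..<a} \<inter> (\<lambda>x. cmod (f x)) -` {C<..})" by (rule continuous_open_preimage) auto
      moreover have "A = {..<a} \<inter> (\<lambda>x. cmod (f x)) -` {C<..}" by (auto simp: A_def)
      ultimately show ?thesis by simp
    qed
    moreover have "y \<in> A" using neg \<open>y < a\<close> by (simp add: A_def)
    moreover have "negligible A" using ae unfolding AE_lebesgue_iff_negligible
      by (rule negligible_subset) (auto simp: A_def)
    ultimately show False using open_not_negligible by blast
  qed
qed

lemma edge_functions_eqI:
  assumes "g \<in> AP_strip" "g' \<in> AP_strip" "lower_edge g = lower_edge g'" "upper_edge g = upper_edge g'"
  shows "g = g'"
proof
  fix z
  consider "Im z = 0" | "Im z = pi" | "Im z \<noteq> 0 \<and> Im z \<noteq> pi" by blast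
  then show "g z = g' z"
  proof cases
    case 1
    then have "z = of_real (Re z)" by (simp add: complex_eq_iff)
    then show ?thesis using fun_cong[OF assms(3), of "Re z"] by (simp add: lower_edge_def)
  next
    case 2
    then have "z = of_real (Re z) + \<i> * of_real pi" by (simp add: complex_eq_iff)
    then show ?thesis using fun_cong[OF assms(4), of "Re z"] unfolding upper_edge_def by simp
  next
    case 3 then show ?thesis using assms(1,2) by (simp add: AP_strip_def)
  qed
qed

text \<open>
  The edge functions approximate \<open>b\<close> near minus infinity, and an almost periodic function is bounded by its
  values there. With the bound 0 this gives uniqueness.
\<close>

lemma edge_bound:
  assumes s: "cmod s = 1" and g: "is_edge s b g" and le: "AE t in lebesgue. cmod (b (cis t)) \<le> C"
  shows "cmod (lower_edge g x) \<le> C" "cmod (upper_edge g x) \<le> C"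
proof -
  have "cmod (lower_edge g x) \<le> C + e \<and> cmod (upper_edge g x) \<le> C + e" if e: "e > 0" for e
  proof -
    obtain X where X: "AE x in lebesgue. x < X \<longrightarrow>
      cmod (b (strip_to_disk s (of_real x)) - lower_edge g x) < e \<and>
      cmod (b (strip_to_disk s (of_real x + \<i> * of_real pi)) - upper_edge g x) < e"
      using is_edge_lines[OF s g e] by blast
    have *: "cmod v \<le> C + e" if "cmod u \<le> C" "cmod (u - v) < e" for u v
      using that norm_triangle_ineq2[of v u] by (simp add: norm_minus_commute)
    have "AE x in lebesgue. x < X \<longrightarrow> cmod (lower_edge g x) \<le> C + e"
      using X AE_log_coordinate[OF s le] by eventually_elim (use * in blast)
    moreover have "AE x in lebesgue. x < X \<longrightarrow> cmod (upper_edge g x) \<le> C + e"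
      using X AE_log_coordinate[OF s le] by eventually_elim (use * in blast)
    ultimately show ?thesis using AP_bound_from_left_AE is_edge_AP[OF g] by blast
  qed
  then show "cmod (lower_edge g x) \<le> C" "cmod (upper_edge g x) \<le> C"
    using field_le_epsilon by blast+
qed

lemma is_edge_lincomb:
  assumes "is_edge s b g" "is_edge s b' g'"
  shows "is_edge s (\<lambda>z. b z + c * b' z) (\<lambda>z. g z + c * g' z)"
proof -
  have "lower_edge (\<lambda>z. g z + c * g' z) = (\<lambda>x. lower_edge g x + c * lower_edge g' x)"
    "upper_edge (\<lambda>z. g z + c * g' z) = (\<lambda>x. upper_edge g x + c * upper_edge g' x)"
    by (auto simp: lower_edge_def upper_edge_def)
  then have "(\<lambda>z. g z + c * g' z) \<in> AP_strip"
    using assms by (auto simp: is_edge_def AP_strip_def intro: AP_add AP_cmult)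
  moreover have "ess_continuous_zero_at s (\<lambda>z. b z + c * b' z - L_map s (\<lambda>z. g z + c * g' z) z)"
    unfolding ess_continuous_zero_at_def
  proof (intro allI impI)
    fix e :: real assume "e > 0"
    define d where "d = e / (1 + cmod c)"
    have p: "1 + cmod c > 0" by (simp add: add_pos_nonneg)
    then have "d > 0" using \<open>e > 0\<close> by (simp add: d_def)
    obtain \<rho> where \<rho>: "\<rho> > 0" "AE t in lebesgue. dist (cis t) s < \<rho> \<longrightarrow> cmod (b (cis t) - L_map s g (cis t)) < d"
      using assms(1) \<open>d > 0\<close> unfolding is_edge_def ess_continuous_zero_at_def by blast
    obtain \<rho>' where \<rho>': "\<rho>' > 0" "AE t in lebesgue. dist (cis t) s < \<rho>' \<longrightarrow> cmod (b' (cis t) - L_map s g' (cis t)) < d"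
      using assms(2) \<open>d > 0\<close> unfolding is_edge_def ess_continuous_zero_at_def by blast
    have "AE t in lebesgue. dist (cis t) s < min \<rho> \<rho>' \<longrightarrow>
      cmod (b (cis t) + c * b' (cis t) - L_map s (\<lambda>z. g z + c * g' z) (cis t)) < e"
      using \<rho>(2) \<rho>'(2)
    proof eventually_elim
      case (elim t)
      show ?case
      proof
        assume "dist (cis t) s < min \<rho> \<rho>'"
        then have 1: "cmod (b (cis t) - L_map s g (cis t)) < d" "cmod (b' (cis t) - L_map s g' (cis t)) < d" using elim by auto
        have "b (cis t) + c * b' (cis t) - L_map s (\<lambda>z. g z + c * g' z) (cis t)
          = (b (cis t) - L_map s g (cis t)) + c * (b' (cis t) - L_map s g' (cis t))"
          by (simp add: L_map_def algebra_simps)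
        also have "cmod \<dots> \<le> cmod (b (cis t) - L_map s g (cis t)) + cmod c * cmod (b' (cis t) - L_map s g' (cis t))"
          by (metis norm_mult norm_triangle_ineq)
        also have "\<dots> < d + cmod c * d"
          using 1 by (intro add_less_le_mono mult_left_mono) auto
        also have "\<dots> = (1 + cmod c) * d" by (simp add: algebra_simps)
        also have "\<dots> = e" using p by (simp add: d_def)
        finally show "cmod (b (cis t) + c * b' (cis t) - L_map s (\<lambda>z. g z + c * g' z) (cis t)) < e" .
      qed
    qed
    then show "\<exists>\<rho>>0. AE t in lebesgue. dist (cis t) s < \<rho> \<longrightarrow>
      cmod (b (cis t) + c * b' (cis t) - L_map s (\<lambda>z. g z + c * g' z) (cis t)) < e"
      using \<rho>(1) \<rho>'(1) by (intro exI[of _ "min \<rho> \<rho>'"]) auto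
  qed
  ultimately show ?thesis by (simp add: is_edge_def)
qed

lemma is_edge_cong:
  assumes "is_edge s b g" "AE t in lebesgue. b (cis t) = b' (cis t)"
  shows "is_edge s b' g"
  unfolding is_edge_def ess_continuous_zero_at_def
proof (intro conjI allI impI)
  show "g \<in> AP_strip" using assms by (simp add: is_edge_def)
  fix e :: real assume "e > 0"
  then obtain \<rho> where \<rho>: "\<rho> > 0" "AE t in lebesgue. dist (cis t) s < \<rho> \<longrightarrow> cmod (b (cis t) - L_map s g (cis t)) < e"
    using assms(1) unfolding is_edge_def ess_continuous_zero_at_def by blast
  have "AE t in lebesgue. dist (cis t) s < \<rho> \<longrightarrow> cmod (b' (cis t) - L_map s g (cis t)) < e"
    using \<rho>(2) assms(2) by eventually_elim simp
  then show "\<exists>\<rho>>0. AE t in lebesgue. dist (cis t) s < \<rho> \<longrightarrow> cmod (b' (cis t) - L_map s g (cis t)) < e"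
    using \<rho>(1) by blast
qed

lemma is_edge_unique:
  assumes s: "cmod s = 1" and g: "is_edge s b g" and g': "is_edge s b g'"
  shows "g = g'"
proof -
  have d: "is_edge s (\<lambda>z. b z + (-1) * b z) (\<lambda>z. g z + (-1) * g' z)" by (rule is_edge_lincomb[OF g g'])
  have "cmod (lower_edge (\<lambda>z. g z + (-1) * g' z) x) \<le> 0" "cmod (upper_edge (\<lambda>z. g z + (-1) * g' z) x) \<le> 0" for x
    by (rule edge_bound[OF s d]; simp)+
  then have "lower_edge g = lower_edge g'" "upper_edge g = upper_edge g'"
    by (auto simp: lower_edge_def upper_edge_def)
  then show ?thesis using g g' by (intro edge_functions_eqI) (auto simp: is_edge_def)
qed

lemma E_hom_eq: "cmod s = 1 \<Longrightarrow> is_edge s b g \<Longrightarrow> E_hom s b = g"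
  unfolding E_hom_def by (rule the_equality) (use is_edge_unique[of s b] in \<open>auto simp: is_edge_def\<close>)

lemma AP_cauchy_limit:
  assumes G: "\<And>n. G n \<in> AP" and c: "\<And>n m y. cmod (G n y - G m y) \<le> 1 / real (Suc n) + 1 / real (Suc m)"
  shows "\<exists>g\<in>AP. \<forall>n y. cmod (G n y - g y) \<le> 1 / real (Suc n)"
proof -
  have conv: "convergent (\<lambda>n. G n y)" for y
  proof (rule Cauchy_convergent, rule metric_CauchyI)
    fix e :: real assume "e > 0"
    obtain M :: nat where M: "1 / real (Suc M) < e / 2" using \<open>e > 0\<close> nat_approx_posE[of "e/2"] by auto
    have "dist (G m y) (G n y) < e" if "m \<ge> M" "n \<ge> M" for m n
    proof -
      have "1 / real (Suc m) \<le> 1 / real (Suc M)" "1 / real (Suc n) \<le> 1 / real (Suc M)"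
        using that by (auto intro!: divide_left_mono)
      then show ?thesis using c[of m y n] M by (simp add: dist_norm)
    qed
    then show "\<exists>M. \<forall>m\<ge>M. \<forall>n\<ge>M. dist (G m y) (G n y) < e" by blast
  qed
  define g where "g = (\<lambda>y. lim (\<lambda>n. G n y))"
  have lim: "(\<lambda>n. G n y) \<longlonglongrightarrow> g y" for y using conv[of y] by (simp add: g_def convergent_LIMSEQ_iff)
  have close: "cmod (G n y - g y) \<le> 1 / real (Suc n)" for n y
  proof (rule tendsto_le[OF sequentially_bot])
    show "(\<lambda>m. 1 / real (Suc n) + 1 / real (Suc m)) \<longlonglongrightarrow> 1 / real (Suc n)"
      using tendsto_add[OF tendsto_const LIMSEQ_Suc[OF lim_1_over_n], of "1 / real (Suc n)"] by simp
    show "(\<lambda>m. cmod (G n y - G m y)) \<longlonglongrightarrow> cmod (G n y - g y)"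
      by (intro tendsto_intros lim)
  qed (use c in simp)
  have "g \<in> AP"
  proof (rule AP_uniform_limit)
    fix e :: real assume "e > 0"
    then obtain n where n: "1 / real (Suc n) < e" using nat_approx_posE by blast
    have "cmod (g x - G n x) \<le> e" for x using close[of n x] n by (simp add: norm_minus_commute)
    then show "\<exists>h\<in>AP. \<forall>x. cmod (g x - h x) \<le> e" using G by blast
  qed
  then show ?thesis using close by blast
qed

lemma SAP_circle_local:
  assumes b: "b \<in> SAP_circle" and s: "cmod s = 1" and e: "e > 0"
  shows "\<exists>Y. \<exists>G :: real \<Rightarrow> real \<Rightarrow> complex. \<forall>k\<in>{-1,1}. G k \<in> AP \<and>
    (AE y in lebesgue. y < Y \<longrightarrow> cmod (b (s * cis (k * exp y)) - G k y) < e)"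
proof -
  have "s \<in> sphere 0 1" using s by simp
  then obtain \<delta> and g :: "real \<Rightarrow> real \<Rightarrow> complex" where \<delta>: "\<delta> \<in> {0<..<pi}" and g: "\<And>k. k \<in> {-1,1} \<Longrightarrow> g k \<in> AP"
    "\<And>k. k \<in> {-1,1} \<Longrightarrow> esssup (lebesgue_on {..<0})
         (\<lambda>x. ereal (cmod (b (s * exp (\<i> * of_real (k * \<delta> * exp x))) - g k x))) < ereal e"
    using b e unfolding SAP_circle_def by blast
  have \<delta>0: "\<delta> > 0" using \<delta> by simp
  have "AE y in lebesgue. y < ln \<delta> \<longrightarrow> cmod (b (s * cis (k * exp y)) - g k (y + - ln \<delta>)) < e" if k: "k \<in> {-1,1}" for k
  proof -
    have "AE x in lebesgue_on {..<0}. ereal (cmod (b (s * exp (\<i> * of_real (k * \<delta> * exp x))) - g k x)) < ereal e"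
      using esssup_AE[of "\<lambda>x. ereal (cmod (b (s * exp (\<i> * of_real (k * \<delta> * exp x))) - g k x))" "lebesgue_on {..<0}"]
      by (rule eventually_mono) (rule le_less_trans[OF _ g(2)[OF k]])
    then have "AE x in lebesgue. x < 0 \<longrightarrow> cmod (b (s * cis (k * (\<delta> * exp x))) - g k x) < e"
      by (subst (asm) AE_restrict_space_iff) (simp_all add: cis_conv_exp mult.assoc)
    then have "AE y in lebesgue. y + - ln \<delta> < 0 \<longrightarrow> cmod (b (s * cis (k * (\<delta> * exp (y + - ln \<delta>)))) - g k (y + - ln \<delta>)) < e"
      by (rule AE_translate)
    then show ?thesis
    proof (rule eventually_mono)
      fix y assume a: "y + - ln \<delta> < 0 \<longrightarrow> cmod (b (s * cis (k * (\<delta> * exp (y + - ln \<delta>)))) - g k (y + - ln \<delta>)) < e"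
      have "\<delta> * exp (y + - ln \<delta>) = exp y" using \<delta>0 by (simp add: exp_diff)
      then show "y < ln \<delta> \<longrightarrow> cmod (b (s * cis (k * exp y)) - g k (y + - ln \<delta>)) < e" using a by simp
    qed
  qed
  then show ?thesis using AP_translate[OF g(1), of _ "- ln \<delta>"]
    by (intro exI[of _ "ln \<delta>"] exI[of _ "\<lambda>k y. g k (y + - ln \<delta>)"]) blast
qed

text \<open>
  The coordinate \<open>y\<close> of the point \<open>s * cis (exp y)\<close> and its coordinate \<open>ln (2 * tan (exp y / 2))\<close> under
  \<open>Ln \<circ> phi_map s\<close> agree asymptotically, hence are interchangeable in uniformly continuous functions.
\<close>

lemma log_tan_asymptotic:
  assumes "d > 0"
  shows "\<exists>Y. \<forall>y<Y. exp y < pi \<and> \<bar>ln (2 * tan (exp y / 2)) - y\<bar> \<le> d"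
proof -
  have "((\<lambda>h::real. tan h / h) \<longlongrightarrow> 1) (at 0)" using DERIV_tan[of "0::real"] by (simp add: DERIV_def)
  moreover have "filterlim (\<lambda>y::real. exp y / 2) (at 0) at_bot"
  proof -
    have "((\<lambda>y::real. exp y / 2) \<longlongrightarrow> 0 / 2) at_bot" by (intro tendsto_divide exp_at_bot tendsto_const) simp
    then show ?thesis unfolding filterlim_at by simp
  qed
  ultimately have "((\<lambda>y::real. tan (exp y / 2) / (exp y / 2)) \<longlongrightarrow> 1) at_bot"
    by (rule filterlim_compose)
  then have "((\<lambda>y::real. ln (tan (exp y / 2) / (exp y / 2))) \<longlongrightarrow> ln 1) at_bot" by (rule tendsto_ln) simp
  then have "\<forall>\<^sub>F y::real in at_bot. dist (ln (tan (exp y / 2) / (exp y / 2))) (ln 1) < d"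
    using assms by (rule tendstoD)
  moreover have "\<forall>\<^sub>F y in at_bot. y < ln pi" by (rule eventually_gt_at_bot)
  ultimately have "\<forall>\<^sub>F y in at_bot. exp y < pi \<and> \<bar>ln (2 * tan (exp y / 2)) - y\<bar> \<le> d"
  proof eventually_elim
    case (elim y)
    have y: "exp y < pi" using elim(2) by (metis exp_less_cancel_iff exp_ln pi_gt_zero)
    then have t: "tan (exp y / 2) > 0" by (intro tan_gt_zero) auto
    have "ln (tan (exp y / 2) / (exp y / 2)) = ln (2 * tan (exp y / 2) / exp y)" by (simp add: mult.commute)
    also have "\<dots> = ln (2 * tan (exp y / 2)) - y" using t by (subst ln_div) auto
    finally show ?case using elim(1) y by (simp add: dist_real_def)
  qed
  then show ?thesis unfolding eventually_at_bot_dense by blast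
qed

text \<open>
  The almost periodic functions that approximate \<open>b\<close> near \<open>s\<close> form, after translation to a common coordinate,
  a Cauchy sequence, because an almost periodic function is bounded by its supremum near minus infinity.
\<close>

lemma edge_exists:
  assumes b: "b \<in> SAP_circle" and s: "cmod s = 1"
  shows "\<exists>g. is_edge s b g"
proof -
  define Pr :: "nat \<Rightarrow> real \<times> (real \<Rightarrow> real \<Rightarrow> complex) \<Rightarrow> bool" where
    "Pr = (\<lambda>n p. \<forall>k\<in>{-1,1}. snd p k \<in> AP \<and>
      (AE y in lebesgue. y < fst p \<longrightarrow> cmod (b (s * cis (k * exp y)) - snd p k y) < 1 / real (Suc n)))"
  have "\<forall>n. \<exists>p. Pr n p"
  proof
    fix n
    have "1 / real (Suc n) > 0" by simp
    from SAP_circle_local[OF b s this] show "\<exists>p. Pr n p" unfolding Pr_def by simp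
  qed
  then obtain p where p: "\<And>n. Pr n (p n)" by metis
  define Y where "Y = (\<lambda>n. fst (p n))"
  define G where "G = (\<lambda>n. snd (p n))"
  have G: "\<And>n k. k \<in> {-1,1} \<Longrightarrow> G n k \<in> AP"
    "\<And>n k. k \<in> {-1,1} \<Longrightarrow> AE y in lebesgue. y < Y n \<longrightarrow> cmod (b (s * cis (k * exp y)) - G n k y) < 1 / real (Suc n)"
    using p unfolding Pr_def Y_def G_def by blast+
  have "\<exists>g\<in>AP. \<forall>n y. cmod (G n k y - g y) \<le> 1 / real (Suc n)" if k: "k \<in> {-1,1}" for k
  proof (rule AP_cauchy_limit)
    fix n m y
    have "AE y in lebesgue. y < min (Y n) (Y m) \<longrightarrow> cmod (G n k y - G m k y) \<le> 1 / real (Suc n) + 1 / real (Suc m)"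
      using G(2)[OF k, of n] G(2)[OF k, of m]
    proof eventually_elim
      case (elim y)
      show ?case
      proof
        assume "y < min (Y n) (Y m)"
        then have "cmod (b (s * cis (k * exp y)) - G n k y) < 1 / real (Suc n)" "cmod (b (s * cis (k * exp y)) - G m k y) < 1 / real (Suc m)"
          using elim by auto
        then show "cmod (G n k y - G m k y) \<le> 1 / real (Suc n) + 1 / real (Suc m)"
          by (intro norm_diff_triangle_le[of _ "b (s * cis (k * exp y))"]) (auto simp: norm_minus_commute)
      qed
    qed
    then show "cmod (G n k y - G m k y) \<le> 1 / real (Suc n) + 1 / real (Suc m)"
      by (rule AP_bound_from_left_AE[OF AP_diff[OF G(1)[OF k] G(1)[OF k]]])
  qed (rule G(1)[OF k])
  then obtain h :: "real \<Rightarrow> real \<Rightarrow> complex" where h: "\<And>k. k \<in> {-1,1} \<Longrightarrow> h k \<in> AP" "\<And>k n y. k \<in> {-1,1} \<Longrightarrow> cmod (G n k y - h k y) \<le> 1 / real (Suc n)"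
    by metis
  define g where "g = (\<lambda>z. if Im z = 0 then h 1 (Re z) else if Im z = pi then h (-1) (Re z) else 0)"
  have lg: "lower_edge g = h 1" and ug: "upper_edge g = h (-1)" by (auto simp: lower_edge_def upper_edge_def g_def)
  have "g \<in> AP_strip" unfolding AP_strip_def using h(1) by (simp add: lg ug) (simp add: g_def)
  moreover have "ess_continuous_zero_at s (\<lambda>z. b z - L_map s g z)"
    unfolding ess_continuous_zero_at_def
  proof (intro allI impI)
    fix e :: real assume "e > 0"
    obtain n where n: "1 / real (Suc n) < e / 4" using \<open>e > 0\<close> nat_approx_posE[of "e/4"] by auto
    have "\<exists>d>0. \<forall>t x. \<bar>t\<bar> \<le> d \<longrightarrow> cmod (h k (x + t) - h k x) \<le> e / 4" if "k \<in> {-1,1}" for k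
      using AP_uniformly_continuous[OF h(1)[OF that], of "e/4"] \<open>e > 0\<close> by (metis zero_less_divide_iff zero_less_numeral)
    then obtain d where d: "\<And>k. k \<in> {-1,1} \<Longrightarrow> d k > 0" "\<And>k t x. k \<in> {-1,1} \<Longrightarrow> \<bar>t\<bar> \<le> d k \<Longrightarrow> cmod (h k (x + t) - h k x) \<le> e / 4"
      by metis
    obtain Y' where Y': "\<And>y. y < Y' \<Longrightarrow> exp y < pi \<and> \<bar>ln (2 * tan (exp y / 2)) - y\<bar> \<le> min (d (-1)) (d 1)"
      using log_tan_asymptotic[of "min (d (-1)) (d 1)"] d(1) by auto
    obtain a where a: "s = cis a" using s by (metis cis_Arg norm_zero sgn_eq div_by_1 of_real_1 zero_neq_one)
    show "\<exists>\<rho>>0. AE t in lebesgue. dist (cis t) s < \<rho> \<longrightarrow> cmod (b (cis t) - L_map s g (cis t)) < e"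
    proof (rule AE_circle_near[OF a])
      fix k :: real assume k: "k \<in> {-1,1}"
      show "AE y in lebesgue. y < min (Y n) Y' \<longrightarrow> cmod (b (s * cis (k * exp y)) - L_map s g (s * cis (k * exp y))) < e"
        using G(2)[OF k, of n]
      proof eventually_elim
        case (elim y)
        show ?case
        proof
          assume y: "y < min (Y n) Y'"
          define l where "l = ln (2 * tan (exp y / 2))"
          have y': "exp y < pi" "\<bar>l - y\<bar> \<le> d k" using Y'[of y] y k by (auto simp: l_def)
          have L: "L_map s g (s * cis (k * exp y)) = h k l"
            using k L_map_lower[OF s exp_gt_zero y'(1), of g] L_map_upper[OF s exp_gt_zero y'(1), of g] by (auto simp: lg ug l_def)
          have "cmod (b (s * cis (k * exp y)) - G n k y) \<le> e/4" using elim y n by simp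
          moreover have "cmod (G n k y - h k y) \<le> e/4" using h(2)[OF k, of n y] n by simp
          moreover have "cmod (h k y - h k l) \<le> e/4" using d(2)[OF k y'(2), of y] by (simp add: norm_minus_commute)
          ultimately have "cmod (b (s * cis (k * exp y)) - h k l) \<le> e/4 + e/4 + e/4"
            using norm_diff_triangle_le by blast
          then show "cmod (b (s * cis (k * exp y)) - L_map s g (s * cis (k * exp y))) < e" using \<open>e > 0\<close> by (simp add: L)
        qed
      qed
    qed
  qed
  ultimately show ?thesis by (auto simp: is_edge_def)
qed

section \<open>Boundary values of bounded holomorphic functions\<close>

text \<open>
  Dominated convergence is available for sequences, so that radial limits are taken along this sequence of radii.
\<close>

definition radius_seq :: "nat \<Rightarrow> real" where
  "radius_seq n = 1 - 1 / real (Suc (Suc n))"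

lemma radius_seq: "0 < radius_seq n" "radius_seq n < 1"
  by (auto simp: radius_seq_def field_simps)

lemma radius_seq_limit: "filterlim radius_seq (at_left 1) sequentially"
proof -
  have "(\<lambda>n. 1 / real (Suc (Suc n))) \<longlonglongrightarrow> 0"
    using LIMSEQ_Suc[OF LIMSEQ_Suc[OF lim_1_over_n]] by simp
  then have "radius_seq \<longlonglongrightarrow> 1"
    using tendsto_diff[OF tendsto_const, of "\<lambda>n. 1 / real (Suc (Suc n))" 0 sequentially 1]
    by (simp add: radius_seq_def[abs_def])
  then show ?thesis unfolding filterlim_at using radius_seq(2) by (auto simp: less_imp_neq)
qed

text \<open>
  By dominated convergence the integral of the excess \<open>max 0 (\<phi> n x - M)\<close> tends to 0.
\<close>

lemma integral_limit_of_AE_bound: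
  fixes \<phi> :: "nat \<Rightarrow> real \<Rightarrow> real"
  assumes ab: "a < b" and cont: "\<And>n. continuous_on {a..b} (\<phi> n)"
    and bd: "\<And>n x. x \<in> {a..b} \<Longrightarrow> \<bar>\<phi> n x\<bar> \<le> C"
    and ae: "AE x in lebesgue. x \<in> {a..b} \<longrightarrow> (\<forall>e>0. \<forall>\<^sub>F n in sequentially. \<phi> n x \<le> M + e)"
    and e: "e > 0"
  shows "\<forall>\<^sub>F n in sequentially. integral {a..b} (\<phi> n) \<le> (M + e) * (b - a)"
proof -
  define \<psi> where "\<psi> = (\<lambda>n x. max 0 (\<phi> n x - M))"
  have \<psi>c: "continuous_on {a..b} (\<psi> n)" for n unfolding \<psi>_def by (intro continuous_intros cont)
  have \<psi>i: "integrable (lebesgue_on {a..b}) (\<psi> n)" for n by (rule continuous_imp_integrable_real[OF \<psi>c])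
  have "(\<lambda>n. integral\<^sup>L (lebesgue_on {a..b}) (\<psi> n)) \<longlonglongrightarrow> integral\<^sup>L (lebesgue_on {a..b}) (\<lambda>x. 0)"
  proof (rule integral_dominated_convergence)
    show "integrable (lebesgue_on {a..b}) (\<lambda>x. C + \<bar>M\<bar>)" by (rule continuous_imp_integrable_real) (rule continuous_on_const)
    show "\<And>n. AE x in lebesgue_on {a..b}. norm (\<psi> n x) \<le> C + \<bar>M\<bar>"
    proof (rule AE_I2)
      fix n x assume "x \<in> space (lebesgue_on {a..b})"
      then have "\<bar>\<phi> n x\<bar> \<le> C" using bd by simp
      then show "norm (\<psi> n x) \<le> C + \<bar>M\<bar>" by (auto simp: \<psi>_def)
    qed
    show "AE x in lebesgue_on {a..b}. (\<lambda>n. \<psi> n x) \<longlonglongrightarrow> 0"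
    proof (subst AE_restrict_space_iff)
      show "AE x in lebesgue. x \<in> {a..b} \<longrightarrow> (\<lambda>n. \<psi> n x) \<longlonglongrightarrow> 0"
        using ae
      proof eventually_elim
        case (elim x)
        show ?case
        proof
          assume "x \<in> {a..b}"
          then have x: "\<And>e. e > 0 \<Longrightarrow> \<forall>\<^sub>F n in sequentially. \<phi> n x \<le> M + e" using elim by blast
          show "(\<lambda>n. \<psi> n x) \<longlonglongrightarrow> 0"
            unfolding tendsto_iff
          proof (intro allI impI)
            fix e :: real assume "e > 0"
            have "\<forall>\<^sub>F n in sequentially. \<phi> n x \<le> M + e/2" using x[of "e/2"] \<open>e > 0\<close> by simp
            then show "\<forall>\<^sub>F n in sequentially. dist (\<psi> n x) 0 < e"
              by eventually_elim (use \<open>e > 0\<close> in \<open>auto simp: \<psi>_def\<close>)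
          qed
        qed
      qed
    qed simp
  qed (use \<psi>i in \<open>auto intro: borel_measurable_integrable\<close>)
  then have "(\<lambda>n. integral {a..b} (\<psi> n)) \<longlonglongrightarrow> 0"
    using lebesgue_integral_eq_integral[OF \<psi>i] by simp
  then have "\<forall>\<^sub>F n in sequentially. dist (integral {a..b} (\<psi> n)) 0 < e * (b - a)"
    by (rule tendstoD) (use e ab in simp)
  then show ?thesis
  proof eventually_elim
    case (elim n)
    have "integral {a..b} (\<phi> n) \<le> integral {a..b} (\<lambda>x. M + \<psi> n x)"
      by (rule integral_le) (auto intro!: integrable_continuous_interval continuous_intros cont \<psi>c simp: \<psi>_def)
    also have "\<dots> = M * (b - a) + integral {a..b} (\<psi> n)"
      using ab by (subst Henstock_Kurzweil_Integration.integral_add)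
        (auto intro!: integrable_continuous_interval \<psi>c)
    also have "\<dots> \<le> M * (b - a) + e * (b - a)" using elim by (simp add: abs_if split: if_splits)
    finally show ?case by (simp add: algebra_simps)
  qed
qed

lemma Hinf_bounded:
  assumes "f \<in> Hinf" obtains C where "C > 0" "\<And>z. cmod (f z) \<le> C"
proof -
  obtain C where C: "C > 0" "\<And>z. z \<in> ball 0 1 \<Longrightarrow> cmod (f z) \<le> C"
    using assms unfolding Hinf_def bounded_pos by auto
  have "cmod (f z) \<le> C" for z
    using C assms by (cases "z \<in> ball 0 1") (auto simp: Hinf_def)
  then show ?thesis using that C(1) by blast
qed

lemma boundary_values_seq:
  "((\<lambda>r. f (of_real r * z)) \<longlongrightarrow> l) (at_left 1) \<Longrightarrow> (\<lambda>n. f (of_real (radius_seq n) * z)) \<longlonglongrightarrow> l"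
  by (rule filterlim_compose[OF _ radius_seq_limit])

lemma radius_seq_inside:
  assumes "cmod w \<le> 1" shows "cmod (of_real (radius_seq m) * w) < 1"
proof -
  have "radius_seq m * cmod w \<le> radius_seq m * 1"
    using radius_seq(1)[of m] by (intro mult_left_mono assms) simp
  moreover have "cmod (of_real (radius_seq m) * w) = radius_seq m * cmod w"
    using radius_seq(1)[of m] by (simp add: norm_mult)
  ultimately show ?thesis using radius_seq(2)[of m] by linarith
qed

text \<open>
  The maximum principle for boundary values.  The Cauchy formula, applied to the powers
  of \<open>f\<close>, bounds \<open>|f z|\<close> by the supremum of the boundary values up to a factor depending on \<open>z\<close>; its \<open>n\<close>-th
  root tends to 1.
\<close>

lemma boundary_maximum_principle:
  assumes f: "f \<in> Hinf" and bv: "has_boundary_values f b"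
    and le: "AE t in lebesgue. cmod (b (cis t)) \<le> M" and z: "z \<in> ball 0 1"
  shows "cmod (f z) \<le> M"
proof -
  have hol: "f holomorphic_on ball 0 1" using f by (simp add: Hinf_def)
  obtain C where C: "C > 0" "\<And>z. cmod (f z) \<le> C" using Hinf_bounded[OF f] by blast
  have M0: "M \<ge> 0"
  proof -
    have "\<not> (\<forall>t. \<not> cmod (b (cis t)) \<le> M)"
    proof
      assume "\<forall>t. \<not> cmod (b (cis t)) \<le> M"
      then have "AE t::real in lebesgue. False" using le by simp
      then have "negligible (UNIV :: real set)" unfolding AE_lebesgue_iff_negligible by simp
      then show False using open_not_negligible[OF open_UNIV UNIV_I] by blast
    qed
    then show ?thesis using norm_ge_zero order_trans by blast
  qed
  have z1: "1 - cmod z > 0" using z by simp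
  have key: "cmod (f z) ^ n * (1 - cmod z) \<le> M ^ n" for n
  proof (rule field_le_epsilon)
    fix e :: real assume "e > 0"
    note inb = radius_seq_inside
    define \<phi> where "\<phi> = (\<lambda>m t. cmod (f (of_real (radius_seq m) * cis t)) ^ n)"
    have ev1: "\<forall>\<^sub>F m in sequentially. integral {0..2*pi} (\<phi> m) \<le> (M ^ n + e) * (2*pi - 0)"
    proof (rule integral_limit_of_AE_bound)
      show "continuous_on {0..2*pi} (\<phi> m)" for m
        unfolding \<phi>_def
        by (intro continuous_intros continuous_on_compose2[OF holomorphic_on_imp_continuous_on[OF hol]])
          (use inb in auto)
      show "\<bar>\<phi> m t\<bar> \<le> C ^ n" for m t
        unfolding \<phi>_def using C by (auto intro: power_mono)
      show "AE t in lebesgue. t \<in> {0..2*pi} \<longrightarrow> (\<forall>e>0. \<forall>\<^sub>F m in sequentially. \<phi> m t \<le> M ^ n + e)"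
        using bv[unfolded has_boundary_values_def] le
      proof eventually_elim
        case (elim t)
        have "(\<lambda>m. \<phi> m t) \<longlonglongrightarrow> cmod (b (cis t)) ^ n"
          unfolding \<phi>_def by (intro tendsto_intros boundary_values_seq elim)
        moreover have "cmod (b (cis t)) ^ n \<le> M ^ n" using elim by (intro power_mono) auto
        ultimately have ev: "\<forall>\<^sub>F m in sequentially. \<phi> m t < M ^ n + e'" if "e' > 0" for e'
          using that by (intro order_tendstoD(2)) auto
        show ?case
        proof (intro impI allI)
          fix e' :: real assume "e' > 0"
          show "\<forall>\<^sub>F m in sequentially. \<phi> m t \<le> M ^ n + e'"
            using ev[OF \<open>e' > 0\<close>] by (rule eventually_mono) simp
        qed
      qed
    qed (use \<open>e > 0\<close> in auto)
    have low: "cmod (f (of_real (radius_seq m) * z)) ^ n * (1 - cmod z) * (2 * pi) \<le> integral {0..2*pi} (\<phi> m)" for m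
    proof -
      define g where "g = (\<lambda>w. f (of_real (radius_seq m) * w) ^ n)"
      have gh: "g holomorphic_on cball 0 1"
      proof -
        have "(f \<circ> (\<lambda>w. of_real (radius_seq m) * w)) holomorphic_on cball 0 1"
        proof (rule holomorphic_on_compose_gen[OF _ hol])
          show "(\<lambda>w. complex_of_real (radius_seq m) * w) holomorphic_on cball 0 1" by (intro holomorphic_intros)
          show "(\<lambda>w. complex_of_real (radius_seq m) * w) ` cball 0 1 \<subseteq> ball 0 1" using inb by auto
        qed
        then show ?thesis unfolding g_def o_def by (rule holomorphic_on_power)
      qed
      have "((\<lambda>u. g u / (u - z)) has_contour_integral (2 * of_real pi * \<i> * g z)) (circlepath 0 1)"
      proof (rule Cauchy_integral_circlepath)
        show "continuous_on (cball 0 1) g" by (rule holomorphic_on_imp_continuous_on[OF gh])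
        show "g holomorphic_on ball 0 1" by (rule holomorphic_on_subset[OF gh ball_subset_cball])
      qed (use z in simp)
      then have I: "((\<lambda>t. g (cis t) / (cis t - z) * \<i> * cis t) has_integral (2 * of_real pi * \<i> * g z)) {0..2*pi}"
        unfolding circlepath_def by (subst (asm) has_contour_integral_part_circlepath_iff) (auto simp: mult.assoc)
      have "cmod (2 * of_real pi * \<i> * g z) \<le> integral {0..2*pi} (\<lambda>t. \<phi> m t / (1 - cmod z))"
        unfolding integral_unique[OF I, symmetric]
      proof (rule integral_norm_bound_integral)
        show "(\<lambda>t. g (cis t) / (cis t - z) * \<i> * cis t) integrable_on {0..2*pi}" using I by blast
        show "(\<lambda>t. \<phi> m t / (1 - cmod z)) integrable_on {0..2*pi}"
          unfolding \<phi>_def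
          by (intro integrable_continuous_interval continuous_intros continuous_on_compose2[OF holomorphic_on_imp_continuous_on[OF hol]])
          (use inb z1 in auto)
        fix t
        have "1 - cmod z \<le> cmod (cis t - z)" using norm_triangle_ineq2[of "cis t" z] by simp
        then have "cmod (g (cis t)) / cmod (cis t - z) \<le> cmod (g (cis t)) / (1 - cmod z)"
          using z1 by (intro divide_left_mono mult_pos_pos) auto
        then show "cmod (g (cis t) / (cis t - z) * \<i> * cis t) \<le> \<phi> m t / (1 - cmod z)"
          by (simp add: norm_mult norm_divide g_def \<phi>_def norm_power)
      qed
      then have "2 * pi * cmod (g z) \<le> integral {0..2*pi} (\<phi> m) / (1 - cmod z)"
        by (simp add: norm_mult)
      then show ?thesis using z1 by (simp add: g_def norm_power field_simps)
    qed
    have "\<forall>\<^sub>F m in sequentially. cmod (f (of_real (radius_seq m) * z)) ^ n * (1 - cmod z) \<le> M ^ n + e"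
    proof (rule eventually_mono[OF ev1])
      fix m assume "integral {0..2*pi} (\<phi> m) \<le> (M ^ n + e) * (2*pi - 0)"
      then have "cmod (f (of_real (radius_seq m) * z)) ^ n * (1 - cmod z) * (2 * pi) \<le> (M ^ n + e) * (2 * pi)"
        using order_trans[OF low[of m]] by simp
      then show "cmod (f (of_real (radius_seq m) * z)) ^ n * (1 - cmod z) \<le> M ^ n + e"
        by (metis mult_le_cancel_right_pos pi_gt_zero zero_less_mult_iff zero_less_numeral)
    qed
    moreover have "(\<lambda>m. cmod (f (of_real (radius_seq m) * z)) ^ n * (1 - cmod z)) \<longlonglongrightarrow> cmod (f z) ^ n * (1 - cmod z)"
    proof -
      have "(\<lambda>m. of_real (radius_seq m) * z) \<longlonglongrightarrow> of_real 1 * z"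
        using radius_seq_limit unfolding filterlim_at by (intro tendsto_intros) auto
      moreover have "isCont f z"
        by (rule field_differentiable_imp_continuous_at[OF holomorphic_on_imp_differentiable_at[OF hol open_ball z]])
      ultimately have "(\<lambda>m. f (of_real (radius_seq m) * z)) \<longlonglongrightarrow> f z"
        using isCont_tendsto_compose by fastforce
      then show ?thesis by (intro tendsto_intros)
    qed
    ultimately show "cmod (f z) ^ n * (1 - cmod z) \<le> M ^ n + e"
      using tendsto_upperbound[OF _ _ sequentially_bot] by blast
  qed
  show ?thesis
  proof (rule ccontr)
    assume neg: "\<not> cmod (f z) \<le> M"
    then have "cmod (f z) > 0" using M0 by linarith
    define q where "q = M / cmod (f z)"
    have "0 \<le> q" "q < 1" using neg M0 \<open>cmod (f z) > 0\<close> unfolding q_def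
      by (simp_all add: pos_divide_less_eq del: zero_less_norm_iff)
    then obtain n where n: "q ^ n < 1 - cmod z" using real_arch_pow_inv[OF z1] by blast
    have "1 - cmod z \<le> q ^ n" using key[of n] \<open>cmod (f z) > 0\<close> by (simp add: q_def power_divide field_simps)
    then show False using n by simp
  qed
qed

lemma strip_to_disk_bound:
  assumes s: "cmod s = 1" and w: "0 \<le> Im w" "Im w \<le> pi"
  shows "2 * \<i> + exp w \<noteq> 0" "cmod (strip_to_disk s w) \<le> 1"
proof -
  have v: "0 \<le> Im (exp w)" using w by (simp add: Im_exp sin_ge_zero)
  then show nz: "2 * \<i> + exp w \<noteq> 0" by (auto simp: complex_eq_iff)
  have "(cmod (2 * \<i> - exp w))\<^sup>2 \<le> (cmod (2 * \<i> + exp w))\<^sup>2"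
    using v unfolding cmod_power2 by (simp add: power2_eq_square algebra_simps)
  then have "cmod (2 * \<i> - exp w) \<le> cmod (2 * \<i> + exp w)" by (rule power2_le_imp_le) simp
  then show "cmod (strip_to_disk s w) \<le> 1"
    using s nz by (simp add: strip_to_disk_def norm_mult norm_divide)
qed

text \<open>
  Shifting the contour from one edge of the strip to the other multiplies the coefficient of
  frequency \<open>\<mu>\<close> by \<open>exp (\<mu> pi)\<close>.  A primitive of the function on the closed strip makes this precise for
  \<open>f (r z)\<close> with \<open>r < 1\<close>: the difference of the integrals over the two edges is bounded uniformly in
  the length of the window and in \<open>r\<close>, so that it disappears in the mean.
\<close>

lemma edge_coefficient_relation:
  assumes f: "f \<in> Hinf" and bv: "has_boundary_values f b" and s: "cmod s = 1" and g: "is_edge s b g"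
  shows "ap_coeff \<mu> (lower_edge g) = of_real (exp (\<mu> * pi)) * ap_coeff \<mu> (upper_edge g)"
proof -
  have hol: "f holomorphic_on ball 0 1" using f by (simp add: Hinf_def)
  obtain C where C: "C > 0" "\<And>z. cmod (f z) \<le> C" using Hinf_bounded[OF f] by blast
  define S where "S = {w. 0 \<le> Im w} \<inter> {w. Im w \<le> pi}"
  have convS: "convex S" unfolding S_def by (intro convex_Int convex_halfspace_Im_ge convex_halfspace_Im_le)
  define z where "z = strip_to_disk s"
  define F where "F = (\<lambda>m w. f (of_real (radius_seq m) * z w) * exp (- \<i> * of_real \<mu> * w))"
  define B where "B = C * exp (\<bar>\<mu>\<bar> * pi)"
  have fd: "F m field_differentiable at w" if w: "w \<in> S" for m w
  proof -
    have nz: "2 * \<i> + exp w \<noteq> 0" and z1: "cmod (z w) \<le> 1"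
      using strip_to_disk_bound[OF s, of w] w by (auto simp: S_def z_def)
    have "open {w::complex. 2 * \<i> + exp w \<noteq> 0}" by (intro open_Collect_neq continuous_intros)
    moreover have "z holomorphic_on {w. 2 * \<i> + exp w \<noteq> 0}"
      unfolding z_def strip_to_disk_def[abs_def] by (intro holomorphic_intros) auto
    ultimately have "z field_differentiable at w"
      using nz holomorphic_on_imp_differentiable_at by blast
    then have 1: "(\<lambda>w. of_real (radius_seq m) * z w) field_differentiable at w"
      by (intro derivative_intros)
    have "of_real (radius_seq m) * z w \<in> ball 0 1" using radius_seq_inside[OF z1] by simp
    then have 2: "f field_differentiable at (of_real (radius_seq m) * z w)"
      by (rule holomorphic_on_imp_differentiable_at[OF hol open_ball])
    have "(\<lambda>w. f (of_real (radius_seq m) * z w)) field_differentiable at w"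
      using field_differentiable_compose[OF 1 2] by (simp add: o_def)
    moreover have "(\<lambda>w. exp (- \<i> * of_real \<mu> * w)) field_differentiable at w"
      by (rule holomorphic_on_imp_differentiable_at[of _ UNIV]) (auto intro!: holomorphic_intros)
    ultimately show ?thesis unfolding F_def by (rule field_differentiable_mult)
  qed
  have cont: "continuous_on S (F m)" for m
    using fd by (intro continuous_at_imp_continuous_on) (auto intro: field_differentiable_imp_continuous_at)
  have bdF: "cmod (F m w) \<le> B" if "w \<in> S" for m w
  proof -
    have "cmod (exp (- \<i> * of_real \<mu> * w)) = exp (\<mu> * Im w)" by simp
    also have "\<dots> \<le> exp (\<bar>\<mu>\<bar> * pi)"
    proof -
      have "\<mu> * Im w \<le> \<bar>\<mu>\<bar> * Im w" using that by (intro mult_right_mono) (auto simp: S_def)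
      also have "\<dots> \<le> \<bar>\<mu>\<bar> * pi" using that by (intro mult_left_mono) (auto simp: S_def)
      finally show ?thesis by simp
    qed
    finally show ?thesis unfolding F_def B_def norm_mult using C by (intro mult_mono) auto
  qed
  have strip: "of_real x \<in> S" "of_real x + \<i> * of_real pi \<in> S" for x by (auto simp: S_def)
  have diffF: "cmod (integral {x1..x2} (\<lambda>x. F m (of_real x)) - integral {x1..x2} (\<lambda>x. F m (of_real x + \<i> * of_real pi))) \<le> 2 * pi * B"
    if "x1 \<le> x2" for m x1 x2
  proof -
    obtain \<Phi> where \<Phi>: "\<And>w. w \<in> S \<Longrightarrow> (\<Phi> has_field_derivative F m w) (at w within S)"
      by (rule holomorphic_convex_primitive[OF convS finite.emptyI cont[of m]]) (use fd interior_subset in blast)+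
    have hor: "integral {x1..x2} (\<lambda>x. F m (of_real x + c)) = \<Phi> (of_real x2 + c) - \<Phi> (of_real x1 + c)"
      if c: "\<And>x. of_real x + c \<in> S" for c
    proof (rule integral_unique, rule fundamental_theorem_of_calculus[OF \<open>x1 \<le> x2\<close>])
      fix x assume "x \<in> {x1..x2}"
      have "((\<lambda>x. of_real x + c) has_vector_derivative 1) (at x within {x1..x2})"
        by (auto intro!: derivative_eq_intros)
      moreover have "(\<Phi> has_field_derivative F m (of_real x + c)) (at (of_real x + c) within (\<lambda>x. of_real x + c) ` {x1..x2})"
        by (rule DERIV_subset[OF \<Phi>[OF c]]) (use c in auto)
      ultimately have "((\<Phi> \<circ> (\<lambda>x. of_real x + c)) has_vector_derivative 1 * F m (of_real x + c)) (at x within {x1..x2})"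
        by (rule field_vector_diff_chain_within)
      then show "((\<lambda>x. \<Phi> (of_real x + c)) has_vector_derivative F m (of_real x + c)) (at x within {x1..x2})"
        by (simp add: o_def)
    qed
    have ver: "cmod (\<Phi> (of_real x + \<i> * of_real pi) - \<Phi> (of_real x)) \<le> B * pi" for x
    proof -
      have "cmod (\<Phi> (of_real x + \<i> * of_real pi) - \<Phi> (of_real x)) \<le> B * cmod (of_real x + \<i> * of_real pi - of_real x)"
        by (rule field_differentiable_bound[OF convS \<Phi> bdF]) (use strip in auto)
      then show ?thesis by (simp add: norm_mult)
    qed
    have "integral {x1..x2} (\<lambda>x. F m (of_real x)) - integral {x1..x2} (\<lambda>x. F m (of_real x + \<i> * of_real pi))
       = (\<Phi> (of_real x1 + \<i> * of_real pi) - \<Phi> (of_real x1)) - (\<Phi> (of_real x2 + \<i> * of_real pi) - \<Phi> (of_real x2))"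
      using hor[of 0] hor[of "\<i> * of_real pi"] strip by simp
    also have "cmod \<dots> \<le> B * pi + B * pi"
      by (rule order_trans[OF norm_triangle_ineq4]) (intro add_mono ver)
    finally show ?thesis by (simp add: mult_ac)
  qed
  define E where "E = exp (\<mu> * pi)"
  have E0: "E > 0" by (simp add: E_def)
  define h where "h = (\<lambda>x. lower_edge g x * cis (- \<mu> * x) - of_real E * (upper_edge g x * cis (- \<mu> * x)))"
  have hAP: "h \<in> AP" unfolding h_def by (intro AP_diff AP_cmult AP_mult_cis is_edge_AP[OF g])
  have Flow: "F m (of_real x) = f (of_real (radius_seq m) * z (of_real x)) * cis (- \<mu> * x)" for m x
    by (simp add: F_def cis_conv_exp mult.assoc)
  have Fup: "F m (of_real x + \<i> * of_real pi) = of_real E * (f (of_real (radius_seq m) * z (of_real x + \<i> * of_real pi)) * cis (- \<mu> * x))" for m x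
  proof -
    have "- \<i> * of_real \<mu> * (of_real x + \<i> * of_real pi) = of_real (\<mu> * pi) + \<i> * of_real (- \<mu> * x)"
      by (simp add: algebra_simps)
    then have "exp (- \<i> * of_real \<mu> * (of_real x + \<i> * of_real pi)) = of_real E * cis (- \<mu> * x)"
      by (simp only: exp_add cis_conv_exp E_def exp_of_real)
    then show ?thesis by (simp add: F_def)
  qed
  have zc: "continuous_on A (\<lambda>x. f (of_real (radius_seq m) * z (of_real x)))" "continuous_on A (\<lambda>x. f (of_real (radius_seq m) * z (of_real x + \<i> * of_real pi)))" for A :: "real set" and m
  proof -
    have c1: "continuous_on A (\<lambda>x. of_real (radius_seq m) * z (of_real x))"
      unfolding z_def strip_to_disk_lower by (intro continuous_intros) simp
    show "continuous_on A (\<lambda>x. f (of_real (radius_seq m) * z (of_real x)))"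
      by (rule continuous_on_compose2[OF holomorphic_on_imp_continuous_on[OF hol] c1])
        (use radius_seq_inside strip_to_disk_bound(2)[OF s] in \<open>auto simp: z_def\<close>)
    have c2: "continuous_on A (\<lambda>x. of_real (radius_seq m) * z (of_real x + \<i> * of_real pi))"
      unfolding z_def strip_to_disk_upper by (intro continuous_intros) simp
    show "continuous_on A (\<lambda>x. f (of_real (radius_seq m) * z (of_real x + \<i> * of_real pi)))"
      by (rule continuous_on_compose2[OF holomorphic_on_imp_continuous_on[OF hol] c2])
        (use radius_seq_inside strip_to_disk_bound(2)[OF s] in \<open>auto simp: z_def\<close>)
  qed
  have "AE t in lebesgue. ((\<lambda>r. f (of_real r * cis t)) \<longlongrightarrow> b (cis t)) (at_left 1)"
    using bv by (simp add: has_boundary_values_def)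
  note rad = AE_log_coordinate[OF s this]
  obtain Dl where Dl: "\<And>x. cmod (lower_edge g x) \<le> Dl" using AP_bounded[OF is_edge_AP(1)[OF g]] by blast
  obtain Du where Du: "\<And>x. cmod (upper_edge g x) \<le> Du" using AP_bounded[OF is_edge_AP(2)[OF g]] by blast
  have est: "cmod (ap_mean h) \<le> 3 * (1 + E) * e" if e: "e > 0" for e
  proof -
    obtain X where X: "AE x in lebesgue. x < X \<longrightarrow>
      cmod (b (strip_to_disk s (of_real x)) - lower_edge g x) < e \<and>
      cmod (b (strip_to_disk s (of_real x + \<i> * of_real pi)) - upper_edge g x) < e"
      using is_edge_lines[OF s g e] by blast
    have win: "cmod (integral {x1..x2} h) \<le> 2 * pi * B + (2 * e) * (1 + E) * (x2 - x1)" if x: "x1 < x2" "x2 < X" for x1 x2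
    proof -
      define \<phi>1 where "\<phi>1 = (\<lambda>m x. cmod (f (of_real (radius_seq m) * z (of_real x)) - lower_edge g x))"
      define \<phi>2 where "\<phi>2 = (\<lambda>m x. cmod (f (of_real (radius_seq m) * z (of_real x + \<i> * of_real pi)) - upper_edge g x))"
      have c\<phi>: "continuous_on {x1..x2} (\<phi>1 m)" "continuous_on {x1..x2} (\<phi>2 m)" for m
        unfolding \<phi>1_def \<phi>2_def by (intro continuous_intros zc AP_continuous is_edge_AP[OF g])+
      have lim: "\<forall>\<^sub>F m in sequentially. cmod (u m - c) \<le> e + e'" if "u \<longlonglongrightarrow> l" "cmod (l - c) < e" "e' > 0" for u l c e'
      proof -
        have "(\<lambda>m. cmod (u m - c)) \<longlonglongrightarrow> cmod (l - c)" by (intro tendsto_intros that)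
        then have "\<forall>\<^sub>F m in sequentially. cmod (u m - c) < e + e'" by (rule order_tendstoD(2)) (use that in simp)
        then show ?thesis by (rule eventually_mono) simp
      qed
      have "\<forall>\<^sub>F m in sequentially. integral {x1..x2} (\<phi>1 m) \<le> (e + e) * (x2 - x1)"
      proof (rule integral_limit_of_AE_bound[OF x(1) c\<phi>(1) _ _ e])
        show "\<bar>\<phi>1 m x\<bar> \<le> C + Dl" for m x
          unfolding \<phi>1_def abs_norm_cancel by (rule order_trans[OF norm_triangle_ineq4]) (intro add_mono C Dl)
        show "AE x in lebesgue. x \<in> {x1..x2} \<longrightarrow> (\<forall>e'>0. \<forall>\<^sub>F m in sequentially. \<phi>1 m x \<le> e + e')"
          using X rad
        proof eventually_elim
          case (elim y)
          show ?case unfolding \<phi>1_def z_def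
          proof (intro impI allI)
            fix e' :: real assume "y \<in> {x1..x2}" "e' > 0"
            then show "\<forall>\<^sub>F m in sequentially. cmod (f (of_real (radius_seq m) * strip_to_disk s (of_real y)) - lower_edge g y) \<le> e + e'"
              using elim x(2) by (intro lim boundary_values_seq) auto
          qed
        qed
      qed
      moreover have "\<forall>\<^sub>F m in sequentially. integral {x1..x2} (\<phi>2 m) \<le> (e + e) * (x2 - x1)"
      proof (rule integral_limit_of_AE_bound[OF x(1) c\<phi>(2) _ _ e])
        show "\<bar>\<phi>2 m x\<bar> \<le> C + Du" for m x
          unfolding \<phi>2_def abs_norm_cancel by (rule order_trans[OF norm_triangle_ineq4]) (intro add_mono C Du)
        show "AE x in lebesgue. x \<in> {x1..x2} \<longrightarrow> (\<forall>e'>0. \<forall>\<^sub>F m in sequentially. \<phi>2 m x \<le> e + e')"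
          using X rad
        proof eventually_elim
          case (elim y)
          show ?case unfolding \<phi>2_def z_def
          proof (intro impI allI)
            fix e' :: real assume "y \<in> {x1..x2}" "e' > 0"
            then show "\<forall>\<^sub>F m in sequentially. cmod (f (of_real (radius_seq m) * strip_to_disk s (of_real y + \<i> * of_real pi)) - upper_edge g y) \<le> e + e'"
              using elim x(2) by (intro lim boundary_values_seq) auto
          qed
        qed
      qed
      ultimately obtain m where m: "integral {x1..x2} (\<phi>1 m) \<le> (e + e) * (x2 - x1)" "integral {x1..x2} (\<phi>2 m) \<le> (e + e) * (x2 - x1)"
        using eventually_happens'[OF sequentially_bot eventually_conj] by blast
      define k where "k = (\<lambda>x. (F m (of_real x) - F m (of_real x + \<i> * of_real pi)))"
      have cF: "continuous_on {x1..x2} (\<lambda>x. F m (of_real x))" "continuous_on {x1..x2} (\<lambda>x. F m (of_real x + \<i> * of_real pi))"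
        unfolding Flow Fup by (intro continuous_intros zc)+
      have ki: "k integrable_on {x1..x2}" unfolding k_def
        by (intro integrable_continuous_interval continuous_intros cF)
      have k: "cmod (integral {x1..x2} k) \<le> 2 * pi * B"
        using diffF[of x1 x2 m] x(1) cF unfolding k_def
        by (subst Henstock_Kurzweil_Integration.integral_diff) (auto intro: integrable_continuous_interval)
      have "cmod (integral {x1..x2} (\<lambda>x. h x - k x)) \<le> integral {x1..x2} (\<lambda>x. \<phi>1 m x + E * \<phi>2 m x)"
      proof (rule integral_norm_bound_integral)
        show "(\<lambda>x. h x - k x) integrable_on {x1..x2}" by (intro integrable_diff AP_integrable[OF hAP] ki)
        show "(\<lambda>x. \<phi>1 m x + E * \<phi>2 m x) integrable_on {x1..x2}"
          by (intro integrable_continuous_interval continuous_intros c\<phi>)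
        fix x
        have "h x - k x = - (f (of_real (radius_seq m) * z (of_real x)) - lower_edge g x) * cis (- \<mu> * x)
          + of_real E * ((f (of_real (radius_seq m) * z (of_real x + \<i> * of_real pi)) - upper_edge g x) * cis (- \<mu> * x))"
          unfolding h_def k_def Flow Fup by (simp add: algebra_simps)
        also have "cmod \<dots> \<le> \<phi>1 m x + E * \<phi>2 m x"
          by (rule order_trans[OF norm_triangle_ineq]) (use E0 in \<open>simp add: norm_mult \<phi>1_def \<phi>2_def norm_minus_commute\<close>)
        finally show "cmod (h x - k x) \<le> \<phi>1 m x + E * \<phi>2 m x" .
      qed
      also have "\<dots> = integral {x1..x2} (\<phi>1 m) + E * integral {x1..x2} (\<phi>2 m)"
        by (subst Henstock_Kurzweil_Integration.integral_add) (auto intro!: integrable_continuous_interval continuous_intros c\<phi>)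
      also have "\<dots> \<le> (e + e) * (x2 - x1) + E * ((e + e) * (x2 - x1))"
        using m E0 by (intro add_mono mult_left_mono) auto
      finally have hk: "cmod (integral {x1..x2} h - integral {x1..x2} k) \<le> (2 * e) * (1 + E) * (x2 - x1)"
        by (subst Henstock_Kurzweil_Integration.integral_diff[symmetric, OF AP_integrable[OF hAP] ki]) (simp add: algebra_simps)
      then show ?thesis
        using k norm_triangle_ineq2[of "integral {x1..x2} h" "integral {x1..x2} k"] by linarith
    qed
    obtain T0 where T0: "T0 > 0" "\<forall>T\<ge>T0. \<forall>c. cmod (integral {c..c+T} h - T *\<^sub>R ap_mean h) \<le> (e * (1 + E) / 2) * T"
      using AP_mean_window[OF hAP, of "e * (1 + E) / 2"] e E0 by auto
    define T where "T = max T0 (4 * pi * B / (e * (1 + E)))"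
    have eE: "e * (1 + E) > 0" using e E0 by simp
    have T: "T > 0" "T \<ge> T0" using T0 by (auto simp: T_def)
    have "4 * pi * B / (e * (1 + E)) \<le> T" by (simp add: T_def)
    then have "4 * pi * B \<le> T * (e * (1 + E))" using eE by (simp only: pos_divide_le_eq)
    define q where "q = T * (e * (1 + E))"
    have TB: "4 * pi * B \<le> q" unfolding q_def by fact
    have "cmod (integral {X-1-T..X-1-T+T} h) \<le> 2 * pi * B + (2 * e) * (1 + E) * (X-1-T+T - (X-1-T))"
      by (rule win) (use T in auto)
    moreover have "(2 * e) * (1 + E) * (X-1-T+T - (X-1-T)) = 2 * q" by (simp add: q_def)
    ultimately have a: "cmod (integral {X-1-T..X-1-T+T} h) \<le> q / 2 + 2 * q" using TB by linarith
    have b: "cmod (T *\<^sub>R ap_mean h - integral {X-1-T..X-1-T+T} h) \<le> q / 2"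
    proof -
      have "(e * (1 + E) / 2) * T = q / 2" by (simp add: q_def)
      then show ?thesis using T0(2)[rule_format, OF T(2), of "X-1-T"] by (simp only: norm_minus_commute)
    qed
    have "cmod (T *\<^sub>R ap_mean h) \<le> 3 * q"
      using a b norm_triangle_sub[of "T *\<^sub>R ap_mean h" "integral {X-1-T..X-1-T+T} h"] by linarith
    also have "\<dots> = T * (3 * (1 + E) * e)" by (simp add: q_def)
    finally show ?thesis using T by simp
  qed
  have "cmod (ap_mean h) \<le> 0"
  proof (rule field_le_epsilon)
    fix d :: real assume "d > 0"
    then show "cmod (ap_mean h) \<le> 0 + d" using est[of "d / (3 * (1 + E))"] E0 by simp
  qed
  moreover have "ap_mean h = ap_coeff \<mu> (lower_edge g) - of_real E * ap_coeff \<mu> (upper_edge g)"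
    unfolding h_def ap_coeff_eq
    by (simp only: ap_mean_diff[OF AP_mult_cis AP_cmult[OF AP_mult_cis]] ap_mean_cmult[OF AP_mult_cis] is_edge_AP[OF g])
  ultimately show ?thesis by (simp add: E_def)
qed

section \<open>Elementary functions with prescribed edge functions\<close>

text \<open>
  Under \<open>Ln \<circ> phi_map s\<close> the function \<open>strip_exp s \<mu>\<close> becomes \<open>exp (\<i> \<mu> w)\<close>.  It is discontinuous at \<open>s\<close> and
  at \<open>- s\<close>, where its value is set to 0.  The factor \<open>peak s p\<close> is 1 at \<open>s\<close>, removes the discontinuity at \<open>- s\<close>, and is small away
  from \<open>s\<close> if \<open>p\<close> is large.
\<close>

definition strip_exp :: "complex \<Rightarrow> real \<Rightarrow> complex \<Rightarrow> complex" where
  "strip_exp s \<mu> z = (if phi_map s z = 0 then 0 else exp (\<i> * of_real \<mu> * Ln (phi_map s z)))"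

definition peak :: "complex \<Rightarrow> nat \<Rightarrow> complex \<Rightarrow> complex" where
  "peak s p z = ((s + z) / (2 * s)) ^ p"

lemma phi_map_Im:
  assumes s: "cmod s = 1" and z: "z \<noteq> - s"
  shows "Im (phi_map s z) = 2 * (1 - (cmod z)\<^sup>2) / (cmod (s + z))\<^sup>2"
proof -
  have "phi_map s z = 2 * \<i> * (s - z) * cnj (s + z) / of_real ((cmod (s + z))\<^sup>2)"
    unfolding phi_map_def complex_div_cnj[of _ "s + z"] by simp
  then have "Im (phi_map s z) = Im (2 * \<i> * (s - z) * cnj (s + z)) / (cmod (s + z))\<^sup>2"
    by (simp only: Im_divide_of_real)
  moreover have "Im (2 * \<i> * (s - z) * cnj (s + z)) = 2 * ((cmod s)\<^sup>2 - (cmod z)\<^sup>2)"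
    unfolding cmod_power2 by (simp add: power2_eq_square algebra_simps)
  ultimately show ?thesis using s by simp
qed

lemma phi_map_nonzero: "z \<noteq> s \<Longrightarrow> z \<noteq> - s \<Longrightarrow> phi_map s z \<noteq> 0"
  unfolding phi_map_def by (auto simp: add_eq_0_iff)

lemma norm_strip_exp_le: "cmod (strip_exp s \<mu> z) \<le> exp (\<bar>\<mu>\<bar> * pi)"
proof (cases "phi_map s z = 0")
  case False
  then have "\<bar>Im (Ln (phi_map s z))\<bar> \<le> pi"
    using Im_Ln_le_pi[of "phi_map s z"] mpi_less_Im_Ln[of "phi_map s z"] by linarith
  then have "\<bar>\<mu>\<bar> * \<bar>Im (Ln (phi_map s z))\<bar> \<le> \<bar>\<mu>\<bar> * pi" by (intro mult_left_mono) auto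
  then have "- (\<mu> * Im (Ln (phi_map s z))) \<le> \<bar>\<mu>\<bar> * pi" by (metis abs_le_D2 abs_mult)
  then show ?thesis by (simp add: strip_exp_def)
qed (simp add: strip_exp_def)

lemma strip_exp_holomorphic:
  assumes s: "cmod s = 1" shows "strip_exp s \<mu> holomorphic_on ball 0 1"
proof -
  have ne: "s + z \<noteq> 0" "z \<noteq> - s" "0 < Im (phi_map s z)" if z: "z \<in> ball 0 1" for z
  proof -
    show ne: "z \<noteq> - s" using z s by auto
    then show nz: "s + z \<noteq> 0" by (metis add.commute add_eq_0_iff2)
    have "(cmod z)\<^sup>2 < 1" using z by (simp add: abs_square_less_1)
    then show "0 < Im (phi_map s z)" using phi_map_Im[OF s ne] nz by simp
  qed
  have "(\<lambda>z. exp (\<i> * of_real \<mu> * Ln (phi_map s z))) holomorphic_on ball 0 1"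
  proof (intro holomorphic_intros)
    show "phi_map s holomorphic_on ball 0 1"
      unfolding phi_map_def[abs_def] by (intro holomorphic_intros) (use ne(1) in blast)
    show "phi_map s z \<notin> \<real>\<^sub>\<le>\<^sub>0" if "z \<in> ball 0 1" for z
      using ne(3)[OF that] by (auto simp: complex_nonpos_Reals_iff)
  qed
  moreover have "exp (\<i> * of_real \<mu> * Ln (phi_map s z)) = strip_exp s \<mu> z" if "z \<in> ball 0 1" for z
    using ne(3)[OF that] by (auto simp: strip_exp_def)
  ultimately show ?thesis by (rule holomorphic_transform)
qed

lemma strip_exp_continuous:
  assumes s: "cmod s = 1" shows "continuous_on (cball 0 1 - {s, - s}) (strip_exp s \<mu>)"
proof -
  define y where "y = (\<lambda>z. 2 * (s - z) / (s + z))"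
  have phi: "phi_map s z = \<i> * y z" for z by (simp add: phi_map_def y_def)
  have y: "y z \<noteq> 0" "0 \<le> Re (y z)" "s + z \<noteq> 0" if z: "z \<in> cball 0 1 - {s, - s}" for z
  proof -
    show "y z \<noteq> 0" using phi_map_nonzero[of z s] z by (auto simp: phi)
    have "(cmod z)\<^sup>2 \<le> 1" using z by (simp add: power_le_one)
    then have "Im (phi_map s z) \<ge> 0" using phi_map_Im[OF s, of z] z by simp
    then show "0 \<le> Re (y z)" by (simp add: phi)
    show "s + z \<noteq> 0" using z by (auto simp: add_eq_0_iff2)
  qed
  have "continuous_on (cball 0 1 - {s, - s}) (\<lambda>z. exp (\<i> * of_real \<mu> * (Ln (y z) + \<i> * of_real pi / 2)))"
  proof (intro continuous_intros)
    show "continuous_on (cball 0 1 - {s, - s}) y" unfolding y_def by (intro continuous_intros) (use y in auto)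
    show "y z \<notin> \<real>\<^sub>\<le>\<^sub>0" if "z \<in> cball 0 1 - {s, - s}" for z
      using y[OF that] by (auto simp: complex_nonpos_Reals_iff complex_eq_iff)
  qed
  moreover have "exp (\<i> * of_real \<mu> * (Ln (y z) + \<i> * of_real pi / 2)) = strip_exp s \<mu> z" if "z \<in> cball 0 1 - {s, - s}" for z
    using y[OF that] by (simp add: strip_exp_def phi Ln_times_ii)
  ultimately show ?thesis by (rule continuous_on_eq)
qed

lemma norm_peak_le:
  assumes s: "cmod s = 1" and z: "cmod z \<le> 1"
  shows "cmod (peak s p z) \<le> 1"
proof -
  have "cmod ((s + z) / (2 * s)) \<le> 1" using norm_triangle_ineq[of s z] s z by (simp add: norm_divide norm_mult)
  then show ?thesis unfolding peak_def norm_power by (intro power_le_one) auto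
qed

text \<open>The parallelogram law makes the peak factor small away from its centre.\<close>

lemma norm_peak_far:
  assumes s: "cmod s = 1" and z: "cmod z \<le> 1" and d: "d \<le> dist z s" "0 \<le> d"
  shows "cmod (peak s (2 * p) z) \<le> (1 - d\<^sup>2 / 4) ^ p"
proof -
  have "(cmod (s + z))\<^sup>2 + (cmod (s - z))\<^sup>2 = 2 * (cmod s)\<^sup>2 + 2 * (cmod z)\<^sup>2"
    unfolding cmod_power2 by (simp add: power2_eq_square algebra_simps)
  moreover have "d\<^sup>2 \<le> (cmod (s - z))\<^sup>2" using d by (intro power_mono) (auto simp: dist_norm norm_minus_commute)
  moreover have "(cmod z)\<^sup>2 \<le> 1" using z by (simp add: power_le_one)
  ultimately have "(cmod (s + z))\<^sup>2 / 4 \<le> 1 - d\<^sup>2 / 4" using s by simp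
  then have "((cmod (s + z))\<^sup>2 / 4) ^ p \<le> (1 - d\<^sup>2 / 4) ^ p" by (intro power_mono) auto
  moreover have "cmod (peak s (2 * p) z) = ((cmod (s + z))\<^sup>2 / 4) ^ p"
    using s by (simp add: peak_def norm_power norm_divide norm_mult power_mult power_divide)
  ultimately show ?thesis by simp
qed

lemma peak_continuous: "cmod s = 1 \<Longrightarrow> continuous_on A (peak s p)"
  unfolding peak_def[abs_def] by (intro continuous_intros) auto

lemma peak_holomorphic: "cmod s = 1 \<Longrightarrow> peak s p holomorphic_on A"
  unfolding peak_def[abs_def] by (intro holomorphic_intros) auto

lemma peak_strip_exp_continuous:
  assumes s: "cmod s = 1" and p: "p > 0"
  shows "continuous_on (cball 0 1 - {s}) (\<lambda>z. peak s p z * strip_exp s \<mu> z)"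
  unfolding continuous_on_def
proof
  fix z assume z: "z \<in> cball 0 1 - {s}"
  show "((\<lambda>z. peak s p z * strip_exp s \<mu> z) \<longlongrightarrow> peak s p z * strip_exp s \<mu> z) (at z within cball 0 1 - {s})"
  proof (cases "z = - s")
    case True
    have "peak s p (- s) = 0" using p by (simp add: peak_def)
    moreover have "((\<lambda>z. peak s p z * strip_exp s \<mu> z) \<longlongrightarrow> 0) (at z within cball 0 1 - {s})"
    proof (rule Lim_null_comparison)
      show "\<forall>\<^sub>F w in at z within cball 0 1 - {s}. norm (peak s p w * strip_exp s \<mu> w) \<le> cmod (peak s p w) * exp (\<bar>\<mu>\<bar> * pi)"
        by (intro always_eventually allI) (simp add: norm_mult mult_left_mono norm_strip_exp_le)
      have "((\<lambda>w. peak s p w) \<longlongrightarrow> peak s p z) (at z within cball 0 1 - {s})"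
        using peak_continuous[OF s, of "insert z (cball 0 1 - {s})" p] unfolding continuous_on_def
        by (meson insertI1 subset_insertI tendsto_within_subset)
      then have "((\<lambda>w. cmod (peak s p w) * exp (\<bar>\<mu>\<bar> * pi)) \<longlongrightarrow> cmod (peak s p z) * exp (\<bar>\<mu>\<bar> * pi)) (at z within cball 0 1 - {s})"
        by (intro tendsto_intros)
      then show "((\<lambda>w. cmod (peak s p w) * exp (\<bar>\<mu>\<bar> * pi)) \<longlongrightarrow> 0) (at z within cball 0 1 - {s})"
        using \<open>peak s p (- s) = 0\<close> True by simp
    qed
    ultimately show ?thesis using True by simp
  next
    case False
    have "continuous_on (cball 0 1 - {s, -s}) (\<lambda>z. peak s p z * strip_exp s \<mu> z)"
      by (intro continuous_intros peak_continuous s strip_exp_continuous)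
    then have "((\<lambda>z. peak s p z * strip_exp s \<mu> z) \<longlongrightarrow> peak s p z * strip_exp s \<mu> z) (at z within cball 0 1 - {s, -s})"
      using z False by (simp add: continuous_on_def)
    moreover have "at z within cball 0 1 - {s, -s} = at z within cball 0 1 - {s}"
      by (rule at_within_nhd[of _ "- {-s}"]) (use False in auto)
    ultimately show ?thesis by simp
  qed
qed

lemma Ln_phi_map_circle:
  assumes s: "cmod s = 1" and z: "cmod z = 1" "z \<noteq> s" "z \<noteq> - s"
  defines "r \<equiv> Re (phi_map s z)"
  shows "phi_map s z = of_real r" "r \<noteq> 0"
    "Ln (phi_map s z) = (if r > 0 then of_real (ln r) else of_real (ln (- r)) + \<i> * of_real pi)"
proof -
  have "Im (phi_map s z) = 0" using phi_map_Im[OF s z(3)] z(1) by simp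
  then show p: "phi_map s z = of_real r" by (simp add: complex_eq_iff r_def)
  show r: "r \<noteq> 0" using phi_map_nonzero[OF z(2,3)] p by auto
  show "Ln (phi_map s z) = (if r > 0 then of_real (ln r) else of_real (ln (- r)) + \<i> * of_real pi)"
    unfolding p using Ln_of_real'[OF r] r by (auto simp: mult.commute)
qed

lemma L_map_circle:
  assumes s: "cmod s = 1" and z: "cmod z = 1" "z \<noteq> s" "z \<noteq> - s"
  shows "L_map s g z = (if Re (phi_map s z) > 0 then lower_edge g (ln (Re (phi_map s z)))
     else upper_edge g (ln (- Re (phi_map s z))))"
  unfolding L_map_def o_def Ln_phi_map_circle(3)[OF s z] by (simp add: lower_edge_def upper_edge_def)

text \<open>
  The edge functions of \<open>c0\<close> plus a combination of the functions \<open>strip_exp s \<mu>\<close>.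
\<close>

definition exp_edge :: "real set \<Rightarrow> (real \<Rightarrow> complex) \<Rightarrow> complex \<Rightarrow> complex \<Rightarrow> complex" where
  "exp_edge B c c0 w = (if Im w = 0 \<or> Im w = pi then c0 + (\<Sum>\<mu>\<in>B. c \<mu> * exp (\<i> * of_real \<mu> * w)) else 0)"

lemma exp_edge_lower: "lower_edge (exp_edge B c c0) = (\<lambda>x. c0 + (\<Sum>\<mu>\<in>B. c \<mu> * cis (\<mu> * x)))"
  by (auto simp: lower_edge_def exp_edge_def cis_conv_exp mult.assoc)

lemma exp_edge_upper: "upper_edge (exp_edge B c c0) = (\<lambda>x. c0 + (\<Sum>\<mu>\<in>B. (c \<mu> * of_real (exp (- (\<mu> * pi)))) * cis (\<mu> * x)))"
proof -
  have "exp (\<i> * of_real \<mu> * (of_real x + \<i> * of_real pi)) = of_real (exp (- (\<mu> * pi))) * cis (\<mu> * x)" for \<mu> x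
  proof -
    have "\<i> * of_real \<mu> * (of_real x + \<i> * of_real pi) = of_real (- (\<mu> * pi)) + \<i> * of_real (\<mu> * x)"
      by (simp add: algebra_simps)
    then show ?thesis by (simp only: exp_add cis_conv_exp exp_of_real)
  qed
  then show ?thesis by (auto simp: upper_edge_def exp_edge_def mult.assoc)
qed

lemma exp_edge_AP_strip: "exp_edge B c c0 \<in> AP_strip"
proof -
  have "lower_edge (exp_edge B c c0) \<in> AP" "upper_edge (exp_edge B c c0) \<in> AP"
    unfolding exp_edge_lower exp_edge_upper by (intro AP_add AP_const AP_trig_sum)+
  then show ?thesis by (simp add: AP_strip_def exp_edge_def)
qed

lemma L_map_exp_edge:
  assumes "cmod s = 1" "cmod z = 1" "z \<noteq> s" "z \<noteq> - s"
  shows "L_map s (exp_edge B c c0) z = c0 + (\<Sum>\<mu>\<in>B. c \<mu> * strip_exp s \<mu> z)"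
proof -
  have "Im (Ln (phi_map s z)) = 0 \<or> Im (Ln (phi_map s z)) = pi" unfolding Ln_phi_map_circle(3)[OF assms] by simp
  moreover have "phi_map s z \<noteq> 0" by (rule phi_map_nonzero[OF assms(3,4)])
  ultimately show ?thesis unfolding L_map_def o_def exp_edge_def strip_exp_def by simp
qed

lemma ap_coeff_const_trig_sum:
  assumes "finite B"
  shows "ap_coeff \<nu> (\<lambda>x. c0 + (\<Sum>\<mu>\<in>B. c \<mu> * cis (\<mu> * x))) = (if \<nu> = 0 then c0 else 0) + (if \<nu> \<in> B then c \<nu> else 0)"
proof -
  have "ap_coeff \<nu> (\<lambda>x. c0) = (if \<nu> = 0 then c0 else 0)"
    using ap_coeff_trig_sum[of "{0}" \<nu> "\<lambda>_. c0"] by simp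
  then show ?thesis
    using ap_coeff_add[OF AP_const[of c0] AP_trig_sum[of c B], of \<nu>] ap_coeff_trig_sum[OF assms, of \<nu> c] by simp
qed

section \<open>Recognising elements of the algebra\<close>

lemma countable_cis_preimage: "countable F \<Longrightarrow> countable {t. cis t \<in> F}"
proof -
  assume F: "countable F"
  have "countable {t. cis t = s}" for s
  proof (cases "\<exists>a. cis a = s")
    case True
    then obtain a where a: "cis a = s" by blast
    have "{t. cis t = s} \<subseteq> range (\<lambda>j::int. a + 2 * pi * of_int j)"
    proof
      fix t assume t: "t \<in> {t. cis t = s}"
      obtain j u where ju: "t = a + u + 2 * pi * of_int j" "\<bar>u\<bar> / 4 \<le> dist (cis t) (cis a)" by (rule angle_near)
      then show "t \<in> range (\<lambda>j::int. a + 2 * pi * of_int j)" using t a by auto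
    qed
    then show ?thesis by (rule countable_subset) simp
  qed auto
  then have "countable (\<Union>s\<in>F. {t. cis t = s})" using F by auto
  moreover have "{t. cis t \<in> F} = (\<Union>s\<in>F. {t. cis t = s})" by auto
  ultimately show ?thesis by simp
qed

lemma AE_cis_notin: "finite F \<Longrightarrow> AE t in lebesgue. cis t \<notin> F"
  unfolding AE_lebesgue_iff_negligible
  by (simp add: negligible_iff_null_sets null_sets_completionI countable_imp_null_set_lborel
      countable_cis_preimage countable_finite)

lemma is_edge_of_limit:
  assumes g: "g \<in> AP_strip" and lim: "((\<lambda>z. b z - L_map s g z) \<longlongrightarrow> 0) (at s within sphere 0 1)"
  shows "is_edge s b g"
  unfolding is_edge_def ess_continuous_zero_at_def
proof (intro conjI g allI impI)
  fix e :: real assume "e > 0"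
  then have "\<forall>\<^sub>F z in at s within sphere 0 1. dist (b z - L_map s g z) 0 < e" by (rule tendstoD[OF lim])
  then obtain \<rho> where \<rho>: "\<rho> > 0" "\<And>z. z \<in> sphere 0 1 \<Longrightarrow> z \<noteq> s \<Longrightarrow> dist z s < \<rho> \<Longrightarrow> cmod (b z - L_map s g z) < e"
    unfolding eventually_at by auto
  have "AE t in lebesgue. cis t \<notin> {s}" by (rule AE_cis_notin) simp
  then have "AE t in lebesgue. dist (cis t) s < \<rho> \<longrightarrow> cmod (b (cis t) - L_map s g (cis t)) < e"
    by eventually_elim (use \<rho>(2) in auto)
  then show "\<exists>\<rho>>0. AE t in lebesgue. dist (cis t) s < \<rho> \<longrightarrow> cmod (b (cis t) - L_map s g (cis t)) < e"
    using \<rho>(1) by blast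
qed

lemma measurable_off_countable:
  fixes f :: "real \<Rightarrow> complex"
  assumes "countable X" "continuous_on (- X) f" shows "f \<in> borel_measurable lebesgue"
  using borel_measurable_continuous_countable_exceptions[OF assms]
  by (intro measurable_completion) simp

text \<open>
  Translating the edge functions by \<open>ln \<delta>\<close> turns the limit at \<open>s\<close> into the estimate on a half line that defines
  semi-almost periodicity.
\<close>

lemma SAP_circle_I:
  assumes F: "finite F" and cont: "continuous_on (sphere 0 1 - F) b" and bd: "\<And>z. z \<in> sphere 0 1 \<Longrightarrow> cmod (b z) \<le> C"
    and edge: "\<And>s. cmod s = 1 \<Longrightarrow> \<exists>g\<in>AP_strip. ((\<lambda>z. b z - L_map s g z) \<longlongrightarrow> 0) (at s within sphere 0 1)"
  shows "b \<in> SAP_circle"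
proof -
  have cT: "countable {t. cis t \<in> F}" by (simp add: countable_cis_preimage countable_finite F)
  have "(\<lambda>t. b (cis t)) \<in> borel_measurable lebesgue"
  proof (rule measurable_off_countable[OF cT])
    show "continuous_on (- {t. cis t \<in> F}) (\<lambda>t. b (cis t))"
      by (rule continuous_on_compose2[OF cont]) (auto intro!: continuous_intros)
  qed
  moreover from this have "esssup lebesgue (\<lambda>t. ereal (cmod (b (cis t)))) \<le> ereal C"
    by (intro esssup_I) (auto simp: bd)
  ultimately have Linf: "b \<in> Linf_circle" unfolding Linf_circle_def by (auto intro: le_less_trans)
  moreover have "\<exists>\<delta>\<in>{0<..<pi}. \<exists>g :: real \<Rightarrow> real \<Rightarrow> complex. \<forall>k\<in>{-1, 1}. g k \<in> AP \<and>
       esssup (lebesgue_on {..<0}) (\<lambda>x. ereal (cmod (b (s * exp (\<i> * of_real (k * \<delta> * exp x))) - g k x))) < ereal e"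
    if s: "s \<in> sphere 0 1" and e: "e > 0" for s e
  proof -
    have s1: "cmod s = 1" using s by simp
    then obtain g where g: "g \<in> AP_strip" "((\<lambda>z. b z - L_map s g z) \<longlongrightarrow> 0) (at s within sphere 0 1)" using edge by blast
    obtain a where a: "s = cis a" using s1 by (metis cis_Arg norm_zero sgn_eq div_by_1 of_real_1 zero_neq_one)
    have "\<forall>\<^sub>F z in at s within sphere 0 1. dist (b z - L_map s g z) 0 < e/4" by (rule tendstoD[OF g(2)]) (use e in simp)
    then obtain \<rho> where \<rho>: "\<rho> > 0" "\<And>z. z \<in> sphere 0 1 \<Longrightarrow> z \<noteq> s \<Longrightarrow> dist z s < \<rho> \<Longrightarrow> cmod (b z - L_map s g z) < e/4"
      unfolding eventually_at by auto
    define h where "h = (\<lambda>k::real. if k = 1 then lower_edge g else upper_edge g)"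
    have hAP: "h k \<in> AP" for k using g(1) by (simp add: h_def AP_strip_def)
    have "\<exists>d>0. \<forall>t x. \<bar>t\<bar> \<le> d \<longrightarrow> cmod (h k (x + t) - h k x) \<le> e / 4" for k
      using AP_uniformly_continuous[OF hAP, of "e/4" k] e by (metis zero_less_divide_iff zero_less_numeral)
    then obtain d where d: "\<And>k. d k > 0" "\<And>k t x. \<bar>t\<bar> \<le> d k \<Longrightarrow> cmod (h k (x + t) - h k x) \<le> e / 4" by metis
    obtain Y where Y: "\<And>y. y < Y \<Longrightarrow> exp y < pi \<and> \<bar>ln (2 * tan (exp y / 2)) - y\<bar> \<le> min (d (-1)) (d 1)"
      using log_tan_asymptotic[of "min (d (-1)) (d 1)"] d(1) by auto
    define \<delta> where "\<delta> = min (min (exp Y) \<rho>) (pi / 2)"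
    have \<delta>: "0 < \<delta>" "\<delta> < pi" "\<delta> \<le> exp Y" "\<delta> \<le> \<rho>"
    proof -
      have "\<delta> \<le> pi / 2" by (simp add: \<delta>_def)
      then show "\<delta> < pi" using pi_gt_zero by linarith
    qed (use \<rho>(1) in \<open>auto simp: \<delta>_def\<close>)
    define G where "G = (\<lambda>k x. h k (x + ln \<delta>))"
    have GAP: "G k \<in> AP" for k unfolding G_def by (rule AP_translate[OF hAP])
    have "esssup (lebesgue_on {..<0}) (\<lambda>x. ereal (cmod (b (s * exp (\<i> * of_real (k * \<delta> * exp x))) - G k x))) < ereal e"
      if k: "k \<in> {-1, 1}" for k
    proof -
      have pw: "cmod (b (s * cis (k * exp y)) - h k y) \<le> e / 2" if "y < ln \<delta>" for y
      proof -
        have "exp y < \<delta>" using that \<delta>(1) by (metis exp_less_cancel_iff exp_ln)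
        then have ey: "exp y < exp Y" "exp y < \<rho>" using \<delta> by linarith+
        then have "y < Y" by simp
        define l where "l = ln (2 * tan (exp y / 2))"
        have y': "exp y < pi" "\<bar>l - y\<bar> \<le> d k" using Y[OF \<open>y < Y\<close>] k by (auto simp: l_def)
        have L: "L_map s g (s * cis (k * exp y)) = h k l"
          using k L_map_lower[OF s1 exp_gt_zero y'(1), of g] L_map_upper[OF s1 exp_gt_zero y'(1), of g] by (auto simp: h_def l_def)
        have kk: "\<bar>k * exp y\<bar> = exp y" using k by auto
        have eq: "s * cis (k * exp y) = cis (a + k * exp y)" by (simp add: a cis_mult)
        have "dist (s * cis (k * exp y)) s < \<rho>"
        proof -
          have "s * cis (k * exp y) - s = s * (cis (k * exp y) - 1)" by (simp add: algebra_simps)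
          then have "dist (s * cis (k * exp y)) s \<le> exp y"
            using norm_cis_minus_one_le[of "k * exp y"] s1 kk by (simp add: dist_norm norm_mult)
          then show ?thesis using ey by simp
        qed
        moreover have "s * cis (k * exp y) \<noteq> s"
        proof
          assume "s * cis (k * exp y) = s"
          then have "\<bar>k * exp y\<bar> / 4 \<le> 0" using dist_cis_ge[of "k * exp y" a] y'(1) kk eq a by simp
          then show False using kk by simp
        qed
        moreover have "s * cis (k * exp y) \<in> sphere 0 1" using s1 by (simp add: norm_mult)
        ultimately have "cmod (b (s * cis (k * exp y)) - h k l) \<le> e / 4" using \<rho>(2) L by fastforce
        moreover have "cmod (h k l - h k y) \<le> e/4" using d(2)[OF y'(2), of y] by simp
        ultimately have "cmod (b (s * cis (k * exp y)) - h k y) \<le> e/4 + e/4" using norm_diff_triangle_le by blast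
        then show ?thesis by simp
      qed
      have pw': "cmod (b (s * cis (k * \<delta> * exp x)) - G k x) \<le> e / 2" if "x < 0" for x
      proof -
        have eq: "k * exp (x + ln \<delta>) = k * \<delta> * exp x" using \<delta>(1) by (simp add: exp_add)
        have "cmod (b (s * cis (k * exp (x + ln \<delta>))) - h k (x + ln \<delta>)) \<le> e / 2" by (rule pw) (use that in simp)
        then show ?thesis by (simp only: G_def eq)
      qed
      have "(\<lambda>x. b (s * cis (k * \<delta> * exp x))) \<in> borel_measurable lebesgue"
      proof (rule measurable_off_countable)
        have "{x. s * cis (k * \<delta> * exp x) \<in> F} \<subseteq> (\<lambda>t. ln (\<bar>t - a\<bar> / \<delta>)) ` {t. cis t \<in> F}"
        proof
          fix x assume "x \<in> {x. s * cis (k * \<delta> * exp x) \<in> F}"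
          then have "a + k * \<delta> * exp x \<in> {t. cis t \<in> F}" by (simp add: a cis_mult)
          moreover have "x = ln (\<bar>(a + k * \<delta> * exp x) - a\<bar> / \<delta>)" using k \<delta>(1) by (auto simp: abs_mult)
          ultimately show "x \<in> (\<lambda>t. ln (\<bar>t - a\<bar> / \<delta>)) ` {t. cis t \<in> F}" by blast
        qed
        then show "countable {x. s * cis (k * \<delta> * exp x) \<in> F}" by (rule countable_subset) (intro countable_image cT)
        show "continuous_on (- {x. s * cis (k * \<delta> * exp x) \<in> F}) (\<lambda>x. b (s * cis (k * \<delta> * exp x)))"
          by (rule continuous_on_compose2[OF cont]) (use s1 in \<open>auto intro!: continuous_intros simp: norm_mult\<close>)
      qed
      moreover have "G k \<in> borel_measurable lebesgue"
        by (rule measurable_off_countable[of "{}"]) (auto intro: AP_continuous GAP)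
      ultimately have "(\<lambda>x. b (s * cis (k * \<delta> * exp x)) - G k x) \<in> borel_measurable (lebesgue_on {..<0})"
        by (intro measurable_restrict_space1 borel_measurable_diff)
      then have "(\<lambda>x. ereal (cmod (b (s * cis (k * \<delta> * exp x)) - G k x))) \<in> borel_measurable (lebesgue_on {..<0})"
        by measurable
      then have "esssup (lebesgue_on {..<0}) (\<lambda>x. ereal (cmod (b (s * cis (k * \<delta> * exp x)) - G k x))) \<le> ereal (e / 2)"
        by (rule esssup_I) (rule AE_I2, use pw' in simp)
      also have "ereal (e / 2) < ereal e" using e by simp
      finally show ?thesis by (simp add: cis_conv_exp)
    qed
    then show ?thesis using \<delta> GAP by (intro bexI[of _ \<delta>] exI[of _ G]) auto
  qed
  ultimately show ?thesis unfolding SAP_circle_def by blast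
qed

lemma radial_limit:
  assumes F: "F \<subseteq> sphere 0 1" and cont: "continuous_on (cball 0 1 - F) b" and t: "cis t \<notin> F"
  shows "((\<lambda>r. b (of_real r * cis t)) \<longlongrightarrow> b (cis t)) (at_left 1)"
proof -
  have "(b \<longlongrightarrow> b (cis t)) (at (cis t) within cball 0 1 - F)"
    using cont t by (simp add: continuous_on_def)
  moreover have "filterlim (\<lambda>r. of_real r * cis t) (at (cis t) within cball 0 1 - F) (at_left 1)"
    unfolding filterlim_at
  proof
    have "((\<lambda>r. complex_of_real r * cis t) \<longlongrightarrow> of_real 1 * cis t) (at_left 1)" by (intro tendsto_intros)
    then show "((\<lambda>r. complex_of_real r * cis t) \<longlongrightarrow> cis t) (at_left 1)" by simp
    have "\<forall>\<^sub>F r::real in at_left 1. r \<in> {0<..<1}" by (rule eventually_at_left_real) simp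
    then show "\<forall>\<^sub>F r in at_left 1. complex_of_real r * cis t \<in> cball 0 1 - F \<and> complex_of_real r * cis t \<noteq> cis t"
    proof eventually_elim
      case (elim r)
      then have n: "cmod (complex_of_real r * cis t) < 1" by (simp add: norm_mult)
      then have "complex_of_real r * cis t \<notin> sphere 0 1" by auto
      then show ?case using F n by auto
    qed
  qed
  ultimately show ?thesis by (rule filterlim_compose)
qed

lemma Hinf_of_boundary_continuous:
  assumes F: "finite F" "F \<subseteq> sphere 0 1" and cont: "continuous_on (cball 0 1 - F) b"
    and hol: "b holomorphic_on ball 0 1" and bd: "\<And>z. z \<in> ball 0 1 \<Longrightarrow> cmod (b z) \<le> C"
  defines "f \<equiv> \<lambda>z. if z \<in> ball 0 1 then b z else 0"
  shows "f \<in> Hinf" "has_boundary_values f b"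
proof -
  have "f holomorphic_on ball 0 1" using hol by (rule holomorphic_transform) (simp add: f_def)
  moreover have "bounded (f ` ball 0 1)" unfolding bounded_iff f_def
    by (intro exI[of _ C]) (use bd in auto)
  ultimately show "f \<in> Hinf" by (auto simp: Hinf_def f_def)
  have "AE t in lebesgue. cis t \<notin> F" by (rule AE_cis_notin[OF F(1)])
  then show "has_boundary_values f b" unfolding has_boundary_values_def
  proof eventually_elim
    case (elim t)
    have "\<forall>\<^sub>F r::real in at_left 1. r \<in> {0<..<1}" by (rule eventually_at_left_real) simp
    then have "\<forall>\<^sub>F r in at_left 1. b (of_real r * cis t) = f (of_real r * cis t)"
      by eventually_elim (simp add: f_def norm_mult)
    then show ?case by (rule Lim_transform_eventually[OF radial_limit[OF F(2) cont elim]])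
  qed
qed

definition edge_sum :: "complex set \<Rightarrow> nat \<Rightarrow> real set \<Rightarrow> (complex \<Rightarrow> real \<Rightarrow> complex) \<Rightarrow> complex \<Rightarrow> complex" where
  "edge_sum F p B c z = (\<Sum>s\<in>F. \<Sum>\<mu>\<in>B. c s \<mu> * (peak s p z * strip_exp s \<mu> z))"

lemma edge_sum_continuous:
  assumes F: "F \<subseteq> sphere 0 1" and p: "p > 0"
  shows "continuous_on (cball 0 1 - F) (edge_sum F p B c)"
  unfolding edge_sum_def[abs_def]
proof (intro continuous_on_sum continuous_on_mult_left)
  fix s \<mu> assume "s \<in> F"
  then have "cmod s = 1" using F by auto
  from peak_strip_exp_continuous[OF this p]
  show "continuous_on (cball 0 1 - F) (\<lambda>z. peak s p z * strip_exp s \<mu> z)"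
    by (rule continuous_on_subset) (use \<open>s \<in> F\<close> in auto)
qed

lemma edge_sum_holomorphic: "F \<subseteq> sphere 0 1 \<Longrightarrow> edge_sum F p B c holomorphic_on ball 0 1"
  unfolding edge_sum_def[abs_def]
  by (intro holomorphic_intros peak_holomorphic strip_exp_holomorphic) auto

lemma norm_edge_sum_le:
  assumes F: "F \<subseteq> sphere 0 1" and z: "cmod z \<le> 1"
  shows "cmod (edge_sum F p B c z) \<le> (\<Sum>s\<in>F. \<Sum>\<mu>\<in>B. cmod (c s \<mu>) * exp (\<bar>\<mu>\<bar> * pi))"
  unfolding edge_sum_def
proof (intro sum_norm_le)
  fix s \<mu> assume "s \<in> F"
  then have s: "cmod s = 1" using F by auto
  have "cmod (peak s p z) * cmod (strip_exp s \<mu> z) \<le> 1 * exp (\<bar>\<mu>\<bar> * pi)"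
    by (intro mult_mono norm_peak_le[OF s z] norm_strip_exp_le) auto
  then show "cmod (c s \<mu> * (peak s p z * strip_exp s \<mu> z)) \<le> cmod (c s \<mu>) * exp (\<bar>\<mu>\<bar> * pi)"
    unfolding norm_mult by (intro mult_left_mono) auto
qed

lemma eventually_at_circle_off: "\<forall>\<^sub>F z in at s within sphere 0 1. z \<noteq> s \<and> z \<noteq> - s \<and> cmod z = 1" if "cmod s = 1" for s :: complex
proof -
  have ne: "s \<noteq> - s" using that by auto
  have "\<forall>\<^sub>F z in at s within sphere 0 1. z \<noteq> - s"
    by (rule tendsto_imp_eventually_ne[OF tendsto_ident_at ne])
  moreover have "\<forall>\<^sub>F z in at s within sphere 0 1. z \<noteq> s \<and> z \<in> sphere 0 1" by (simp add: eventually_at_filter)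
  ultimately show ?thesis by eventually_elim simp
qed

text \<open>
  Near one of its centres \<open>s\<close>, an edge sum differs from the corresponding sum of exponentials by a
  function that is continuous at \<open>s\<close>.
\<close>

lemma edge_sum_limit:
  fixes c :: "complex \<Rightarrow> real \<Rightarrow> complex" and B :: "real set"
  assumes F: "finite F" "F \<subseteq> sphere 0 1" and p: "p > 0" and s: "cmod s = 1"
    and q: "continuous_on (cball 0 1) q"
  defines "c' \<equiv> \<lambda>\<mu>. if s \<in> F then c s \<mu> else 0"
  defines "c0 \<equiv> q s + edge_sum (F - {s}) p B c s"
  shows "((\<lambda>z. q z + edge_sum F p B c z - L_map s (exp_edge B c' c0) z) \<longlongrightarrow> 0) (at s within sphere 0 1)"
proof -
  define r where "r = (\<lambda>z. q z + edge_sum (F - {s}) p B c z)"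
  have "continuous_on (cball 0 1 - (F - {s})) r"
    unfolding r_def using F q
    by (intro continuous_intros edge_sum_continuous p) (auto intro: continuous_on_subset)
  moreover have "s \<in> cball 0 1 - (F - {s})" using s by simp
  ultimately have "(r \<longlongrightarrow> r s) (at s within cball 0 1 - (F - {s}))" by (simp add: continuous_on_def)
  moreover have "at s within cball 0 1 - (F - {s}) = at s within cball 0 1"
  proof (rule at_within_nhd)
    show "open (- (F - {s}))" by (intro open_Compl finite_imp_closed finite_Diff F(1))
  qed auto
  ultimately have "(r \<longlongrightarrow> r s) (at s within sphere 0 1)"
    by (metis tendsto_within_subset sphere_cball)
  then have 1: "((\<lambda>z. r z - c0) \<longlongrightarrow> c0 - c0) (at s within sphere 0 1)" by (intro tendsto_intros) (simp add: r_def c0_def)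
  have 2: "((\<lambda>z. \<Sum>\<mu>\<in>B. c' \<mu> * ((peak s p z - 1) * strip_exp s \<mu> z)) \<longlongrightarrow> (\<Sum>\<mu>\<in>B. c' \<mu> * 0)) (at s within sphere 0 1)"
  proof (intro tendsto_sum tendsto_mult_left)
    fix \<mu>
    have "s \<noteq> 0" using s by auto
    then have ps: "peak s p s = 1" by (simp add: peak_def)
    have "(peak s p \<longlongrightarrow> peak s p s) (at s within sphere 0 1)"
      using peak_continuous[OF s, of "sphere 0 1" p] s by (simp add: continuous_on_def)
    then have "((\<lambda>z. cmod (peak s p z - 1) * exp (\<bar>\<mu>\<bar> * pi)) \<longlongrightarrow> cmod (peak s p s - 1) * exp (\<bar>\<mu>\<bar> * pi)) (at s within sphere 0 1)"
      by (intro tendsto_intros)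
    then have "((\<lambda>z. cmod (peak s p z - 1) * exp (\<bar>\<mu>\<bar> * pi)) \<longlongrightarrow> 0) (at s within sphere 0 1)" by (simp add: ps)
    then show "((\<lambda>z. (peak s p z - 1) * strip_exp s \<mu> z) \<longlongrightarrow> 0) (at s within sphere 0 1)"
      by (rule Lim_null_comparison[rotated]) (intro always_eventually allI, simp add: norm_mult mult_left_mono norm_strip_exp_le)
  qed
  have lim: "((\<lambda>z. (r z - c0) + (\<Sum>\<mu>\<in>B. c' \<mu> * ((peak s p z - 1) * strip_exp s \<mu> z))) \<longlongrightarrow> 0) (at s within sphere 0 1)"
    using tendsto_add[OF 1 2] by simp
  have "\<forall>\<^sub>F z in at s within sphere 0 1. (r z - c0) + (\<Sum>\<mu>\<in>B. c' \<mu> * ((peak s p z - 1) * strip_exp s \<mu> z))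
     = q z + edge_sum F p B c z - L_map s (exp_edge B c' c0) z"
    using eventually_at_circle_off[OF s]
  proof eventually_elim
    case (elim z)
    have "L_map s (exp_edge B c' c0) z = c0 + (\<Sum>\<mu>\<in>B. c' \<mu> * strip_exp s \<mu> z)"
      by (rule L_map_exp_edge[OF s]) (use elim in auto)
    moreover have "edge_sum F p B c z = edge_sum (F - {s}) p B c z + (\<Sum>\<mu>\<in>B. c' \<mu> * (peak s p z * strip_exp s \<mu> z))"
    proof (cases "s \<in> F")
      case True
      then show ?thesis unfolding edge_sum_def c'_def by (subst sum.remove[OF F(1) True]) (simp add: add.commute)
    qed (simp add: c'_def)
    ultimately show ?case by (simp add: r_def algebra_simps sum_subtractf sum.distrib)
  qed
  then show ?thesis by (rule Lim_transform_eventually[OF lim])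
qed

lemma exp_edge_spec:
  assumes B: "finite B" and c: "\<And>\<mu>. \<mu> \<in> B \<Longrightarrow> c \<mu> \<noteq> 0 \<Longrightarrow> \<mu> \<in> G" and z: "0 \<in> G"
  shows "ap_spec (lower_edge (exp_edge B c c0)) \<subseteq> G" "ap_spec (upper_edge (exp_edge B c c0)) \<subseteq> G"
  unfolding ap_spec_def exp_edge_lower exp_edge_upper
  using ap_coeff_const_trig_sum[OF B, of _ c0 c] ap_coeff_const_trig_sum[OF B, of _ c0 "\<lambda>\<mu>. c \<mu> * of_real (exp (- (\<mu> * pi)))"] c z
  by (auto split: if_splits)

text \<open>
  At \<open>s\<close> the edge functions consist of the exponentials with coefficients \<open>c s\<close> and of a constant, the value at \<open>s\<close>
  of the part that is continuous there. The constant has spectrum in \<open>{0}\<close>.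
\<close>

lemma SAP_spec_Hinf_I:
  assumes S: "S \<subseteq> sphere 0 1" and F: "finite F" "F \<subseteq> S" and B: "finite B" and p: "p > 0"
    and q: "q holomorphic_on UNIV" and zero: "\<And>s. s \<in> S \<Longrightarrow> 0 \<in> \<Sigma> s"
    and c: "\<And>s \<mu>. s \<in> F \<Longrightarrow> \<mu> \<in> B \<Longrightarrow> c s \<mu> \<noteq> 0 \<Longrightarrow> \<mu> \<in> \<Sigma> s"
  shows "(\<lambda>z. if z \<in> ball 0 1 then q z + edge_sum F p B c z else 0) \<in> SAP_spec_Hinf S \<Sigma>"
proof -
  define b where "b = (\<lambda>z. q z + edge_sum F p B c z)"
  have FS: "F \<subseteq> sphere 0 1" using F S by blast
  have qc: "continuous_on A q" for A
    by (rule continuous_on_subset[OF holomorphic_on_imp_continuous_on[OF q]]) simp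
  have bc: "continuous_on (cball 0 1 - F) b"
    unfolding b_def by (intro continuous_intros qc edge_sum_continuous FS p)
  have "bounded (q ` cball 0 1)" by (intro compact_imp_bounded compact_continuous_image qc) simp
  then obtain C where C: "\<forall>x\<in>q ` cball 0 1. norm x \<le> C" unfolding bounded_iff by blast
  have qC: "cmod (q z) \<le> C" if "cmod z \<le> 1" for z
    by (rule C[rule_format], rule imageI) (use that in simp)
  have bd: "cmod (b z) \<le> C + (\<Sum>s\<in>F. \<Sum>\<mu>\<in>B. cmod (c s \<mu>) * exp (\<bar>\<mu>\<bar> * pi))" if "cmod z \<le> 1" for z
    unfolding b_def by (intro order_trans[OF norm_triangle_ineq] add_mono norm_edge_sum_le FS qC that)
  have bh: "b holomorphic_on ball 0 1"
    unfolding b_def by (intro holomorphic_intros holomorphic_on_subset[OF q] edge_sum_holomorphic FS) auto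
  have edge: "((\<lambda>z. b z - L_map s (exp_edge B (\<lambda>\<mu>. if s \<in> F then c s \<mu> else 0) (q s + edge_sum (F - {s}) p B c s)) z) \<longlongrightarrow> 0) (at s within sphere 0 1)"
    if "cmod s = 1" for s
    unfolding b_def by (rule edge_sum_limit[OF F(1) FS p that qc])
  have circ: "b \<in> SAP_circle"
  proof (rule SAP_circle_I[OF F(1)])
    show "continuous_on (sphere 0 1 - F) b" by (rule continuous_on_subset[OF bc]) auto
    show "\<exists>g\<in>AP_strip. ((\<lambda>z. b z - L_map s g z) \<longlongrightarrow> 0) (at s within sphere 0 1)" if "cmod s = 1" for s
      using edge[OF that] exp_edge_AP_strip by blast
  qed (rule bd, simp)
  moreover have "continuous_on (sphere 0 1 - S) b" by (rule continuous_on_subset[OF bc]) (use F in auto)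
  ultimately have "b \<in> SAP S" unfolding SAP_def by auto
  moreover have "ap_spec (lower_edge (E_hom s b)) \<subseteq> \<Sigma> s \<and> ap_spec (upper_edge (E_hom s b)) \<subseteq> \<Sigma> s" if s: "s \<in> S" for s
  proof -
    have s1: "cmod s = 1" using s S by auto
    have E: "E_hom s b = exp_edge B (\<lambda>\<mu>. if s \<in> F then c s \<mu> else 0) (q s + edge_sum (F - {s}) p B c s)"
      by (rule E_hom_eq[OF s1 is_edge_of_limit[OF exp_edge_AP_strip edge[OF s1]]])
    have "\<mu> \<in> \<Sigma> s" if "\<mu> \<in> B" "(if s \<in> F then c s \<mu> else 0) \<noteq> 0" for \<mu>
      using c[of s \<mu>] that by (simp split: if_splits)
    then show ?thesis unfolding E by (intro conjI exp_edge_spec[OF B _ zero[OF s]])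
  qed
  ultimately have "b \<in> SAP_spec S \<Sigma>" unfolding SAP_spec_def by blast
  moreover have "(\<lambda>z. if z \<in> ball 0 1 then b z else 0) \<in> Hinf" "has_boundary_values (\<lambda>z. if z \<in> ball 0 1 then b z else 0) b"
    by (rule Hinf_of_boundary_continuous[OF F(1) FS bc bh bd]; simp)+
  ultimately show ?thesis unfolding SAP_spec_Hinf_def b_def by blast
qed

section \<open>Local oscillation of the boundary values\<close>

text \<open>
  The essential oscillation of \<open>b\<close> at \<open>s\<close>, up to a factor 2.
\<close>

definition near_const :: "(complex \<Rightarrow> complex) \<Rightarrow> real \<Rightarrow> complex \<Rightarrow> bool" where
  "near_const b e s \<longleftrightarrow> (\<exists>c. \<exists>\<rho>>0. AE t in lebesgue. dist (cis t) s < \<rho> \<longrightarrow> cmod (b (cis t) - c) \<le> e)"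

lemma near_constI_limit:
  assumes "(b \<longlongrightarrow> l) (at s within sphere 0 1)" "e > 0"
  shows "near_const b e s"
proof -
  have "\<forall>\<^sub>F z in at s within sphere 0 1. dist (b z) l < e" by (rule tendstoD[OF assms])
  then obtain \<rho> where \<rho>: "\<rho> > 0" "\<And>z. z \<in> sphere 0 1 \<Longrightarrow> z \<noteq> s \<Longrightarrow> dist z s < \<rho> \<Longrightarrow> dist (b z) l < e"
    unfolding eventually_at by auto
  have "AE t in lebesgue. cis t \<notin> {s}" by (rule AE_cis_notin) simp
  then have "AE t in lebesgue. dist (cis t) s < \<rho> \<longrightarrow> cmod (b (cis t) - l) \<le> e"
    by eventually_elim (use \<rho>(2) in \<open>auto simp: dist_norm less_imp_le\<close>)
  then show ?thesis using \<rho>(1) unfolding near_const_def by blast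
qed

lemma near_const_diff:
  assumes "near_const b e s" "near_const b' e' s"
  shows "near_const (\<lambda>z. b z - b' z) (e + e') s"
proof -
  obtain c \<rho> where 1: "\<rho> > 0" "AE t in lebesgue. dist (cis t) s < \<rho> \<longrightarrow> cmod (b (cis t) - c) \<le> e"
    using assms(1) unfolding near_const_def by blast
  obtain c' \<rho>' where 2: "\<rho>' > 0" "AE t in lebesgue. dist (cis t) s < \<rho>' \<longrightarrow> cmod (b' (cis t) - c') \<le> e'"
    using assms(2) unfolding near_const_def by blast
  have "AE t in lebesgue. dist (cis t) s < min \<rho> \<rho>' \<longrightarrow> cmod (b (cis t) - b' (cis t) - (c - c')) \<le> e + e'"
    using 1(2) 2(2)
  proof eventually_elim
    case (elim t)
    have eq: "b (cis t) - b' (cis t) - (c - c') = (b (cis t) - c) - (b' (cis t) - c')" by simp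
    show ?case unfolding eq using elim norm_triangle_ineq4[of "b (cis t) - c" "b' (cis t) - c'"] by auto
  qed
  then show ?thesis using 1(1) 2(1) unfolding near_const_def by (intro exI[of _ "c - c'"] exI[of _ "min \<rho> \<rho>'"]) auto
qed

lemma L_map_limit:
  assumes s: "cmod s = 1" and g: "g \<in> AP_strip" and z: "cmod z = 1" "z \<noteq> s" "z \<noteq> - s"
  shows "(L_map s g \<longlongrightarrow> L_map s g z) (at z within sphere 0 1)"
proof -
  define r where "r = (\<lambda>z. Re (phi_map s z))"
  have sz: "s + z \<noteq> 0" using z(3) by (metis add.commute add_eq_0_iff2)
  have "(phi_map s \<longlongrightarrow> phi_map s z) (at z within sphere 0 1)"
    unfolding phi_map_def[abs_def] by (intro tendsto_intros sz)
  then have r: "(r \<longlongrightarrow> r z) (at z within sphere 0 1)" unfolding r_def by (rule tendsto_Re)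
  have r0: "r z \<noteq> 0" unfolding r_def by (rule Ln_phi_map_circle(2)[OF s z])
  have "\<forall>\<^sub>F w in at z within sphere 0 1. w \<noteq> s" "\<forall>\<^sub>F w in at z within sphere 0 1. w \<noteq> - s"
    using z by (auto intro!: tendsto_imp_eventually_ne[OF tendsto_ident_at])
  moreover have "\<forall>\<^sub>F w in at z within sphere 0 1. w \<in> sphere 0 1" by (simp add: eventually_at_filter)
  ultimately have off: "\<forall>\<^sub>F w in at z within sphere 0 1. w \<noteq> s \<and> w \<noteq> - s \<and> cmod w = 1"
    by eventually_elim simp
  have ic: "isCont (lower_edge g) x" "isCont (upper_edge g) x" for x
    using g AP_continuous[of _ UNIV] by (auto simp: AP_strip_def continuous_on_eq_continuous_at)
  show ?thesis
  proof (cases "r z > 0")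
    case True
    have "((\<lambda>w. lower_edge g (ln (r w))) \<longlongrightarrow> lower_edge g (ln (r z))) (at z within sphere 0 1)"
      by (rule isCont_tendsto_compose[OF ic(1)]) (intro tendsto_intros r r0)
    moreover have "\<forall>\<^sub>F w in at z within sphere 0 1. lower_edge g (ln (r w)) = L_map s g w"
      using off order_tendstoD(1)[OF r True] by eventually_elim (simp add: L_map_circle[OF s] r_def)
    ultimately show ?thesis using L_map_circle[OF s z, of g] True
      by (simp add: r_def Lim_transform_eventually)
  next
    case False
    then have neg: "r z < 0" using r0 by simp
    have "((\<lambda>w. upper_edge g (ln (- r w))) \<longlongrightarrow> upper_edge g (ln (- r z))) (at z within sphere 0 1)"
      by (rule isCont_tendsto_compose[OF ic(2)]) (intro tendsto_intros r, use r0 in simp)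
    moreover have "\<forall>\<^sub>F w in at z within sphere 0 1. upper_edge g (ln (- r w)) = L_map s g w"
      using off order_tendstoD(2)[OF r neg] by eventually_elim (simp add: L_map_circle[OF s] r_def)
    ultimately show ?thesis using L_map_circle[OF s z, of g] False
      by (simp add: r_def Lim_transform_eventually)
  qed
qed

text \<open>
  Near each point \<open>s\<close>, a semi-almost periodic function is close to a function that is continuous
  off \<open>s\<close>.  By compactness it oscillates noticeably only at finitely many points of \<open>S\<close>.
\<close>

lemma finite_oscillation_points:
  assumes S: "closed S" and b: "b \<in> SAP S" and e: "e > 0"
  shows "\<exists>F. finite F \<and> F \<subseteq> S \<and> F \<subseteq> sphere 0 1 \<and> (\<forall>s. cmod s = 1 \<longrightarrow> s \<notin> F \<longrightarrow> near_const b e s)"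
proof -
  have bc: "b \<in> SAP_circle" using b by (simp add: SAP_def)
  obtain h where h: "continuous_on (sphere 0 1 - S) h" "AE t in lebesgue. cis t \<notin> S \<longrightarrow> b (cis t) = h (cis t)"
    using b by (auto simp: SAP_def)
  have loc: "\<exists>\<rho>>0. \<forall>z. cmod z = 1 \<longrightarrow> z \<noteq> s \<longrightarrow> dist z s < \<rho> \<longrightarrow> near_const b e z" if s: "cmod s = 1" for s
  proof -
    obtain g where g: "is_edge s b g" using edge_exists[OF bc s] by blast
    then have gs: "g \<in> AP_strip" by (simp add: is_edge_def)
    obtain \<rho> where \<rho>: "\<rho> > 0" "AE t in lebesgue. dist (cis t) s < \<rho> \<longrightarrow> cmod (b (cis t) - L_map s g (cis t)) < e/2"
      using g e unfolding is_edge_def ess_continuous_zero_at_def by (meson half_gt_zero)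
    have "near_const b e z" if z: "cmod z = 1" "z \<noteq> s" "dist z s < min \<rho> 1" for z
    proof -
      have "dist (- s) s = 2" using s by (simp add: dist_norm norm_minus_commute flip: mult_2)
      then have zs: "z \<noteq> - s" using z by auto
      have "near_const (L_map s g) (e/2) z"
        by (rule near_constI_limit[OF L_map_limit[OF s gs z(1,2) zs]]) (use e in simp)
      then obtain c \<rho>' where c: "\<rho>' > 0" "AE t in lebesgue. dist (cis t) z < \<rho>' \<longrightarrow> cmod (L_map s g (cis t) - c) \<le> e/2"
        unfolding near_const_def by blast
      define \<rho>'' where "\<rho>'' = min \<rho>' (\<rho> - dist z s)"
      have "AE t in lebesgue. dist (cis t) z < \<rho>'' \<longrightarrow> cmod (b (cis t) - c) \<le> e"
        using \<rho>(2) c(2)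
      proof eventually_elim
        case (elim t)
        show ?case
        proof
          assume d: "dist (cis t) z < \<rho>''"
          then have "dist (cis t) s < \<rho>" using dist_triangle[of "cis t" s z] by (simp add: \<rho>''_def)
          then have "cmod (b (cis t) - L_map s g (cis t)) \<le> e/2" "cmod (L_map s g (cis t) - c) \<le> e/2"
            using elim d by (auto simp: \<rho>''_def)
          then have "cmod (b (cis t) - c) \<le> e/2 + e/2" by (rule norm_diff_triangle_le)
          then show "cmod (b (cis t) - c) \<le> e" by simp
        qed
      qed
      moreover have "\<rho>'' > 0" using c(1) z(3) by (simp add: \<rho>''_def)
      ultimately show ?thesis unfolding near_const_def by blast
    qed
    then show ?thesis using \<rho>(1) by (intro exI[of _ "min \<rho> 1"]) auto
  qed
  then obtain \<rho> where \<rho>: "\<And>s. cmod s = 1 \<Longrightarrow> \<rho> s > 0" "\<And>s z. cmod s = 1 \<Longrightarrow> cmod z = 1 \<Longrightarrow> z \<noteq> s \<Longrightarrow> dist z s < \<rho> s \<Longrightarrow> near_const b e z"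
    by metis
  have cpt: "compact (sphere (0::complex) 1)" by simp
  have cover: "sphere (0::complex) 1 \<subseteq> (\<Union>s\<in>sphere 0 1. ball s (\<rho> s))" using \<rho>(1) by (auto intro!: bexI)
  obtain D where D: "D \<subseteq> sphere (0::complex) 1" "finite D" "sphere (0::complex) 1 \<subseteq> (\<Union>s\<in>D. ball s (\<rho> s))"
    by (rule compactE_image[OF cpt _ cover]) auto
  define F where "F = {s \<in> sphere 0 1. \<not> near_const b e s}"
  have "F \<subseteq> D"
  proof
    fix z assume z: "z \<in> F"
    then obtain s where s: "s \<in> D" "z \<in> ball s (\<rho> s)" using D(3) by (auto simp: F_def)
    then have "cmod s = 1" using D(1) by auto
    then show "z \<in> D" using \<rho>(2)[of s z] z s by (auto simp: F_def dist_commute)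
  qed
  then have "finite F" using D(2) finite_subset by blast
  moreover have "F \<subseteq> S"
  proof
    fix z assume z: "z \<in> F"
    show "z \<in> S"
    proof (rule ccontr)
      assume "z \<notin> S"
      have "(h \<longlongrightarrow> h z) (at z within sphere 0 1 - S)" using h(1) z \<open>z \<notin> S\<close> by (simp add: continuous_on_def F_def)
      moreover have "at z within sphere 0 1 - S = at z within sphere 0 1"
        by (rule at_within_nhd[of _ "- S"]) (use S \<open>z \<notin> S\<close> in auto)
      ultimately have "near_const h e z" using near_constI_limit[OF _ e] by simp
      then obtain c \<rho>' where c: "\<rho>' > 0" "AE t in lebesgue. dist (cis t) z < \<rho>' \<longrightarrow> cmod (h (cis t) - c) \<le> e"
        unfolding near_const_def by blast
      obtain d where d: "d > 0" "ball z d \<subseteq> - S" using S \<open>z \<notin> S\<close> open_contains_ball[of "- S"] by auto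
      have "AE t in lebesgue. dist (cis t) z < min \<rho>' d \<longrightarrow> cmod (b (cis t) - c) \<le> e"
        using c(2) h(2)
      proof eventually_elim
        case (elim t)
        show ?case
        proof
          assume a: "dist (cis t) z < min \<rho>' d"
          then have "cis t \<in> ball z d" by (simp add: dist_commute)
          then have "cis t \<notin> S" using d by blast
          then show "cmod (b (cis t) - c) \<le> e" using elim a by simp
        qed
      qed
      then have "near_const b e z" unfolding near_const_def using c(1) d(1) by (metis min_less_iff_conj)
      then show False using z by (simp add: F_def)
    qed
  qed
  ultimately show ?thesis by (intro exI[of _ F]) (auto simp: F_def)
qed

text \<open>
  Finitely many arcs on which \<open>b\<close> is nearly constant cover the circle, and a sufficiently small rotation does not leave
  the arc.
\<close>

lemma rotation_oscillation:
  assumes nc: "\<And>s. cmod s = 1 \<Longrightarrow> near_const b e s"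
  shows "\<exists>\<delta>>0. \<forall>u. \<bar>u\<bar> < \<delta> \<longrightarrow> (AE t in lebesgue. cmod (b (cis (t + u)) - b (cis t)) \<le> 2 * e)"
proof -
  have "\<forall>s. \<exists>p. cmod s = 1 \<longrightarrow> snd p > 0 \<and> (AE t in lebesgue. dist (cis t) s < snd p \<longrightarrow> cmod (b (cis t) - fst p) \<le> e)"
    using nc unfolding near_const_def by auto
  from choice[OF this] obtain p where p: "\<And>s. cmod s = 1 \<Longrightarrow> snd (p s) > 0 \<and> (AE t in lebesgue. dist (cis t) s < snd (p s) \<longrightarrow> cmod (b (cis t) - fst (p s)) \<le> e)"
    by blast
  define c where "c = (\<lambda>s. fst (p s))"
  define \<rho> where "\<rho> = (\<lambda>s. snd (p s))"
  have \<rho>: "\<And>s. cmod s = 1 \<Longrightarrow> \<rho> s > (0::real)"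
    "\<And>s. cmod s = 1 \<Longrightarrow> AE t in lebesgue. dist (cis t) s < \<rho> s \<longrightarrow> cmod (b (cis t) - c s) \<le> e"
    using p by (simp_all add: c_def \<rho>_def)
  have cpt: "compact (sphere (0::complex) 1)" by simp
  have cover: "sphere (0::complex) 1 \<subseteq> (\<Union>s\<in>sphere 0 1. ball s (\<rho> s / 2))" using \<rho>(1) by (auto intro!: bexI)
  obtain D where D: "D \<subseteq> sphere (0::complex) 1" "finite D" "sphere (0::complex) 1 \<subseteq> (\<Union>s\<in>D. ball s (\<rho> s / 2))"
    by (rule compactE_image[OF cpt _ cover]) auto
  define \<delta> where "\<delta> = Min (insert 1 ((\<lambda>s. \<rho> s / 2) ` D))"
  have \<delta>: "\<delta> > 0" unfolding \<delta>_def using D(1,2) \<rho>(1) by (subst Min_gr_iff) auto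
  have \<delta>le: "\<delta> \<le> \<rho> s / 2" if "s \<in> D" for s unfolding \<delta>_def using D(2) that by (intro Min_le) auto
  have ae: "AE t in lebesgue. \<forall>s\<in>D. dist (cis t) s < \<rho> s \<longrightarrow> cmod (b (cis t) - c s) \<le> e"
    by (rule AE_finite_allI[OF D(2)]) (use \<rho>(2) D(1) in auto)
  have "AE t in lebesgue. cmod (b (cis (t + u)) - b (cis t)) \<le> 2 * e" if u: "\<bar>u\<bar> < \<delta>" for u
    using ae AE_translate[OF ae, of u]
  proof eventually_elim
    case (elim t)
    obtain s where s: "s \<in> D" "dist (cis t) s < \<rho> s / 2" using D(3) by (force simp: dist_commute)
    have "dist (cis (t + u)) (cis t) \<le> \<bar>u\<bar>"
    proof -
      have "cis (t + u) - cis t = cis t * (cis u - 1)" by (simp add: cis_mult algebra_simps)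
      then show ?thesis using norm_cis_minus_one_le[of u] by (simp add: dist_norm norm_mult)
    qed
    then have "dist (cis (t + u)) s < \<rho> s" using dist_triangle[of "cis (t + u)" s "cis t"] s \<delta>le[OF s(1)] u by simp
    moreover have "dist (cis t) s < \<rho> s" using s zero_le_dist[of "cis t" s] by linarith
    ultimately have "cmod (b (cis (t + u)) - c s) \<le> e" "cmod (c s - b (cis t)) \<le> e"
      using elim s(1) by (auto simp: norm_minus_commute)
    then have "cmod (b (cis (t + u)) - b (cis t)) \<le> e + e" by (rule norm_diff_triangle_le)
    then show ?case by simp
  qed
  then show ?thesis using \<delta> by blast
qed

section \<open>Smoothing by rotations\<close>

definition taylor_coeff :: "(complex \<Rightarrow> complex) \<Rightarrow> nat \<Rightarrow> complex" where
  "taylor_coeff f n = (deriv ^^ n) f 0 / fact n"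

text \<open>On circles, \<open>f\<close> is an almost periodic function of the angle, with the Taylor coefficients as
  Fourier coefficients, because the power series converges uniformly there.\<close>

lemma circle_function:
  assumes f: "f \<in> Hinf" and z: "z \<in> ball 0 1"
  shows "(\<lambda>t. f (z * cis t)) \<in> AP"
    "ap_coeff \<mu> (\<lambda>t. f (z * cis t)) = (\<Sum>n | real n = \<mu>. taylor_coeff f n * z ^ n)"
proof -
  have hol: "f holomorphic_on ball 0 1" using f by (simp add: Hinf_def)
  have ser: "(\<lambda>n. taylor_coeff f n * w ^ n) sums f w" if "w \<in> ball 0 1" for w
    using holomorphic_power_series[OF hol that] by (simp add: taylor_coeff_def)
  define r where "r = (1 + cmod z) / 2"
  have r: "cmod z < r" "r < 1" using z by (auto simp: r_def)
  then have r0: "0 < r" using norm_ge_zero[of z] by linarith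
  have "summable (\<lambda>n. taylor_coeff f n * (of_real r) ^ n)"
    using ser[of "of_real r"] r r0 by (auto simp: sums_iff)
  then have sm: "summable (\<lambda>n. norm (taylor_coeff f n * z ^ n))"
    by (rule powser_insidea) (use r r0 in simp)
  define S where "S = (\<lambda>N t. \<Sum>n<N. (taylor_coeff f n * z ^ n) * cis (real n * t))"
  have SAP: "S N \<in> AP" for N unfolding S_def by (intro AP_sum AP_cmult AP_cis)
  have ap: "\<exists>N0. \<forall>N\<ge>N0. \<forall>t. cmod (f (z * cis t) - S N t) \<le> e" if e: "e > 0" for e
  proof -
    obtain N0 where N0: "\<And>N. N \<ge> N0 \<Longrightarrow> norm (\<Sum>n. norm (taylor_coeff f (n + N) * z ^ (n + N))) < e"
      using suminf_exist_split[OF e sm] by blast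
    have "cmod (f (z * cis t) - S N t) \<le> e" if "N \<ge> N0" for N t
    proof -
      have eq: "taylor_coeff f n * (z * cis t) ^ n = (taylor_coeff f n * z ^ n) * cis (real n * t)" for n
        by (simp add: power_mult_distrib Complex.DeMoivre)
      have "z * cis t \<in> ball 0 1" using z by (simp add: norm_mult)
      from ser[OF this] have s: "(\<lambda>n. (taylor_coeff f n * z ^ n) * cis (real n * t)) sums f (z * cis t)" by (simp only: eq)
      have "f (z * cis t) - S N t = (\<Sum>n. (taylor_coeff f (n + N) * z ^ (n + N)) * cis (real (n + N) * t))"
        using suminf_minus_initial_segment[of "\<lambda>n. (taylor_coeff f n * z ^ n) * cis (real n * t)" N] s
        by (simp add: sums_iff S_def)
      also have "cmod \<dots> \<le> (\<Sum>n. norm ((taylor_coeff f (n + N) * z ^ (n + N)) * cis (real (n + N) * t)))"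
        by (rule summable_norm) (use summable_ignore_initial_segment[OF sm, of N] in \<open>simp add: norm_mult\<close>)
      also have "\<dots> = (\<Sum>n. norm (taylor_coeff f (n + N) * z ^ (n + N)))" by (simp add: norm_mult)
      also have "\<dots> \<le> e" using N0[OF that] by (simp add: abs_le_iff)
      finally show ?thesis .
    qed
    then show ?thesis by blast
  qed
  show A: "(\<lambda>t. f (z * cis t)) \<in> AP"
  proof (rule AP_uniform_limit)
    fix e :: real assume "e > 0"
    then show "\<exists>g\<in>AP. \<forall>x. cmod (f (z * cis x) - g x) \<le> e" using ap SAP by blast
  qed
  have coS: "ap_coeff \<mu> (S N) = (\<Sum>n | n < N \<and> real n = \<mu>. taylor_coeff f n * z ^ n)" for N
  proof -
    have "ap_coeff \<mu> (S N) = (\<Sum>n<N. (taylor_coeff f n * z ^ n) * (if real n = \<mu> then 1 else 0))"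
    proof -
      have "(\<lambda>x. S N x * cis (- \<mu> * x)) = (\<lambda>x. \<Sum>n<N. (taylor_coeff f n * z ^ n) * cis ((real n - \<mu>) * x))"
        unfolding S_def sum_distrib_right by (intro ext sum.cong refl) (simp add: cis_mult algebra_simps)
      then show ?thesis unfolding ap_coeff_eq
        using ap_mean_lincomb[of "{..<N}" "\<lambda>n x. cis ((real n - \<mu>) * x)" "\<lambda>n. taylor_coeff f n * z ^ n"]
        by (simp add: AP_cis ap_mean_cis)
    qed
    also have "\<dots> = (\<Sum>n\<in>{n\<in>{..<N}. real n = \<mu>}. taylor_coeff f n * z ^ n)"
      unfolding sum.inter_filter[OF finite_lessThan] by (intro sum.cong refl) auto
    finally show ?thesis by simp
  qed
  define M where "M = Suc (nat \<lceil>\<mu>\<rceil>)"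
  have eq: "{n. n < N \<and> real n = \<mu>} = {n. real n = \<mu>}" if N: "N \<ge> M" for N
  proof -
    have "n < N" if "real n = \<mu>" for n using N by (simp add: M_def flip: that)
    then show ?thesis by auto
  qed
  have "cmod (ap_coeff \<mu> (\<lambda>t. f (z * cis t)) - (\<Sum>n | real n = \<mu>. taylor_coeff f n * z ^ n)) \<le> 0"
  proof (rule field_le_epsilon)
    fix e :: real assume "e > 0"
    then obtain N0 where N0: "\<And>N t. N \<ge> N0 \<Longrightarrow> cmod (f (z * cis t) - S N t) \<le> e" using ap by blast
    have "ap_coeff \<mu> (\<lambda>t. f (z * cis t)) - (\<Sum>n | real n = \<mu>. taylor_coeff f n * z ^ n)
      = ap_coeff \<mu> (\<lambda>t. f (z * cis t) - S (max N0 M) t)"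
      unfolding ap_coeff_diff[OF A SAP] coS by (simp add: eq)
    also have "cmod \<dots> \<le> e" by (rule norm_ap_coeff_le[OF AP_diff[OF A SAP] N0]) simp
    finally show "cmod (ap_coeff \<mu> (\<lambda>t. f (z * cis t)) - (\<Sum>n | real n = \<mu>. taylor_coeff f n * z ^ n)) \<le> 0 + e" by simp
  qed
  then show "ap_coeff \<mu> (\<lambda>t. f (z * cis t)) = (\<Sum>n | real n = \<mu>. taylor_coeff f n * z ^ n)" by simp
qed

text \<open>
  The convolution of \<open>f\<close> with \<open>K\<close> on the circle. As a mean over the line it is subject to the results on
  almost periodic functions, and \<open>K\<close> may have frequencies that are not integers.
\<close>

definition smooth_part :: "(real \<Rightarrow> real) \<Rightarrow> (complex \<Rightarrow> complex) \<Rightarrow> complex \<Rightarrow> complex" where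
  "smooth_part K f z = ap_mean (\<lambda>t. f (z * cis t) * of_real (K t))"

lemma smooth_part_polynomial:
  assumes f: "f \<in> Hinf" and z: "z \<in> ball 0 1" and K: "trig_kernel B k K"
  shows "smooth_part K f z = (\<Sum>n | real n \<in> B. k (real n) * taylor_coeff f n * z ^ n)"
proof -
  have B: "finite B" using K by (simp add: trig_kernel_def)
  have "smooth_part K f z = (\<Sum>\<mu>\<in>B. k \<mu> * ap_coeff \<mu> (\<lambda>t. f (z * cis t)))"
    using ap_mean_kernel[OF circle_function(1)[OF f z] K, of 0] by (simp add: smooth_part_def)
  also have "\<dots> = (\<Sum>\<mu>\<in>B. \<Sum>n | real n = \<mu>. k (real n) * taylor_coeff f n * z ^ n)"
    unfolding circle_function(2)[OF f z] sum_distrib_left by (intro sum.cong refl) auto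
  also have "\<dots> = (\<Sum>n\<in>(\<Union>\<mu>\<in>B. {n. real n = \<mu>}). k (real n) * taylor_coeff f n * z ^ n)"
  proof (rule sum.UNION_disjoint[symmetric, OF B])
    show "\<forall>\<mu>\<in>B. finite {n. real n = \<mu>}"
    proof
      fix \<mu> show "finite {n. real n = \<mu>}" by (rule finite_subset[of _ "{nat \<lfloor>\<mu>\<rfloor>}"]) auto
    qed
  qed auto
  also have "(\<Union>\<mu>\<in>B. {n. real n = \<mu>}) = {n. real n \<in> B}" by auto
  finally show ?thesis .
qed

lemma smooth_part_lincomb:
  assumes f: "f \<in> Hinf" and g: "g \<in> Hinf" and z: "z \<in> ball 0 1" and K: "trig_kernel B k K"
  shows "smooth_part K (\<lambda>w. f w + c * g w) z = smooth_part K f z + c * smooth_part K g z"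
proof -
  have 1: "(\<lambda>t. f (z * cis t) * of_real (K t)) \<in> AP" "(\<lambda>t. g (z * cis t) * of_real (K t)) \<in> AP"
    by (intro AP_mult circle_function z f g trig_kernel_AP[OF K])+
  have "(\<lambda>t. (f (z * cis t) + c * g (z * cis t)) * of_real (K t)) = (\<lambda>t. f (z * cis t) * of_real (K t) + c * (g (z * cis t) * of_real (K t)))"
    by (simp add: algebra_simps)
  then show ?thesis unfolding smooth_part_def
    by (simp only: ap_mean_add[OF 1(1) AP_cmult[OF 1(2)]] ap_mean_cmult[OF 1(2)])
qed

lemma smooth_part_bound:
  assumes f: "f \<in> Hinf" and z: "z \<in> ball 0 1" and K: "trig_kernel B k K" and C: "\<And>w. w \<in> ball 0 1 \<Longrightarrow> cmod (f w) \<le> C"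
  shows "cmod (smooth_part K f z) \<le> C"
proof -
  have "cmod (ap_mean (\<lambda>t. f (z * cis (0 + t)) * of_real (K t))) \<le> C"
    by (rule kernel_mean_bound[OF circle_function(1)[OF f z] K]) (use z in \<open>auto intro!: C simp: norm_mult\<close>)
  then show ?thesis by (simp add: smooth_part_def)
qed

lemma Hinf_lincomb: "f \<in> Hinf \<Longrightarrow> g \<in> Hinf \<Longrightarrow> (\<lambda>z. f z + c * g z) \<in> Hinf"
proof -
  assume f: "f \<in> Hinf" and g: "g \<in> Hinf"
  obtain A where A: "\<And>z. cmod (f z) \<le> A" using Hinf_bounded[OF f] by blast
  obtain B where B: "\<And>z. cmod (g z) \<le> B" using Hinf_bounded[OF g] by blast
  have "cmod (f z + c * g z) \<le> A + cmod c * B" for z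
    by (rule order_trans[OF norm_triangle_ineq]) (intro add_mono A, simp add: norm_mult mult_left_mono B)
  then have "bounded ((\<lambda>z. f z + c * g z) ` ball 0 1)" unfolding bounded_iff by blast
  then show ?thesis using f g by (auto simp: Hinf_def intro!: holomorphic_intros)
qed

lemma boundary_values_lincomb:
  assumes "has_boundary_values f b" "has_boundary_values g b'"
  shows "has_boundary_values (\<lambda>z. f z + c * g z) (\<lambda>z. b z + c * b' z)"
  using assms unfolding has_boundary_values_def by eventually_elim (intro tendsto_intros)

lemma boundary_values_rotate:
  assumes bv: "has_boundary_values f b"
  shows "AE t in lebesgue. ((\<lambda>r. f (of_real r * cis t * cis u)) \<longlongrightarrow> b (cis (t + u))) (at_left 1)"
proof -
  have "AE t in lebesgue. ((\<lambda>r. f (of_real r * cis (t + u))) \<longlongrightarrow> b (cis (t + u))) (at_left 1)"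
    using bv unfolding has_boundary_values_def by (rule AE_translate)
  then show ?thesis by (simp add: mult.assoc cis_mult)
qed

text \<open>
  A bounded holomorphic function whose boundary values have small local oscillation is nearly
  invariant under small rotations, by the maximum principle, and is therefore nearly
  reproduced by a kernel concentrated at the identity of the circle.
\<close>

lemma smooth_part_close:
  assumes f: "f \<in> Hinf" and bv: "has_boundary_values f b" and e: "e > 0"
    and nc: "\<And>s. cmod s = 1 \<Longrightarrow> near_const b e s"
  shows "\<exists>\<eta>>0. \<forall>B k K z. trig_kernel B k K \<longrightarrow> Re (ap_mean (\<lambda>t. of_real (K t * (1 - cos (1 * t))))) \<le> \<eta> \<longrightarrow>
    z \<in> ball 0 1 \<longrightarrow> cmod (smooth_part K f z - f z) \<le> 3 * e"
proof -
  obtain C where C: "C > 0" "\<And>z. cmod (f z) \<le> C" using Hinf_bounded[OF f] by blast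
  obtain \<delta>0 where \<delta>0: "\<delta>0 > 0" "\<And>u. \<bar>u\<bar> < \<delta>0 \<Longrightarrow> AE t in lebesgue. cmod (b (cis (t + u)) - b (cis t)) \<le> 2 * e"
    using rotation_oscillation[OF nc] by blast
  define \<delta> where "\<delta> = min \<delta>0 1"
  have \<delta>: "0 < \<delta>" "\<delta> \<le> 1" "\<delta> \<le> \<delta>0" using \<delta>0(1) by (auto simp: \<delta>_def)
  have rot: "cmod (f (z * cis u) - f z) \<le> 2 * e" if u: "\<bar>u\<bar> < \<delta>" and z: "z \<in> ball 0 1" for u z
  proof -
    define g where "g = (\<lambda>z. f (z * cis u) - f z)"
    have hol: "f holomorphic_on ball 0 1" using f by (simp add: Hinf_def)
    have "(f \<circ> (\<lambda>z. z * cis u)) holomorphic_on ball 0 1"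
      by (rule holomorphic_on_compose_gen[OF _ hol]) (auto intro!: holomorphic_intros simp: norm_mult)
    then have "g holomorphic_on ball 0 1" unfolding g_def o_def by (intro holomorphic_intros hol)
    moreover have "cmod (g w) \<le> C + C" for w
      unfolding g_def by (rule order_trans[OF norm_triangle_ineq4]) (intro add_mono C)
    then have "bounded (g ` ball 0 1)" unfolding bounded_iff by blast
    ultimately have "g \<in> Hinf" using f by (auto simp: Hinf_def g_def norm_mult)
    moreover have "has_boundary_values g (\<lambda>z. b (z * cis u) - b z)"
      unfolding has_boundary_values_def g_def
      using boundary_values_rotate[OF bv, of u] bv[unfolded has_boundary_values_def]
      by eventually_elim (simp add: cis_mult tendsto_diff)
    moreover have "AE t in lebesgue. cmod (b (cis t * cis u) - b (cis t)) \<le> 2 * e"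
      using \<delta>0(2)[of u] u \<delta>(3) by (simp add: cis_mult)
    ultimately have "cmod (g z) \<le> 2 * e" using z by (rule boundary_maximum_principle)
    then show ?thesis by (simp add: g_def)
  qed
  have cd: "1 - cos \<delta> > 0"
  proof -
    have "cos \<delta> < cos 0" using \<delta> pi_gt3 by (intro cos_monotone_0_pi) linarith+
    then show ?thesis by simp
  qed
  define A where "A = 2 * C / (1 - cos \<delta>)"
  have A0: "A > 0" using C cd by (simp add: A_def)
  have all: "cmod (f (z * cis t) - f z) \<le> 2 * e + A * (1 - cos (1 * t))" if z: "z \<in> ball 0 1" for t z
  proof -
    obtain j :: int and u where ju: "t = 0 + u + 2 * pi * of_int j" "\<bar>u\<bar> \<le> pi" by (rule angle_near[of t 0])
    have "cis t = cis u * cis (2 * pi * of_int j)" unfolding ju(1) cis_mult by simp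
    then have ct: "cis t = cis u" by (simp only: cis_multiple_2pi Ints_of_int mult_1_right)
    then have cc: "cos t = cos u" by (metis cis.simps(1))
    show ?thesis
    proof (cases "\<bar>u\<bar> < \<delta>")
      case True
      have "0 \<le> A * (1 - cos (1 * t))" using A0 by simp
      then show ?thesis using rot[OF True z] by (simp add: ct)
    next
      case False
      have "cos \<bar>u\<bar> \<le> cos \<delta>" using False ju(2) \<delta> by (intro cos_monotone_0_pi_le) auto
      then have "A * (1 - cos \<delta>) \<le> A * (1 - cos t)" using A0 by (intro mult_left_mono) (auto simp: cc)
      moreover have "A * (1 - cos \<delta>) = 2 * C" using cd by (simp add: A_def)
      moreover have "cmod (f (z * cis t) - f z) \<le> C + C" by (rule order_trans[OF norm_triangle_ineq4]) (intro add_mono C)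
      ultimately show ?thesis using e by simp
    qed
  qed
  have "cmod (smooth_part K f z - f z) \<le> 3 * e"
    if K: "trig_kernel B k K" and conc: "Re (ap_mean (\<lambda>t. of_real (K t * (1 - cos (1 * t))))) \<le> e / A" and z: "z \<in> ball 0 1" for B k K z
  proof -
    have "cmod (smooth_part K f z - f z) \<le> 2 * e + A * (e / A)"
      unfolding smooth_part_def
      by (rule kernel_mean_close[OF circle_function(1)[OF f z] K all[OF z] _ conc]) (use A0 in simp)
    then show ?thesis using A0 by simp
  qed
  then show ?thesis using e A0 by (intro exI[of _ "e / A"]) auto
qed

section \<open>Separating the edge functions\<close>

definition edge_fun :: "complex \<Rightarrow> (complex \<Rightarrow> complex) \<Rightarrow> complex \<Rightarrow> complex" where
  "edge_fun s f = (THE g. \<exists>b. has_boundary_values f b \<and> is_edge s b g)"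

text \<open>
  The coefficients of the upper edge function are determined by these, by \<open>edge_coefficient_relation\<close>.
\<close>

definition edge_coeff :: "complex \<Rightarrow> real \<Rightarrow> (complex \<Rightarrow> complex) \<Rightarrow> complex" where
  "edge_coeff s \<mu> f = ap_coeff \<mu> (lower_edge (edge_fun s f))"

text \<open>
  The approximating operators are linear on the following space, which is larger than the algebra
  and on which linearity is immediate: all that matters is that boundary values and edge functions
  exist.
\<close>

definition Hinf_edges :: "complex set \<Rightarrow> (complex \<Rightarrow> complex) set" where
  "Hinf_edges F = {f \<in> Hinf. \<exists>b. has_boundary_values f b \<and> (\<forall>s\<in>F. \<exists>g. is_edge s b g)}"

lemma boundary_values_unique:
  assumes "has_boundary_values f b" "has_boundary_values f b'"
  shows "AE t in lebesgue. b (cis t) = b' (cis t)"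
  using assms unfolding has_boundary_values_def
  by eventually_elim (rule tendsto_unique[OF trivial_limit_at_left_real])

lemma edge_fun_eq:
  assumes s: "cmod s = 1" and b: "has_boundary_values f b" and g: "is_edge s b g"
  shows "edge_fun s f = g"
  unfolding edge_fun_def
proof (rule the_equality)
  show "\<exists>b. has_boundary_values f b \<and> is_edge s b g" using b g by blast
  fix g' assume "\<exists>b. has_boundary_values f b \<and> is_edge s b g'"
  then obtain b' where b': "has_boundary_values f b'" "is_edge s b' g'" by blast
  have "is_edge s b g'" by (rule is_edge_cong[OF b'(2) boundary_values_unique[OF b'(1) b]])
  then show "g' = g" using is_edge_unique[OF s] g by blast
qed

lemma Hinf_edges_lincomb:
  assumes F: "F \<subseteq> sphere 0 1" and f: "f \<in> Hinf_edges F" and g: "g \<in> Hinf_edges F"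
  shows "(\<lambda>z. f z + c * g z) \<in> Hinf_edges F"
    "s \<in> F \<Longrightarrow> edge_coeff s \<mu> (\<lambda>z. f z + c * g z) = edge_coeff s \<mu> f + c * edge_coeff s \<mu> g"
proof -
  obtain b where b: "f \<in> Hinf" "has_boundary_values f b" "\<And>s. s \<in> F \<Longrightarrow> \<exists>h. is_edge s b h"
    using f by (auto simp: Hinf_edges_def)
  obtain b' where b': "g \<in> Hinf" "has_boundary_values g b'" "\<And>s. s \<in> F \<Longrightarrow> \<exists>h. is_edge s b' h"
    using g by (auto simp: Hinf_edges_def)
  note bv = boundary_values_lincomb[OF b(2) b'(2), of c]
  show "(\<lambda>z. f z + c * g z) \<in> Hinf_edges F"
    unfolding Hinf_edges_def
  proof (intro CollectI conjI exI[of _ "\<lambda>z. b z + c * b' z"])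
    show "(\<lambda>z. f z + c * g z) \<in> Hinf" by (rule Hinf_lincomb[OF b(1) b'(1)])
    show "has_boundary_values (\<lambda>z. f z + c * g z) (\<lambda>z. b z + c * b' z)" by (rule bv)
    show "\<forall>s\<in>F. \<exists>g. is_edge s (\<lambda>z. b z + c * b' z) g"
    proof
      fix s assume s: "s \<in> F"
      obtain h where h: "is_edge s b h" using b(3)[OF s] by blast
      obtain h' where h': "is_edge s b' h'" using b'(3)[OF s] by blast
      show "\<exists>g. is_edge s (\<lambda>z. b z + c * b' z) g" using is_edge_lincomb[OF h h'] by blast
    qed
  qed
  assume s: "s \<in> F"
  then have s1: "cmod s = 1" using F by auto
  obtain h h' where h: "is_edge s b h" "is_edge s b' h'" using b(3) b'(3) s by blast
  have "lower_edge (\<lambda>z. h z + c * h' z) = (\<lambda>x. lower_edge h x + c * lower_edge h' x)" by (auto simp: lower_edge_def)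
  then show "edge_coeff s \<mu> (\<lambda>z. f z + c * g z) = edge_coeff s \<mu> f + c * edge_coeff s \<mu> g"
    unfolding edge_coeff_def edge_fun_eq[OF s1 bv is_edge_lincomb[OF h]] edge_fun_eq[OF s1 b(2) h(1)] edge_fun_eq[OF s1 b'(2) h(2)]
    using ap_coeff_add[OF is_edge_AP(1)[OF h(1)] AP_cmult[OF is_edge_AP(1)[OF h(2)]]] ap_coeff_cmult[OF is_edge_AP(1)[OF h(2)]]
    by simp
qed

lemma boundary_values_bound:
  assumes "has_boundary_values f b" "\<And>z. z \<in> ball 0 1 \<Longrightarrow> cmod (f z) \<le> C"
  shows "AE t in lebesgue. cmod (b (cis t)) \<le> C"
  using assms(1) unfolding has_boundary_values_def
proof eventually_elim
  case (elim t)
  have "\<forall>\<^sub>F r::real in at_left 1. r \<in> {0<..<1}" by (rule eventually_at_left_real) simp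
  then have "\<forall>\<^sub>F r in at_left 1. cmod (f (of_real r * cis t)) \<le> C"
    by eventually_elim (rule assms(2), simp add: norm_mult)
  then show ?case using tendsto_upperbound[OF tendsto_norm[OF elim] _ trivial_limit_at_left_real] by blast
qed

text \<open>On the circle, a kernel sum over \<open>strip_exp\<close> is the kernel mean of one of the edge functions;
  on the upper edge this uses the relation between the coefficients of the two edges.\<close>

lemma kernel_sum_on_circle:
  assumes f: "f \<in> Hinf" and bv: "has_boundary_values f b" and s: "cmod s = 1" and g: "is_edge s b g"
    and z: "cmod z = 1" "z \<noteq> s" "z \<noteq> - s"
  defines "x \<equiv> ln \<bar>Re (phi_map s z)\<bar>"
  shows "(\<Sum>\<mu>\<in>B. k \<mu> * edge_coeff s \<mu> f * strip_exp s \<mu> z) =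
    (if Re (phi_map s z) > 0 then \<Sum>\<mu>\<in>B. k \<mu> * ap_coeff \<mu> (lower_edge g) * cis (\<mu> * x)
     else \<Sum>\<mu>\<in>B. k \<mu> * ap_coeff \<mu> (upper_edge g) * cis (\<mu> * x))"
    "L_map s g z = (if Re (phi_map s z) > 0 then lower_edge g x else upper_edge g x)"
proof -
  have nz: "phi_map s z \<noteq> 0" by (rule phi_map_nonzero[OF z(2,3)])
  have r: "Re (phi_map s z) \<noteq> 0" by (rule Ln_phi_map_circle(2)[OF s z])
  note Ln = Ln_phi_map_circle(3)[OF s z]
  have A: "edge_coeff s \<mu> f = ap_coeff \<mu> (lower_edge g)" for \<mu>
    by (simp add: edge_coeff_def edge_fun_eq[OF s bv g])
  show "L_map s g z = (if Re (phi_map s z) > 0 then lower_edge g x else upper_edge g x)"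
    unfolding L_map_circle[OF s z] x_def by simp
  show "(\<Sum>\<mu>\<in>B. k \<mu> * edge_coeff s \<mu> f * strip_exp s \<mu> z) =
    (if Re (phi_map s z) > 0 then \<Sum>\<mu>\<in>B. k \<mu> * ap_coeff \<mu> (lower_edge g) * cis (\<mu> * x)
     else \<Sum>\<mu>\<in>B. k \<mu> * ap_coeff \<mu> (upper_edge g) * cis (\<mu> * x))"
  proof (cases "Re (phi_map s z) > 0")
    case True
    then have "strip_exp s \<mu> z = cis (\<mu> * x)" for \<mu>
      using nz Ln by (simp add: strip_exp_def x_def cis_conv_exp mult.assoc)
    then show ?thesis using True by (simp add: A)
  next
    case False
    have "edge_coeff s \<mu> f * strip_exp s \<mu> z = ap_coeff \<mu> (upper_edge g) * cis (\<mu> * x)" for \<mu>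
    proof -
      have "\<i> * of_real \<mu> * (of_real x + \<i> * of_real pi) = of_real (- (\<mu> * pi)) + \<i> * of_real (\<mu> * x)"
        by (simp add: algebra_simps)
      then have "exp (\<i> * of_real \<mu> * (of_real x + \<i> * of_real pi)) = of_real (exp (- (\<mu> * pi))) * cis (\<mu> * x)"
        by (simp only: exp_add cis_conv_exp exp_of_real)
      then have "strip_exp s \<mu> z = of_real (exp (- (\<mu> * pi))) * cis (\<mu> * x)"
        using nz Ln False r by (simp add: strip_exp_def x_def)
      moreover have "edge_coeff s \<mu> f = of_real (exp (\<mu> * pi)) * ap_coeff \<mu> (upper_edge g)"
        unfolding A by (rule edge_coefficient_relation[OF f bv s g])
      moreover have "complex_of_real (exp (\<mu> * pi)) * of_real (exp (- (\<mu> * pi))) = 1"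
        by (simp add: exp_minus flip: of_real_mult)
      ultimately show ?thesis by (simp add: mult_ac)
    qed
    then show ?thesis using False by (simp add: mult.assoc)
  qed
qed

text \<open>
  On the boundary the sum is a kernel mean of an edge function and hence bounded by \<open>C\<close>; the maximum principle carries
  this bound into the disk.
\<close>

lemma kernel_sum_bound:
  assumes s: "cmod s = 1" and f: "f \<in> Hinf" and bv: "has_boundary_values f b" and g: "is_edge s b g"
    and K: "trig_kernel B k K" and C: "\<And>w. w \<in> ball 0 1 \<Longrightarrow> cmod (f w) \<le> C" and z: "z \<in> ball 0 1"
  shows "cmod (\<Sum>\<mu>\<in>B. k \<mu> * edge_coeff s \<mu> f * strip_exp s \<mu> z) \<le> C"
proof -
  define u where "u = (\<lambda>z. \<Sum>\<mu>\<in>B. k \<mu> * edge_coeff s \<mu> f * strip_exp s \<mu> z)"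
  have ss: "{s, - s} \<subseteq> sphere 0 1" using s by auto
  have "continuous_on (cball 0 1 - {s, - s}) u"
    unfolding u_def by (intro continuous_on_sum continuous_on_mult_left strip_exp_continuous s)
  moreover have "u holomorphic_on ball 0 1"
    unfolding u_def by (intro holomorphic_intros strip_exp_holomorphic s)
  moreover have "cmod (u z) \<le> (\<Sum>\<mu>\<in>B. cmod (k \<mu> * edge_coeff s \<mu> f) * exp (\<bar>\<mu>\<bar> * pi))" for z
    unfolding u_def by (rule sum_norm_le) (unfold norm_mult[of "_ * _"], intro mult_left_mono norm_strip_exp_le, simp)
  ultimately have H: "(\<lambda>z. if z \<in> ball 0 1 then u z else 0) \<in> Hinf" "has_boundary_values (\<lambda>z. if z \<in> ball 0 1 then u z else 0) u"
    using Hinf_of_boundary_continuous[of "{s, - s}" u] ss by auto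
  have bC: "AE t in lebesgue. cmod (b (cis t)) \<le> C" by (rule boundary_values_bound[OF bv C])
  have "AE t in lebesgue. cis t \<notin> {s, - s}" by (rule AE_cis_notin) simp
  then have "AE t in lebesgue. cmod (u (cis t)) \<le> C"
  proof eventually_elim
    case (elim t)
    have "cmod (\<Sum>\<mu>\<in>B. k \<mu> * ap_coeff \<mu> h * cis (\<mu> * x)) \<le> C" if "h \<in> AP" "\<And>x. cmod (h x) \<le> C" for h x
      using kernel_mean_bound[OF that(1) K that(2), of x] ap_mean_kernel[OF that(1) K, of x] by simp
    then show ?case unfolding u_def using kernel_sum_on_circle(1)[OF f bv s g, of "cis t" k B] elim
      edge_bound[OF s g bC] is_edge_AP[OF g] by auto
  qed
  from boundary_maximum_principle[OF H this z] show ?thesis using z by (simp add: u_def)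
qed

text \<open>
  At most one of the peaks is centred close to \<open>z\<close>, and the others are as small there as required if \<open>p\<close> is large.
\<close>

lemma peak_sum_bound:
  assumes F: "finite F" "F \<subseteq> sphere 0 1"
  shows "\<exists>p>0. \<forall>z. cmod z \<le> 1 \<longrightarrow> (\<Sum>s\<in>F. cmod (peak s p z)) \<le> 2"
proof -
  \<comment> \<open>at most half the distance of any two points of \<open>F\<close>, so that at most one of them is closer than \<open>d\<close> to \<open>z\<close>\<close>
  define d where "d = Min (insert 1 ((\<lambda>(s, s'). dist s s' / 2) ` {(s, s') \<in> F \<times> F. s \<noteq> s'}))"
  have fin: "finite {(s, s') \<in> F \<times> F. s \<noteq> s'}" by (rule finite_subset[of _ "F \<times> F"]) (use F in auto)
  have d0: "d > 0" unfolding d_def using fin by (subst Min_gr_iff) auto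
  have d1: "d \<le> 1" unfolding d_def using fin by (intro Min_le) auto
  have dle: "d \<le> dist s s' / 2" if "s \<in> F" "s' \<in> F" "s \<noteq> s'" for s s'
    unfolding d_def using fin that by (intro Min_le) (auto intro!: image_eqI[of _ _ "(s, s')"])
  \<comment> \<open>the square of the bound for the base of a peak at distance \<open>d\<close> from its centre\<close>
  define q where "q = 1 - d\<^sup>2 / 4"
  have "d\<^sup>2 \<le> 1" using d0 d1 by (simp add: power_le_one)
  then have q: "0 \<le> q" "q < 1" using d0 by (auto simp: q_def)
  obtain n where n: "q ^ n < 1 / (real (card F) + 1)" using real_arch_pow_inv[of "1 / (real (card F) + 1)" q] q by auto
  define m where "m = Suc n"
  have "q ^ m \<le> q ^ n" using q by (simp add: m_def mult_left_le_one_le)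
  then have m: "q ^ m * (real (card F) + 1) \<le> 1" using n by (simp add: pos_less_divide_eq) (smt (verit) mult_right_mono of_nat_0_le_iff)
  have "(\<Sum>s\<in>F. cmod (peak s (2 * m) z)) \<le> 2" if z: "cmod z \<le> 1" for z
  proof -
    have le1: "cmod (peak s (2 * m) z) \<le> 1" if "s \<in> F" for s using norm_peak_le[OF _ z] F that by auto
    have far: "cmod (peak s (2 * m) z) \<le> q ^ m" if "s \<in> F" "d \<le> dist z s" for s
      unfolding q_def by (rule norm_peak_far[OF _ z that(2)]) (use F that d0 in auto)
    have card: "real (card A) * q ^ m \<le> 1" if "A \<subseteq> F" for A
    proof -
      have "real (card A) * q ^ m \<le> (real (card F) + 1) * q ^ m"
        using card_mono[OF F(1) that] q by (intro mult_right_mono) auto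
      then show ?thesis using m by (simp add: mult.commute)
    qed
    show ?thesis
    proof (cases "\<exists>s\<in>F. dist z s < d")
      case True
      then obtain s where s: "s \<in> F" "dist z s < d" by blast
      have "(\<Sum>s\<in>F. cmod (peak s (2 * m) z)) = cmod (peak s (2 * m) z) + (\<Sum>s\<in>F - {s}. cmod (peak s (2 * m) z))"
        by (rule sum.remove[OF F(1) s(1)])
      also have "\<dots> \<le> 1 + (\<Sum>s\<in>F - {s}. q ^ m)"
      proof (intro add_mono le1 s sum_mono far)
        fix s' assume s': "s' \<in> F - {s}"
        then show "s' \<in> F" by simp
        show "d \<le> dist z s'" using dle[of s s'] s s' dist_triangle[of s s' z] by (auto simp: dist_commute)
      qed
      also have "\<dots> \<le> 1 + 1" using card[of "F - {s}"] by simp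
      finally show ?thesis by simp
    next
      case False
      then have "(\<Sum>s\<in>F. cmod (peak s (2 * m) z)) \<le> (\<Sum>s\<in>F. q ^ m)" by (intro sum_mono far) auto
      also have "\<dots> \<le> 2" using card[of F] by simp
      finally show ?thesis .
    qed
  qed
  then show ?thesis by (intro exI[of _ "2 * m"]) (auto simp: m_def)
qed

section \<open>The approximating operators\<close>

definition edge_part :: "complex set \<Rightarrow> nat \<Rightarrow> real set \<Rightarrow> (real \<Rightarrow> complex) \<Rightarrow> (complex \<Rightarrow> complex) \<Rightarrow> complex \<Rightarrow> complex" where
  "edge_part F p B k f z = (if z \<in> ball 0 1 then edge_sum F p B (\<lambda>s \<mu>. k \<mu> * edge_coeff s \<mu> f) z else 0)"

lemma edge_part_Hinf:
  assumes F: "finite F" "F \<subseteq> sphere 0 1" and p: "p > 0"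
  shows "edge_part F p B k f \<in> Hinf"
    "has_boundary_values (edge_part F p B k f) (edge_sum F p B (\<lambda>s \<mu>. k \<mu> * edge_coeff s \<mu> f))"
proof -
  have bd: "cmod (edge_sum F p B c z) \<le> (\<Sum>s\<in>F. \<Sum>\<mu>\<in>B. cmod (c s \<mu>) * exp (\<bar>\<mu>\<bar> * pi))" if "z \<in> ball 0 1" for c z
    by (rule norm_edge_sum_le[OF F(2)]) (use that in simp)
  note H = Hinf_of_boundary_continuous[OF F edge_sum_continuous[OF F(2) p] edge_sum_holomorphic[OF F(2)] bd]
  have eq: "edge_part F p B k f = (\<lambda>z. if z \<in> ball 0 1 then edge_sum F p B (\<lambda>s \<mu>. k \<mu> * edge_coeff s \<mu> f) z else 0)"
    by (rule ext) (simp add: edge_part_def)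
  show "edge_part F p B k f \<in> Hinf"
    "has_boundary_values (edge_part F p B k f) (edge_sum F p B (\<lambda>s \<mu>. k \<mu> * edge_coeff s \<mu> f))"
    unfolding eq by (rule H; assumption)+
qed

lemma edge_part_bound:
  assumes F: "finite F" "F \<subseteq> sphere 0 1" and f: "f \<in> Hinf_edges F" and K: "trig_kernel B k K"
    and p: "\<And>z. cmod z \<le> 1 \<Longrightarrow> (\<Sum>s\<in>F. cmod (peak s p z)) \<le> 2"
    and C: "\<And>w. w \<in> ball 0 1 \<Longrightarrow> cmod (f w) \<le> C"
  shows "cmod (edge_part F p B k f z) \<le> 2 * C"
proof (cases "z \<in> ball 0 1")
  case True
  have C0: "0 \<le> C" using order_trans[OF norm_ge_zero C[OF True]] .
  obtain b where b: "f \<in> Hinf" "has_boundary_values f b" "\<And>s. s \<in> F \<Longrightarrow> \<exists>g. is_edge s b g"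
    using f by (auto simp: Hinf_edges_def)
  have "edge_part F p B k f z = (\<Sum>s\<in>F. peak s p z * (\<Sum>\<mu>\<in>B. k \<mu> * edge_coeff s \<mu> f * strip_exp s \<mu> z))"
    using True by (simp add: edge_part_def edge_sum_def sum_distrib_left mult_ac)
  also have "cmod \<dots> \<le> (\<Sum>s\<in>F. cmod (peak s p z) * C)"
  proof (rule sum_norm_le)
    fix s assume s: "s \<in> F"
    then obtain g where g: "is_edge s b g" using b(3) by blast
    have "cmod s = 1" using s F by auto
    from kernel_sum_bound[OF this b(1,2) g K C True]
    show "cmod (peak s p z * (\<Sum>\<mu>\<in>B. k \<mu> * edge_coeff s \<mu> f * strip_exp s \<mu> z)) \<le> cmod (peak s p z) * C"
      unfolding norm_mult[of "peak s p z"] by (rule mult_left_mono[OF _ norm_ge_zero])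
  qed
  also have "\<dots> = (\<Sum>s\<in>F. cmod (peak s p z)) * C" by (simp add: sum_distrib_right)
  also have "\<dots> \<le> 2 * C" by (rule mult_right_mono[OF p C0]) (use True in simp)
  finally show ?thesis .
next
  case False
  have "0 \<le> C" using order_trans[OF norm_ge_zero C[of 0]] by simp
  then show ?thesis using False by (simp add: edge_part_def)
qed

lemma edge_part_lincomb:
  assumes F: "F \<subseteq> sphere 0 1" and f: "f \<in> Hinf_edges F" and g: "g \<in> Hinf_edges F"
  shows "edge_part F p B k (\<lambda>z. f z + c * g z) z = edge_part F p B k f z + c * edge_part F p B k g z"
proof (cases "z \<in> ball 0 1")
  case True
  have "edge_part F p B k (\<lambda>z. f z + c * g z) z =
    (\<Sum>s\<in>F. \<Sum>\<mu>\<in>B. (k \<mu> * (edge_coeff s \<mu> f + c * edge_coeff s \<mu> g)) * (peak s p z * strip_exp s \<mu> z))"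
    using True unfolding edge_part_def edge_sum_def
    by (simp add: Hinf_edges_lincomb(2)[OF F f g])
  also have "\<dots> = edge_part F p B k f z + c * edge_part F p B k g z"
    using True unfolding edge_part_def edge_sum_def
    by (simp add: sum_distrib_left algebra_simps sum.distrib)
  finally show ?thesis .
qed (simp add: edge_part_def)

text \<open>
  Away from \<open>F\<close> the edge part is continuous and the function itself oscillates little. At a point
  of \<open>F\<close> both are close, up to a constant, to the same edge function.
\<close>

lemma remainder_near_const:
  assumes F: "finite F" "F \<subseteq> sphere 0 1" and p: "p > 0" and e: "e > 0" and s: "cmod s = 1"
    and f: "f \<in> Hinf" and bv: "has_boundary_values f b"
    and off: "s \<notin> F \<Longrightarrow> near_const b e s"
    and g: "s \<in> F \<Longrightarrow> is_edge s b g"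
    and lo: "\<And>x. s \<in> F \<Longrightarrow> cmod ((\<Sum>\<mu>\<in>B. k \<mu> * ap_coeff \<mu> (lower_edge g) * cis (\<mu> * x)) - lower_edge g x) \<le> e"
    and up: "\<And>x. s \<in> F \<Longrightarrow> cmod ((\<Sum>\<mu>\<in>B. k \<mu> * ap_coeff \<mu> (upper_edge g) * cis (\<mu> * x)) - upper_edge g x) \<le> e"
  shows "near_const (\<lambda>z. b z - edge_sum F p B (\<lambda>s \<mu>. k \<mu> * edge_coeff s \<mu> f) z) (3 * e) s"
proof -
  define c where "c = (\<lambda>s \<mu>. k \<mu> * edge_coeff s \<mu> f)"
  define c' where "c' = (\<lambda>\<mu>. if s \<in> F then c s \<mu> else 0)"
  define c0 where "c0 = edge_sum (F - {s}) p B c s"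
  have lim: "((\<lambda>z. edge_sum F p B c z - L_map s (exp_edge B c' c0) z) \<longlongrightarrow> 0) (at s within sphere 0 1)"
    using edge_sum_limit[OF F p s, of "\<lambda>_. 0" B c] unfolding c'_def c0_def by simp
  have nc: "near_const (\<lambda>z. edge_sum F p B c z - L_map s (exp_edge B c' c0) z) e s"
    by (rule near_constI_limit[OF lim e])
  have off': "AE t in lebesgue. cis t \<notin> {s, - s}" by (rule AE_cis_notin) simp
  show ?thesis
  proof (cases "s \<in> F")
    case True
    have "near_const (\<lambda>z. b z - L_map s g z) e s"
    proof -
      obtain \<rho> where \<rho>: "\<rho> > 0" "AE t in lebesgue. dist (cis t) s < \<rho> \<longrightarrow> cmod (b (cis t) - L_map s g (cis t)) < e"
        using g[OF True] e unfolding is_edge_def ess_continuous_zero_at_def by blast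
      have "AE t in lebesgue. dist (cis t) s < \<rho> \<longrightarrow> cmod (b (cis t) - L_map s g (cis t) - 0) \<le> e"
        using \<rho>(2) by eventually_elim auto
      then show ?thesis using \<rho>(1) unfolding near_const_def by blast
    qed
    moreover have "near_const (\<lambda>z. L_map s g z - L_map s (exp_edge B c' c0) z) e s"
    proof -
      have "AE t in lebesgue. dist (cis t) s < 1 \<longrightarrow> cmod (L_map s g (cis t) - L_map s (exp_edge B c' c0) (cis t) - (- c0)) \<le> e"
        using off'
      proof eventually_elim
        case (elim t)
        have t: "cmod (cis t) = 1" "cis t \<noteq> s" "cis t \<noteq> - s" using elim by auto
        define x where "x = ln \<bar>Re (phi_map s (cis t))\<bar>"
        note KS = kernel_sum_on_circle(1)[OF f bv s g[OF True] t, of k B, folded x_def]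
          kernel_sum_on_circle(2)[OF f bv s g[OF True] t, folded x_def]
        have "L_map s (exp_edge B c' c0) (cis t) = c0 + (\<Sum>\<mu>\<in>B. k \<mu> * edge_coeff s \<mu> f * strip_exp s \<mu> (cis t))"
          unfolding L_map_exp_edge[OF s t] by (simp add: c'_def c_def True)
        then have "cmod (L_map s g (cis t) - L_map s (exp_edge B c' c0) (cis t) - (- c0)) =
          cmod ((\<Sum>\<mu>\<in>B. k \<mu> * edge_coeff s \<mu> f * strip_exp s \<mu> (cis t)) - L_map s g (cis t))"
          by (simp add: norm_minus_commute algebra_simps)
        also have "\<dots> \<le> e" unfolding KS using lo[OF True, of x] up[OF True, of x] by (auto split: if_split)
        finally show ?case by blast
      qed
      then show ?thesis unfolding near_const_def by (intro exI[of _ "- c0"] exI[of _ 1]) simp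
    qed
    ultimately have "near_const (\<lambda>z. b z - L_map s g z - (edge_sum F p B c z - L_map s (exp_edge B c' c0) z - (L_map s g z - L_map s (exp_edge B c' c0) z))) (e + (e + e)) s"
      by (intro near_const_diff nc)
    then show ?thesis by (simp add: c_def algebra_simps)
  next
    case False
    have zero: "L_map s (exp_edge B c' c0) (cis t) = c0" if "cis t \<notin> {s, - s}" for t
      using L_map_exp_edge[OF s, of "cis t" B c' c0] that False by (simp add: c'_def)
    have "near_const (\<lambda>z. b z - (edge_sum F p B c z - L_map s (exp_edge B c' c0) z)) (e + e) s"
      by (rule near_const_diff[OF off[OF False] nc])
    then obtain d \<rho> where d: "\<rho> > 0" "AE t in lebesgue. dist (cis t) s < \<rho> \<longrightarrow>
        cmod (b (cis t) - (edge_sum F p B c (cis t) - L_map s (exp_edge B c' c0) (cis t)) - d) \<le> e + e"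
      unfolding near_const_def by blast
    have "AE t in lebesgue. dist (cis t) s < \<rho> \<longrightarrow> cmod (b (cis t) - edge_sum F p B c (cis t) - (d - c0)) \<le> 3 * e"
      using d(2) off'
    proof eventually_elim
      case (elim t)
      have "b (cis t) - (edge_sum F p B c (cis t) - L_map s (exp_edge B c' c0) (cis t)) - d
        = b (cis t) - edge_sum F p B c (cis t) - (d - c0)" unfolding zero[OF elim(2)] by (simp add: algebra_simps)
      from elim(1)[unfolded this] show ?case using e by linarith
    qed
    then show ?thesis using d(1) unfolding near_const_def c_def by blast
  qed
qed

text \<open>
  Only the remainder is smoothed. Smoothing by rotations would destroy the edge part, which has no limit at the points of \<open>F\<close>.
\<close>

definition approximant ::
  "complex set \<Rightarrow> nat \<Rightarrow> real set \<Rightarrow> (real \<Rightarrow> complex) \<Rightarrow> (real \<Rightarrow> real) \<Rightarrow> (complex \<Rightarrow> complex) \<Rightarrow> complex \<Rightarrow> complex" where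
  "approximant F p B k K f z = (if z \<in> ball 0 1 then
     smooth_part K (\<lambda>w. f w + (-1) * edge_part F p B k f w) z + edge_part F p B k f z else 0)"

lemma remainder_Hinf:
  assumes F: "finite F" "F \<subseteq> sphere 0 1" and p: "p > 0" and f: "f \<in> Hinf_edges F"
  shows "(\<lambda>w. f w + (-1) * edge_part F p B k f w) \<in> Hinf"
  using f by (intro Hinf_lincomb edge_part_Hinf F p) (simp add: Hinf_edges_def)

lemma approximant_lincomb:
  assumes F: "finite F" "F \<subseteq> sphere 0 1" and p: "p > 0" and K: "trig_kernel B' k' K"
    and f: "f \<in> Hinf_edges F" and g: "g \<in> Hinf_edges F"
  shows "approximant F p B k K (\<lambda>z. f z + c * g z) z = approximant F p B k K f z + c * approximant F p B k K g z"
proof (cases "z \<in> ball 0 1")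
  case True
  have "(\<lambda>w. f w + c * g w + (-1) * edge_part F p B k (\<lambda>z. f z + c * g z) w) =
    (\<lambda>w. (f w + (-1) * edge_part F p B k f w) + c * (g w + (-1) * edge_part F p B k g w))"
    unfolding edge_part_lincomb[OF F(2) f g] by (simp add: algebra_simps)
  then have "approximant F p B k K (\<lambda>z. f z + c * g z) z =
    smooth_part K (\<lambda>w. (f w + (-1) * edge_part F p B k f w) + c * (g w + (-1) * edge_part F p B k g w)) z
    + (edge_part F p B k f z + c * edge_part F p B k g z)"
    using True unfolding approximant_def edge_part_lincomb[OF F(2) f g] by simp
  also have "\<dots> = approximant F p B k K f z + c * approximant F p B k K g z"
    unfolding smooth_part_lincomb[OF remainder_Hinf[OF F p f] remainder_Hinf[OF F p g] True K]
    using True by (simp add: approximant_def algebra_simps)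
  finally show ?thesis .
qed (simp add: approximant_def)

lemma approximant_bound:
  assumes F: "finite F" "F \<subseteq> sphere 0 1" and p: "p > 0" "\<And>z. cmod z \<le> 1 \<Longrightarrow> (\<Sum>s\<in>F. cmod (peak s p z)) \<le> 2"
    and K: "trig_kernel B k K" "trig_kernel B' k' K'" and f: "f \<in> Hinf_edges F"
    and C: "\<And>w. w \<in> ball 0 1 \<Longrightarrow> cmod (f w) \<le> C" and z: "z \<in> ball 0 1"
  shows "cmod (approximant F p B k K' f z) \<le> 5 * C"
proof -
  have E: "cmod (edge_part F p B k f w) \<le> 2 * C" for w by (rule edge_part_bound[OF F f K(1) p(2) C])
  have "cmod (f w + (-1) * edge_part F p B k f w) \<le> 3 * C" if "w \<in> ball 0 1" for w
    using norm_triangle_ineq4[of "f w" "edge_part F p B k f w"] E[of w] C[OF that] by simp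
  from smooth_part_bound[OF remainder_Hinf[OF F p(1) f] z K(2) this]
  have "cmod (smooth_part K' (\<lambda>w. f w + (-1) * edge_part F p B k f w) z) \<le> 3 * C" .
  then show ?thesis using z norm_triangle_ineq[of "smooth_part K' (\<lambda>w. f w + (-1) * edge_part F p B k f w) z" "edge_part F p B k f z"] E[of z]
    unfolding approximant_def by simp
qed

lemma approximant_eq:
  assumes F: "finite F" "F \<subseteq> sphere 0 1" and p: "p > 0" and K: "trig_kernel B' k' K" and f: "f \<in> Hinf_edges F"
  shows "approximant F p B k K f = (\<lambda>z. if z \<in> ball 0 1 then
    (\<Sum>n | real n \<in> B'. k' (real n) * taylor_coeff (\<lambda>w. f w + (-1) * edge_part F p B k f w) n * z ^ n) +
    edge_sum F p B (\<lambda>s \<mu>. k \<mu> * edge_coeff s \<mu> f) z else 0)"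
  unfolding approximant_def
  by (intro ext if_cong refl) (simp only: smooth_part_polynomial[OF remainder_Hinf[OF F p f] _ K], simp add: edge_part_def)

lemma sum_of_functions: "(\<Sum>x\<in>A. g x) z = (\<Sum>x\<in>A. g x z)"
  for g :: "'a \<Rightarrow> 'b \<Rightarrow> 'c::comm_monoid_add"
  by (induction A rule: infinite_finite_induct) auto

lemma approximant_in_span:
  assumes F: "finite F" "F \<subseteq> sphere 0 1" and p: "p > 0" and K: "trig_kernel B' k' K" and f: "f \<in> Hinf_edges F"
  shows "approximant F p B k K f \<in> module.span scale_fun
    ((\<lambda>n z. if z \<in> ball 0 1 then z ^ n else 0) ` {n. real n \<in> B'} \<union>
     (\<lambda>(s, \<mu>) z. if z \<in> ball 0 1 then peak s p z * strip_exp s \<mu> z else 0) ` (F \<times> B))"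
proof -
  interpret V: vector_space scale_fun by (rule vector_space_scale_fun)
  define u where "u = (\<lambda>n z::complex. if z \<in> ball 0 1 then z ^ n else 0)"
  define v where "v = (\<lambda>s \<mu> z. if z \<in> ball 0 1 then peak s p z * strip_exp s \<mu> z else 0)"
  define a where "a = (\<lambda>n. k' (real n) * taylor_coeff (\<lambda>w. f w + (-1) * edge_part F p B k f w) n)"
  define c where "c = (\<lambda>s \<mu>. k \<mu> * edge_coeff s \<mu> f)"
  have "approximant F p B k K f = (\<Sum>n | real n \<in> B'. scale_fun (a n) (u n)) + (\<Sum>s\<in>F. \<Sum>\<mu>\<in>B. scale_fun (c s \<mu>) (v s \<mu>))"
    unfolding approximant_eq[OF F p K f]
    by (rule ext) (simp add: sum_of_functions scale_fun_def u_def v_def a_def c_def edge_sum_def)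
  moreover have "scale_fun (a n) (u n) \<in> V.span (u ` {n. real n \<in> B'} \<union> (\<lambda>(s, \<mu>). v s \<mu>) ` (F \<times> B))" if "real n \<in> B'" for n
    by (intro V.span_scale V.span_base) (use that in auto)
  moreover have "scale_fun (c s \<mu>) (v s \<mu>) \<in> V.span (u ` {n. real n \<in> B'} \<union> (\<lambda>(s, \<mu>). v s \<mu>) ` (F \<times> B))" if "s \<in> F" "\<mu> \<in> B" for s \<mu>
    by (intro V.span_scale V.span_base) (use that in auto)
  ultimately have "approximant F p B k K f \<in> V.span (u ` {n. real n \<in> B'} \<union> (\<lambda>(s, \<mu>). v s \<mu>) ` (F \<times> B))"
    by (simp only:) (intro V.span_add V.span_sum, auto)
  moreover have "(\<lambda>(s, \<mu>). v s \<mu>) = (\<lambda>(s, \<mu>) z. if z \<in> ball 0 1 then peak s p z * strip_exp s \<mu> z else 0)"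
    by (auto simp: v_def fun_eq_iff)
  ultimately show ?thesis unfolding u_def by simp
qed

text \<open>The factors \<open>k \<mu>\<close> can only remove frequencies, so that the edge part has no new spectrum, and the polynomial part
  contributes constants.\<close>

lemma approximant_in_algebra:
  assumes S: "S \<subseteq> sphere 0 1" and F: "finite F" "F \<subseteq> S" and p: "p > 0" and B: "finite B"
    and K: "trig_kernel B' k' K" and zero: "\<And>s. s \<in> S \<Longrightarrow> 0 \<in> \<Sigma> s" and f: "f \<in> SAP_spec_Hinf S \<Sigma>" "f \<in> Hinf_edges F"
  shows "approximant F p B k K f \<in> SAP_spec_Hinf S \<Sigma>"
proof -
  have FS: "F \<subseteq> sphere 0 1" using F S by blast
  obtain b where b: "b \<in> SAP_spec S \<Sigma>" "has_boundary_values f b" using f(1) by (auto simp: SAP_spec_Hinf_def)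
  have "\<mu> \<in> \<Sigma> s" if s: "s \<in> F" and ne: "k \<mu> * edge_coeff s \<mu> f \<noteq> 0" for s \<mu>
  proof -
    have s1: "cmod s = 1" using s FS by auto
    have "b \<in> SAP_circle" using b(1) by (simp add: SAP_spec_def SAP_def)
    then obtain g where g: "is_edge s b g" using edge_exists[OF _ s1] by blast
    have "ap_coeff \<mu> (lower_edge (E_hom s b)) \<noteq> 0"
      using ne unfolding edge_coeff_def edge_fun_eq[OF s1 b(2) g] E_hom_eq[OF s1 g] by simp
    then have "\<mu> \<in> ap_spec (lower_edge (E_hom s b))" by (simp add: ap_spec_def)
    then show ?thesis using b(1) s F by (auto simp: SAP_spec_def)
  qed
  then show ?thesis unfolding approximant_eq[OF F(1) FS p K f(2)]
    by (intro SAP_spec_Hinf_I S F B p zero holomorphic_intros) auto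
qed

lemma SAP_spec_Hinf_edges: "F \<subseteq> sphere 0 1 \<Longrightarrow> SAP_spec_Hinf S \<Sigma> \<subseteq> Hinf_edges F"
proof
  fix f assume F: "F \<subseteq> sphere 0 1" and f: "f \<in> SAP_spec_Hinf S \<Sigma>"
  then obtain b where b: "f \<in> Hinf" "b \<in> SAP_spec S \<Sigma>" "has_boundary_values f b" by (auto simp: SAP_spec_Hinf_def)
  then have bc: "b \<in> SAP_circle" by (simp add: SAP_spec_def SAP_def)
  have "\<exists>g. is_edge s b g" if "s \<in> F" for s by (rule edge_exists[OF bc]) (use that F in auto)
  then show "f \<in> Hinf_edges F" using b unfolding Hinf_edges_def by blast
qed

text \<open>The bound 5 is the same for all points \<open>F\<close> and kernels; their choice only affects the closeness to the identity.\<close>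

lemma approximant_operator:
  assumes S: "S \<subseteq> sphere 0 1" and F: "finite F" "F \<subseteq> S"
    and p: "p > 0" "\<And>z. cmod z \<le> 1 \<Longrightarrow> (\<Sum>s\<in>F. cmod (peak s p z)) \<le> 2"
    and K: "trig_kernel B k K" "trig_kernel B' k' K'" and zero: "\<And>s. s \<in> S \<Longrightarrow> 0 \<in> \<Sigma> s"
  shows "bounded_finite_rank_operator scale_fun (SAP_spec_Hinf S \<Sigma>) disk_norm (approximant F p B k K')"
  unfolding bounded_finite_rank_operator_def
proof (intro conjI ballI allI)
  let ?P = "approximant F p B k K'" and ?X = "SAP_spec_Hinf S \<Sigma>"
  have FS: "F \<subseteq> sphere 0 1" using F S by blast
  note XE = subsetD[OF SAP_spec_Hinf_edges[OF FS]]
  note lin = approximant_lincomb[OF F(1) FS p(1) K(2) XE XE]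
  have fin: "finite B" "finite B'" using K by (auto simp: trig_kernel_def)
  show "?P \<in> ?X \<rightarrow> ?X"
    by (intro funcsetI approximant_in_algebra[OF S F p(1) fin(1) K(2) zero] XE)
  show "?P (f + g) = ?P f + ?P g" if "f \<in> ?X" "g \<in> ?X" for f g
  proof
    fix z show "?P (f + g) z = (?P f + ?P g) z"
      using lin[OF that, of B k 1 z] by (simp add: plus_fun_def)
  qed
  show "?P (scale_fun c f) = scale_fun c (?P f)" if "f \<in> ?X" for c f
  proof
    have "scale_fun c f = (\<lambda>z. f z + (c - 1) * f z)" by (simp add: scale_fun_def algebra_simps)
    then show "?P (scale_fun c f) z = scale_fun c (?P f) z" for z
      using lin[OF that that, of B k "c - 1" z] by (simp add: scale_fun_def algebra_simps)
  qed
  have "disk_norm (?P f) \<le> 5 * disk_norm f" if f: "f \<in> ?X" for f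
    unfolding disk_norm_def[of "?P f"]
  proof (rule cSUP_least)
    fix z :: complex assume z: "z \<in> ball 0 1"
    have "bounded (f ` ball 0 1)" using f by (simp add: SAP_spec_Hinf_def Hinf_def)
    then show "cmod (?P f z) \<le> 5 * disk_norm f"
      by (intro approximant_bound[OF F(1) FS p K XE[OF f] _ z] cmod_le_disk_norm)
  qed simp
  then show "\<exists>C. \<forall>f\<in>?X. disk_norm (?P f) \<le> C * disk_norm f" by blast
  have "finite (real -` B')" by (intro finite_vimageI fin) (simp add: inj_on_def)
  then have "finite {n. real n \<in> B'}" by (simp add: vimage_def)
  then have "finite ((\<lambda>n z::complex. if z \<in> ball 0 1 then z ^ n else 0) ` {n. real n \<in> B'} \<union>
     (\<lambda>(s, \<mu>) z. if z \<in> ball 0 1 then peak s p z * strip_exp s \<mu> z else 0) ` (F \<times> B))"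
    using F(1) fin(1) by simp
  moreover have "?P ` ?X \<subseteq> module.span scale_fun ((\<lambda>n z::complex. if z \<in> ball 0 1 then z ^ n else 0) ` {n. real n \<in> B'} \<union>
     (\<lambda>(s, \<mu>) z. if z \<in> ball 0 1 then peak s p z * strip_exp s \<mu> z else 0) ` (F \<times> B))"
    using approximant_in_span[OF F(1) FS p(1) K(2) XE] by blast
  ultimately show "\<exists>D. finite D \<and> ?P ` ?X \<subseteq> module.span scale_fun D" by blast
qed

text \<open>
  The parameters are chosen one after another: the points \<open>F\<close> at which some member of \<open>N\<close> oscillates by more than
  \<open>e\<close>, a kernel for the edge functions at these points, the exponent of the peaks, and finally, for the remainders that these
  determine, the kernel for the rotations.
\<close>

lemma approximation_on_finite_sets:
  assumes S: "S \<subseteq> sphere 0 1" "closed S" and zero: "\<And>s. s \<in> S \<Longrightarrow> 0 \<in> \<Sigma> s"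
    and N: "finite N" "N \<subseteq> SAP_spec_Hinf S \<Sigma>" and e: "e > 0"
  shows "\<exists>P. bounded_finite_rank_operator scale_fun (SAP_spec_Hinf S \<Sigma>) disk_norm P \<and>
    (\<forall>f\<in>N. \<forall>z\<in>ball 0 1. cmod (P f z - f z) \<le> 9 * e) \<and>
    (\<forall>f\<in>SAP_spec_Hinf S \<Sigma>. \<forall>g\<in>SAP_spec_Hinf S \<Sigma>. \<forall>C. (\<forall>w\<in>ball 0 1. cmod (f w - g w) \<le> C) \<longrightarrow>
      (\<forall>z\<in>ball 0 1. cmod (P f z - P g z) \<le> 5 * C))"
proof -
  have "\<forall>f\<in>N. \<exists>b. b \<in> SAP_spec S \<Sigma> \<and> has_boundary_values f b" using N(2) by (auto simp: SAP_spec_Hinf_def)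
  then obtain b where b: "\<And>f. f \<in> N \<Longrightarrow> b f \<in> SAP_spec S \<Sigma>" "\<And>f. f \<in> N \<Longrightarrow> has_boundary_values f (b f)"
    by (auto dest!: bchoice)
  have NH: "f \<in> Hinf" if "f \<in> N" for f using that N by (auto simp: SAP_spec_Hinf_def)
  have bS: "b f \<in> SAP S" "b f \<in> SAP_circle" if "f \<in> N" for f
    using b(1)[OF that] by (auto simp: SAP_spec_def SAP_def)
  have "\<forall>f\<in>N. \<exists>F. finite F \<and> F \<subseteq> S \<and> F \<subseteq> sphere 0 1 \<and> (\<forall>s. cmod s = 1 \<longrightarrow> s \<notin> F \<longrightarrow> near_const (b f) e s)"
    using finite_oscillation_points[OF S(2) bS(1) e] by blast
  from bchoice[OF this] obtain F0 where
    F0: "\<forall>f\<in>N. finite (F0 f) \<and> F0 f \<subseteq> S \<and> F0 f \<subseteq> sphere 0 1 \<and> (\<forall>s. cmod s = 1 \<longrightarrow> s \<notin> F0 f \<longrightarrow> near_const (b f) e s)" ..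
  define F where "F = (\<Union>f\<in>N. F0 f)"
  have F: "finite F" "F \<subseteq> S" "F \<subseteq> sphere 0 1" using F0 N(1) by (auto simp: F_def)
  have s1: "cmod s = 1" if "s \<in> F" for s using that F(3) by auto
  have off: "near_const (b f) e s" if "f \<in> N" "cmod s = 1" "s \<notin> F" for f s
    using F0 that by (auto simp: F_def)
  have edge: "is_edge s (b f) (edge_fun s f)" if f: "f \<in> N" and s: "s \<in> F" for f s
  proof -
    obtain g where "is_edge s (b f) g" using edge_exists[OF bS(2)[OF f] s1[OF s]] by blast
    then show ?thesis using edge_fun_eq[OF s1[OF s] b(2)[OF f]] by simp
  qed
  define \<F> where "\<F> = (\<lambda>(f, s). lower_edge (edge_fun s f)) ` (N \<times> F) \<union> (\<lambda>(f, s). upper_edge (edge_fun s f)) ` (N \<times> F)"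
  have fF: "finite \<F>" using N(1) F(1) by (simp add: \<F>_def)
  have FAP: "\<F> \<subseteq> AP" using is_edge_AP[OF edge] by (auto simp: \<F>_def)
  obtain B k K where K: "trig_kernel B k K"
    and app: "\<And>h x. h \<in> \<F> \<Longrightarrow> cmod ((\<Sum>\<mu>\<in>B. k \<mu> * ap_coeff \<mu> h * cis (\<mu> * x)) - h x) \<le> e"
    by (rule AP_kernel_approximation[OF fF FAP e]) (rule that)
  have inF: "lower_edge (edge_fun s f) \<in> \<F>" "upper_edge (edge_fun s f) \<in> \<F>" if "f \<in> N" "s \<in> F" for f s
    using that by (auto simp: \<F>_def)
  obtain p where p: "p > 0" "\<And>z. cmod z \<le> 1 \<Longrightarrow> (\<Sum>s\<in>F. cmod (peak s p z)) \<le> 2"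
    using peak_sum_bound[OF F(1,3)] by blast
  define R where "R = (\<lambda>f w. f w + (-1) * edge_part F p B k f w)"
  have "\<forall>f\<in>N. \<exists>\<eta>>0. \<forall>B k K z. trig_kernel B k K \<longrightarrow> Re (ap_mean (\<lambda>t. of_real (K t * (1 - cos (1 * t))))) \<le> \<eta> \<longrightarrow>
    z \<in> ball 0 1 \<longrightarrow> cmod (smooth_part K (R f) z - R f z) \<le> 3 * (3 * e)"
  proof
    fix f assume f: "f \<in> N"
    have H: "R f \<in> Hinf" unfolding R_def by (intro Hinf_lincomb NH f edge_part_Hinf F p)
    have bv: "has_boundary_values (R f) (\<lambda>z. b f z + (-1) * edge_sum F p B (\<lambda>s \<mu>. k \<mu> * edge_coeff s \<mu> f) z)"
      unfolding R_def by (intro boundary_values_lincomb b f edge_part_Hinf F p)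
    have "near_const (\<lambda>z. b f z + (-1) * edge_sum F p B (\<lambda>s \<mu>. k \<mu> * edge_coeff s \<mu> f) z) (3 * e) s" if s: "cmod s = 1" for s
      using remainder_near_const[OF F(1,3) p(1) e s NH[OF f] b(2)[OF f] off[OF f s] edge[OF f] app[OF inF(1)[OF f]] app[OF inF(2)[OF f]]]
      by simp
    from smooth_part_close[OF H bv _ this] e
    show "\<exists>\<eta>>0. \<forall>B k K z. trig_kernel B k K \<longrightarrow> Re (ap_mean (\<lambda>t. of_real (K t * (1 - cos (1 * t))))) \<le> \<eta> \<longrightarrow>
      z \<in> ball 0 1 \<longrightarrow> cmod (smooth_part K (R f) z - R f z) \<le> 3 * (3 * e)" by simp
  qed
  from bchoice[OF this] obtain \<eta> where \<eta>: "\<forall>f\<in>N. \<eta> f > 0 \<and> (\<forall>B k K z. trig_kernel B k K \<longrightarrow> Re (ap_mean (\<lambda>t. of_real (K t * (1 - cos (1 * t))))) \<le> \<eta> f \<longrightarrow>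
    z \<in> ball 0 1 \<longrightarrow> cmod (smooth_part K (R f) z - R f z) \<le> 3 * (3 * e))" ..
  define \<eta>0 where "\<eta>0 = Min (insert 1 (\<eta> ` N))"
  have \<eta>0: "\<eta>0 > 0" "\<And>f. f \<in> N \<Longrightarrow> \<eta>0 \<le> \<eta> f" using \<eta> N(1) by (auto simp: \<eta>0_def)
  obtain B' k' K' where K': "trig_kernel B' k' K'"
    and conc: "\<And>\<mu>. \<mu> \<in> {1} \<Longrightarrow> Re (ap_mean (\<lambda>t. of_real (K' t * (1 - cos (\<mu> * t))))) \<le> \<eta>0"
    by (rule trig_kernel_exists[OF _ \<eta>0(1), of "{1}"]) (simp, rule that)
  define P where "P = approximant F p B k K'"
  have "cmod (P f z - f z) \<le> 9 * e" if f: "f \<in> N" and z: "z \<in> ball 0 1" for f z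
  proof -
    have "Re (ap_mean (\<lambda>t. of_real (K' t * (1 - cos (1 * t))))) \<le> \<eta> f" by (rule order_trans[OF conc \<eta>0(2)[OF f]]) simp
    then have "cmod (smooth_part K' (R f) z - R f z) \<le> 3 * (3 * e)"
      using conjunct2[OF bspec[OF \<eta> f], rule_format, OF K' _ z] by simp
    moreover have "P f z - f z = smooth_part K' (R f) z - R f z"
      using z by (simp add: P_def approximant_def R_def)
    ultimately show ?thesis by simp
  qed
  moreover have "cmod (P f z - P g z) \<le> 5 * C" if f: "f \<in> SAP_spec_Hinf S \<Sigma>" and g: "g \<in> SAP_spec_Hinf S \<Sigma>"
    and C: "\<forall>w\<in>ball 0 1. cmod (f w - g w) \<le> C" and z: "z \<in> ball 0 1" for f g C z
  proof -
    note XE = subsetD[OF SAP_spec_Hinf_edges[OF F(3)]]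
    have "P f z - P g z = approximant F p B k K' (\<lambda>z. f z + (-1) * g z) z"
      unfolding approximant_lincomb[OF F(1,3) p(1) K' XE[OF f] XE[OF g]] P_def by simp
    also have "cmod \<dots> \<le> 5 * C"
      by (rule approximant_bound[OF F(1,3) p K K' Hinf_edges_lincomb(1)[OF F(3) XE[OF f] XE[OF g]] _ z]) (use C in auto)
    finally show ?thesis .
  qed
  moreover have "bounded_finite_rank_operator scale_fun (SAP_spec_Hinf S \<Sigma>) disk_norm P"
    unfolding P_def by (rule approximant_operator[OF S(1) F(1,2) p K K' zero])
  ultimately show ?thesis by (intro exI[of _ P] conjI ballI allI impI) auto
qed

section \<open>The approximation property\<close>

theorem theorem3p6:
  fixes S :: "complex set" and \<Sigma> :: "complex \<Rightarrow> real set"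
  assumes "S \<subseteq> sphere 0 1" and "closed S"
    and "\<And>s. s \<in> S \<Longrightarrow> unital_additive_semigroup (\<Sigma> s)"
    and "\<And>s. s \<in> S \<Longrightarrow> \<Sigma> s \<noteq> {0}"
  shows "approximation_property scale_fun (SAP_spec_Hinf S \<Sigma>) disk_norm"
  unfolding approximation_property_def
proof (intro allI impI)
  fix K and \<epsilon> :: real
  let ?X = "SAP_spec_Hinf S \<Sigma>"
  assume "compactin (Metric_space.mtopology ?X (norm_dist ?X disk_norm)) K \<and> 0 < \<epsilon>"
  then have K: "compactin (Metric_space.mtopology ?X (norm_dist ?X disk_norm)) K" and \<epsilon>: "0 < \<epsilon>" by auto
  have XH: "?X \<subseteq> Hinf" by (auto simp: SAP_spec_Hinf_def)
  interpret M: Metric_space ?X "norm_dist ?X disk_norm" by (rule Metric_space_Hinf[OF XH])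
  have zero: "0 \<in> \<Sigma> s" if "s \<in> S" for s using assms(3)[OF that] by (simp add: unital_additive_semigroup_def)
  \<comment> \<open>the three errors below add up to \<open>5 e + 9 e + e\<close>\<close>
  define e where "e = \<epsilon> / 20"
  have e: "e > 0" using \<epsilon> by (simp add: e_def)
  have tb: "M.mtotally_bounded K" by (rule M.compactin_imp_mtotally_bounded[OF K])
  have KX: "K \<subseteq> ?X" by (rule M.mtotally_bounded_imp_subset[OF tb])
  obtain N where N: "finite N" "N \<subseteq> K" "K \<subseteq> (\<Union>f\<in>N. M.mball f e)"
    using tb[unfolded M.mtotally_bounded_def, rule_format, OF e] by (elim exE conjE) (rule that)
  have NX: "N \<subseteq> ?X" using N(2) KX by blast
  obtain P where P: "bounded_finite_rank_operator scale_fun ?X disk_norm P"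
    and close: "\<forall>f\<in>N. \<forall>z\<in>ball 0 1. cmod (P f z - f z) \<le> 9 * e"
    and lip: "\<forall>f\<in>?X. \<forall>g\<in>?X. \<forall>C. (\<forall>w\<in>ball 0 1. cmod (f w - g w) \<le> C) \<longrightarrow> (\<forall>z\<in>ball 0 1. cmod (P f z - P g z) \<le> 5 * C)"
    by (rule exE[OF approximation_on_finite_sets[OF assms(1,2) zero N(1) NX e]]) (assumption, elim conjE, rule that)
  have "disk_norm (P f - f) < \<epsilon>" if f: "f \<in> K" for f
  proof -
    obtain h where h: "h \<in> N" "f \<in> M.mball h e" using N(3) f by blast
    have fX: "f \<in> ?X" and hX: "h \<in> ?X" using f h KX NX by auto
    have "disk_norm (h - f) < e" using h(2) fX hX unfolding M.in_mball by (simp add: norm_dist_def)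
    moreover have "bounded ((h - f) ` ball 0 1)"
    proof -
      have "bounded (h ` ball 0 1)" "bounded (f ` ball 0 1)" using fX hX XH by (auto simp: Hinf_def)
      then show ?thesis using bounded_minus_comp[of h "ball 0 1" f] by (simp add: fun_diff_def)
    qed
    ultimately have d: "cmod (f w - h w) \<le> e" if "w \<in> ball 0 1" for w
      using cmod_le_disk_norm[of "h - f" w] that by (simp add: norm_minus_commute)
    have "disk_norm (P f - f) \<le> 15 * e" unfolding disk_norm_def
    proof (rule cSUP_least)
      fix z :: complex assume z: "z \<in> ball 0 1"
      have "cmod (P f z - P h z) \<le> 5 * e" using bspec[OF bspec[OF lip fX] hX, rule_format, OF d z] .
      moreover have "cmod (P h z - h z) \<le> 9 * e" using close h(1) z by blast
      moreover have eq: "(P f - f) z = (P f z - P h z) + (P h z - h z) - (f z - h z)" by simp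
      ultimately show "cmod ((P f - f) z) \<le> 15 * e" unfolding eq
        using norm_triangle_ineq[of "P f z - P h z" "P h z - h z"]
          norm_triangle_ineq4[of "(P f z - P h z) + (P h z - h z)" "f z - h z"] d[OF z] by linarith
    qed simp
    then show ?thesis using \<epsilon> by (simp add: e_def)
  qed
  then show "\<exists>P. bounded_finite_rank_operator scale_fun ?X disk_norm P \<and> (\<forall>f\<in>K. disk_norm (P f - f) < \<epsilon>)"
    using P by blast
qed

end
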